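(* Let $C$ be a manifold with a pre-contact distribution $\xi_C$, line bundle $\ell=TC/\xi_C$, and characteristic foliation $\mathcal{F}$, and let $G$ be a complement to $T\mathcal{F}$ in $TC$. Then the following three maps are chain maps: $$d^G_{1,0}\circ(\sigma|_K)^*\colon(\Omega^\bullet(\mathcal{F},\ell),d_{\nabla^\ell})\to(\Omega_D^{1,\bullet}(\ell),-d^G_{0,1}),$$ $$\tau\colon(\Omega_D^{1,\bullet}(\ell),-d_{0,1}^G)\to(\Omega^\bullet(K,J^1_\perp\ell),d_{\nabla^{J^1_\perp\ell}}),$$ $$R:=-\wedge^\bullet(-\sigma|_K^{-1})^*\otimes(\sigma_\perp\circ\varpi_\perp^\sharp)\colon(\Omega^\bullet(K,J^1_\perp\ell),d_{\nabla^{J^1_\perp\ell}})\to(\Omega^\bullet(\mathcal{F},N\mathcal{F}),-d_{\nabla^{N\mathcal{F}}}),$$ and $$\Phi_G=R\circ\tau\circ d_{1,0}^G\circ(\sigma|_K)^*.$$ In particular, $\Phi_G$ is a chain map $$\Phi_G\colon(\Omega^\bullet(\mathcal{F},\ell),d_{\nabla^\ell})\longrightarrow(\Omega^\bullet(\mathcal{F},N\mathcal{F}),-d_{\nabla^{N\mathcal{F}}}).$$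
   Context: Pre-contact data. For a hyperplane distribution $\xi_C$ on $C$, let $\ell:=TC/\xi_C$, let $\theta_C\in\Omega^1(C,\ell)$ be the quotient projection, and let $\omega(X,Y)=\theta_C([X,Y])$ for $X,Y\in\Gamma(\xi_C)$. $\xi_C$ is pre-contact if $\ker\omega^\flat\subset\xi_C$ has constant rank; it is then involutive and its foliation $\mathcal{F}$ is the characteristic foliation, $T\mathcal{F}=\ker\omega^\flat$. Let $N\mathcal{F}=TC/T\mathcal{F}$. Atiyah algebroid. Sections of $D\ell\to C$ are derivations of $\ell$: $\mathbb{R}$-linear maps $\square\colon\Gamma(\ell)\to\Gamma(\ell)$ with $\square(f\lambda)=\sigma(\square)(f)\lambda+f\square\lambda$ for a unique vector field $\sigma(\square)$. $D\ell$ is a Lie algebroid with commutator bracket and anchor the symbol $\sigma\colon D\ell\to TC$; it acts tautologically on $\ell$, giving the Koszul differential $d_D$ on $\Omega^\bullet_D(\ell):=\Gamma(\wedge^\bullet(D\ell)^*\otimes\ell)$. Put $\varpi:=d_D(\sigma^*\theta_C)$, $\varpi^\flat\colon D\ell\to(D\ell)^*\otimes\ell$, $K:=\ker\varpi^\flat$, a Lie subalgebroid which $\sigma$ maps isomorphically onto $T\mathcal{F}$. Let $\widetilde G:=\sigma^{-1}(G)$, so $D\ell=K\oplus\widetilde G$ with projection $\mathrm{pr}_K$; $\varpi^\flat$ restricts to an isomorphism $\varpi^\flat|_{\widetilde G}\colon\widetilde G\to\widetilde G^*\otimes\ell$. Quotients. $D_\perp\ell:=D\ell/K\simeq\widetilde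 G$, with class of $\square$ denoted $\overline\square$. $J^1_\perp\ell\subset(D\ell)^*\otimes\ell$ is the annihilator of $K$, identified with $(D_\perp\ell)^*\otimes\ell$. $\sigma$ induces $\sigma_\perp\colon D_\perp\ell\to N\mathcal{F}$, $\sigma_\perp(\overline\square)=\sigma(\square)\bmod T\mathcal{F}$. $\varpi^\flat$ induces an isomorphism $\varpi^\flat_\perp\colon D_\perp\ell\to J^1_\perp\ell$ with inverse $\varpi_\perp^\sharp$. Representations. $T\mathcal{F}$ acts on $\ell$ by $\nabla^\ell_X\theta_C(Y)=\theta_C([X,Y])$ and on $N\mathcal{F}$ by $\nabla^{N\mathcal{F}}_X(Y\bmod T\mathcal{F})=[X,Y]\bmod T\mathcal{F}$. $K$ acts on $\ell$ by $\nabla^\ell_\Delta\lambda=\Delta\lambda$, on $D_\perp\ell$ by $\nabla^{D_\perp\ell}_\Delta\overline\square=\overline{[\Delta,\square]}$, and on $J^1_\perp\ell$ by $\langle\nabla^{J^1_\perp\ell}_\Delta\alpha,\overline\square\rangle=\Delta\langle\alpha,\overline\square\rangle-\langle\alpha,\nabla^{D_\perp\ell}_\Delta\overline\square\rangle$. For a Lie algebroid $A\in\{T\mathcal{F},K\}$ and an $A$-representation $(E,\nabla)$, $d_\nabla$ is the Koszul differential on $\Omega^\bullet(A,E)=\Gamma(\wedge^\bullet A^*\otimes E)$; $\Omega^\bullet(\mathcal{F},E):=\Omega^\bullet(T\mathcal{F},E)$. Bigrading. The splitting gives $\Omega_D^i(\ell)\simeq\bigoplus_{a+b=i}\Omega_D^{a,b}(\ell)$,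 $\Omega_D^{a,b}(\ell):=\Gamma(\wedge^a(D_\perp\ell)^*\otimes\wedge^bK^*\otimes\ell)$, and $d_D=d_{0,1}^G+d_{1,0}^G+d_{2,-1}^G$ with $d_{i,j}^G$ of bidegree $(i,j)$. Note $\Omega^{0,\bullet}_D(\ell)=\Omega^\bullet(K,\ell)$. The map $\tau\colon\Omega_D^{1,b}(\ell)\to\Omega^b(K,J^1_\perp\ell)$ is defined by $\eta(\overline\square,\Delta_1,\ldots,\Delta_b)=\langle\tau(\eta)(\Delta_1,\ldots,\Delta_b),\overline\square\rangle$ for $\square\in\Gamma(\widetilde G)$, $\Delta_i\in\Gamma(K)$. The map $R$ in degree $b$ is induced by the vector bundle map $-(-1)^b\wedge^b(\sigma|_K^{-1})^*\otimes(\sigma_\perp\circ\varpi_\perp^\sharp)\colon\wedge^bK^*\otimes J^1_\perp\ell\to\wedge^bT^*\mathcal{F}\otimes N\mathcal{F}$. The map $\Phi_G\colon\Omega^\bullet(\mathcal{F},\ell)\to\Omega^\bullet(\mathcal{F},N\mathcal{F})$ is defined by $$\langle\beta,\Phi_G(\eta)(\sigma(\Delta_1),\ldots,\sigma(\Delta_n))\rangle=d_D(\mathrm{pr}_K^*\sigma^*\eta)\big(\Delta_1,\ldots,\Delta_n,(\varpi^\flat|_{\widetilde G})^{-1}(\sigma^*\beta)\big)$$ for $\eta\in\Omega^n(\mathcal{F},\ell)$, $\beta\in\Gamma(N^*\mathcal{F}\otimes\ell)$, $\Delta_i\in\Gamma(K)$, where $N^*\mathcal{F}\otimes\ell\simeq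 G^*\otimes\ell$. *)

theory Defs
  imports "HOL-Analysis.Analysis" "HOL-Algebra.Module" "HOL-Algebra.AbelCoset"
begin

text \<open>
  A manifold \<open>C\<close> is a second countable Hausdorff type with an atlas. Vector bundles over \<open>C\<close> are
  handled through their modules of sections over the ring of smooth functions, using the standard
  identifications \<open>\<Gamma>(E/F) = \<Gamma>(E)/\<Gamma>(F)\<close> and \<open>\<Gamma>(\<Lambda>\<^sup>n A\<^sup>* \<otimes> E) =\<close> alternating \<open>C\<^sup>\<infinity>(C)\<close>-multilinear maps
  \<open>\<Gamma>(A)\<^sup>n \<rightarrow> \<Gamma>(E)\<close>. Distributions, in contrast, are families of subspaces of the tangent spaces.
  Maps between carriers are \<^const>\<open>extensional\<close>, so equality of maps is HOL equality.
\<close>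

section \<open>Smooth manifolds\<close>

text \<open>Only meant for open sets.\<close>

primrec Ck_on ::
  "nat \<Rightarrow> 'e::real_normed_vector set \<Rightarrow> ('e \<Rightarrow> 'f::real_normed_vector) \<Rightarrow> bool" where
  "Ck_on 0 S f \<longleftrightarrow> continuous_on S f"
| "Ck_on (Suc k) S f \<longleftrightarrow>
     (\<forall>x\<in>S. f differentiable (at x)) \<and> (\<forall>v. Ck_on k S (\<lambda>x. frechet_derivative f (at x) v))"

definition smooth_on :: "'e::real_normed_vector set \<Rightarrow> ('e \<Rightarrow> 'f::real_normed_vector) \<Rightarrow> bool" where
  "smooth_on S f \<longleftrightarrow> (\<forall>k. Ck_on k S f)"

type_synonym ('a, 'e) atlas = "('a set \<times> ('a \<Rightarrow> 'e)) set"

definition smooth_manifold ::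
  "('a::{second_countable_topology, t2_space}, 'e::euclidean_space) atlas \<Rightarrow> bool" where
  "smooth_manifold A \<longleftrightarrow>
     (\<Union>(U, \<phi>)\<in>A. U) = UNIV \<and>
     (\<forall>(U, \<phi>)\<in>A. open U \<and> open (\<phi> ` U) \<and> homeomorphism U (\<phi> ` U) \<phi> (inv_into U \<phi>)) \<and>
     (\<forall>(U, \<phi>)\<in>A. \<forall>(V, \<psi>)\<in>A. smooth_on (\<phi> ` (U \<inter> V)) (\<psi> \<circ> inv_into U \<phi>))"

definition Cinf :: "('a, 'e::euclidean_space) atlas \<Rightarrow> ('a \<Rightarrow> real) ring" where
  "Cinf A =
     \<lparr>carrier = {f. \<forall>(U, \<phi>)\<in>A. smooth_on (\<phi> ` U) (f \<circ> inv_into U \<phi>)},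
      monoid.mult = (\<lambda>f g p. f p * g p), one = (\<lambda>_. 1),
      zero = (\<lambda>_. 0), add = (\<lambda>f g p. f p + g p)\<rparr>"

text \<open>Tangent vectors at \<open>p\<close> are derivations at \<open>p\<close> of the smooth functions, vector fields are
  derivations of the smooth functions; both are set to \<open>0\<close> on functions that are not smooth.\<close>

type_synonym 'a tvec = "('a \<Rightarrow> real) \<Rightarrow> real"
type_synonym 'a vfield = "('a \<Rightarrow> real) \<Rightarrow> 'a \<Rightarrow> real"

definition tangent_space :: "('a, 'e::euclidean_space) atlas \<Rightarrow> 'a \<Rightarrow> 'a tvec set" where
  "tangent_space A p =
     {v. (\<forall>f. f \<notin> carrier (Cinf A) \<longrightarrow> v f = 0) \<and>
         (\<forall>f\<in>carrier (Cinf A). \<forall>g\<in>carrier (Cinf A). \<forall>c.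
            v (\<lambda>q. f q + g q) = v f + v g \<and>
            v (\<lambda>q. c * f q) = c * v f \<and>
            v (\<lambda>q. f q * g q) = v f * g p + f p * v g)}"

definition TC :: "('a, 'e::euclidean_space) atlas \<Rightarrow> ('a \<Rightarrow> real, 'a vfield) module" where
  "TC A =
     \<lparr>carrier = {X. (\<forall>f. f \<notin> carrier (Cinf A) \<longrightarrow> X f = (\<lambda>_. 0)) \<and>
         (\<forall>f\<in>carrier (Cinf A). X f \<in> carrier (Cinf A)) \<and>
         (\<forall>f\<in>carrier (Cinf A). \<forall>g\<in>carrier (Cinf A). \<forall>c p.
            X (\<lambda>q. f q + g q) p = X f p + X g p \<and>
            X (\<lambda>q. c * f q) p = c * X f p \<and>
            X (\<lambda>q. f q * g q) p = X f p * g p + f p * X g p)},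
      monoid.mult = undefined, one = undefined,
      zero = (\<lambda>f p. 0), add = (\<lambda>X Y f p. X f p + Y f p),
      smult = (\<lambda>h X f p. h p * X f p)\<rparr>"

definition lie :: "'a vfield \<Rightarrow> 'a vfield \<Rightarrow> 'a vfield" where
  "lie X Y = (\<lambda>f p. X (Y f) p - Y (X f) p)"

definition at_point :: "'a vfield \<Rightarrow> 'a \<Rightarrow> 'a tvec" where
  "at_point X p = (\<lambda>f. X f p)"

type_synonym 'a distr = "'a \<Rightarrow> 'a tvec set"

definition sections :: "('a, 'e::euclidean_space) atlas \<Rightarrow> 'a distr \<Rightarrow> 'a vfield set" where
  "sections A E = {X \<in> carrier (TC A). \<forall>p. at_point X p \<in> E p}"

definition basis_of :: "'a tvec set \<Rightarrow> nat \<Rightarrow> (nat \<Rightarrow> 'a tvec) \<Rightarrow> bool" where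
  "basis_of V r v \<longleftrightarrow> bij_betw (\<lambda>c f. \<Sum>i<r. c i * v i f) ({..<r} \<rightarrow>\<^sub>E (UNIV :: real set)) V"

text \<open>Local frames may be taken to consist of globally defined vector fields, by shrinking the
  neighbourhood and multiplying with a bump function.\<close>

definition subbundle :: "('a::topological_space, 'e::euclidean_space) atlas \<Rightarrow> nat \<Rightarrow> 'a distr \<Rightarrow> bool"
  where
  "subbundle A r E \<longleftrightarrow>
     (\<forall>p. \<exists>U e. open U \<and> p \<in> U \<and> (\<forall>i<r. e i \<in> carrier (TC A)) \<and>
        (\<forall>q\<in>U. basis_of (E q) r (\<lambda>i. at_point (e i) q)))"

definition hyperplane_distribution ::
  "('a::topological_space, 'e::euclidean_space) atlas \<Rightarrow> 'a distr \<Rightarrow> bool" where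
  "hyperplane_distribution A \<xi> \<longleftrightarrow> subbundle A (DIM('e) - 1) \<xi>"

section \<open>Modules, forms and complexes\<close>

definition quot_module :: "('r, 'm) module \<Rightarrow> 'm set \<Rightarrow> ('r, 'm set) module" where
  "quot_module M N =
     \<lparr>carrier = a_rcosets\<^bsub>M\<^esub> N, monoid.mult = undefined, one = undefined,
      zero = N, add = set_add M,
      smult = (\<lambda>r B. \<Union>x\<in>B. N +>\<^bsub>M\<^esub> (r \<odot>\<^bsub>M\<^esub> x))\<rparr>"

text \<open>The map induced on cosets by a map \<open>f\<close> that is constant on each coset.\<close>

definition induced :: "('m \<Rightarrow> 'n) \<Rightarrow> 'm set \<Rightarrow> 'n" where
  "induced f B = the_elem (f ` B)"

definition hom_module ::
  "'r ring \<Rightarrow> ('r, 'm) module \<Rightarrow> ('r, 'n) module \<Rightarrow> ('r, 'm \<Rightarrow> 'n) module" where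
  "hom_module R M N =
     \<lparr>carrier = {h \<in> carrier M \<rightarrow>\<^sub>E carrier N.
         (\<forall>x\<in>carrier M. \<forall>y\<in>carrier M. h (x \<oplus>\<^bsub>M\<^esub> y) = h x \<oplus>\<^bsub>N\<^esub> h y) \<and>
         (\<forall>r\<in>carrier R. \<forall>x\<in>carrier M. h (r \<odot>\<^bsub>M\<^esub> x) = r \<odot>\<^bsub>N\<^esub> h x)},
      monoid.mult = undefined, one = undefined,
      zero = (\<lambda>x\<in>carrier M. \<zero>\<^bsub>N\<^esub>), add = (\<lambda>g h. \<lambda>x\<in>carrier M. g x \<oplus>\<^bsub>N\<^esub> h x),
      smult = (\<lambda>r h. \<lambda>x\<in>carrier M. r \<odot>\<^bsub>N\<^esub> h x)\<rparr>"

definition tuples :: "('r, 'x) module \<Rightarrow> nat \<Rightarrow> 'x list set" where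
  "tuples L n = {xs. length xs = n \<and> set xs \<subseteq> carrier L}"

definition forms ::
  "'r ring \<Rightarrow> ('r, 'x) module \<Rightarrow> ('r, 'y) module \<Rightarrow> nat \<Rightarrow> ('r, 'x list \<Rightarrow> 'y) module" where
  "forms R L E n =
     \<lparr>carrier = {\<eta> \<in> tuples L n \<rightarrow>\<^sub>E carrier E.
         (\<forall>xs\<in>tuples L n. \<forall>i<n. \<forall>x\<in>carrier L. \<forall>y\<in>carrier L.
            \<eta> (xs[i := x \<oplus>\<^bsub>L\<^esub> y]) = \<eta> (xs[i := x]) \<oplus>\<^bsub>E\<^esub> \<eta> (xs[i := y])) \<and>
         (\<forall>xs\<in>tuples L n. \<forall>i<n. \<forall>r\<in>carrier R. \<forall>x\<in>carrier L.
            \<eta> (xs[i := r \<odot>\<^bsub>L\<^esub> x]) = r \<odot>\<^bsub>E\<^esub> \<eta> (xs[i := x])) \<and>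
         (\<forall>xs\<in>tuples L n. \<forall>j<n. \<forall>i<j. xs ! i = xs ! j \<longrightarrow> \<eta> xs = \<zero>\<^bsub>E\<^esub>)},
      monoid.mult = undefined, one = undefined,
      zero = (\<lambda>xs\<in>tuples L n. \<zero>\<^bsub>E\<^esub>), add = (\<lambda>\<eta> \<zeta>. \<lambda>xs\<in>tuples L n. \<eta> xs \<oplus>\<^bsub>E\<^esub> \<zeta> xs),
      smult = (\<lambda>r \<eta>. \<lambda>xs\<in>tuples L n. r \<odot>\<^bsub>E\<^esub> \<eta> xs)\<rparr>"

definition pullback :: "('r, 'x) module \<Rightarrow> nat \<Rightarrow> ('x \<Rightarrow> 'z) \<Rightarrow> ('z list \<Rightarrow> 'y) \<Rightarrow> 'x list \<Rightarrow> 'y" where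
  "pullback L n g \<eta> = (\<lambda>xs\<in>tuples L n. \<eta> (map g xs))"

text \<open>\<open>(-1)\<^sup>k e\<close>\<close>

definition signed :: "('r, 'y) module \<Rightarrow> nat \<Rightarrow> 'y \<Rightarrow> 'y" where
  "signed E k e = (if even k then e else \<ominus>\<^bsub>E\<^esub> e)"

definition omit :: "nat \<Rightarrow> 'x list \<Rightarrow> 'x list" where
  "omit i xs = take i xs @ drop (Suc i) xs"

text \<open>Koszul differential in degree \<open>n\<close> of the Lie algebroid with module of sections \<open>L\<close> and bracket
  \<open>br\<close>, acting on \<open>E\<close> by \<open>nab\<close>.\<close>

definition koszul ::
  "('r, 'x) module \<Rightarrow> ('x \<Rightarrow> 'x \<Rightarrow> 'x) \<Rightarrow> ('r, 'y) module \<Rightarrow> ('x \<Rightarrow> 'y \<Rightarrow> 'y) \<Rightarrow> nat \<Rightarrow>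
   ('x list \<Rightarrow> 'y) \<Rightarrow> 'x list \<Rightarrow> 'y" where
  "koszul L br E nab n \<eta> = (\<lambda>xs\<in>tuples L (Suc n).
     (\<Oplus>\<^bsub>E\<^esub>i\<in>{..n}. signed E i (nab (xs ! i) (\<eta> (omit i xs)))) \<oplus>\<^bsub>E\<^esub>
     (\<Oplus>\<^bsub>E\<^esub>j\<in>{..n}. \<Oplus>\<^bsub>E\<^esub>i\<in>{..<j}.
        signed E (i + j) (\<eta> (br (xs ! i) (xs ! j) # omit i (omit j xs)))))"

text \<open>\<open>\<real>\<close>-linearity, the reals being the constant functions.\<close>

definition real_linear ::
  "('a \<Rightarrow> real, 'x) module \<Rightarrow> ('a \<Rightarrow> real, 'y) module \<Rightarrow> ('x \<Rightarrow> 'y) \<Rightarrow> bool" where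
  "real_linear M N h \<longleftrightarrow>
     h \<in> carrier M \<rightarrow> carrier N \<and>
     (\<forall>x\<in>carrier M. \<forall>y\<in>carrier M. h (x \<oplus>\<^bsub>M\<^esub> y) = h x \<oplus>\<^bsub>N\<^esub> h y) \<and>
     (\<forall>c. \<forall>x\<in>carrier M. h ((\<lambda>_. c) \<odot>\<^bsub>M\<^esub> x) = (\<lambda>_. c) \<odot>\<^bsub>N\<^esub> h x)"

definition cochain_complex ::
  "(nat \<Rightarrow> ('a \<Rightarrow> real, 'x) module) \<Rightarrow> (nat \<Rightarrow> 'x \<Rightarrow> 'x) \<Rightarrow> bool" where
  "cochain_complex M d \<longleftrightarrow>
     (\<forall>n. real_linear (M n) (M (Suc n)) (d n) \<and>
          (\<forall>x\<in>carrier (M n). d (Suc n) (d n x) = \<zero>\<^bsub>M (Suc (Suc n))\<^esub>))"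

definition neg_diff ::
  "(nat \<Rightarrow> ('a \<Rightarrow> real, 'x) module) \<Rightarrow> (nat \<Rightarrow> 'x \<Rightarrow> 'x) \<Rightarrow> nat \<Rightarrow> 'x \<Rightarrow> 'x" where
  "neg_diff M d n x = \<ominus>\<^bsub>M (Suc n)\<^esub> d n x"

definition chain_map ::
  "(nat \<Rightarrow> ('a \<Rightarrow> real, 'x) module) \<Rightarrow> (nat \<Rightarrow> 'x \<Rightarrow> 'x) \<Rightarrow>
   (nat \<Rightarrow> ('a \<Rightarrow> real, 'y) module) \<Rightarrow> (nat \<Rightarrow> 'y \<Rightarrow> 'y) \<Rightarrow> (nat \<Rightarrow> 'x \<Rightarrow> 'y) \<Rightarrow> bool" where
  "chain_map M d N d' F \<longleftrightarrow>
     cochain_complex M d \<and> cochain_complex N d' \<and>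
     (\<forall>n. real_linear (M n) (N n) (F n) \<and>
          (\<forall>x\<in>carrier (M n). F (Suc n) (d n x) = d' n (F n x)))"

section \<open>Pre-contact distributions\<close>

definition ell :: "('a, 'e::euclidean_space) atlas \<Rightarrow> 'a distr \<Rightarrow> ('a \<Rightarrow> real, 'a vfield set) module"
  where "ell A \<xi> = quot_module (TC A) (sections A \<xi>)"

definition theta :: "('a, 'e::euclidean_space) atlas \<Rightarrow> 'a distr \<Rightarrow> 'a vfield \<Rightarrow> 'a vfield set"
  where "theta A \<xi> X = sections A \<xi> +>\<^bsub>TC A\<^esub> X"

definition omega ::
  "('a, 'e::euclidean_space) atlas \<Rightarrow> 'a distr \<Rightarrow> 'a vfield \<Rightarrow> 'a vfield \<Rightarrow> 'a vfield set"
  where "omega A \<xi> X Y = theta A \<xi> (lie X Y)"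

definition vanishes_at :: "'a distr \<Rightarrow> 'a vfield set \<Rightarrow> 'a \<Rightarrow> bool" where
  "vanishes_at \<xi> s p \<longleftrightarrow> (\<forall>Z\<in>s. at_point Z p \<in> \<xi> p)"

text \<open>The kernel of \<open>\<omega>\<^sup>\<flat>\<close> at each point; \<open>\<omega>\<close> is tensorial and every vector in \<open>\<xi> p\<close> is the value of a
  global section of \<open>\<xi>\<close>.\<close>

definition char_dist :: "('a, 'e::euclidean_space) atlas \<Rightarrow> 'a distr \<Rightarrow> 'a distr" where
  "char_dist A \<xi> p =
     {at_point X p | X. X \<in> sections A \<xi> \<and> (\<forall>Y\<in>sections A \<xi>. vanishes_at \<xi> (omega A \<xi> X Y) p)}"

definition precontact ::
  "('a::topological_space, 'e::euclidean_space) atlas \<Rightarrow> 'a distr \<Rightarrow> bool" where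
  "precontact A \<xi> \<longleftrightarrow>
     hyperplane_distribution A \<xi> \<and> (\<exists>k. \<forall>p. \<exists>v. basis_of (char_dist A \<xi> p) k v)"

definition complement_of_TF ::
  "('a::topological_space, 'e::euclidean_space) atlas \<Rightarrow> 'a distr \<Rightarrow> 'a distr \<Rightarrow> bool" where
  "complement_of_TF A \<xi> G \<longleftrightarrow>
     (\<exists>r. subbundle A r G) \<and>
     (\<forall>p. bij_betw (\<lambda>(u, w) f. u f + w f) (char_dist A \<xi> p \<times> G p) (tangent_space A p))"

definition TF :: "('a, 'e::euclidean_space) atlas \<Rightarrow> 'a distr \<Rightarrow> ('a \<Rightarrow> real, 'a vfield) module" where
  "TF A \<xi> = (TC A)\<lparr>carrier := sections A (char_dist A \<xi>)\<rparr>"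

definition NF :: "('a, 'e::euclidean_space) atlas \<Rightarrow> 'a distr \<Rightarrow> ('a \<Rightarrow> real, 'a vfield set) module"
  where "NF A \<xi> = quot_module (TC A) (carrier (TF A \<xi>))"

definition mod_TF :: "('a, 'e::euclidean_space) atlas \<Rightarrow> 'a distr \<Rightarrow> 'a vfield \<Rightarrow> 'a vfield set"
  where "mod_TF A \<xi> X = carrier (TF A \<xi>) +>\<^bsub>TC A\<^esub> X"

text \<open>\<open>N\<^sup>*\<F> \<otimes> \<ell>\<close>\<close>

definition NF_dual_ell ::
  "('a, 'e::euclidean_space) atlas \<Rightarrow> 'a distr \<Rightarrow> ('a \<Rightarrow> real, 'a vfield set \<Rightarrow> 'a vfield set) module"
  where "NF_dual_ell A \<xi> = hom_module (Cinf A) (NF A \<xi>) (ell A \<xi>)"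

section \<open>The Atiyah algebroid\<close>

type_synonym 'a derivation = "'a vfield set \<Rightarrow> 'a vfield set"

definition is_symbol ::
  "('a, 'e::euclidean_space) atlas \<Rightarrow> 'a distr \<Rightarrow> 'a derivation \<Rightarrow> 'a vfield \<Rightarrow> bool" where
  "is_symbol A \<xi> D X \<longleftrightarrow> X \<in> carrier (TC A) \<and>
     (\<forall>f\<in>carrier (Cinf A). \<forall>s\<in>carrier (ell A \<xi>).
        D (f \<odot>\<^bsub>ell A \<xi>\<^esub> s) = X f \<odot>\<^bsub>ell A \<xi>\<^esub> s \<oplus>\<^bsub>ell A \<xi>\<^esub> f \<odot>\<^bsub>ell A \<xi>\<^esub> D s)"

definition Dell ::
  "('a, 'e::euclidean_space) atlas \<Rightarrow> 'a distr \<Rightarrow> ('a \<Rightarrow> real, 'a derivation) module" where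
  "Dell A \<xi> = (let l = ell A \<xi> in
     \<lparr>carrier = {D \<in> extensional (carrier l). real_linear l l D \<and> (\<exists>!X. is_symbol A \<xi> D X)},
      monoid.mult = undefined, one = undefined,
      zero = (\<lambda>s\<in>carrier l. \<zero>\<^bsub>l\<^esub>), add = (\<lambda>D D'. \<lambda>s\<in>carrier l. D s \<oplus>\<^bsub>l\<^esub> D' s),
      smult = (\<lambda>f D. \<lambda>s\<in>carrier l. f \<odot>\<^bsub>l\<^esub> D s)\<rparr>)"

definition symbol :: "('a, 'e::euclidean_space) atlas \<Rightarrow> 'a distr \<Rightarrow> 'a derivation \<Rightarrow> 'a vfield" where
  "symbol A \<xi> D = (THE X. is_symbol A \<xi> D X)"

definition commutator ::
  "('a, 'e::euclidean_space) atlas \<Rightarrow> 'a distr \<Rightarrow> 'a derivation \<Rightarrow> 'a derivation \<Rightarrow> 'a derivation" where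
  "commutator A \<xi> D D' = (\<lambda>s\<in>carrier (ell A \<xi>). D (D' s) \<ominus>\<^bsub>ell A \<xi>\<^esub> D' (D s))"

definition Omega_D ::
  "('a, 'e::euclidean_space) atlas \<Rightarrow> 'a distr \<Rightarrow> nat \<Rightarrow>
   ('a \<Rightarrow> real, 'a derivation list \<Rightarrow> 'a vfield set) module" where
  "Omega_D A \<xi> n = forms (Cinf A) (Dell A \<xi>) (ell A \<xi>) n"

definition d_D ::
  "('a, 'e::euclidean_space) atlas \<Rightarrow> 'a distr \<Rightarrow> nat \<Rightarrow>
   ('a derivation list \<Rightarrow> 'a vfield set) \<Rightarrow> 'a derivation list \<Rightarrow> 'a vfield set" where
  "d_D A \<xi> n = koszul (Dell A \<xi>) (commutator A \<xi>) (ell A \<xi>) (\<lambda>D s. D s) n"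

definition varpi ::
  "('a, 'e::euclidean_space) atlas \<Rightarrow> 'a distr \<Rightarrow> 'a derivation list \<Rightarrow> 'a vfield set" where
  "varpi A \<xi> =
     d_D A \<xi> 1 (pullback (Dell A \<xi>) 1 (symbol A \<xi>) (\<lambda>Xs\<in>tuples (TC A) 1. theta A \<xi> (Xs ! 0)))"

text \<open>\<open>(D\<ell>)\<^sup>* \<otimes> \<ell>\<close>\<close>

definition Dell_dual ::
  "('a, 'e::euclidean_space) atlas \<Rightarrow> 'a distr \<Rightarrow> ('a \<Rightarrow> real, 'a derivation \<Rightarrow> 'a vfield set) module"
  where "Dell_dual A \<xi> = hom_module (Cinf A) (Dell A \<xi>) (ell A \<xi>)"

definition varpi_flat ::
  "('a, 'e::euclidean_space) atlas \<Rightarrow> 'a distr \<Rightarrow> 'a derivation \<Rightarrow> 'a derivation \<Rightarrow> 'a vfield set" where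
  "varpi_flat A \<xi> D = (\<lambda>D'\<in>carrier (Dell A \<xi>). varpi A \<xi> [D, D'])"

definition KK ::
  "('a, 'e::euclidean_space) atlas \<Rightarrow> 'a distr \<Rightarrow> ('a \<Rightarrow> real, 'a derivation) module" where
  "KK A \<xi> = (Dell A \<xi>)\<lparr>carrier :=
     {D \<in> carrier (Dell A \<xi>). varpi_flat A \<xi> D = \<zero>\<^bsub>Dell_dual A \<xi>\<^esub>}\<rparr>"

definition Gt ::
  "('a, 'e::euclidean_space) atlas \<Rightarrow> 'a distr \<Rightarrow> 'a distr \<Rightarrow> ('a \<Rightarrow> real, 'a derivation) module" where
  "Gt A \<xi> G = (Dell A \<xi>)\<lparr>carrier := {D \<in> carrier (Dell A \<xi>). symbol A \<xi> D \<in> sections A G}\<rparr>"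

definition prK ::
  "('a, 'e::euclidean_space) atlas \<Rightarrow> 'a distr \<Rightarrow> 'a distr \<Rightarrow> 'a derivation \<Rightarrow> 'a derivation" where
  "prK A \<xi> G D = (THE \<Delta>. \<Delta> \<in> carrier (KK A \<xi>) \<and> D \<ominus>\<^bsub>Dell A \<xi>\<^esub> \<Delta> \<in> carrier (Gt A \<xi> G))"

definition symbolK_inv ::
  "('a, 'e::euclidean_space) atlas \<Rightarrow> 'a distr \<Rightarrow> 'a vfield \<Rightarrow> 'a derivation" where
  "symbolK_inv A \<xi> = inv_into (carrier (KK A \<xi>)) (symbol A \<xi>)"

text \<open>\<open>\<varpi>\<^sup>\<flat>\<close> restricted to \<open>\<sigma>\<^sup>-\<^sup>1(G)\<close>, as a map into \<open>\<sigma>\<^sup>-\<^sup>1(G)\<^sup>* \<otimes> \<ell>\<close>, and its inverse.\<close>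

definition varpi_flat_Gt ::
  "('a, 'e::euclidean_space) atlas \<Rightarrow> 'a distr \<Rightarrow> 'a distr \<Rightarrow> 'a derivation \<Rightarrow>
   'a derivation \<Rightarrow> 'a vfield set" where
  "varpi_flat_Gt A \<xi> G D = (\<lambda>D'\<in>carrier (Gt A \<xi> G). varpi A \<xi> [D, D'])"

definition varpi_flat_Gt_inv ::
  "('a, 'e::euclidean_space) atlas \<Rightarrow> 'a distr \<Rightarrow> 'a distr \<Rightarrow>
   ('a derivation \<Rightarrow> 'a vfield set) \<Rightarrow> 'a derivation" where
  "varpi_flat_Gt_inv A \<xi> G = inv_into (carrier (Gt A \<xi> G)) (varpi_flat_Gt A \<xi> G)"

section \<open>Quotients and representations\<close>

definition Dperp ::
  "('a, 'e::euclidean_space) atlas \<Rightarrow> 'a distr \<Rightarrow> ('a \<Rightarrow> real, 'a derivation set) module" where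
  "Dperp A \<xi> = quot_module (Dell A \<xi>) (carrier (KK A \<xi>))"

definition mod_K :: "('a, 'e::euclidean_space) atlas \<Rightarrow> 'a distr \<Rightarrow> 'a derivation \<Rightarrow> 'a derivation set"
  where "mod_K A \<xi> D = carrier (KK A \<xi>) +>\<^bsub>Dell A \<xi>\<^esub> D"

definition J1perp ::
  "('a, 'e::euclidean_space) atlas \<Rightarrow> 'a distr \<Rightarrow> ('a \<Rightarrow> real, 'a derivation \<Rightarrow> 'a vfield set) module"
  where "J1perp A \<xi> = (Dell_dual A \<xi>)\<lparr>carrier :=
     {\<alpha> \<in> carrier (Dell_dual A \<xi>). \<forall>\<Delta>\<in>carrier (KK A \<xi>). \<alpha> \<Delta> = \<zero>\<^bsub>ell A \<xi>\<^esub>}\<rparr>"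

text \<open>The pairing of \<open>J\<^sup>1\<^sub>\<bottom>\<ell>\<close> with \<open>D\<^sub>\<bottom>\<ell>\<close>.\<close>

definition pairing :: "('a derivation \<Rightarrow> 'a vfield set) \<Rightarrow> 'a derivation set \<Rightarrow> 'a vfield set" where
  "pairing \<alpha> B = induced \<alpha> B"

definition symbol_perp ::
  "('a, 'e::euclidean_space) atlas \<Rightarrow> 'a distr \<Rightarrow> 'a derivation set \<Rightarrow> 'a vfield set" where
  "symbol_perp A \<xi> = induced (\<lambda>D. mod_TF A \<xi> (symbol A \<xi> D))"

definition varpi_flat_perp ::
  "('a, 'e::euclidean_space) atlas \<Rightarrow> 'a distr \<Rightarrow> 'a derivation set \<Rightarrow>
   'a derivation \<Rightarrow> 'a vfield set" where
  "varpi_flat_perp A \<xi> = induced (varpi_flat A \<xi>)"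

definition varpi_sharp_perp ::
  "('a, 'e::euclidean_space) atlas \<Rightarrow> 'a distr \<Rightarrow> ('a derivation \<Rightarrow> 'a vfield set) \<Rightarrow>
   'a derivation set" where
  "varpi_sharp_perp A \<xi> = inv_into (carrier (Dperp A \<xi>)) (varpi_flat_perp A \<xi>)"

definition nabla_ell ::
  "('a, 'e::euclidean_space) atlas \<Rightarrow> 'a distr \<Rightarrow> 'a vfield \<Rightarrow> 'a vfield set \<Rightarrow> 'a vfield set" where
  "nabla_ell A \<xi> X = induced (\<lambda>Y. theta A \<xi> (lie X Y))"

definition nabla_NF ::
  "('a, 'e::euclidean_space) atlas \<Rightarrow> 'a distr \<Rightarrow> 'a vfield \<Rightarrow> 'a vfield set \<Rightarrow> 'a vfield set" where
  "nabla_NF A \<xi> X = induced (\<lambda>Y. mod_TF A \<xi> (lie X Y))"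

definition nabla_Dperp ::
  "('a, 'e::euclidean_space) atlas \<Rightarrow> 'a distr \<Rightarrow> 'a derivation \<Rightarrow> 'a derivation set \<Rightarrow>
   'a derivation set" where
  "nabla_Dperp A \<xi> \<Delta> = induced (\<lambda>D. mod_K A \<xi> (commutator A \<xi> \<Delta> D))"

definition nabla_J1perp ::
  "('a, 'e::euclidean_space) atlas \<Rightarrow> 'a distr \<Rightarrow> 'a derivation \<Rightarrow>
   ('a derivation \<Rightarrow> 'a vfield set) \<Rightarrow> 'a derivation \<Rightarrow> 'a vfield set" where
  "nabla_J1perp A \<xi> \<Delta> \<alpha> = (\<lambda>D\<in>carrier (Dell A \<xi>).
     \<Delta> (pairing \<alpha> (mod_K A \<xi> D)) \<ominus>\<^bsub>ell A \<xi>\<^esub> pairing \<alpha> (nabla_Dperp A \<xi> \<Delta> (mod_K A \<xi> D)))"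

section \<open>The complexes\<close>

definition Omega_F_ell ::
  "('a, 'e::euclidean_space) atlas \<Rightarrow> 'a distr \<Rightarrow> nat \<Rightarrow>
   ('a \<Rightarrow> real, 'a vfield list \<Rightarrow> 'a vfield set) module" where
  "Omega_F_ell A \<xi> n = forms (Cinf A) (TF A \<xi>) (ell A \<xi>) n"

definition d_F_ell ::
  "('a, 'e::euclidean_space) atlas \<Rightarrow> 'a distr \<Rightarrow> nat \<Rightarrow>
   ('a vfield list \<Rightarrow> 'a vfield set) \<Rightarrow> 'a vfield list \<Rightarrow> 'a vfield set" where
  "d_F_ell A \<xi> n = koszul (TF A \<xi>) lie (ell A \<xi>) (nabla_ell A \<xi>) n"

definition Omega_F_NF ::
  "('a, 'e::euclidean_space) atlas \<Rightarrow> 'a distr \<Rightarrow> nat \<Rightarrow>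
   ('a \<Rightarrow> real, 'a vfield list \<Rightarrow> 'a vfield set) module" where
  "Omega_F_NF A \<xi> n = forms (Cinf A) (TF A \<xi>) (NF A \<xi>) n"

definition d_F_NF ::
  "('a, 'e::euclidean_space) atlas \<Rightarrow> 'a distr \<Rightarrow> nat \<Rightarrow>
   ('a vfield list \<Rightarrow> 'a vfield set) \<Rightarrow> 'a vfield list \<Rightarrow> 'a vfield set" where
  "d_F_NF A \<xi> n = koszul (TF A \<xi>) lie (NF A \<xi>) (nabla_NF A \<xi>) n"

definition Omega_K_J1perp ::
  "('a, 'e::euclidean_space) atlas \<Rightarrow> 'a distr \<Rightarrow> nat \<Rightarrow>
   ('a \<Rightarrow> real, 'a derivation list \<Rightarrow> 'a derivation \<Rightarrow> 'a vfield set) module" where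
  "Omega_K_J1perp A \<xi> n = forms (Cinf A) (KK A \<xi>) (J1perp A \<xi>) n"

definition d_K_J1perp ::
  "('a, 'e::euclidean_space) atlas \<Rightarrow> 'a distr \<Rightarrow> nat \<Rightarrow>
   ('a derivation list \<Rightarrow> 'a derivation \<Rightarrow> 'a vfield set) \<Rightarrow>
   'a derivation list \<Rightarrow> 'a derivation \<Rightarrow> 'a vfield set" where
  "d_K_J1perp A \<xi> n = koszul (KK A \<xi>) (commutator A \<xi>) (J1perp A \<xi>) (nabla_J1perp A \<xi>) n"

text \<open>Under \<open>D\<ell> = K \<oplus> \<sigma>\<^sup>-\<^sup>1(G)\<close> and \<open>D\<^sub>\<bottom>\<ell> \<simeq> \<sigma>\<^sup>-\<^sup>1(G)\<close>, the forms of bidegree \<open>(a, b)\<close> are the forms of degree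
  \<open>a + b\<close> that vanish on lists of sections of \<open>K\<close> and \<open>\<sigma>\<^sup>-\<^sup>1(G)\<close> unless exactly \<open>b\<close> of them are taken
  from \<open>K\<close>.\<close>

definition Omega_D_bi ::
  "('a, 'e::euclidean_space) atlas \<Rightarrow> 'a distr \<Rightarrow> 'a distr \<Rightarrow> nat \<Rightarrow> nat \<Rightarrow>
   ('a \<Rightarrow> real, 'a derivation list \<Rightarrow> 'a vfield set) module" where
  "Omega_D_bi A \<xi> G a b = (Omega_D A \<xi> (a + b))\<lparr>carrier :=
     {\<eta> \<in> carrier (Omega_D A \<xi> (a + b)). \<forall>I \<subseteq> {..<a + b}. \<forall>xs\<in>tuples (Dell A \<xi>) (a + b).
        (\<forall>i<a + b. xs ! i \<in> carrier (if i \<in> I then KK A \<xi> else Gt A \<xi> G)) \<and> card I \<noteq> b \<longrightarrow>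
        \<eta> xs = \<zero>\<^bsub>ell A \<xi>\<^esub>}\<rparr>"

text \<open>Component of bidegree \<open>(a, b)\<close> of a form of degree \<open>a + b\<close>.\<close>

definition component ::
  "('a, 'e::euclidean_space) atlas \<Rightarrow> 'a distr \<Rightarrow> 'a distr \<Rightarrow> nat \<Rightarrow> nat \<Rightarrow>
   ('a derivation list \<Rightarrow> 'a vfield set) \<Rightarrow> 'a derivation list \<Rightarrow> 'a vfield set" where
  "component A \<xi> G a b \<eta> = (\<lambda>xs\<in>tuples (Dell A \<xi>) (a + b).
     \<Oplus>\<^bsub>ell A \<xi>\<^esub>I\<in>{I. I \<subseteq> {..<a + b} \<and> card I = b}.
       \<eta> (map (\<lambda>i. if i \<in> I then prK A \<xi> G (xs ! i)
                    else xs ! i \<ominus>\<^bsub>Dell A \<xi>\<^esub> prK A \<xi> G (xs ! i)) [0..<a + b]))"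

definition d01 ::
  "('a, 'e::euclidean_space) atlas \<Rightarrow> 'a distr \<Rightarrow> 'a distr \<Rightarrow> nat \<Rightarrow> nat \<Rightarrow>
   ('a derivation list \<Rightarrow> 'a vfield set) \<Rightarrow> 'a derivation list \<Rightarrow> 'a vfield set" where
  "d01 A \<xi> G a b \<eta> = component A \<xi> G a (b + 1) (d_D A \<xi> (a + b) \<eta>)"

definition d10 ::
  "('a, 'e::euclidean_space) atlas \<Rightarrow> 'a distr \<Rightarrow> 'a distr \<Rightarrow> nat \<Rightarrow> nat \<Rightarrow>
   ('a derivation list \<Rightarrow> 'a vfield set) \<Rightarrow> 'a derivation list \<Rightarrow> 'a vfield set" where
  "d10 A \<xi> G a b \<eta> = component A \<xi> G (a + 1) b (d_D A \<xi> (a + b) \<eta>)"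

section \<open>The maps\<close>

text \<open>\<open>(\<sigma>|\<^sub>K)\<^sup>*\<close>, and the identification \<open>pr\<^sub>K\<^sup>*\<close> of \<open>\<Omega>\<^sup>n(K, \<ell>)\<close> with the forms of bidegree \<open>(0, n)\<close>.\<close>

definition symbolK_pull ::
  "('a, 'e::euclidean_space) atlas \<Rightarrow> 'a distr \<Rightarrow> nat \<Rightarrow>
   ('a vfield list \<Rightarrow> 'a vfield set) \<Rightarrow> 'a derivation list \<Rightarrow> 'a vfield set" where
  "symbolK_pull A \<xi> n = pullback (KK A \<xi>) n (symbol A \<xi>)"

definition prK_pull ::
  "('a, 'e::euclidean_space) atlas \<Rightarrow> 'a distr \<Rightarrow> 'a distr \<Rightarrow> nat \<Rightarrow>
   ('a derivation list \<Rightarrow> 'a vfield set) \<Rightarrow> 'a derivation list \<Rightarrow> 'a vfield set" where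
  "prK_pull A \<xi> G n = pullback (Dell A \<xi>) n (prK A \<xi> G)"

definition d10_symbolK_pull ::
  "('a, 'e::euclidean_space) atlas \<Rightarrow> 'a distr \<Rightarrow> 'a distr \<Rightarrow> nat \<Rightarrow>
   ('a vfield list \<Rightarrow> 'a vfield set) \<Rightarrow> 'a derivation list \<Rightarrow> 'a vfield set" where
  "d10_symbolK_pull A \<xi> G n \<eta> = d10 A \<xi> G 0 n (prK_pull A \<xi> G n (symbolK_pull A \<xi> n \<eta>))"

definition tau ::
  "('a, 'e::euclidean_space) atlas \<Rightarrow> 'a distr \<Rightarrow> 'a distr \<Rightarrow> nat \<Rightarrow>
   ('a derivation list \<Rightarrow> 'a vfield set) \<Rightarrow> 'a derivation list \<Rightarrow> 'a derivation \<Rightarrow> 'a vfield set" where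
  "tau A \<xi> G b \<eta> = (\<lambda>\<Delta>s\<in>tuples (KK A \<xi>) b.
     THE \<alpha>. \<alpha> \<in> carrier (J1perp A \<xi>) \<and>
       (\<forall>D\<in>carrier (Gt A \<xi> G). \<eta> (D # \<Delta>s) = pairing \<alpha> (mod_K A \<xi> D)))"

definition Rmap ::
  "('a, 'e::euclidean_space) atlas \<Rightarrow> 'a distr \<Rightarrow> nat \<Rightarrow>
   ('a derivation list \<Rightarrow> 'a derivation \<Rightarrow> 'a vfield set) \<Rightarrow> 'a vfield list \<Rightarrow> 'a vfield set" where
  "Rmap A \<xi> b \<eta> = (\<lambda>Xs\<in>tuples (TF A \<xi>) b.
     \<ominus>\<^bsub>NF A \<xi>\<^esub> signed (NF A \<xi>) b
       (symbol_perp A \<xi> (varpi_sharp_perp A \<xi> (\<eta> (map (symbolK_inv A \<xi>) Xs)))))"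

text \<open>\<open>\<sigma>\<^sup>*\<beta>\<close> as a section of \<open>\<sigma>\<^sup>-\<^sup>1(G)\<^sup>* \<otimes> \<ell>\<close>, for a section \<open>\<beta>\<close> of \<open>N\<^sup>*\<F> \<otimes> \<ell> \<simeq> G\<^sup>* \<otimes> \<ell>\<close>.\<close>

definition symbol_pull_beta ::
  "('a, 'e::euclidean_space) atlas \<Rightarrow> 'a distr \<Rightarrow> 'a distr \<Rightarrow>
   ('a vfield set \<Rightarrow> 'a vfield set) \<Rightarrow> 'a derivation \<Rightarrow> 'a vfield set" where
  "symbol_pull_beta A \<xi> G \<beta> = (\<lambda>D\<in>carrier (Gt A \<xi> G). \<beta> (mod_TF A \<xi> (symbol A \<xi> D)))"

definition Phi ::
  "('a, 'e::euclidean_space) atlas \<Rightarrow> 'a distr \<Rightarrow> 'a distr \<Rightarrow> nat \<Rightarrow>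
   ('a vfield list \<Rightarrow> 'a vfield set) \<Rightarrow> 'a vfield list \<Rightarrow> 'a vfield set" where
  "Phi A \<xi> G n \<eta> = (THE \<zeta>. \<zeta> \<in> carrier (Omega_F_NF A \<xi> n) \<and>
     (\<forall>\<beta>\<in>carrier (NF_dual_ell A \<xi>). \<forall>\<Delta>s\<in>tuples (KK A \<xi>) n.
        \<beta> (\<zeta> (map (symbol A \<xi>) \<Delta>s)) =
        d_D A \<xi> n (prK_pull A \<xi> G n (symbolK_pull A \<xi> n \<eta>))
          (\<Delta>s @ [varpi_flat_Gt_inv A \<xi> G (symbol_pull_beta A \<xi> G \<beta>)])))"

end

theory Submission
 imports Defs
begin

text \<open>
Cartan's recursion \<open>\<iota>\<^sub>x d = \<L>\<^sub>x - d \<iota>\<^sub>x\<close> for the Koszul differential yields \<open>d\<^sup>2 = 0\<close> and naturality under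
maps of representations by induction on the degree.

Geometry enters at three points: \<open>\<Gamma>(\<ell>)\<close> is a faithful module, its endomorphisms are multiplications
by functions (so \<open>ker \<sigma>\<close> is spanned by the identity), and \<open>\<omega>\<close> is nondegenerate modulo \<open>T\<F>\<close>. Together
they show that \<open>\<varpi>\<^sup>\<flat>\<close> maps onto \<open>J\<^sup>1\<^sub>\<bottom>\<ell>\<close> with kernel \<open>K\<close>. All other steps are algebra.

A form of bidegree \<open>(1, b)\<close> is determined by its values on one section of \<open>\<sigma>\<^sup>-\<^sup>1(G)\<close> followed by \<open>b\<close>
sections of \<open>K\<close>. On such arguments the first chain map is the identity \<open>d\<^sub>D\<^sup>2 = 0\<close>, to which the
component \<open>d\<^sub>2\<^sub>,\<^sub>-\<^sub>1\<close> does not contribute; for \<open>\<tau>\<close> both sides are expanded by the Koszul formula; for \<open>R\<close>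
the reason is that \<open>\<varpi>\<^sup>\<flat>\<close>, hence \<open>\<sigma>\<^sub>\<bottom> \<circ> \<varpi>\<^sup>\<sharp>\<^sub>\<bottom>\<close>, is equivariant. Finally \<open>\<Phi>\<^sub>G\<close> is the composite because
\<open>\<varpi>\<close> is skew and moving the last argument of the form to the front costs \<open>(-1)\<^sup>n\<close>; the defining equation of
\<open>\<Phi>\<^sub>G\<close> has one solution since \<open>N\<^sup>*\<F> \<otimes> \<ell>\<close> separates the sections of \<open>N\<F>\<close>.\<close>

section \<open>Modules of functions\<close>

text \<open>Most modules here are quotients or modules of maps, where an identity has no normal form
  to compute with; hence the embedding into families of functions. For a quotient it takes a linear
  map with the right kernel, and geometry has to supply it: for \<ell> a projector with kernel
  \<Gamma>(\<xi>), glued from local contact forms; for N\<F> the projection to G along T\<F>; for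
  D\<ell>/K the projection to the preimage of G. The hard step is that \<varpi>^\<flat> is onto. A
  preimage of \<alpha> is prescribed on representatives of sections of \<ell>, and it descends to
  \<ell> only if it kills \<Gamma>(\<xi>). This condition is an equation \<omega>(X', Y) =
  \<gamma>(Y) on \<xi>. It is solvable because \<gamma> vanishes on T\<F>, which holds because
  \<alpha> vanishes on K. The factor (-1)^b in R depends on the degree, so it turns a map that
  commutes with the differentials into one that anticommutes; hence the negated differential on its
  target.\<close>

text \<open>The map \<open>\<iota>\<close> realises the elements of the module by families of functions; equations in the module
 thereby become equations between real numbers.\<close>

locale fun_module =
 fixes S :: "('a => real) set" and M :: "('a => real, 'm) module" (structure)
  and \<iota> :: "'m => 'i => 'a => real"
 assumes const_mem: "(\<lambda>_. c) \<in> S"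
  and zero_mem [simp]: "\<zero> \<in> carrier M"
  and add_mem [simp]: "x \<in> carrier M ==> y \<in> carrier M ==> x \<oplus> y \<in> carrier M"
  and smult_mem [simp]: "r \<in> S ==> x \<in> carrier M ==> r \<odot> x \<in> carrier M"
  and inj: "inj_on \<iota> (carrier M)"
  and zero_val [simp]: "\<iota> \<zero> i p = 0"
  and add_val [simp]: "x \<in> carrier M ==> y \<in> carrier M ==> \<iota> (x \<oplus> y) i p = \<iota> x i p + \<iota> y i p"
  and smult_val [simp]: "r \<in> S ==> x \<in> carrier M ==> \<iota> (r \<odot> x) i p = r p * \<iota> x i p"
begin

lemma eqI: "x \<in> carrier M ==> y \<in> carrier M ==> (\<And>i p. \<iota> x i p = \<iota> y i p) ==> x = y"
 using inj by (auto simp: inj_on_def fun_eq_iff)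

lemma abelian_group: "abelian_group M"
proof (rule abelian_groupI)
 fix x assume x: "x \<in> carrier M"
 show "\<exists>y\<in>carrier M. y \<oplus> x = \<zero>"
  by (rule bexI[of _ "(\<lambda>_. - 1) \<odot> x"]) (auto intro!: eqI simp: x const_mem)
qed (auto intro!: eqI)

sublocale abelian_group M
 by (rule abelian_group)

lemma neg_val [simp]: "x \<in> carrier M ==> \<iota> (\<ominus> x) i p = - \<iota> x i p"
 using add_val[of x "\<ominus> x" i p] by (simp add: r_neg)

lemma minus_val [simp]: "x \<in> carrier M ==> y \<in> carrier M ==> \<iota> (x \<ominus> y) i p = \<iota> x i p - \<iota> y i p"
 by (simp add: a_minus_def)

lemma finsum_val [simp]:
 "finite I ==> f \<in> I \<rightarrow> carrier M ==> \<iota> (finsum M f I) i p = (\<Sum>k\<in>I. \<iota> (f k) i p)"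
 by (induction I rule: finite_induct) (auto simp: Pi_def)

lemma signed_mem [simp]: "x \<in> carrier M ==> signed M k x \<in> carrier M"
 by (simp add: signed_def)

lemma signed_val [simp]: "x \<in> carrier M ==> \<iota> (signed M k x) i p = (- 1) ^ k * \<iota> x i p"
 by (simp add: signed_def)

text \<open>\<open>TF\<close>, \<open>KK\<close> and the forms of bidegree (1, b) are cut out of
  modules already realised; they keep the same realisation.\<close>

lemma sub: 
 assumes "N \<subseteq> carrier M" "\<zero> \<in> N" "\<And>x y. x \<in> N ==> y \<in> N ==> x \<oplus> y \<in> N"
  "\<And>r x. r \<in> S ==> x \<in> N ==> r \<odot> x \<in> N"
 shows "fun_module S (M\<lparr>carrier := N\<rparr>) \<iota>"
 using assms const_mem inj_on_subset[OF inj assms(1)] by unfold_locales (auto simp: subset_iff)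

end

lemma tuples_0 [simp]: "tuples L 0 = {[]}"
 by (auto simp: tuples_def)

lemma Cons_tuples [simp]: "x # xs \<in> tuples L (Suc n) \<longleftrightarrow> x \<in> carrier L \<and> xs \<in> tuples L n"
 by (auto simp: tuples_def)

lemma tup_SucE:
 assumes "xs \<in> tuples L (Suc n)"
 obtains y ys where "xs = y # ys" "y \<in> carrier L" "ys \<in> tuples L n"
 using assms by (cases xs) (auto simp: tuples_def)

section \<open>Alternating forms\<close>

locale fm_pair = L: fun_module S L \<kappa> + E: fun_module S E \<iota>
 for S :: "('a => real) set" and L :: "('a => real, 'x) module" and \<kappa> :: "'x => 'j => 'a => real"
  and E :: "('a => real, 'y) module" and \<iota> :: "'y => 'i => 'a => real"
begin

abbreviation (input) e_add (infixl "+\<^sub>e" 65) where "s +\<^sub>e t \<equiv> s \<oplus>\<^bsub>E\<^esub> t"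
abbreviation (input) e_diff (infixl "-\<^sub>e" 65) where "s -\<^sub>e t \<equiv> s \<ominus>\<^bsub>E\<^esub> t"
abbreviation (input) e_neg ("-\<^sub>e _" [81] 80) where "-\<^sub>e s \<equiv> \<ominus>\<^bsub>E\<^esub> s"
abbreviation (input) e_smult (infixl "*\<^sub>e" 70) where "f *\<^sub>e s \<equiv> f \<odot>\<^bsub>E\<^esub> s"
abbreviation (input) e_zero ("0\<^sub>e") where "0\<^sub>e \<equiv> \<zero>\<^bsub>E\<^esub>"
abbreviation (input) x_add (infixl "+\<^sub>x" 65) where "s +\<^sub>x t \<equiv> s \<oplus>\<^bsub>L\<^esub> t"
abbreviation (input) x_diff (infixl "-\<^sub>x" 65) where "s -\<^sub>x t \<equiv> s \<ominus>\<^bsub>L\<^esub> t"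
abbreviation (input) x_neg ("-\<^sub>x _" [81] 80) where "-\<^sub>x s \<equiv> \<ominus>\<^bsub>L\<^esub> s"
abbreviation (input) x_smult (infixl "*\<^sub>x" 70) where "f *\<^sub>x s \<equiv> f \<odot>\<^bsub>L\<^esub> s"
abbreviation (input) x_zero ("0\<^sub>x") where "0\<^sub>x \<equiv> \<zero>\<^bsub>L\<^esub>"

text \<open>Conditions are put on the first slot only, and alternation on the first two; the
  recursion through the contractions \<eta>(x, ...) carries them to all slots. This is the shape
  that inductions along Cartan's formula need. Values outside \<open>tuples L n\<close> are
  unconstrained.\<close>

primrec altform :: "nat => ('x list => 'y) => bool" where
 "altform 0 \<eta> \<longleftrightarrow> \<eta> [] \<in> carrier E"
| "altform (Suc n) \<eta> \<longleftrightarrow>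
   (\<forall>x\<in>carrier L. altform n (\<lambda>xs. \<eta> (x # xs))) \<and>
   (\<forall>x\<in>carrier L. \<forall>y\<in>carrier L. \<forall>xs\<in>tuples L n.
    \<eta> ((x +\<^sub>x y) # xs) = \<eta> (x # xs) +\<^sub>e \<eta> (y # xs)) \<and>
   (\<forall>r\<in>S. \<forall>x\<in>carrier L. \<forall>xs\<in>tuples L n. \<eta> ((r *\<^sub>x x) # xs) = r *\<^sub>e \<eta> (x # xs)) \<and>
   (\<forall>x\<in>carrier L. \<forall>xs. x # xs \<in> tuples L n \<longrightarrow> \<eta> (x # x # xs) = 0\<^sub>e)"

lemma altform_mem: "altform n \<eta> ==> xs \<in> tuples L n ==> \<eta> xs \<in> carrier E"
 by (induction n arbitrary: \<eta> xs) (auto elim!: tup_SucE)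

lemma altform_cong: "(\<And>xs. xs \<in> tuples L n ==> \<eta> xs = \<zeta> xs) ==> altform n \<eta> \<longleftrightarrow> altform n \<zeta>"
proof (induction n arbitrary: \<eta> \<zeta>)
 case (Suc n)
 have "altform n (\<lambda>xs. \<eta> (x # xs)) \<longleftrightarrow> altform n (\<lambda>xs. \<zeta> (x # xs))" if "x \<in> carrier L" for x
  using that Suc.prems by (intro Suc.IH) auto
 thus ?case
  using Suc.prems by (auto simp: tuples_def) 
qed auto

lemma altform_Cons: "altform (Suc n) \<eta> ==> x \<in> carrier L ==> altform n (\<lambda>xs. \<eta> (x # xs))"
 by simp

lemma altform_add: "altform n \<eta> ==> altform n \<zeta> ==> altform n (\<lambda>xs. \<eta> xs +\<^sub>e \<zeta> xs)"
proof (induction n arbitrary: \<eta> \<zeta>)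
 case (Suc n)
 note mem = altform_mem[OF Suc.prems(1)] altform_mem[OF Suc.prems(2)]
 show ?case
  using Suc mem by (auto intro!: E.eqI simp: algebra_simps)
qed auto

lemma altform_smult: "r \<in> S ==> altform n \<eta> ==> altform n (\<lambda>xs. r *\<^sub>e \<eta> xs)"
proof (induction n arbitrary: \<eta>)
 case (Suc n)
 note mem = altform_mem[OF Suc.prems(2)]
 show ?case
  using Suc mem by (auto intro!: E.eqI simp: algebra_simps)
qed auto

lemma altform_zero: "altform n (\<lambda>xs. 0\<^sub>e)"
 by (induction n) (auto intro!: E.eqI)

lemma altform_diff: "altform n \<eta> ==> altform n \<zeta> ==> altform n (\<lambda>xs. \<eta> xs -\<^sub>e \<zeta> xs)"
proof (induction n arbitrary: \<eta> \<zeta>)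
 case (Suc n)
 note mem = altform_mem[OF Suc.prems(1)] altform_mem[OF Suc.prems(2)]
 show ?case
  using Suc mem by (auto intro!: E.eqI simp: algebra_simps)
qed auto

section \<open>Skew symmetry, and slots other than the first\<close>

lemma altform_swap:
 assumes "altform (Suc (Suc n)) \<eta>" "x \<in> carrier L" "y \<in> carrier L" "xs \<in> tuples L n"
 shows "\<eta> (x # y # xs) = -\<^sub>e \<eta> (y # x # xs)"
proof -
 note mem = altform_mem[OF assms(1)]
 \<comment> \<open>Polarisation: this value is expanded in both of the first two slots.\<close>
 have "\<eta> ((x +\<^sub>x y) # (x +\<^sub>x y) # xs) = 0\<^sub>e"
  using assms by simp
 moreover have "\<eta> ((x +\<^sub>x y) # zs) = \<eta> (x # zs) +\<^sub>e \<eta> (y # zs)" if "zs \<in> tuples L (Suc n)" for zs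
  using assms that by simp
 moreover have "\<eta> (z # (x +\<^sub>x y) # xs) = \<eta> (z # x # xs) +\<^sub>e \<eta> (z # y # xs)" if "z \<in> carrier L" for z
  using assms that by simp
 moreover have "\<eta> (x # x # xs) = 0\<^sub>e" "\<eta> (y # y # xs) = 0\<^sub>e"
  using assms by simp_all
 ultimately have "\<eta> (x # y # xs) +\<^sub>e \<eta> (y # x # xs) = 0\<^sub>e"
  using assms(2-) mem[of "x # y # xs"] mem[of "y # x # xs"] by (auto simp: E.a_comm)
 thus ?thesis
  using assms mem by (metis Cons_tuples E.minus_equality)
qed

lemma altform_list_update_add:
 "altform n \<eta> ==> xs \<in> tuples L n ==> i < n ==> x \<in> carrier L ==> y \<in> carrier L ==>
  \<eta> (xs[i := x +\<^sub>x y]) = \<eta> (xs[i := x]) +\<^sub>e \<eta> (xs[i := y])"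
proof (induction n arbitrary: \<eta> xs i)
 case (Suc n)
 from Suc.prems(2) obtain z zs where xs: "xs = z # zs" "z \<in> carrier L" "zs \<in> tuples L n"
  by (rule tup_SucE)
 show ?case
  using Suc.prems Suc.IH[of "\<lambda>xs. \<eta> (z # xs)" zs "i - 1"] xs by (cases i) auto
qed auto

lemma altform_list_update_smult:
 "altform n \<eta> ==> xs \<in> tuples L n ==> i < n ==> x \<in> carrier L ==> r \<in> S ==>
  \<eta> (xs[i := r *\<^sub>x x]) = r *\<^sub>e \<eta> (xs[i := x])"
proof (induction n arbitrary: \<eta> xs i)
 case (Suc n)
 from Suc.prems(2) obtain z zs where xs: "xs = z # zs" "z \<in> carrier L" "zs \<in> tuples L n"
  by (rule tup_SucE)
 show ?case
  using Suc.prems Suc.IH[of "\<lambda>xs. \<eta> (z # xs)" zs "i - 1"] xs by (cases i) auto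
qed auto

text \<open>If the next entry z differs from x, the contraction with z falls under the induction
  hypothesis, and one transposition brings x back to the front.\<close>

lemma altform_Cons_eq_zero:
 "altform (Suc n) \<eta> ==> x \<in> carrier L ==> xs \<in> tuples L n ==> x \<in> set xs ==> \<eta> (x # xs) = 0\<^sub>e"
proof (induction n arbitrary: \<eta> xs)
 case (Suc n)
 from Suc.prems(3) obtain z zs where xs: "xs = z # zs" "z \<in> carrier L" "zs \<in> tuples L n"
  by (rule tup_SucE)
 show ?case
 proof (cases "x = z")
  case True
  thus ?thesis using Suc.prems xs by simp
 next
  case False
  hence "\<eta> (z # x # zs) = 0\<^sub>e"
   using Suc.prems xs by (intro Suc.IH[of "\<lambda>xs. \<eta> (z # xs)"]) (auto simp del: altform.simps(2) dest: altform_Cons)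
  thus ?thesis
   using altform_swap[OF Suc.prems(1), of x z zs] xs Suc.prems by simp
 qed
qed auto

lemma altform_eq_zero:
 "altform n \<eta> ==> xs \<in> tuples L n ==> j < n ==> i < j ==> xs ! i = xs ! j ==> \<eta> xs = 0\<^sub>e"
proof (induction n arbitrary: \<eta> xs i j)
 case (Suc n)
 from Suc.prems(2) obtain z zs where xs: "xs = z # zs" "z \<in> carrier L" "zs \<in> tuples L n"
  by (rule tup_SucE)
 obtain j' where j: "j = Suc j'" using Suc.prems by (cases j) auto
 have len: "length zs = n" using xs by (auto simp: tuples_def)
 show ?case
 proof (cases i)
  case 0
  hence "z \<in> set zs" using Suc.prems xs j len by auto
  thus ?thesis
   using altform_Cons_eq_zero[OF Suc.prems(1), of z zs] xs by simp
 next
  case (Suc i')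
  thus ?thesis
   using Suc.prems Suc.IH[of "\<lambda>xs. \<eta> (z # xs)" zs j' i'] xs j by auto
 qed
qed auto

text \<open>Moving slot i to the front passes i entries, one transposition each. The signs of the
  Koszul formula are traded for slot positions with this rule.\<close>

lemma altform_list_update:
 "altform n \<eta> ==> xs \<in> tuples L n ==> i < n ==> x \<in> carrier L ==>
  \<eta> (xs[i := x]) = signed E i (\<eta> (x # omit i xs))"
proof (induction n arbitrary: \<eta> xs i)
 case (Suc n)
 from Suc.prems(2) obtain z zs where xs: "xs = z # zs" "z \<in> carrier L" "zs \<in> tuples L n"
  by (rule tup_SucE)
 show ?case
 proof (cases i)
  case 0
  thus ?thesis using xs by (simp add: omit_def signed_def)
 next
  case (Suc i')
  have om: "omit i' zs \<in> tuples L (n - 1)" "n = Suc (n - 1)"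
   using xs Suc Suc.prems(3) by (auto simp: omit_def tuples_def dest: in_set_takeD in_set_dropD)
  have "\<eta> (z # zs[i' := x]) = signed E i' (\<eta> (z # x # omit i' zs))"
   using Suc.prems Suc xs by (intro Suc.IH[of "\<lambda>xs. \<eta> (z # xs)"]) auto
  also have "\<eta> (z # x # omit i' zs) = -\<^sub>e \<eta> (x # z # omit i' zs)"
   using Suc.prems xs om by (intro altform_swap[of "n - 1"]) auto
  also have "signed E i' (-\<^sub>e \<eta> (x # z # omit i' zs)) = signed E i (\<eta> (x # omit i xs))"
   using Suc xs altform_mem[OF Suc.prems(1), of "x # z # omit i' zs"] om Suc.prems
   by (cases n) (auto simp: omit_def signed_def)
  finally show ?thesis using xs Suc by simp
 qed
qed auto

lemma list_update_tuples [simp]: "xs \<in> tuples L n ==> x \<in> carrier L ==> xs[i := x] \<in> tuples L n"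
 by (auto simp: tuples_def dest!: set_update_subset_insert[THEN subsetD])

text \<open>The bridge between \<open>forms\<close>, with its conditions on every slot, and the
  recursive \<open>altform\<close>. A condition on slot i + 1 of \<eta> is the condition on slot i
  of a contraction, so both directions are inductions.\<close>

lemma forms_iff:
 assumes "carrier R = S"
 shows "\<eta> \<in> carrier (forms R L E n) \<longleftrightarrow> \<eta> \<in> extensional (tuples L n) \<and> altform n \<eta>"
proof
 assume *: "\<eta> \<in> extensional (tuples L n) \<and> altform n \<eta>"
 thus "\<eta> \<in> carrier (forms R L E n)"
  using assms by (auto simp: forms_def PiE_def altform_mem altform_list_update_add
    altform_list_update_smult intro: altform_eq_zero)
next
 assume *: "\<eta> \<in> carrier (forms R L E n)"
 have "altform n \<eta>" if
  "\<forall>xs\<in>tuples L n. \<eta> xs \<in> carrier E"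
  "\<forall>xs\<in>tuples L n. \<forall>i<n. \<forall>x\<in>carrier L. \<forall>y\<in>carrier L.
      \<eta> (xs[i := x +\<^sub>x y]) = \<eta> (xs[i := x]) +\<^sub>e \<eta> (xs[i := y])"
   "\<forall>xs\<in>tuples L n. \<forall>i<n. \<forall>r\<in>S. \<forall>x\<in>carrier L.
      \<eta> (xs[i := r *\<^sub>x x]) = r *\<^sub>e \<eta> (xs[i := x])"
   "\<forall>xs\<in>tuples L n. \<forall>j<n. \<forall>i<j. xs ! i = xs ! j \<longrightarrow> \<eta> xs = 0\<^sub>e"
  using that
 proof (induction n arbitrary: \<eta>)
  case (Suc n)
  have "altform n (\<lambda>xs. \<eta> (x # xs))" if "x \<in> carrier L" for x
  proof (rule Suc.IH; intro ballI allI impI)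
   fix xs i j assume "xs \<in> tuples L n" "j < n" "i < j" "xs ! i = xs ! j"
   thus "\<eta> (x # xs) = 0\<^sub>e"
    using Suc.prems(4)[rule_format, of "x # xs" "Suc j" "Suc i"] that by auto
  next
   fix xs i y z assume "xs \<in> tuples L n" "i < n" "y \<in> carrier L" "z \<in> carrier L"
   thus "\<eta> (x # xs[i := y +\<^sub>x z]) = \<eta> (x # xs[i := y]) +\<^sub>e \<eta> (x # xs[i := z])"
    using Suc.prems(2)[rule_format, of "x # xs" "Suc i"] that by auto
  next
   fix xs i y r assume "xs \<in> tuples L n" "i < n" "y \<in> carrier L" "r \<in> S"
   thus "\<eta> (x # xs[i := r *\<^sub>x y]) = r *\<^sub>e \<eta> (x # xs[i := y])"
    using Suc.prems(3)[rule_format, of "x # xs" "Suc i"] that by auto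
  qed (use Suc.prems(1) that in auto)
  moreover have "\<eta> ((x +\<^sub>x y) # xs) = \<eta> (x # xs) +\<^sub>e \<eta> (y # xs)"
   if "x \<in> carrier L" "y \<in> carrier L" "xs \<in> tuples L n" for x y xs
   using Suc.prems(2)[rule_format, of "x # xs" 0] that by auto
  moreover have "\<eta> ((r *\<^sub>x x) # xs) = r *\<^sub>e \<eta> (x # xs)"
   if "x \<in> carrier L" "r \<in> S" "xs \<in> tuples L n" for x r xs
   using Suc.prems(3)[rule_format, of "x # xs" 0] that by auto
  moreover have "\<eta> (x # x # xs) = 0\<^sub>e" if "x \<in> carrier L" "x # xs \<in> tuples L n" for x xs
   using Suc.prems(4)[rule_format, of "x # x # xs" 1 0] that by (auto simp: tuples_def)
  ultimately show ?case by simp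
 qed auto
 thus "\<eta> \<in> extensional (tuples L n) \<and> altform n \<eta>"
  using * assms by (auto simp: forms_def PiE_def Pi_def)
qed

text \<open>A form is realised by its values on admissible tuples. The index set also contains lists
  of wrong length or with foreign entries; there a form is \<open>undefined\<close>, so the
  realisation is set to 0.\<close>

lemma fun_module_forms:
 assumes "carrier R = S"
 shows "fun_module S (forms R L E n) (\<lambda>\<eta> (xs, i) p. if xs \<in> tuples L n then \<iota> (\<eta> xs) i p else 0)"
proof (unfold_locales, goal_cases)
 case 5
 show ?case
 proof (rule inj_onI)
  fix \<eta> \<zeta> assume *: "\<eta> \<in> carrier (forms R L E n)" "\<zeta> \<in> carrier (forms R L E n)" and
   eq: "(\<lambda>(xs, i) p. if xs \<in> tuples L n then \<iota> (\<eta> xs) i p else 0) =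
      (\<lambda>(xs, i) p. if xs \<in> tuples L n then \<iota> (\<zeta> xs) i p else 0)"
  hence "\<eta> xs = \<zeta> xs" if "xs \<in> tuples L n" for xs
   using that by (auto simp: fun_eq_iff forms_iff[OF assms] altform_mem split: if_splits intro!: E.eqI)
  thus "\<eta> = \<zeta>"
   using * by (auto simp: forms_iff[OF assms] intro: extensionalityI)
 qed
next
 case (3 x y)
 have "altform n (\<lambda>xs\<in>tuples L n. x xs +\<^sub>e y xs) = altform n (\<lambda>xs. x xs +\<^sub>e y xs)"
  by (rule altform_cong) auto
 with 3 show ?case
  by (simp add: forms_iff[OF assms] altform_add) (simp add: forms_def)
next
 case (4 r x)
 have "altform n (\<lambda>xs\<in>tuples L n. r *\<^sub>e x xs) = altform n (\<lambda>xs. r *\<^sub>e x xs)"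
  by (rule altform_cong) auto
 with 4 show ?case
  by (simp add: forms_iff[OF assms] altform_smult) (simp add: forms_def)
next
 case 2
 have "altform n (\<lambda>xs\<in>tuples L n. 0\<^sub>e) = altform n (\<lambda>xs. 0\<^sub>e)"
  by (rule altform_cong) auto
 thus ?case
  by (simp add: forms_iff[OF assms] altform_zero) (simp add: forms_def)
qed (auto simp: forms_iff[OF assms] altform_mem L.const_mem, auto simp: forms_def altform_mem)

end

section \<open>The Koszul differential\<close>

text \<open>The algebra of a Lie algebroid with a flat action on E: Leibniz rules with a common
  anchor, the Jacobi identity and flatness. Instances are T\<F> acting on \<ell> and on N\<F>,
  D\<ell> acting on \<ell>, and K acting on J.\<close>

locale lie_rep = fm_pair S L \<kappa> E \<iota>
 for S :: "('a => real) set" and L :: "('a => real, 'x) module" and \<kappa> :: "'x => 'j => 'a => real"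
  and E :: "('a => real, 'y) module" and \<iota> :: "'y => 'i => 'a => real" +
 fixes br :: "'x => 'x => 'x" and anc :: "'x => ('a => real) => 'a => real" and nab :: "'x => 'y => 'y"
 assumes br_mem [simp]: "x \<in> carrier L ==> y \<in> carrier L ==> br x y \<in> carrier L"
  and br_add_left [simp]: "x \<in> carrier L ==> y \<in> carrier L ==> z \<in> carrier L ==>
   br (x +\<^sub>x y) z = br x z +\<^sub>x br y z"
  and br_self [simp]: "x \<in> carrier L ==> br x x = 0\<^sub>x"
  and br_add_right [simp]: "x \<in> carrier L ==> y \<in> carrier L ==> z \<in> carrier L ==>
   br x (y +\<^sub>x z) = br x y +\<^sub>x br x z"
  and br_smult [simp]: "r \<in> S ==> x \<in> carrier L ==> y \<in> carrier L ==>
   br x (r *\<^sub>x y) = r *\<^sub>x br x y +\<^sub>x anc x r *\<^sub>x y"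
  and jacobi: "x \<in> carrier L ==> y \<in> carrier L ==> z \<in> carrier L ==>
   br x (br y z) = br (br x y) z +\<^sub>x br y (br x z)"
  and anc_mem [simp]: "x \<in> carrier L ==> r \<in> S ==> anc x r \<in> S"
  and anc_const [simp]: "x \<in> carrier L ==> anc x (\<lambda>_. c) = (\<lambda>_. 0)"
  and nab_mem [simp]: "x \<in> carrier L ==> e \<in> carrier E ==> nab x e \<in> carrier E"
  and nab_add_left [simp]: "x \<in> carrier L ==> y \<in> carrier L ==> e \<in> carrier E ==>
   nab (x +\<^sub>x y) e = nab x e +\<^sub>e nab y e"
  and nab_smult_left [simp]: "r \<in> S ==> x \<in> carrier L ==> e \<in> carrier E ==>
   nab (r *\<^sub>x x) e = r *\<^sub>e nab x e"
  and nab_add_right [simp]: "x \<in> carrier L ==> e \<in> carrier E ==> f \<in> carrier E ==>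
   nab x (e +\<^sub>e f) = nab x e +\<^sub>e nab x f"
  and nab_smult_right [simp]: "x \<in> carrier L ==> e \<in> carrier E ==> r \<in> S ==>
   nab x (r *\<^sub>e e) = r *\<^sub>e nab x e +\<^sub>e anc x r *\<^sub>e e"
  and flat: "x \<in> carrier L ==> y \<in> carrier L ==> e \<in> carrier E ==>
   nab (br x y) e = nab x (nab y e) -\<^sub>e nab y (nab x e)"
begin

lemma E_neg_smult: "e \<in> carrier E ==> -\<^sub>e e = (\<lambda>_. - 1) *\<^sub>e e"
 by (auto intro!: E.eqI simp: E.const_mem)

lemma L_neg_smult: "x \<in> carrier L ==> -\<^sub>x x = (\<lambda>_. - 1) *\<^sub>x x"
 by (auto intro!: L.eqI simp: E.const_mem)

lemma nab_neg [simp]: "x \<in> carrier L ==> e \<in> carrier E ==> nab x (-\<^sub>e e) = -\<^sub>e nab x e"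
 using E.const_mem[of "-1"] E.const_mem[of 0]
 by (auto simp: E_neg_smult intro!: E.eqI)

lemma nab_minus [simp]: "x \<in> carrier L ==> e \<in> carrier E ==> f \<in> carrier E ==>
  nab x (e -\<^sub>e f) = nab x e -\<^sub>e nab x f"
 by (simp add: a_minus_def)

lemma nab_zero [simp]: "x \<in> carrier L ==> nab x 0\<^sub>e = 0\<^sub>e"
 using nab_minus[of x "0\<^sub>e" "0\<^sub>e"] by (simp add: E.r_neg a_minus_def)

lemma br_swap:
 assumes x: "x \<in> carrier L" and y: "y \<in> carrier L"
 shows "br y x = -\<^sub>x br x y"
proof -
 have "(br x x +\<^sub>x br y x) +\<^sub>x (br x y +\<^sub>x br y y) = br (x +\<^sub>x y) (x +\<^sub>x y)"
  using x y by (simp del: br_self)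
 hence "br y x +\<^sub>x br x y = 0\<^sub>x"
  using x y by simp
 thus ?thesis using x y by (metis L.minus_equality br_mem)
qed

text \<open>Lie derivative and differential, by Cartan's formulas
 \<open>\<iota>\<^sub>y \<L>\<^sub>x = \<L>\<^sub>x \<iota>\<^sub>y - \<iota>\<^bsub>[x, y]\<^esub>\<close> and \<open>\<iota>\<^sub>x d = \<L>\<^sub>x - d \<iota>\<^sub>x\<close>.\<close>

primrec lieD :: "'x => 'x list => ('x list => 'y) => 'y" where
 "lieD x [] \<eta> = nab x (\<eta> [])"
| "lieD x (y # ys) \<eta> = lieD x ys (\<lambda>zs. \<eta> (y # zs)) -\<^sub>e \<eta> (br x y # ys)"

primrec dif :: "'x list => ('x list => 'y) => 'y" where
 "dif [] \<eta> = 0\<^sub>e"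
| "dif (x # xs) \<eta> = lieD x xs \<eta> -\<^sub>e dif xs (\<lambda>zs. \<eta> (x # zs))"

text \<open>\<open>dr \<and> \<eta>\<close>\<close>

primrec wedge :: "('a => real) => 'x list => ('x list => 'y) => 'y" where
 "wedge r [] \<eta> = 0\<^sub>e"
| "wedge r (x # xs) \<eta> = anc x r *\<^sub>e \<eta> xs -\<^sub>e wedge r xs (\<lambda>zs. \<eta> (x # zs))"

text \<open>Linearity of the operators in the form only uses that its values lie in E;
  multilinearity enters when the arguments vary.\<close>

definition E_valued :: "nat => ('x list => 'y) => bool" where
 "E_valued n \<eta> \<longleftrightarrow> (\<forall>xs\<in>tuples L n. \<eta> xs \<in> carrier E)"

lemma E_valuedD: "E_valued n \<eta> ==> xs \<in> tuples L n ==> \<eta> xs \<in> carrier E"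
 by (simp add: E_valued_def)

lemma E_valued_Cons [simp]: "E_valued (Suc n) \<eta> ==> x \<in> carrier L ==> E_valued n (\<lambda>xs. \<eta> (x # xs))"
 by (simp add: E_valued_def)

lemma altform_valued: "altform n \<eta> ==> E_valued n \<eta>"
 by (simp add: E_valued_def altform_mem)

section \<open>Lie derivative and differential: linear in the form, tensorial in the
  arguments\<close>

lemma lieD_mem [simp]: "E_valued n \<eta> ==> x \<in> carrier L ==> xs \<in> tuples L n ==> lieD x xs \<eta> \<in> carrier E"
proof (induction n arbitrary: \<eta> xs)
 case (Suc n)
 thus ?case by (auto elim!: tup_SucE simp: E_valuedD)
qed (simp add: E_valued_def)

lemma lieD_cong:
 "(\<And>ys. ys \<in> tuples L n ==> \<eta> ys = \<zeta> ys) ==> x \<in> carrier L ==> xs \<in> tuples L n ==> lieD x xs \<eta> = lieD x xs \<zeta>"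
proof (induction n arbitrary: \<eta> \<zeta> xs)
 case (Suc n)
 from Suc.prems(3) obtain z zs where xs: "xs = z # zs" "z \<in> carrier L" "zs \<in> tuples L n"
  by (rule tup_SucE)
 thus ?case using Suc.prems Suc.IH[of "\<lambda>xs. \<eta> (z # xs)" "\<lambda>xs. \<zeta> (z # xs)" zs] by simp
qed auto

lemma lieD_add: "E_valued n \<eta> ==> E_valued n \<zeta> ==> x \<in> carrier L ==> xs \<in> tuples L n ==>
  lieD x xs (\<lambda>zs. \<eta> zs +\<^sub>e \<zeta> zs) = lieD x xs \<eta> +\<^sub>e lieD x xs \<zeta>"
proof (induction n arbitrary: \<eta> \<zeta> xs)
 case (Suc n)
 from Suc.prems(4) obtain z zs where xs: "xs = z # zs" "z \<in> carrier L" "zs \<in> tuples L n"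
  by (rule tup_SucE)
 show ?case
  using Suc.prems xs E_valuedD[OF Suc.prems(1)] E_valuedD[OF Suc.prems(2)]
   lieD_mem[of n "\<lambda>xs. \<eta> (z # xs)" x zs] lieD_mem[of n "\<lambda>xs. \<zeta> (z # xs)" x zs]
  by (simp add: Suc.IH) (auto intro!: E.eqI)
qed (simp add: E_valued_def)

lemma lieD_diff: "E_valued n \<eta> ==> E_valued n \<zeta> ==> x \<in> carrier L ==> xs \<in> tuples L n ==>
  lieD x xs (\<lambda>zs. \<eta> zs -\<^sub>e \<zeta> zs) = lieD x xs \<eta> -\<^sub>e lieD x xs \<zeta>"
proof (induction n arbitrary: \<eta> \<zeta> xs)
 case (Suc n)
 from Suc.prems(4) obtain z zs where xs: "xs = z # zs" "z \<in> carrier L" "zs \<in> tuples L n"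
  by (rule tup_SucE)
 show ?case
  using Suc.prems xs E_valuedD[OF Suc.prems(1)] E_valuedD[OF Suc.prems(2)]
   lieD_mem[of n "\<lambda>xs. \<eta> (z # xs)" x zs] lieD_mem[of n "\<lambda>xs. \<zeta> (z # xs)" x zs]
  by (simp add: Suc.IH) (auto intro!: E.eqI)
qed (simp add: E_valued_def)

lemma lieD_smult: "E_valued n \<eta> ==> r \<in> S ==> x \<in> carrier L ==> xs \<in> tuples L n ==>
  lieD x xs (\<lambda>zs. r *\<^sub>e \<eta> zs) = r *\<^sub>e lieD x xs \<eta> +\<^sub>e anc x r *\<^sub>e \<eta> xs"
proof (induction n arbitrary: \<eta> xs)
 case (Suc n)
 from Suc.prems(4) obtain z zs where xs: "xs = z # zs" "z \<in> carrier L" "zs \<in> tuples L n"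
  by (rule tup_SucE)
 show ?case
  using Suc.prems xs E_valuedD[OF Suc.prems(1)] lieD_mem[of n "\<lambda>xs. \<eta> (z # xs)" x zs]
  by (simp add: Suc.IH) (auto intro!: E.eqI simp: algebra_simps)
qed (simp add: E_valued_def)

lemma lieD_zero [simp]: "x \<in> carrier L ==> lieD x xs (\<lambda>zs. 0\<^sub>e) = 0\<^sub>e"
 by (induction xs) (auto simp: a_minus_def)

lemma lieD_add_arg: "altform n \<eta> ==> x \<in> carrier L ==> y \<in> carrier L ==> xs \<in> tuples L n ==>
  lieD (x +\<^sub>x y) xs \<eta> = lieD x xs \<eta> +\<^sub>e lieD y xs \<eta>"
proof (induction n arbitrary: \<eta> xs)
 case (Suc n)
 from Suc.prems(4) obtain z zs where xs: "xs = z # zs" "z \<in> carrier L" "zs \<in> tuples L n"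
  by (rule tup_SucE)
 note a = altform_Cons[OF Suc.prems(1) xs(2)]
 show ?case
  using Suc.prems xs altform_mem[OF Suc.prems(1)] lieD_mem[OF altform_valued[OF a], of x zs] 
   lieD_mem[OF altform_valued[OF a], of y zs] Suc.IH[OF a]
  by (auto intro!: E.eqI)
qed simp

lemma wedge_mem [simp]: "E_valued n \<eta> ==> r \<in> S ==> xs \<in> tuples L (Suc n) ==> wedge r xs \<eta> \<in> carrier E"
proof (induction n arbitrary: \<eta> xs)
 case (Suc n)
 from Suc.prems(3) obtain z zs where xs: "xs = z # zs" "z \<in> carrier L" "zs \<in> tuples L (Suc n)"
  by (rule tup_SucE)
 show ?case
  using Suc.prems xs Suc.IH[of "\<lambda>xs. \<eta> (z # xs)" zs] E_valuedD[OF Suc.prems(1)] by simp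
qed (auto elim!: tup_SucE simp: E_valued_def)

lemma wedge_cong:
 "(\<And>ys. ys \<in> tuples L n ==> \<eta> ys = \<zeta> ys) ==> xs \<in> tuples L (Suc n) ==> wedge r xs \<eta> = wedge r xs \<zeta>"
proof (induction n arbitrary: \<eta> \<zeta> xs)
 case (Suc n)
 from Suc.prems(2) obtain z zs where xs: "xs = z # zs" "z \<in> carrier L" "zs \<in> tuples L (Suc n)"
  by (rule tup_SucE)
 show ?case
  using Suc.prems xs Suc.IH[of "\<lambda>xs. \<eta> (z # xs)" "\<lambda>xs. \<zeta> (z # xs)" zs] by simp
qed (auto elim!: tup_SucE)

lemma wedge_neg: "E_valued n \<eta> ==> r \<in> S ==> xs \<in> tuples L (Suc n) ==>
 wedge r xs (\<lambda>ys. -\<^sub>e \<eta> ys) = -\<^sub>e wedge r xs \<eta>"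
proof (induction n arbitrary: \<eta> xs)
 case (Suc n)
 from Suc.prems(3) obtain z zs where xs: "xs = z # zs" "z \<in> carrier L" "zs \<in> tuples L (Suc n)"
  by (rule tup_SucE)
 show ?case
  using Suc.prems xs E_valuedD[OF Suc.prems(1)] wedge_mem[of n "\<lambda>xs. \<eta> (z # xs)" r zs]
  by (simp add: Suc.IH) (auto intro!: E.eqI)
qed (auto elim!: tup_SucE intro!: E.eqI simp: E_valued_def)

lemma br_smult_left:
 assumes "r \<in> S" "x \<in> carrier L" "y \<in> carrier L"
 shows "br (r *\<^sub>x x) y = r *\<^sub>x br x y +\<^sub>x (\<lambda>_. - 1) *\<^sub>x (anc y r *\<^sub>x x)"
 using assms E.const_mem[of "-1"] br_swap[of y "r *\<^sub>x x"] br_swap[of y x]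
 by (auto intro!: L.eqI)

text \<open>This is \<L>_(r x) = r \<L>_x + dr \<and> \<iota>_x. The derivative of r enters through
  [r x, z] = r [x, z] - z(r) x.\<close>

lemma lieD_smult_arg: "altform n \<eta> ==> r \<in> S ==> x \<in> carrier L ==> xs \<in> tuples L n ==>
  lieD (r *\<^sub>x x) xs \<eta> = r *\<^sub>e lieD x xs \<eta> +\<^sub>e wedge r xs (\<lambda>ys. \<eta> (x # ys))"
proof (induction n arbitrary: \<eta> xs)
 case (Suc n)
 from Suc.prems(4) obtain z zs where xs: "xs = z # zs" "z \<in> carrier L" "zs \<in> tuples L n"
  by (rule tup_SucE)
 note a = altform_Cons[OF Suc.prems(1) xs(2)]
 \<comment> \<open>The induction hypothesis is applied to the contraction with z, where z stands
   before x; in the claim x stands in front. One transposition inside the wedge product gives the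
   sign. For n = 0 both wedge products are empty.\<close>
 have w: "wedge r zs (\<lambda>ys. \<eta> (z # x # ys)) = -\<^sub>e wedge r zs (\<lambda>ys. \<eta> (x # z # ys)) \<and>
   wedge r zs (\<lambda>ys. \<eta> (x # z # ys)) \<in> carrier E"
 proof (cases n)
  case 0
  thus ?thesis using xs by (auto intro!: E.eqI)
 next
  case (Suc m)
  have "wedge r zs (\<lambda>ys. \<eta> (z # x # ys)) = wedge r zs (\<lambda>ys. -\<^sub>e \<eta> (x # z # ys))"
   using Suc xs Suc.prems by (intro wedge_cong[of m] altform_swap[of m]) auto
  also have "\<dots> = -\<^sub>e wedge r zs (\<lambda>ys. \<eta> (x # z # ys))"
   using Suc xs Suc.prems altform_mem[OF Suc.prems(1)]
   by (intro wedge_neg[of m]) (auto simp: E_valued_def)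
  moreover have "wedge r zs (\<lambda>ys. \<eta> (x # z # ys)) \<in> carrier E"
   using Suc xs Suc.prems altform_mem[OF Suc.prems(1)]
   by (intro wedge_mem[of m]) (auto simp: E_valued_def)
  ultimately show ?thesis by simp
 qed
 have "\<eta> (br (r *\<^sub>x x) z # zs) = r *\<^sub>e \<eta> (br x z # zs) -\<^sub>e anc z r *\<^sub>e \<eta> (x # zs)"
  using Suc.prems xs E.const_mem[of "-1"] altform_mem[OF Suc.prems(1)]
  by (simp add: br_smult_left) (auto intro!: E.eqI)
 thus ?case
  using Suc.prems xs altform_mem[OF Suc.prems(1)] lieD_mem[OF altform_valued[OF a], of x zs] 
   Suc.IH[OF a] w
  by (auto intro!: E.eqI simp: algebra_simps)
qed simp

text \<open>Two failures of linearity over functions cancel: \<open>lieD_smult\<close> contributes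
  \<open>anc x r\<close> with a plus sign, the bracket of x with r y contributes it with a minus
  sign.\<close>

lemma altform_lieD: "altform n \<eta> ==> x \<in> carrier L ==> altform n (\<lambda>xs. lieD x xs \<eta>)"
proof (induction n arbitrary: \<eta>)
 case (Suc n)
 note a = altform_Cons[OF Suc.prems(1)]
 note m = altform_mem[OF Suc.prems(1)]
 note v = lieD_mem[OF altform_valued[OF a]]
 show ?case
  unfolding altform.simps
 proof (intro conjI ballI allI impI)
  fix y assume y: "y \<in> carrier L"
  show "altform n (\<lambda>xs. lieD x (y # xs) \<eta>)"
   using Suc y by (auto intro!: altform_diff)
  fix xs assume "y # xs \<in> tuples L n"
  then obtain n' where n': "n = Suc n'" "xs \<in> tuples L n'"
   by (cases n) auto
  have "lieD x (y # y # xs) \<eta> = (lieD x xs (\<lambda>zs. \<eta> (y # y # zs)) -\<^sub>e \<eta> (y # br x y # xs)) -\<^sub>e \<eta> (br x y # y # xs)"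
   by simp
  also have "lieD x xs (\<lambda>zs. \<eta> (y # y # zs)) = lieD x xs (\<lambda>zs. 0\<^sub>e)"
   using n' Suc.prems y by (intro lieD_cong[of n']) auto
  also have "\<eta> (y # br x y # xs) = -\<^sub>e \<eta> (br x y # y # xs)"
   using n' Suc.prems y by (intro altform_swap[of n']) auto
  finally show "lieD x (y # y # xs) \<eta> = 0\<^sub>e"
   using n' Suc.prems y m by (auto intro!: E.eqI)
 next
  fix y z xs assume *: "y \<in> carrier L" "z \<in> carrier L" "xs \<in> tuples L n"
  have "lieD x xs (\<lambda>xs. \<eta> ((y +\<^sub>x z) # xs)) = lieD x xs (\<lambda>xs. \<eta> (y # xs) +\<^sub>e \<eta> (z # xs))"
   using * Suc.prems by (intro lieD_cong[of n]) auto
  also have "\<dots> = lieD x xs (\<lambda>xs. \<eta> (y # xs)) +\<^sub>e lieD x xs (\<lambda>xs. \<eta> (z # xs))"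
   using * Suc.prems by (intro lieD_add[of n] altform_valued a) auto
  finally show "lieD x ((y +\<^sub>x z) # xs) \<eta> = lieD x (y # xs) \<eta> +\<^sub>e lieD x (z # xs) \<eta>"
   using * Suc.prems m v by (auto intro!: E.eqI)
 next
  fix r y xs assume *: "y \<in> carrier L" "r \<in> S" "xs \<in> tuples L n"
  have "lieD x xs (\<lambda>xs. \<eta> ((r *\<^sub>x y) # xs)) = lieD x xs (\<lambda>xs. r *\<^sub>e \<eta> (y # xs))"
   using * Suc.prems by (intro lieD_cong[of n]) auto
  also have "\<dots> = r *\<^sub>e lieD x xs (\<lambda>xs. \<eta> (y # xs)) +\<^sub>e anc x r *\<^sub>e \<eta> (y # xs)"
   using * Suc.prems by (intro lieD_smult[of n] altform_valued a) auto
  finally show "lieD x ((r *\<^sub>x y) # xs) \<eta> = r *\<^sub>e lieD x (y # xs) \<eta>"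
   using * Suc.prems m v by (auto intro!: E.eqI simp: algebra_simps)
 qed
qed simp

lemma dif_mem [simp]: "E_valued n \<eta> ==> xs \<in> tuples L (Suc n) ==> dif xs \<eta> \<in> carrier E"
proof (induction n arbitrary: \<eta> xs)
 case (Suc n)
 from Suc.prems(2) obtain z zs where xs: "xs = z # zs" "z \<in> carrier L" "zs \<in> tuples L (Suc n)"
  by (rule tup_SucE)
 show ?case
  using Suc.prems xs Suc.IH[of "\<lambda>xs. \<eta> (z # xs)" zs] lieD_mem[of "Suc n" \<eta> z zs] by simp
qed (auto elim!: tup_SucE simp: E_valued_def)

lemma dif_cong:
 "(\<And>ys. ys \<in> tuples L n ==> \<eta> ys = \<zeta> ys) ==> xs \<in> tuples L (Suc n) ==> dif xs \<eta> = dif xs \<zeta>"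
proof (induction n arbitrary: \<eta> \<zeta> xs)
 case (Suc n)
 from Suc.prems(2) obtain z zs where xs: "xs = z # zs" "z \<in> carrier L" "zs \<in> tuples L (Suc n)"
  by (rule tup_SucE)
 show ?case
  using Suc.prems xs Suc.IH[of "\<lambda>xs. \<eta> (z # xs)" "\<lambda>xs. \<zeta> (z # xs)" zs]
   lieD_cong[of "Suc n" \<eta> \<zeta> z zs] by simp
qed (auto elim!: tup_SucE)

lemma dif_add: "E_valued n \<eta> ==> E_valued n \<zeta> ==> xs \<in> tuples L (Suc n) ==>
  dif xs (\<lambda>zs. \<eta> zs +\<^sub>e \<zeta> zs) = dif xs \<eta> +\<^sub>e dif xs \<zeta>"
proof (induction n arbitrary: \<eta> \<zeta> xs)
 case (Suc n)
 from Suc.prems(3) obtain z zs where xs: "xs = z # zs" "z \<in> carrier L" "zs \<in> tuples L (Suc n)"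
  by (rule tup_SucE)
 show ?case
  using Suc.prems xs dif_mem[of n "\<lambda>xs. \<eta> (z # xs)" zs] dif_mem[of n "\<lambda>xs. \<zeta> (z # xs)" zs]
   lieD_mem[of "Suc n" \<eta> z zs] lieD_mem[of "Suc n" \<zeta> z zs]
  by (simp add: Suc.IH lieD_add[of "Suc n"]) (auto intro!: E.eqI)
qed (auto elim!: tup_SucE simp: E_valued_def intro!: E.eqI)

lemma dif_diff: "E_valued n \<eta> ==> E_valued n \<zeta> ==> xs \<in> tuples L (Suc n) ==>
  dif xs (\<lambda>zs. \<eta> zs -\<^sub>e \<zeta> zs) = dif xs \<eta> -\<^sub>e dif xs \<zeta>"
proof (induction n arbitrary: \<eta> \<zeta> xs)
 case (Suc n)
 from Suc.prems(3) obtain z zs where xs: "xs = z # zs" "z \<in> carrier L" "zs \<in> tuples L (Suc n)"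
  by (rule tup_SucE)
 show ?case
  using Suc.prems xs dif_mem[of n "\<lambda>xs. \<eta> (z # xs)" zs] dif_mem[of n "\<lambda>xs. \<zeta> (z # xs)" zs]
   lieD_mem[of "Suc n" \<eta> z zs] lieD_mem[of "Suc n" \<zeta> z zs]
  by (simp add: Suc.IH lieD_diff[of "Suc n"]) (auto intro!: E.eqI)
qed (auto elim!: tup_SucE simp: E_valued_def intro!: E.eqI)

lemma dif_smult: "E_valued n \<eta> ==> r \<in> S ==> xs \<in> tuples L (Suc n) ==>
  dif xs (\<lambda>zs. r *\<^sub>e \<eta> zs) = r *\<^sub>e dif xs \<eta> +\<^sub>e wedge r xs \<eta>"
proof (induction n arbitrary: \<eta> xs)
 case (Suc n)
 from Suc.prems(3) obtain z zs where xs: "xs = z # zs" "z \<in> carrier L" "zs \<in> tuples L (Suc n)"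
  by (rule tup_SucE)
 show ?case
  using Suc.prems xs dif_mem[of n "\<lambda>xs. \<eta> (z # xs)" zs] wedge_mem[of n "\<lambda>xs. \<eta> (z # xs)" r zs]
   lieD_mem[of "Suc n" \<eta> z zs] E_valuedD[OF Suc.prems(1)]
  by (simp add: Suc.IH lieD_smult[of "Suc n"]) (auto intro!: E.eqI simp: algebra_simps)
qed (auto elim!: tup_SucE simp: E_valued_def intro!: E.eqI simp: algebra_simps)

lemma dif_zero [simp]: "set xs \<subseteq> carrier L ==> dif xs (\<lambda>zs. 0\<^sub>e) = 0\<^sub>e"
 by (induction xs) (auto simp: a_minus_def)

text \<open>By \<open>lieD_smult_arg\<close> and \<open>dif_smult\<close> both halves of Cartan's
  formula produce the same \<open>wedge\<close> term, with opposite signs; this is linearity over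
  functions in the first slot.\<close>

lemma altform_dif: "altform n \<eta> ==> altform (Suc n) (\<lambda>xs. dif xs \<eta>)"
proof (induction n arbitrary: \<eta>)
 case 0
 thus ?case
  by (auto intro!: E.eqI simp: algebra_simps)
next
 case (Suc n)
 note a = altform_Cons[OF Suc.prems(1)]
 note m = altform_mem[OF Suc.prems(1)]
 note v = dif_mem[OF altform_valued[OF a]]
 note lv = lieD_mem[OF altform_valued[OF Suc.prems]]
 show ?case
  unfolding altform.simps(2)[of "Suc n"]
 proof (intro conjI ballI allI impI)
  fix y assume y: "y \<in> carrier L"
  show "altform (Suc n) (\<lambda>xs. dif (y # xs) \<eta>)"
   using Suc.IH[OF a[OF y]] y Suc.prems by (auto intro!: altform_diff altform_lieD simp del: altform.simps)
  fix xs assume "y # xs \<in> tuples L (Suc n)"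
  hence xs: "xs \<in> tuples L n"
   by auto
  have "dif (y # y # xs) \<eta> = (lieD y xs (\<lambda>zs. \<eta> (y # zs)) -\<^sub>e \<eta> (br y y # xs)) -\<^sub>e
    (lieD y xs (\<lambda>zs. \<eta> (y # zs)) -\<^sub>e dif xs (\<lambda>zs. \<eta> (y # y # zs)))"
   by simp
  also have "dif xs (\<lambda>zs. \<eta> (y # y # zs)) = 0\<^sub>e"
  proof (cases n)
   case (Suc m)
   have "dif xs (\<lambda>zs. \<eta> (y # y # zs)) = dif xs (\<lambda>zs. 0\<^sub>e)"
    using Suc xs Suc.prems y by (intro dif_cong[of m]) auto
   thus ?thesis using xs by (auto simp: tuples_def)
  qed (use xs in auto)
  \<comment> \<open>The bracket is the zero element, written as the zero function times y so that
    linearity over functions applies.\<close>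
  also have "\<eta> (br y y # xs) = 0\<^sub>e"
  proof -
   have "\<eta> (((\<lambda>_. 0) *\<^sub>x y) # xs) = (\<lambda>_. 0) *\<^sub>e \<eta> (y # xs)"
    using Suc.prems y xs E.const_mem[of 0] by auto
   moreover have "(\<lambda>_. 0) *\<^sub>e \<eta> (y # xs) = 0\<^sub>e" "(\<lambda>_. 0) *\<^sub>x y = 0\<^sub>x"
    using y xs m[of "y # xs"] E.const_mem[of 0] by (auto intro!: E.eqI L.eqI)
   ultimately show ?thesis using y by simp
  qed
  finally show "dif (y # y # xs) \<eta> = 0\<^sub>e"
   using xs Suc.prems y m lieD_mem[OF altform_valued[OF a], of y y xs] by (auto intro!: E.eqI)
 next
  fix y z xs assume *: "y \<in> carrier L" "z \<in> carrier L" "xs \<in> tuples L (Suc n)"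
  have "dif xs (\<lambda>xs. \<eta> ((y +\<^sub>x z) # xs)) = dif xs (\<lambda>xs. \<eta> (y # xs) +\<^sub>e \<eta> (z # xs))"
   using * Suc.prems by (intro dif_cong[of n]) auto
  also have "\<dots> = dif xs (\<lambda>xs. \<eta> (y # xs)) +\<^sub>e dif xs (\<lambda>xs. \<eta> (z # xs))"
   using * Suc.prems by (intro dif_add[of n] altform_valued a) auto
  finally show "dif ((y +\<^sub>x z) # xs) \<eta> = dif (y # xs) \<eta> +\<^sub>e dif (z # xs) \<eta>"
   using * Suc.prems v lv lieD_add_arg[OF Suc.prems, of y z xs] by (auto intro!: E.eqI)
 next
  fix r y xs assume *: "y \<in> carrier L" "r \<in> S" "xs \<in> tuples L (Suc n)"
  have "dif xs (\<lambda>xs. \<eta> ((r *\<^sub>x y) # xs)) = dif xs (\<lambda>xs. r *\<^sub>e \<eta> (y # xs))"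
   using * Suc.prems by (intro dif_cong[of n]) auto
  also have "\<dots> = r *\<^sub>e dif xs (\<lambda>xs. \<eta> (y # xs)) +\<^sub>e wedge r xs (\<lambda>xs. \<eta> (y # xs))"
   using * Suc.prems by (intro dif_smult[of n] altform_valued a) auto
  finally show "dif ((r *\<^sub>x y) # xs) \<eta> = r *\<^sub>e dif (y # xs) \<eta>"
   using * Suc.prems v lv lieD_smult_arg[OF Suc.prems, of r y xs] 
    wedge_mem[OF altform_valued[OF a], of y r xs] by (auto intro!: E.eqI simp: algebra_simps)
 qed
qed

section \<open>Cartan's commutation rules and d^2 = 0\<close>

lemma lieD_commute:
 "altform n \<eta> ==> x \<in> carrier L ==> y \<in> carrier L ==> xs \<in> tuples L n ==>
  lieD x xs (\<lambda>zs. lieD y zs \<eta>) -\<^sub>e lieD y xs (\<lambda>zs. lieD x zs \<eta>) = lieD (br x y) xs \<eta>"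
proof (induction n arbitrary: \<eta> xs)
 case 0
 thus ?case by (simp add: flat)
next
 case (Suc n)
 from Suc.prems(4) obtain z zs where xs: "xs = z # zs" "z \<in> carrier L" "zs \<in> tuples L n"
  by (rule tup_SucE)
 note a = altform_Cons[OF Suc.prems(1)]
 note m = altform_mem[OF Suc.prems(1)]
 have lv: "E_valued n (\<lambda>zs. lieD u zs (\<lambda>zs. \<eta> (v # zs)))" if "u \<in> carrier L" "v \<in> carrier L" for u v
  using that by (intro altform_valued altform_lieD a)
 note v = lieD_mem[OF lv] lieD_mem[OF altform_valued[OF a]] lieD_mem[OF altform_valued[OF Suc.prems(1)]]
 have step: "lieD u xs (\<lambda>zs. lieD v zs \<eta>) =
   (lieD u zs (\<lambda>zs. lieD v zs (\<lambda>zs. \<eta> (z # zs))) -\<^sub>e lieD u zs (\<lambda>zs. \<eta> (br v z # zs))) -\<^sub>e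
   (lieD v zs (\<lambda>zs. \<eta> (br u z # zs)) -\<^sub>e \<eta> (br v (br u z) # zs))"
  if "u \<in> carrier L" "v \<in> carrier L" for u v
  using that xs lieD_diff[OF lv[of v z] altform_valued[OF a], of "br v z" u zs] by simp
 \<comment> \<open>Flatness settles degree 0. Each further slot adds iterated brackets with its
   entry, and the Jacobi identity compares them.\<close>
 have "\<eta> (br x (br y z) # zs) = \<eta> (br (br x y) z # zs) +\<^sub>e \<eta> (br y (br x z) # zs)"
  using jacobi[of x y z] Suc.prems xs by simp
 thus ?case
  using Suc.IH[OF a[OF xs(2)] Suc.prems(2,3) xs(3), symmetric] step[of x y] step[of y x] xs Suc.prems v m
  by (auto intro!: E.eqI)
qed

text \<open>Contracting with y leaves the commutator of \<L>_x and \<L>_y, which is \<L>_[x, y], and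
  the claim for the contracted form, which is the induction hypothesis.\<close>

lemma lieD_dif:
 "altform n \<eta> ==> x \<in> carrier L ==> xs \<in> tuples L (Suc n) ==>
  lieD x xs (\<lambda>zs. dif zs \<eta>) = dif xs (\<lambda>zs. lieD x zs \<eta>)"
proof (induction n arbitrary: \<eta> xs)
 case 0
 thus ?case
  by (auto elim!: tup_SucE intro!: E.eqI simp: flat)
next
 case (Suc n)
 from Suc.prems(3) obtain y ys where xs: "xs = y # ys" "y \<in> carrier L" "ys \<in> tuples L (Suc n)"
  by (rule tup_SucE)
 note a = altform_Cons[OF Suc.prems(1)]
 note m = altform_mem[OF Suc.prems(1)]
 note lv = altform_valued[OF altform_lieD[OF Suc.prems(1)]]
  altform_valued[OF altform_lieD[OF a[OF xs(2)] Suc.prems(2)]]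
  altform_valued[OF altform_dif[OF a[OF xs(2)]]] 
  altform_valued[OF a[of "br x y"]]
 note v = lieD_mem[OF lv(1)] lieD_mem[OF lv(3)] dif_mem[OF lv(2)] dif_mem[OF lv(4)]
  lieD_mem[OF altform_valued[OF Suc.prems(1)]]
 have "lieD x xs (\<lambda>zs. dif zs \<eta>) =
   (lieD x ys (\<lambda>zs. lieD y zs \<eta>) -\<^sub>e lieD x ys (\<lambda>zs. dif zs (\<lambda>zs. \<eta> (y # zs)))) -\<^sub>e
   (lieD (br x y) ys \<eta> -\<^sub>e dif ys (\<lambda>zs. \<eta> (br x y # zs)))"
  using lieD_diff[OF lv(1,3)] xs Suc.prems by simp
 moreover have "dif xs (\<lambda>zs. lieD x zs \<eta>) =
   lieD y ys (\<lambda>zs. lieD x zs \<eta>) -\<^sub>e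
   (dif ys (\<lambda>zs. lieD x zs (\<lambda>zs. \<eta> (y # zs))) -\<^sub>e dif ys (\<lambda>zs. \<eta> (br x y # zs)))"
  using dif_diff[OF lv(2,4)] xs Suc.prems by simp
 ultimately show ?case
  using Suc.IH[OF a[OF xs(2)] Suc.prems(2) xs(3)] xs Suc.prems v lieD_commute[OF Suc.prems(1,2) xs(2,3), symmetric]
  by (auto intro!: E.eqI)
qed

lemma dif_dif: "altform n \<eta> ==> xs \<in> tuples L (Suc (Suc n)) ==> dif xs (\<lambda>zs. dif zs \<eta>) = 0\<^sub>e"
proof (induction n arbitrary: \<eta> xs)
 case 0
 thus ?case
  by (auto elim!: tup_SucE intro!: E.eqI simp: flat)
next
 case (Suc n)
 from Suc.prems(2) obtain y ys where xs: "xs = y # ys" "y \<in> carrier L" "ys \<in> tuples L (Suc (Suc n))"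
  by (rule tup_SucE)
 note a = altform_Cons[OF Suc.prems(1) xs(2)]
 note lv = altform_valued[OF altform_lieD[OF Suc.prems(1) xs(2)]] altform_valued[OF altform_dif[OF a]]
 have "dif xs (\<lambda>zs. dif zs \<eta>) = lieD y ys (\<lambda>zs. dif zs \<eta>) -\<^sub>e
   (dif ys (\<lambda>zs. lieD y zs \<eta>) -\<^sub>e dif ys (\<lambda>zs. dif zs (\<lambda>zs. \<eta> (y # zs))))"
  using xs dif_diff[OF lv] by simp
 thus ?case
  using Suc.IH[OF a xs(3)] lieD_dif[OF Suc.prems(1) xs(2,3)] dif_mem[OF lv(1) xs(3)]
  by (auto intro!: E.eqI)
qed

section \<open>Agreement of the recursion with the Koszul formula\<close>

lemma lieD_eq:
 "altform n \<eta> ==> x \<in> carrier L ==> xs \<in> tuples L n ==>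
  \<iota> (lieD x xs \<eta>) k p = \<iota> (nab x (\<eta> xs)) k p - (\<Sum>i<n. \<iota> (\<eta> (xs[i := br x (xs ! i)])) k p)"
proof (induction n arbitrary: \<eta> xs)
 case (Suc n)
 from Suc.prems(3) obtain z zs where xs: "xs = z # zs" "z \<in> carrier L" "zs \<in> tuples L n"
  by (rule tup_SucE)
 note a = altform_Cons[OF Suc.prems(1) xs(2)]
 show ?case
  using Suc.IH[OF a Suc.prems(2) xs(3)] lieD_mem[OF altform_valued[OF a] Suc.prems(2) xs(3)] xs 
   altform_mem[OF Suc.prems(1)] Suc.prems(2)
  by (simp add: sum.lessThan_Suc_shift del: sum.lessThan_Suc)
qed simp

lemma nth_tuples [simp]: "xs \<in> tuples L n ==> i < n ==> xs ! i \<in> carrier L"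
 by (auto simp: tuples_def)

lemma omit_tuples [simp]: "xs \<in> tuples L (Suc n) ==> i \<le> n ==> omit i xs \<in> tuples L n"
 by (auto simp: omit_def tuples_def dest: in_set_takeD in_set_dropD)

lemma br_Cons_omit_tuples [simp]:
 assumes "xs \<in> tuples L (Suc n)" "i < j" "j \<le> n" "x \<in> carrier L"
 shows "x # omit i (omit j xs) \<in> tuples L n"
 using assms by (cases n) auto

text \<open>Under the realisation the sums in E become sums of reals, which can be split and
  reindexed.\<close>

lemma koszul_val:
 assumes "altform n \<eta>" "xs \<in> tuples L (Suc n)"
 shows "koszul L br E nab n \<eta> xs \<in> carrier E"
  and "\<iota> (koszul L br E nab n \<eta> xs) k p =
   (\<Sum>i\<le>n. (- 1) ^ i * \<iota> (nab (xs ! i) (\<eta> (omit i xs))) k p) +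
   (\<Sum>j\<le>n. \<Sum>i<j. (- 1) ^ (i + j) * \<iota> (\<eta> (br (xs ! i) (xs ! j) # omit i (omit j xs))) k p)"
proof -
 note m = altform_mem[OF assms(1)]
 have 1: "(\<lambda>i. signed E i (nab (xs ! i) (\<eta> (omit i xs)))) \<in> {..n} \<rightarrow> carrier E"
  using assms m by (intro Pi_I E.signed_mem nab_mem) auto
 have 2: "(\<lambda>i. signed E (i + j) (\<eta> (br (xs ! i) (xs ! j) # omit i (omit j xs)))) \<in> {..<j} \<rightarrow> carrier E"
  if "j \<le> n" for j
  using assms that by (intro Pi_I E.signed_mem m br_Cons_omit_tuples br_mem nth_tuples[of _ "Suc n"]) auto
 hence 3: "(\<lambda>j. \<Oplus>\<^bsub>E\<^esub>i\<in>{..<j}. signed E (i + j) (\<eta> (br (xs ! i) (xs ! j) # omit i (omit j xs))))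
   \<in> {..n} \<rightarrow> carrier E"
  by (intro Pi_I E.finsum_closed) auto
 have 4: "\<iota> (signed E i (nab (xs ! i) (\<eta> (omit i xs)))) k p = (- 1) ^ i * \<iota> (nab (xs ! i) (\<eta> (omit i xs))) k p"
  if "i \<le> n" for i
  using assms m that by (intro E.signed_val nab_mem) auto
 have 5: "\<iota> (\<Oplus>\<^bsub>E\<^esub>i\<in>{..<j}. signed E (i + j) (\<eta> (br (xs ! i) (xs ! j) # omit i (omit j xs)))) k p = 
   (\<Sum>i<j. (- 1) ^ (i + j) * \<iota> (\<eta> (br (xs ! i) (xs ! j) # omit i (omit j xs))) k p)" if "j \<le> n" for j
  unfolding E.finsum_val[OF finite_lessThan 2[OF that]]
  using assms that by (intro sum.cong refl E.signed_val m br_Cons_omit_tuples br_mem nth_tuples[of _ "Suc n"]) auto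
 show "koszul L br E nab n \<eta> xs \<in> carrier E"
  using 1 3 assms by (auto simp: koszul_def intro!: E.add_mem E.finsum_closed)
 show "\<iota> (koszul L br E nab n \<eta> xs) k p =
   (\<Sum>i\<le>n. (- 1) ^ i * \<iota> (nab (xs ! i) (\<eta> (omit i xs))) k p) +
   (\<Sum>j\<le>n. \<Sum>i<j. (- 1) ^ (i + j) * \<iota> (\<eta> (br (xs ! i) (xs ! j) # omit i (omit j xs))) k p)"
  using 1 3 assms by (simp add: koszul_def E.finsum_closed 4 5)
qed

lemma omit_0 [simp]: "omit 0 (x # xs) = xs"
 and omit_Suc [simp]: "omit (Suc i) (x # xs) = x # omit i xs"
 by (simp_all add: omit_def)

text \<open>In Koszul's formula the terms in which x acts or is bracketed add up to \<L>_x. In all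
  other terms x is a passive argument: it shifts every index by one, which flips the sign of the
  single sum, and it stands behind the bracket in the double sum, which flips the sign
  there.\<close>

lemma koszul_Cons:
 assumes "altform (Suc n) \<eta>" "x \<in> carrier L" "ys \<in> tuples L (Suc n)"
 shows "koszul L br E nab (Suc n) \<eta> (x # ys) = lieD x ys \<eta> -\<^sub>e koszul L br E nab n (\<lambda>zs. \<eta> (x # zs)) ys"
proof (rule E.eqI)
 note a = altform_Cons[OF assms(1,2)]
 note m = altform_mem[OF assms(1)]
 show "koszul L br E nab (Suc n) \<eta> (x # ys) \<in> carrier E"
  using assms by (intro koszul_val) auto
 show "lieD x ys \<eta> -\<^sub>e koszul L br E nab n (\<lambda>zs. \<eta> (x # zs)) ys \<in> carrier E"
  using assms koszul_val(1)[OF a, of ys] lieD_mem[OF altform_valued[OF assms(1)]] by simp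
 fix k p
 \<comment> \<open>The terms with i = 0. Putting the bracket back into slot j absorbs (-1)^j and
   matches the unrolled Lie derivative.\<close>
 have 1: "(- 1) ^ (Suc j) * \<iota> (\<eta> (br x (ys ! j) # omit j ys)) k p = - \<iota> (\<eta> (ys[j := br x (ys ! j)])) k p"
  if "j \<le> n" for j
  using assms that m[of "br x (ys ! j) # omit j ys"] altform_list_update[OF assms(1,3), of j "br x (ys ! j)"]
  by (simp add: E.signed_val)
 \<comment> \<open>Both indices are shifted, so the parity of their sum is unchanged; the sign comes
   from exchanging x with the bracket in front of it.\<close>
 have 2: "(- 1) ^ (Suc i + Suc j) * \<iota> (\<eta> (br (ys ! i) (ys ! j) # x # omit i (omit j ys))) k p =
   - ((- 1) ^ (i + j) * \<iota> (\<eta> (x # br (ys ! i) (ys ! j) # omit i (omit j ys))) k p)"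
  if "i < j" "j \<le> n" for i j
 proof -
  obtain n' where n': "n = Suc n'" using \<open>i < j\<close> \<open>j \<le> n\<close> by (cases n) auto
  have o: "omit i (omit j ys) \<in> tuples L n'"
   using n' that assms by simp
  have "\<eta> (br (ys ! i) (ys ! j) # x # omit i (omit j ys)) = -\<^sub>e \<eta> (x # br (ys ! i) (ys ! j) # omit i (omit j ys))"
   using that assms n' o by (intro altform_swap[of n']) auto
  moreover have "\<eta> (x # br (ys ! i) (ys ! j) # omit i (omit j ys)) \<in> carrier E"
   using that assms n' o by (intro m) auto
  ultimately show ?thesis by simp
 qed
 have "\<iota> (koszul L br E nab (Suc n) \<eta> (x # ys)) k p =
   \<iota> (nab x (\<eta> ys)) k p - (\<Sum>i\<le>n. (- 1) ^ i * \<iota> (nab (ys ! i) (\<eta> (x # omit i ys))) k p) +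
   (\<Sum>j\<le>n. - \<iota> (\<eta> (ys[j := br x (ys ! j)])) k p +
    (\<Sum>i<j. - ((- 1) ^ (i + j) * \<iota> (\<eta> (x # br (ys ! i) (ys ! j) # omit i (omit j ys))) k p)))"
 proof -
  have "(\<Sum>j\<le>Suc n. \<Sum>i<j. (- 1) ^ (i + j) * \<iota> (\<eta> (br ((x # ys) ! i) ((x # ys) ! j) # omit i (omit j (x # ys)))) k p)
   = (\<Sum>j\<le>n. \<Sum>i<Suc j. (- 1) ^ (i + Suc j) * \<iota> (\<eta> (br ((x # ys) ! i) (ys ! j) # omit i (x # omit j ys))) k p)"
   by (simp only: sum.atMost_Suc_shift) simp
  also have "\<dots> = (\<Sum>j\<le>n. - \<iota> (\<eta> (ys[j := br x (ys ! j)])) k p +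
    (\<Sum>i<j. - ((- 1) ^ (i + j) * \<iota> (\<eta> (x # br (ys ! i) (ys ! j) # omit i (omit j ys))) k p)))"
  proof (rule sum.cong[OF refl])
   fix j assume "j \<in> {..n}"
   hence j: "j \<le> n" by simp
   have "(\<Sum>i<Suc j. (- 1) ^ (i + Suc j) * \<iota> (\<eta> (br ((x # ys) ! i) (ys ! j) # omit i (x # omit j ys))) k p) =
     (- 1) ^ (Suc j) * \<iota> (\<eta> (br x (ys ! j) # omit j ys)) k p +
     (\<Sum>i<j. (- 1) ^ (Suc i + Suc j) * \<iota> (\<eta> (br (ys ! i) (ys ! j) # x # omit i (omit j ys))) k p)"
    by (simp only: sum.lessThan_Suc_shift) simp
   thus "(\<Sum>i<Suc j. (- 1) ^ (i + Suc j) * \<iota> (\<eta> (br ((x # ys) ! i) (ys ! j) # omit i (x # omit j ys))) k p) =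
     - \<iota> (\<eta> (ys[j := br x (ys ! j)])) k p +
    (\<Sum>i<j. - ((- 1) ^ (i + j) * \<iota> (\<eta> (x # br (ys ! i) (ys ! j) # omit i (omit j ys))) k p))"
    using 1[OF j] 2[OF _ j] by (simp del: power_Suc)
  qed
  moreover have "(\<Sum>i\<le>Suc n. (- 1) ^ i * \<iota> (nab ((x # ys) ! i) (\<eta> (omit i (x # ys)))) k p) =
   \<iota> (nab x (\<eta> ys)) k p - (\<Sum>i\<le>n. (- 1) ^ i * \<iota> (nab (ys ! i) (\<eta> (x # omit i ys))) k p)"
   by (simp only: sum.atMost_Suc_shift) (simp add: sum_negf)
  ultimately show ?thesis
   using assms by (subst koszul_val(2)[OF assms(1)]) simp_all
 qed
 moreover have "{..<Suc n} = {..n}" by auto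
 ultimately show "\<iota> (koszul L br E nab (Suc n) \<eta> (x # ys)) k p =
   \<iota> (lieD x ys \<eta> -\<^sub>e koszul L br E nab n (\<lambda>zs. \<eta> (x # zs)) ys) k p"
  using assms koszul_val[OF a, of ys] lieD_mem[OF altform_valued[OF assms(1)]]
  by (simp add: lieD_eq[OF assms(1)] sum.distrib sum_negf sum_subtractf)
qed

lemma koszul_eq_dif: "altform n \<eta> ==> xs \<in> tuples L (Suc n) ==> koszul L br E nab n \<eta> xs = dif xs \<eta>"
proof (induction n arbitrary: \<eta> xs)
 case 0
 hence "koszul L br E nab 0 \<eta> xs \<in> carrier E" 
  using koszul_val by blast
 thus ?case
  using 0 koszul_val(2)[of 0 \<eta> xs]
  by (auto elim!: tup_SucE intro!: E.eqI)
next
 case (Suc n)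
 from Suc.prems(2) obtain z zs where xs: "xs = z # zs" "z \<in> carrier L" "zs \<in> tuples L (Suc n)"
  by (rule tup_SucE)
 thus ?case
  using koszul_Cons[OF Suc.prems(1) xs(2,3)] Suc.IH[OF altform_Cons[OF Suc.prems(1) xs(2)] xs(3)] by simp
qed

lemma koszul_forms:
 assumes "altform n \<eta>" and R: "carrier R = S"
 shows "koszul L br E nab n \<eta> \<in> carrier (forms R L E (Suc n))"
proof -
 have "altform (Suc n) (koszul L br E nab n \<eta>) \<longleftrightarrow> altform (Suc n) (\<lambda>xs. dif xs \<eta>)"
  using assms by (intro altform_cong koszul_eq_dif)
 thus ?thesis
  using altform_dif[OF assms(1)] by (simp add: forms_iff[OF R]) (simp add: koszul_def)
qed

text \<open>Since dr = 0 for a constant r, the differential is linear over the reals.\<close>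

lemma wedge_const: "E_valued n \<eta> ==> xs \<in> tuples L (Suc n) ==> wedge (\<lambda>_. c) xs \<eta> = 0\<^sub>e"
proof (induction n arbitrary: \<eta> xs)
 case (Suc n)
 from Suc.prems(2) obtain z zs where xs: "xs = z # zs" "z \<in> carrier L" "zs \<in> tuples L (Suc n)"
  by (rule tup_SucE)
 show ?case
  using Suc.prems xs Suc.IH[of "\<lambda>xs. \<eta> (z # xs)" zs] E_valuedD[OF Suc.prems(1)] E.const_mem[of 0]
  by (auto intro!: E.eqI)
qed (use E.const_mem[of 0] in \<open>auto elim!: tup_SucE simp: E_valued_def intro!: E.eqI\<close>)

lemma cochain_complex_koszul:
 assumes R: "carrier R = S"
 shows "cochain_complex (forms R L E) (koszul L br E nab)"
 unfolding cochain_complex_def real_linear_def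
proof (intro allI conjI ballI)
 fix n
 interpret F: fun_module S "forms R L E m" "\<lambda>\<eta> (xs, i) p. if xs \<in> tuples L m then \<iota> (\<eta> xs) i p else 0" for m
  by (rule fun_module_forms[OF R])
 show "koszul L br E nab n \<in> carrier (forms R L E n) \<rightarrow> carrier (forms R L E (Suc n))"
  by (intro funcsetI koszul_forms[OF _ R]) (simp add: forms_iff[OF R])
 fix \<eta> assume \<eta>: "\<eta> \<in> carrier (forms R L E n)"
 hence a: "altform n \<eta>" by (simp add: forms_iff[OF R])
 have a2: "altform (Suc n) (koszul L br E nab n \<eta>)"
  using koszul_forms[OF a R] by (simp add: forms_iff[OF R])
 show "koszul L br E nab (Suc n) (koszul L br E nab n \<eta>) = \<zero>\<^bsub>forms R L E (Suc (Suc n))\<^esub>"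
 proof (rule extensionalityI[of _ "tuples L (Suc (Suc n))"])
  fix xs assume xs: "xs \<in> tuples L (Suc (Suc n))"
  have "koszul L br E nab (Suc n) (koszul L br E nab n \<eta>) xs = dif xs (koszul L br E nab n \<eta>)"
   using a2 xs by (rule koszul_eq_dif)
  also have "\<dots> = dif xs (\<lambda>ys. dif ys \<eta>)"
   using a xs by (intro dif_cong[of "Suc n"] koszul_eq_dif) auto
  also have "\<dots> = 0\<^sub>e"
   using a xs by (rule dif_dif)
  finally show "koszul L br E nab (Suc n) (koszul L br E nab n \<eta>) xs = \<zero>\<^bsub>forms R L E (Suc (Suc n))\<^esub> xs"
   using xs by (simp add: forms_def)
 qed (simp_all add: koszul_def forms_def)
 {
  fix c
  have c: "(\<lambda>_. c) \<odot>\<^bsub>forms R L E n\<^esub> \<eta> \<in> carrier (forms R L E n)"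
   using \<eta> E.const_mem by simp
  show "koszul L br E nab n ((\<lambda>_. c) \<odot>\<^bsub>forms R L E n\<^esub> \<eta>) = (\<lambda>_. c) \<odot>\<^bsub>forms R L E (Suc n)\<^esub> koszul L br E nab n \<eta>"
  proof (rule extensionalityI[of _ "tuples L (Suc n)"])
   fix xs assume xs: "xs \<in> tuples L (Suc n)"
   have "koszul L br E nab n ((\<lambda>_. c) \<odot>\<^bsub>forms R L E n\<^esub> \<eta>) xs = dif xs ((\<lambda>_. c) \<odot>\<^bsub>forms R L E n\<^esub> \<eta>)"
    using c xs by (intro koszul_eq_dif) (auto simp: forms_iff[OF R])
   also have "\<dots> = dif xs (\<lambda>ys. (\<lambda>_. c) *\<^sub>e \<eta> ys)"
    using xs by (intro dif_cong[of n]) (auto simp: forms_def)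
   also have "\<dots> = (\<lambda>_. c) *\<^sub>e dif xs \<eta>"
    using xs a E.const_mem dif_mem[OF altform_valued[OF a] xs]
    by (simp add: dif_smult[of n] altform_valued wedge_const[OF altform_valued[OF a] xs])
   finally show "koszul L br E nab n ((\<lambda>_. c) \<odot>\<^bsub>forms R L E n\<^esub> \<eta>) xs = ((\<lambda>_. c) \<odot>\<^bsub>forms R L E (Suc n)\<^esub> koszul L br E nab n \<eta>) xs"
    using xs a by (simp add: koszul_eq_dif) (simp add: forms_def koszul_eq_dif)
  qed (simp_all add: koszul_def forms_def)
 }
 fix \<zeta> assume \<zeta>: "\<zeta> \<in> carrier (forms R L E n)"
 hence b: "altform n \<zeta>" by (simp add: forms_iff[OF R])
 have ab: "\<eta> \<oplus>\<^bsub>forms R L E n\<^esub> \<zeta> \<in> carrier (forms R L E n)"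
  using \<eta> \<zeta> by simp
 show "koszul L br E nab n (\<eta> \<oplus>\<^bsub>forms R L E n\<^esub> \<zeta>) =
   koszul L br E nab n \<eta> \<oplus>\<^bsub>forms R L E (Suc n)\<^esub> koszul L br E nab n \<zeta>"
 proof (rule extensionalityI[of _ "tuples L (Suc n)"])
  fix xs assume xs: "xs \<in> tuples L (Suc n)"
  have "koszul L br E nab n (\<eta> \<oplus>\<^bsub>forms R L E n\<^esub> \<zeta>) xs = dif xs (\<eta> \<oplus>\<^bsub>forms R L E n\<^esub> \<zeta>)"
   using ab xs by (intro koszul_eq_dif) (auto simp: forms_iff[OF R])
  also have "\<dots> = dif xs (\<lambda>ys. \<eta> ys +\<^sub>e \<zeta> ys)"
   using xs by (intro dif_cong[of n]) (auto simp: forms_def)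
  also have "\<dots> = dif xs \<eta> +\<^sub>e dif xs \<zeta>"
   using xs a b by (simp add: dif_add[of n] altform_valued)
  finally show "koszul L br E nab n (\<eta> \<oplus>\<^bsub>forms R L E n\<^esub> \<zeta>) xs =
   (koszul L br E nab n \<eta> \<oplus>\<^bsub>forms R L E (Suc n)\<^esub> koszul L br E nab n \<zeta>) xs"
   using xs a b by (simp add: koszul_eq_dif) (simp add: forms_def koszul_eq_dif)
 qed (simp_all add: koszul_def forms_def)
qed

end

section \<open>Smooth functions on open sets\<close>

lemma linear_eq_sum_Basis:
 fixes h :: "'a::euclidean_space => 'b::real_vector"
 assumes "linear h"
 shows "h w = (\<Sum>b\<in>Basis. (w \<bullet> b) *\<^sub>R h b)"
proof -
 have "h (\<Sum>b\<in>Basis. (w \<bullet> b) *\<^sub>R b) = (\<Sum>b\<in>Basis. (w \<bullet> b) *\<^sub>R h b)"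
  unfolding linear_sum[OF assms] linear_scale[OF assms] ..
 thus ?thesis by (simp add: euclidean_representation)
qed

lemma Ck_on_subset: "Ck_on k S f ==> T \<subseteq> S ==> Ck_on k T f"
 by (induction k arbitrary: f) (auto intro: continuous_on_subset)

lemma Ck_on_SucD: "Ck_on (Suc k) S f ==> Ck_on k S f"
 by (induction k arbitrary: f)
  (auto intro!: continuous_at_imp_continuous_on differentiable_imp_continuous_within)

lemma Ck_on_has_derivative:
 "Ck_on (Suc k) S f ==> x \<in> S ==> (f has_derivative frechet_derivative f (at x)) (at x)"
 by (simp add: frechet_derivative_works[symmetric])

text \<open>\<open>Ck_on\<close> uses derivatives of the function on the whole space; openness makes
  them depend on its values in S alone.\<close>

lemma Ck_on_cong:
 "open S ==> (\<And>x. x \<in> S ==> f x = g x) ==> Ck_on k S f ==> Ck_on k S g"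
proof (induction k arbitrary: f g)
 case 0
 thus ?case using continuous_on_eq[of S f g] by simp
next
 case (Suc k)
 have d: "g differentiable (at x)" "frechet_derivative f (at x) = frechet_derivative g (at x)"
  if x: "x \<in> S" for x
 proof -
  show "g differentiable (at x)"
  proof -
   obtain D where "(f has_derivative D) (at x)"
    using Suc.prems(3) x by (auto simp: differentiable_def)
   hence "(g has_derivative D) (at x)"
    using Suc.prems(1) x Suc.prems(2) by (rule has_derivative_transform_within_open)
   thus ?thesis by (auto simp: differentiable_def)
  qed
  show "frechet_derivative f (at x) = frechet_derivative g (at x)"
   using Suc.prems x by (intro frechet_derivative_transform_within_open[of _ _ S]) auto
 qed
 have "Ck_on k S (\<lambda>x. frechet_derivative g (at x) v)" for v
  by (rule Suc.IH[of "\<lambda>x. frechet_derivative f (at x) v"]) (use Suc.prems d in auto)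
 with d show ?case by simp
qed

text \<open>\<open>frechet_derivative\<close> is defined by choice; this rule lets any explicit
  derivative take its place.\<close>

lemma Ck_on_SucI:
 assumes "open S" "\<And>x. x \<in> S ==> (f has_derivative f' x) (at x)" "\<And>v. Ck_on k S (\<lambda>x. f' x v)"
 shows "Ck_on (Suc k) S f"
proof -
 have "Ck_on k S (\<lambda>x. frechet_derivative f (at x) v)" for v
  by (rule Ck_on_cong[OF assms(1) _ assms(3)[of v]])
   (use frechet_derivative_at[OF assms(2)] in auto)
 thus ?thesis
  using assms(2) by (auto simp: differentiable_def)
qed

lemma Ck_on_const: "open S ==> Ck_on k S (\<lambda>_. c)"
 by (induction k arbitrary: c) (auto intro!: Ck_on_SucI[where f' = "\<lambda>_ _. 0"] simp del: Ck_on.simps(2))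

lemma Ck_on_linear:
 assumes "bounded_linear h" "open S"
 shows "Ck_on k S f ==> Ck_on k S (\<lambda>x. h (f x))"
proof (induction k arbitrary: f)
 case 0
 thus ?case using assms by (auto intro: linear_continuous_on_compose bounded_linear.linear bounded_linear.continuous_on)
next
 case (Suc k)
 show ?case
  by (rule Ck_on_SucI[OF assms(2), where f' = "\<lambda>x v. h (frechet_derivative f (at x) v)"])
   (use Suc bounded_linear.has_derivative[OF assms(1) Ck_on_has_derivative[OF Suc.prems]] in auto)
qed

lemma Ck_on_add: "open S ==> Ck_on k S f ==> Ck_on k S g ==> Ck_on k S (\<lambda>x. f x + g x)"
proof (induction k arbitrary: f g)
 case (Suc k)
 show ?case
  by (rule Ck_on_SucI[OF Suc.prems(1), where f' = "\<lambda>x v. frechet_derivative f (at x) v + frechet_derivative g (at x) v"])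
   (use Suc has_derivative_add[OF Suc.prems(2,3)[THEN Ck_on_has_derivative]] in auto)
qed (auto intro: continuous_intros)

lemma Ck_on_sum: "open S ==> (\<And>i. i \<in> I ==> Ck_on k S (f i)) ==> Ck_on k S (\<lambda>x. \<Sum>i\<in>I. f i x)"
 by (induction I rule: infinite_finite_induct) (auto intro: Ck_on_const Ck_on_add)

lemma Ck_on_bilinear:
 assumes "bounded_bilinear h" "open S"
 shows "Ck_on k S f ==> Ck_on k S g ==> Ck_on k S (\<lambda>x. h (f x) (g x))"
proof (induction k arbitrary: f g)
 case 0
 thus ?case using assms by (auto intro: bounded_bilinear.continuous_on)
next
 case (Suc k)
 note D = Suc.prems[THEN Ck_on_SucD]
 show ?case
  by (rule Ck_on_SucI[OF assms(2), where f' = "\<lambda>x v. h (f x) (frechet_derivative g (at x) v) + h (frechet_derivative f (at x) v) (g x)"])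
   (use Suc assms(2) D bounded_bilinear.FDERIV[OF assms(1) Suc.prems[THEN Ck_on_has_derivative]] in
    \<open>auto intro!: Ck_on_add\<close>)
qed

lemma Ck_on_compose:
 fixes f :: "'a::real_normed_vector => 'b::euclidean_space" and g :: "'b => 'c::real_normed_vector"
 assumes "open S" "open T" "f ` S \<subseteq> T"
 shows "Ck_on k S f ==> Ck_on k T g ==> Ck_on k S (\<lambda>x. g (f x))"
proof (induction k arbitrary: g)
 case 0
 thus ?case using assms by (auto intro: continuous_on_compose2)
next
 case (Suc k)
 \<comment> \<open>The chain rule in coordinates. \<open>Ck_on\<close> controls derivatives in fixed
   directions only, but Dg is applied to a direction that moves with x; the expansion in the basis
   leaves products of controlled functions.\<close>
 have d: "((\<lambda>x. g (f x)) has_derivative 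
   (\<lambda>v. \<Sum>b\<in>Basis. (frechet_derivative f (at x) v \<bullet> b) *\<^sub>R frechet_derivative g (at (f x)) b)) (at x)"
  if x: "x \<in> S" for x
 proof -
  have g: "(g has_derivative frechet_derivative g (at (f x))) (at (f x))"
   using Suc.prems(2) assms x by (intro Ck_on_has_derivative) auto
  hence "linear (frechet_derivative g (at (f x)))"
   by (rule has_derivative_linear)
  hence eq: "frechet_derivative g (at (f x)) (frechet_derivative f (at x) v) =
    (\<Sum>b\<in>Basis. (frechet_derivative f (at x) v \<bullet> b) *\<^sub>R frechet_derivative g (at (f x)) b)" for v
   by (rule linear_eq_sum_Basis)
  show ?thesis
   using has_derivative_compose[OF Ck_on_has_derivative[OF Suc.prems(1) x] g] unfolding eq .
 qed
 have "Ck_on k S (\<lambda>x. frechet_derivative g (at (f x)) b)" for b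
  using Suc.IH[of "\<lambda>y. frechet_derivative g (at y) b"] Suc.prems Ck_on_SucD by auto
 thus ?case
  using Suc.prems(1) assms(1)
  by (intro Ck_on_SucI[OF assms(1) d])
   (auto intro!: Ck_on_sum Ck_on_bilinear[OF bounded_bilinear_scaleR] Ck_on_linear[OF bounded_linear_inner_left])
qed

lemma Ck_on_local:
 "(\<And>x. x \<in> S ==> \<exists>T. open T \<and> x \<in> T \<and> Ck_on k T f) ==> Ck_on k S f"
proof (induction k arbitrary: f)
 case 0
 thus ?case
  by (auto intro!: continuous_at_imp_continuous_on) (metis continuous_on_eq_continuous_at)
next
 case (Suc k)
 have "f differentiable (at x)" if "x \<in> S" for x
  using Suc.prems[OF that] by auto
 moreover have "Ck_on k S (\<lambda>x. frechet_derivative f (at x) v)" for v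
  using Suc.prems by (intro Suc.IH) (metis Ck_on.simps(2))
 ultimately show ?case by simp
qed

lemma Ck_on_id: "open S ==> Ck_on k S (\<lambda>x. x)"
proof (cases k)
 case (Suc n)
 assume "open S"
 thus ?thesis
  unfolding Suc by (intro Ck_on_SucI[where f' = "\<lambda>_ v. v"] Ck_on_const) auto
qed (auto intro: continuous_intros)

section \<open>Closure properties of smooth maps\<close>

named_theorems smooth

lemma smooth_on_const [smooth]: "open S ==> smooth_on S (\<lambda>_. c)"
 and smooth_on_id [smooth]: "open S ==> smooth_on S (\<lambda>x. x)"
 and smooth_on_add [smooth]: "open S ==> smooth_on S f ==> smooth_on S g ==> smooth_on S (\<lambda>x. f x + g x)"
 and smooth_on_sum [smooth]: "open S ==> (\<And>i. i \<in> I ==> smooth_on S (F i)) ==> smooth_on S (\<lambda>x. \<Sum>i\<in>I. F i x)"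
 by (simp_all add: smooth_on_def Ck_on_const Ck_on_id Ck_on_add Ck_on_sum)

lemma smooth_on_cong: "open S ==> (\<And>x. x \<in> S ==> f x = g x) ==> smooth_on S f ==> smooth_on S g"
 using Ck_on_cong[of S f g] by (simp add: smooth_on_def)

lemma smooth_on_subset: "smooth_on S f ==> T \<subseteq> S ==> smooth_on T f"
 by (auto simp: smooth_on_def intro: Ck_on_subset)

lemma smooth_on_linear: "bounded_linear h ==> open S ==> smooth_on S f ==> smooth_on S (\<lambda>x. h (f x))"
 and smooth_on_bilinear: "bounded_bilinear q ==> open S ==> smooth_on S f ==> smooth_on S g ==> smooth_on S (\<lambda>x. q (f x) (g x))"
 by (simp_all add: smooth_on_def Ck_on_linear Ck_on_bilinear)

lemmas smooth_on_mult [smooth] = smooth_on_bilinear[OF bounded_bilinear_mult]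
lemmas smooth_on_inner [smooth] = smooth_on_bilinear[OF bounded_bilinear_inner]

lemma smooth_on_diff [smooth]:
 "open S ==> smooth_on S f ==> smooth_on S g ==> smooth_on S (\<lambda>x. f x - g x)"
 using smooth_on_add[of S f "\<lambda>x. - g x"] smooth_on_linear[of uminus S g]
 by (simp add: bounded_linear_minus bounded_linear_ident)

lemma smooth_on_compose:
 fixes f :: "'a::real_normed_vector => 'b::euclidean_space" and g :: "'b => 'c::real_normed_vector"
 shows "open S ==> open T ==> f ` S \<subseteq> T ==> smooth_on S f ==> smooth_on T g ==> smooth_on S (\<lambda>x. g (f x))"
 using Ck_on_compose[of S T f _ g] by (simp add: smooth_on_def)

lemma smooth_on_local: "(\<And>x. x \<in> S ==> \<exists>T. open T \<and> x \<in> T \<and> smooth_on T f) ==> smooth_on S f"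
 unfolding smooth_on_def by (rule allI, rule Ck_on_local) metis

lemma smooth_on_has_deriv:
 "smooth_on S f ==> x \<in> S ==> (f has_derivative frechet_derivative f (at x)) (at x)"
 by (rule Ck_on_has_derivative[of 0 S]) (simp_all only: smooth_on_def simp_thms)

lemma smooth_on_frechet_derivative:
 "smooth_on S f ==> smooth_on S (\<lambda>x. frechet_derivative f (at x) v)"
 unfolding smooth_on_def by (metis Ck_on.simps(2))

lemma smooth_on_continuous_on: "smooth_on S f ==> continuous_on S f"
 unfolding smooth_on_def by (metis Ck_on.simps(1))

text \<open>The functions c x^(-n) are closed under differentiation: the constant absorbs the
  exponent and the direction. This is the generalisation that the induction on the order
  needs.\<close>

lemma smooth_on_inverse: "smooth_on (- {0::real}) inverse"
proof -
 have "Ck_on k (- {0::real}) (\<lambda>x. c * inverse x ^ n)" for k n and c :: real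
 proof (induction k arbitrary: c n)
  case 0
  thus ?case by (auto intro!: continuous_intros)
 next
  case (Suc k)
  have "((\<lambda>x. c * inverse x ^ n) has_real_derivative (- c * real n) * inverse x ^ Suc n) (at x)"
   if "x \<noteq> 0" for x
   using that by (auto intro!: derivative_eq_intros simp: field_simps power_Suc[symmetric] simp del: power_Suc)
    (cases n; auto)
  moreover have "Ck_on k (- {0::real}) (\<lambda>x. (- c * real n * v) * inverse x ^ Suc n)" for v
   by (rule Suc.IH)
  ultimately show ?case
  proof (intro Ck_on_SucI[where f' = "\<lambda>x. (*) ((- c * real n) * inverse x ^ Suc n)"], goal_cases)
   case (3 v)
   have "(\<lambda>x. (- c * real n * v) * inverse x ^ Suc n) = (\<lambda>x. (- c * real n) * inverse x ^ Suc n * v)"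
    by (simp add: mult_ac)
   with 3(2)[of v] show ?case by (simp only:)
  qed (auto simp: has_field_derivative_def)
 qed
 from this[of _ 1 1] show ?thesis by (simp add: smooth_on_def)
qed

subsection \<open>Bump functions\<close>

text \<open>The family generated by exp(-1/t) under differentiation: the derivative of member n
  combines members n + 1 and n + 2.\<close>

definition flat_exp :: "nat => real => real" where
 "flat_exp n t = (if t \<le> 0 then 0 else inverse t ^ n * exp (- inverse t))"

lemma flat_exp_tendsto_0: "(flat_exp n \<longlongrightarrow> 0) (at 0)"
proof -
 have "((\<lambda>x. x ^ n / exp x) \<longlongrightarrow> (0::real)) at_top"
  by (rule tendsto_power_div_exp_0)
 hence "((\<lambda>t. inverse t ^ n / exp (inverse t)) \<longlongrightarrow> (0::real)) (at_right 0)"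
  by (rule filterlim_compose[OF _ filterlim_inverse_at_top_right])
 hence "(flat_exp n \<longlongrightarrow> 0) (at_right 0)"
  by (rule Lim_transform_eventually)
   (auto simp: eventually_at_filter flat_exp_def exp_minus field_simps)
 moreover have "(flat_exp n \<longlongrightarrow> 0) (at_left 0)"
  by (rule Lim_transform_eventually[OF tendsto_const]) (auto simp: eventually_at_filter flat_exp_def)
 ultimately show ?thesis by (simp add: filterlim_split_at)
qed

lemma flat_exp_deriv: "(flat_exp n has_real_derivative flat_exp (n + 2) t - real n * flat_exp (n + 1) t) (at t)"
proof (cases t "0::real" rule: linorder_cases)
 case less
 have "((\<lambda>_. 0) has_real_derivative 0) (at t)" by simp
 moreover have "\<forall>\<^sub>F x in nhds t. flat_exp n x = 0"
  using eventually_nhds_in_open[of "{..<0}" t] less by (auto simp: flat_exp_def elim: eventually_mono)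
 ultimately show ?thesis
  using less by (subst DERIV_cong_ev[OF refl _ refl, where g = "\<lambda>_. 0"]) (auto simp: flat_exp_def)
next
 case greater
 have "((\<lambda>t. inverse t ^ n * exp (- inverse t)) has_real_derivative
   inverse t ^ (n + 2) * exp (- inverse t) - real n * (inverse t ^ (n + 1) * exp (- inverse t))) (at t)"
  using greater
  by (auto intro!: derivative_eq_intros simp: field_simps) (cases n; auto simp: field_simps)
 moreover have "\<forall>\<^sub>F x in nhds t. flat_exp n x = inverse x ^ n * exp (- inverse x)"
  using eventually_nhds_in_open[of "{0<..}" t] greater by (auto simp: flat_exp_def elim: eventually_mono)
 ultimately show ?thesis
  using greater
  by (subst DERIV_cong_ev[OF refl _ refl, where g = "\<lambda>t. inverse t ^ n * exp (- inverse t)"]) (auto simp: flat_exp_def)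
next
 case equal
 \<comment> \<open>At 0 the difference quotient is the next member of the family, so its limit is
   already known.\<close>
 have "((\<lambda>y. (flat_exp n y - flat_exp n 0) / (y - 0)) \<longlongrightarrow> 0) (at 0)"
  by (rule Lim_transform_eventually[OF flat_exp_tendsto_0[of "Suc n"]])
   (auto simp: eventually_at_filter flat_exp_def field_simps)
 thus ?thesis
  using equal by (simp add: has_field_derivative_iff flat_exp_def)
qed

lemma smooth_on_flat_exp: "smooth_on UNIV (flat_exp n)"
proof -
 have "Ck_on k UNIV (flat_exp n)" for k
 proof (induction k arbitrary: n)
  case 0
  thus ?case
   by (auto intro!: continuous_at_imp_continuous_on DERIV_isCont[OF flat_exp_deriv])
 next
  case (Suc k)
  show ?case
  proof (rule Ck_on_SucI[where f' = "\<lambda>t. (*) (flat_exp (n + 2) t + (- real n) * flat_exp (n + 1) t)"])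
   show "(flat_exp n has_derivative (*) (flat_exp (n + 2) t + (- real n) * flat_exp (n + 1) t)) (at t)" for t
    using flat_exp_deriv[of n t] by (simp add: has_field_derivative_def)
   show "Ck_on k UNIV (\<lambda>t. (flat_exp (n + 2) t + (- real n) * flat_exp (n + 1) t) * v)" for v
    by (intro Ck_on_bilinear[OF bounded_bilinear_mult] Ck_on_add Ck_on_const open_UNIV Suc.IH)
  qed simp
 qed
 thus ?thesis by (simp add: smooth_on_def)
qed

lemma bump_exists:
 fixes p :: "'e::euclidean_space"
 assumes "r > 0"
 shows "\<exists>b. smooth_on UNIV b \<and> (\<forall>x\<in>cball p r. b x = (1::real)) \<and> (\<forall>x. 2 * r \<le> dist p x \<longrightarrow> b x = 0)"
proof -
 \<comment> \<open>q is a polynomial, hence smooth at p too, with q >= 1 within distance r of p and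
   q <= 0 beyond distance 2 r. The quotient F(q) / (F(q) + F(1 - q)) is 1 in the first region and 0
   in the second.\<close>
 define q :: "'e => real" where "q x = 2 - (1 / r\<^sup>2) * ((x - p) \<bullet> (x - p))" for x
 define F where "F = flat_exp 0"
 have pos: "F t + F (1 - t) > 0" for t
  by (auto simp: F_def flat_exp_def intro: add_pos_pos)
 have q: "smooth_on UNIV q"
  unfolding q_def by (intro smooth open_UNIV)
 have F: "smooth_on UNIV (\<lambda>x. F (g x))" if "smooth_on UNIV g" for g :: "'e => real"
  by (rule smooth_on_compose[OF open_UNIV open_UNIV subset_UNIV that])
   (simp add: F_def smooth_on_flat_exp)
 have s: "smooth_on UNIV (\<lambda>x. F (q x) * inverse (F (q x) + F (1 - q x)))"
 proof (rule smooth_on_mult[OF open_UNIV F[OF q]])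
  have 1: "smooth_on UNIV (\<lambda>x. F (q x) + F (1 - q x))"
   by (intro smooth_on_add F q smooth_on_diff smooth_on_const open_UNIV)
  have "F (q x) + F (1 - q x) \<noteq> 0" for x
   using pos[of "q x"] by simp
  hence 2: "(\<lambda>x. F (q x) + F (1 - q x)) ` UNIV \<subseteq> - {0}"
   by auto
  show "smooth_on UNIV (\<lambda>x. inverse (F (q x) + F (1 - q x)))"
   by (rule smooth_on_compose[OF open_UNIV open_Compl[OF closed_singleton] 2 1 smooth_on_inverse])
 qed
 have n: "(x - p) \<bullet> (x - p) = (dist p x)\<^sup>2" for x
  by (simp add: dist_norm norm_minus_commute[of p x] power2_norm_eq_inner)
 show ?thesis
 proof (rule exI, intro conjI ballI allI impI, rule s)
  fix x assume "x \<in> cball p r"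
  hence "(dist p x)\<^sup>2 \<le> r\<^sup>2" using assms by (simp add: power_mono)
  hence "1 - q x \<le> 0" using assms by (simp add: q_def n field_simps)
  thus "F (q x) * inverse (F (q x) + F (1 - q x)) = 1"
   by (auto simp: F_def flat_exp_def)
 next
  fix x assume "2 * r \<le> dist p x"
  hence "(2 * r)\<^sup>2 \<le> (dist p x)\<^sup>2" using assms by (intro power_mono) auto
  hence "4 * r\<^sup>2 \<le> (dist p x)\<^sup>2" by (simp add: power_mult_distrib)
  hence "2 * r\<^sup>2 \<le> (dist p x)\<^sup>2" using zero_le_power2[of r] by linarith
  hence "q x \<le> 0" using assms by (simp add: q_def n field_simps)
  thus "F (q x) * inverse (F (q x) + F (1 - q x)) = 0"
   by (simp add: F_def flat_exp_def)
 qed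
qed

subsection \<open>Hadamard's lemma\<close>

text \<open>Differentiation under the integral brings out a factor t. The weight w absorbs it, so
  the derivative is an integral of the same kind and the argument can be iterated.\<close>

lemma integral_has_derivative:
 fixes h :: "'e::euclidean_space => real"
 assumes S: "open S" "convex S" "p \<in> S" and h: "smooth_on S h" and x: "x \<in> S"
  and w: "continuous_on {0..1} w"
 shows "((\<lambda>x. integral {0..1} (\<lambda>t. w t * h (p + t *\<^sub>R (x - p)))) has_derivative
  (\<lambda>v. integral {0..1} (\<lambda>t. (w t * t) * frechet_derivative h (at (p + t *\<^sub>R (x - p))) v))) (at x)"
proof -
 define c where "c t x = p + t *\<^sub>R (x - p)" for t and x :: 'e
 have c: "c t x \<in> S" if "t \<in> {0..1}" "x \<in> S" for t x
 proof -
  have "c t x = (1 - t) *\<^sub>R p + t *\<^sub>R x" by (simp add: c_def algebra_simps)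
  thus ?thesis using S that by (auto simp: convex_def)
 qed
 \<comment> \<open>The rule for parameter integrals wants the derivative of the integrand as a
   continuous map into the bounded linear maps; continuity is checked on basis vectors.\<close>
 define fx where "fx x t = Blinfun (\<lambda>v. (w t * t) * frechet_derivative h (at (c t x)) v)" for x t
 have bl: "bounded_linear (\<lambda>v. (w t * t) * frechet_derivative h (at (c t x)) v)"
  if "t \<in> {0..1}" "x \<in> S" for t x
  using smooth_on_has_deriv[OF h c[OF that]] 
  by (intro bounded_linear_const_mult) (auto dest: has_derivative_bounded_linear)
 have fx: "blinfun_apply (fx x t) = (\<lambda>v. (w t * t) * frechet_derivative h (at (c t x)) v)"
  if "t \<in> {0..1}" "x \<in> S" for x t
  unfolding fx_def using bl[OF that] by (rule bounded_linear_Blinfun_apply)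
 have cc: "continuous_on (S \<times> {0..1}) (\<lambda>y. c (snd y) (fst y))"
  unfolding c_def by (intro continuous_intros)
 have cont: "continuous_on (S \<times> cbox 0 1) (\<lambda>(x, t). fx x t)"
 proof (rule continuous_on_blinfun_componentwise)
  fix i :: 'e assume "i \<in> Basis"
  have "continuous_on (S \<times> {0..1}) (\<lambda>y. w (snd y) * snd y * frechet_derivative h (at (c (snd y) (fst y))) i)"
   by (intro continuous_intros continuous_on_compose2[OF w]
     continuous_on_compose2[OF smooth_on_continuous_on[OF smooth_on_frechet_derivative[OF h]] cc])
    (auto intro: c)
  hence "continuous_on (S \<times> cbox 0 1) (\<lambda>y. w (snd y) * snd y * frechet_derivative h (at (c (snd y) (fst y))) i)"
   by simp
  thus "continuous_on (S \<times> cbox 0 1) (\<lambda>y. blinfun_apply (case y of (x, t) => fx x t) i)"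
   by (rule continuous_on_eq) (auto simp: fx)
 qed
 have "((\<lambda>x. integral (cbox 0 1) (\<lambda>t. w t * h (c t x))) has_derivative blinfun_apply (integral (cbox 0 1) (fx x)))
  (at x within S)"
 proof (rule leibniz_rule[OF _ _ cont x S(2)])
  fix x and t :: real assume *: "x \<in> S" "t \<in> cbox 0 1"
  have "(c t has_derivative (\<lambda>v. t *\<^sub>R v)) (at x)"
   unfolding c_def by (auto intro!: derivative_eq_intros)
  from has_derivative_compose[OF this smooth_on_has_deriv[OF h c]] *
  have "((\<lambda>x. h (c t x)) has_derivative (\<lambda>v. frechet_derivative h (at (c t x)) (t *\<^sub>R v))) (at x)"
   by auto
  moreover have "linear (frechet_derivative h (at (c t x)))"
   using smooth_on_has_deriv[OF h c] * by (auto intro: has_derivative_linear)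
  ultimately have "((\<lambda>x. w t * h (c t x)) has_derivative (\<lambda>v. w t * (t * frechet_derivative h (at (c t x)) v))) (at x)"
   by (intro has_derivative_mult_right) (simp add: linear_scale)
  thus "((\<lambda>x. w t * h (c t x)) has_derivative blinfun_apply (fx x t)) (at x within S)"
   using * by (simp add: fx mult_ac has_derivative_at_withinI)
 next
  fix x assume x: "x \<in> S"
  have "continuous_on {0..1} (\<lambda>t. w t * h (c t x))"
   using w x c by (intro continuous_intros continuous_on_compose2[OF smooth_on_continuous_on[OF h]])
    (auto simp: c_def intro!: continuous_intros)
  thus "(\<lambda>t. w t * h (c t x)) integrable_on cbox 0 1"
   by (simp add: integrable_continuous_real)
 qed
 moreover have "blinfun_apply (integral (cbox 0 1) (fx x)) =
   (\<lambda>v. integral {0..1} (\<lambda>t. (w t * t) * frechet_derivative h (at (c t x)) v))"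
 proof
  fix v
  have "continuous_on {0..1} (fx x)"
   using continuous_on_compose2[OF cont, of "{0..1}" "Pair x"] x
    continuous_on_Pair[OF continuous_on_const continuous_on_id, of "{0..1}" x] by auto
  hence "blinfun_apply (integral (cbox 0 1) (fx x)) v = integral (cbox 0 1) (\<lambda>t. fx x t v)"
   by (intro blinfun_apply_integral) (simp add: integrable_continuous_real)
  also have "\<dots> = integral {0..1} (\<lambda>t. (w t * t) * frechet_derivative h (at (c t x)) v)"
   using x by (auto intro!: integral_cong simp: fx)
  finally show "blinfun_apply (integral (cbox 0 1) (fx x)) v =
   integral {0..1} (\<lambda>t. (w t * t) * frechet_derivative h (at (c t x)) v)" .
 qed
 ultimately show ?thesis
  using S x by (simp add: c_def at_within_open[of x S])
qed

lemma smooth_on_integral: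
 fixes h :: "'e::euclidean_space => real"
 assumes S: "open S" "convex S" "p \<in> S" and h: "smooth_on S h" and w: "continuous_on {0..1} w"
 shows "smooth_on S (\<lambda>x. integral {0..1} (\<lambda>t. w t * h (p + t *\<^sub>R (x - p))))"
proof -
 have "Ck_on k S (\<lambda>x. integral {0..1} (\<lambda>t. w t * h (p + t *\<^sub>R (x - p))))" for k
  using h w
 proof (induction k arbitrary: h w)
  case 0
  show ?case
   using has_derivative_continuous[OF integral_has_derivative[OF S 0(1) _ 0(2)]]
   by (auto intro!: continuous_at_imp_continuous_on)
 next
  case (Suc k)
  have "continuous_on {0..1} (\<lambda>t. w t * t)" by (intro continuous_intros Suc.prems)
  thus ?case
   using smooth_on_frechet_derivative[OF Suc.prems(1)]
   by (intro Ck_on_SucI[OF S(1) integral_has_derivative[OF S Suc.prems(1) _ Suc.prems(2)]] Suc.IH)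
 qed
 thus ?thesis by (simp add: smooth_on_def)
qed

lemma hadamard:
 fixes f :: "'e::euclidean_space => real"
 assumes S: "open S" "convex S" "p \<in> S" and f: "smooth_on S f"
 shows "\<exists>g. (\<forall>b\<in>Basis. smooth_on S (g b) \<and> g b p = frechet_derivative f (at p) b) \<and>
  (\<forall>x\<in>S. f x = f p + (\<Sum>b\<in>Basis. ((x - p) \<bullet> b) * g b x))"
proof -
 \<comment> \<open>f x - f p is the integral of the derivative of f along the segment from p to x; g
   collects its partial derivatives. The weight 1 makes it an instance of
   \<open>smooth_on_integral\<close>.\<close>
 define g where "g b x = integral {0..1} (\<lambda>t. 1 * frechet_derivative f (at (p + t *\<^sub>R (x - p))) b)" for b x
 have "f x = f p + (\<Sum>b\<in>Basis. ((x - p) \<bullet> b) * g b x)" if x: "x \<in> S" for x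
 proof -
  define c where "c t = p + t *\<^sub>R (x - p)" for t
  have c: "c t \<in> S" if "t \<in> {0..1}" for t
  proof -
   have "c t = (1 - t) *\<^sub>R p + t *\<^sub>R x" by (simp add: c_def algebra_simps)
   thus ?thesis using S that x by (auto simp: convex_def)
  qed
  have d: "((\<lambda>t. f (c t)) has_vector_derivative (\<Sum>b\<in>Basis. ((x - p) \<bullet> b) * frechet_derivative f (at (c t)) b)) (at t within {0..1})"
   if t: "t \<in> {0..1}" for t
  proof -
   have "(c has_derivative (\<lambda>s. s *\<^sub>R (x - p))) (at t)"
    unfolding c_def by (auto intro!: derivative_eq_intros)
   from has_derivative_compose[OF this smooth_on_has_deriv[OF f c[OF t]]]
   have "((\<lambda>t. f (c t)) has_derivative (\<lambda>s. frechet_derivative f (at (c t)) (s *\<^sub>R (x - p)))) (at t)" .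
   moreover have l: "linear (frechet_derivative f (at (c t)))"
    using smooth_on_has_deriv[OF f c[OF t]] by (auto intro: has_derivative_linear)
   moreover have "frechet_derivative f (at (c t)) (x - p) = (\<Sum>b\<in>Basis. ((x - p) \<bullet> b) * frechet_derivative f (at (c t)) b)"
    using linear_eq_sum_Basis[OF l, of "x - p"] by simp
   ultimately show ?thesis
    by (simp add: has_vector_derivative_def linear_scale has_derivative_at_withinI)
  qed
  have "((\<lambda>t. \<Sum>b\<in>Basis. ((x - p) \<bullet> b) * frechet_derivative f (at (c t)) b) has_integral f (c 1) - f (c 0)) {0..1}"
   by (rule fundamental_theorem_of_calculus[OF _ d]) auto
  moreover have "((\<lambda>t. \<Sum>b\<in>Basis. ((x - p) \<bullet> b) * frechet_derivative f (at (c t)) b) has_integral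
    (\<Sum>b\<in>Basis. ((x - p) \<bullet> b) * g b x)) {0..1}"
  proof (intro has_integral_sum has_integral_mult_right finite_Basis)
   fix b :: 'e
   have "continuous_on {0..1} (\<lambda>t. frechet_derivative f (at (c t)) b)"
    by (intro continuous_on_compose2[OF smooth_on_continuous_on[OF smooth_on_frechet_derivative[OF f]]])
     (auto simp: c_def[abs_def] intro!: continuous_intros c[unfolded c_def])
   thus "((\<lambda>t. frechet_derivative f (at (c t)) b) has_integral g b x) {0..1}"
    unfolding g_def by (simp add: c_def integrable_continuous_real integrable_integral)
  qed
  ultimately have "f (c 1) - f (c 0) = (\<Sum>b\<in>Basis. ((x - p) \<bullet> b) * g b x)"
   by (rule has_integral_unique)
  thus ?thesis by (simp add: c_def)
 qed
 moreover have "smooth_on S (g b)" for b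
  unfolding g_def by (intro smooth_on_integral[OF S smooth_on_frechet_derivative[OF f]] continuous_intros)
 moreover have "g b p = frechet_derivative f (at p) b" for b
  by (simp add: g_def)
 ultimately show ?thesis by (intro exI[of _ g]) auto
qed

section \<open>Functions and vector fields on manifolds\<close>

locale manifold =
 fixes A :: "('a::{second_countable_topology, t2_space}, 'e::euclidean_space) atlas"
 assumes man: "smooth_manifold A"
begin

abbreviation "S \<equiv> carrier (Cinf A)"
abbreviation "T \<equiv> carrier (TC A)"

lemma chart_exists: obtains U \<phi> where "(U, \<phi>) \<in> A" "p \<in> U"
proof -
 have "p \<in> (\<Union>(U, \<phi>)\<in>A. U)" using man by (simp add: smooth_manifold_def)
 thus ?thesis using that by auto
qed

lemma chart:
 assumes "(U, \<phi>) \<in> A"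
 shows "open U" "open (\<phi> ` U)" "homeomorphism U (\<phi> ` U) \<phi> (inv_into U \<phi>)"
 using assms man by (auto simp: smooth_manifold_def)

lemma chart_inv [simp]: "(U, \<phi>) \<in> A ==> q \<in> U ==> inv_into U \<phi> (\<phi> q) = q"
 using chart(3)[of U \<phi>] by (auto simp: homeomorphism_def)

lemma open_chart_image: "(U, \<phi>) \<in> A ==> open V ==> open (\<phi> ` (U \<inter> V))"
 using homeomorphism_imp_open_map[OF chart(3), of U \<phi> "U \<inter> V"] chart(2)[of U \<phi>]
 by (auto simp: openin_open_Int openin_open_eq)

lemma open_chart_preimage:
 assumes "(U, \<phi>) \<in> A" "open B"
 shows "open {q \<in> U. \<phi> q \<in> B}"
proof -
 have "continuous_on U \<phi>" "open U"
  using chart[OF assms(1)] by (auto simp: homeomorphism_def)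
 hence "open (\<phi> -` B \<inter> U)"
  using assms(2) by (metis continuous_on_open_vimage)
 moreover have "\<phi> -` B \<inter> U = {q \<in> U. \<phi> q \<in> B}" by auto
 ultimately show ?thesis by simp
qed

lemma CinfD: "f \<in> S ==> (U, \<phi>) \<in> A ==> smooth_on (\<phi> ` U) (\<lambda>x. f (inv_into U \<phi> x))"
 by (auto simp: Cinf_def comp_def)

lemma CinfI:
 assumes "\<And>V \<psi> q. (V, \<psi>) \<in> A ==> q \<in> V ==>
  \<exists>U. open U \<and> q \<in> U \<and> smooth_on (\<psi> ` (V \<inter> U)) (\<lambda>x. f (inv_into V \<psi> x))"
 shows "f \<in> S"
proof -
 have "smooth_on (\<psi> ` V) (\<lambda>x. f (inv_into V \<psi> x))" if V: "(V, \<psi>) \<in> A" for V \<psi>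
 proof (rule smooth_on_local)
  fix x assume "x \<in> \<psi> ` V"
  then obtain q where q: "q \<in> V" "x = \<psi> q" by auto
  then obtain U where "open U" "q \<in> U" "smooth_on (\<psi> ` (V \<inter> U)) (\<lambda>x. f (inv_into V \<psi> x))"
   using assms[OF V] by blast
  thus "\<exists>T. open T \<and> x \<in> T \<and> smooth_on T (\<lambda>x. f (inv_into V \<psi> x))"
   using open_chart_image[OF V] q by (intro exI[of _ "\<psi> ` (V \<inter> U)"]) auto
 qed
 thus ?thesis by (auto simp: Cinf_def comp_def)
qed

lemma Cinf_local:
 assumes "\<And>p. \<exists>U g. open U \<and> p \<in> U \<and> g \<in> S \<and> (\<forall>q\<in>U. f q = g q)"
 shows "f \<in> S"
proof (rule CinfI)
 fix V \<psi> q assume V: "(V, \<psi>) \<in> A" "q \<in> V"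
 obtain U g where U: "open U" "q \<in> U" "g \<in> S" "\<forall>q\<in>U. f q = g q"
  using assms by blast
 have "smooth_on (\<psi> ` (V \<inter> U)) (\<lambda>x. g (inv_into V \<psi> x))"
  using CinfD[OF U(3) V(1)] by (rule smooth_on_subset) auto
 hence "smooth_on (\<psi> ` (V \<inter> U)) (\<lambda>x. f (inv_into V \<psi> x))"
  by (rule smooth_on_cong[OF open_chart_image[OF V(1) U(1)], rotated]) (use V U in auto)
 thus "\<exists>U. open U \<and> q \<in> U \<and> smooth_on (\<psi> ` (V \<inter> U)) (\<lambda>x. f (inv_into V \<psi> x))"
  using U by blast
qed

lemma Cinf_const [simp]: "(\<lambda>_. c) \<in> S"
 by (auto simp: Cinf_def comp_def intro!: smooth_on_const chart)

lemma Cinf_add [simp]: "f \<in> S ==> g \<in> S ==> (\<lambda>p. f p + g p) \<in> S"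
 by (auto simp: Cinf_def comp_def intro!: smooth_on_add chart)

lemma Cinf_mult [simp]: "f \<in> S ==> g \<in> S ==> (\<lambda>p. f p * g p) \<in> S"
 by (auto simp: Cinf_def comp_def intro!: smooth_on_mult chart)

lemma Cinf_uminus [simp]: "f \<in> S ==> (\<lambda>p. - f p) \<in> S"
 using Cinf_mult[of "\<lambda>_. - 1" f] by simp

lemma Cinf_diff [simp]: "f \<in> S ==> g \<in> S ==> (\<lambda>p. f p - g p) \<in> S"
 using Cinf_add[of f "\<lambda>p. - g p"] by simp

lemma Cinf_sum [simp]: "(\<And>i. i \<in> I ==> f i \<in> S) ==> (\<lambda>p. \<Sum>i\<in>I. f i p) \<in> S"
 by (induction I rule: infinite_finite_induct) auto

lemma Cinf_prod [simp]: "(\<And>i. i \<in> I ==> f i \<in> S) ==> (\<lambda>p. \<Prod>i\<in>I. f i p) \<in> S"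
 by (induction I rule: infinite_finite_induct) auto

lemma Cinf_continuous: "f \<in> S ==> continuous_on UNIV f"
proof -
 assume f: "f \<in> S"
 have "isCont f p" for p
 proof -
  obtain U \<phi> where U: "(U, \<phi>) \<in> A" "p \<in> U" by (rule chart_exists)
  have "continuous_on U (\<lambda>q. f (inv_into U \<phi> (\<phi> q)))"
   using chart(3)[OF U(1)] continuous_on_compose2[OF smooth_on_continuous_on[OF CinfD[OF f U(1)]], of U \<phi>]
   by (simp add: homeomorphism_def)
  hence "continuous_on U f"
   by (rule continuous_on_eq) (use U in auto)
  thus ?thesis
   using U chart(1)[OF U(1)] by (simp add: continuous_on_eq_continuous_at)
 qed
 thus ?thesis by (simp add: continuous_at_imp_continuous_on)
qed

lemma open_nonzero: "f \<in> S ==> open {p. f p \<noteq> 0}"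
 using open_Collect_neq[OF Cinf_continuous continuous_on_const] by simp

section \<open>Extension by zero and bump functions on the manifold\<close>

lemma Cinf_extend:
 assumes U: "(U, \<phi>) \<in> A" and B: "open B" "smooth_on B F"
  and K: "compact K" "K \<subseteq> {q \<in> U. \<phi> q \<in> B}"
  and f: "\<And>q. q \<notin> K ==> f q = 0" "\<And>q. q \<in> U ==> \<phi> q \<in> B ==> f q = F (\<phi> q)"
 shows "f \<in> S"
proof (rule CinfI)
 fix V \<psi> q assume V: "(V, \<psi>) \<in> A" "q \<in> V"
 show "\<exists>U. open U \<and> q \<in> U \<and> smooth_on (\<psi> ` (V \<inter> U)) (\<lambda>x. f (inv_into V \<psi> x))"
 \<comment> \<open>K is compact, hence closed because points are separated. So near a point of K the
   function is F in the chart, and near any other point it is 0.\<close>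
 proof (cases "q \<in> K")
  case True
  define W where "W = {q \<in> U. \<phi> q \<in> B}"
  have W: "open W" "q \<in> W" "W \<subseteq> U"
   using open_chart_preimage[OF U B(1)] K True by (auto simp: W_def)
  have o: "open (\<psi> ` (V \<inter> W))"
   using V W by (intro open_chart_image)
  \<comment> \<open>Smoothness has to be checked in every chart V of the atlas; the chart U in which
    F lives is reached by the transition map.\<close>
  have "smooth_on (\<psi> ` (V \<inter> U)) (\<lambda>x. \<phi> (inv_into V \<psi> x))"
   using man U V unfolding smooth_manifold_def comp_def by blast
  hence "smooth_on (\<psi> ` (V \<inter> W)) (\<lambda>x. \<phi> (inv_into V \<psi> x))"
   by (rule smooth_on_subset) (use W in auto)
  hence "smooth_on (\<psi> ` (V \<inter> W)) (\<lambda>x. F (\<phi> (inv_into V \<psi> x)))"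
   by (intro smooth_on_compose[OF o B(1) _ _ B(2)]) (use V in \<open>auto simp: W_def\<close>)
  hence "smooth_on (\<psi> ` (V \<inter> W)) (\<lambda>x. f (inv_into V \<psi> x))"
   by (rule smooth_on_cong[OF o, rotated]) (use V in \<open>auto simp: W_def f\<close>)
  thus ?thesis using W by blast
 next
  case False
  have W: "open (- K)" using K by (simp add: compact_imp_closed open_Compl)
  have "smooth_on (\<psi> ` (V \<inter> - K)) (\<lambda>x. f (inv_into V \<psi> x))"
   by (rule smooth_on_cong[OF open_chart_image[OF V(1) W] _ smooth_on_const[OF open_chart_image[OF V(1) W], of 0]])
    (use V f in auto)
  thus ?thesis using W False by blast
 qed
qed

text \<open>\<open>Cinf_extend\<close> extends a chart expression by zero from a compact support
  only; hence K is part of the result besides the open set N on which \<beta> is 1.\<close>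

lemma bump:
 assumes U: "(U, \<phi>) \<in> A" "p \<in> U" and W: "open W" "p \<in> W"
 obtains \<beta> K N where "\<beta> \<in> S" "compact K" "K \<subseteq> U \<inter> W" "\<And>q. q \<notin> K ==> \<beta> q = 0"
  "open N" "p \<in> N" "N \<subseteq> K" "\<And>q. q \<in> N ==> \<beta> q = 1"
proof -
 obtain e where e: "e > 0" "cball (\<phi> p) e \<subseteq> \<phi> ` (U \<inter> W)"
  using open_chart_image[OF U(1) W(1)] U W unfolding open_contains_cball by (metis IntI imageI)
 obtain b where b: "smooth_on UNIV b" "\<forall>x\<in>cball (\<phi> p) (e / 2). b x = (1::real)" "\<forall>x. 2 * (e / 2) \<le> dist (\<phi> p) x \<longrightarrow> b x = 0"
  using bump_exists[of "e / 2" "\<phi> p"] e(1) by (meson half_gt_zero)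
 define K where "K = inv_into U \<phi> ` cball (\<phi> p) e"
 define \<beta> where "\<beta> q = (if q \<in> U then b (\<phi> q) else 0)" for q
 define N where "N = {q \<in> U. \<phi> q \<in> ball (\<phi> p) (e / 2)}"
 have "continuous_on (cball (\<phi> p) e) (inv_into U \<phi>)"
  by (rule continuous_on_subset[of "\<phi> ` U"]) (use chart(3)[OF U(1)] e in \<open>auto simp: homeomorphism_def\<close>)
 hence 1: "compact K" unfolding K_def by (intro compact_continuous_image compact_cball)
 have 2: "K \<subseteq> U \<inter> W" using e U by (auto simp: K_def)
 have inK: "q \<in> K" if "q \<in> U" "\<phi> q \<in> cball (\<phi> p) e" for q
  unfolding K_def using that U by (metis chart_inv imageI)
 have 3: "\<beta> q = 0" if "q \<notin> K" for q
  using that inK[of q] b(3)[rule_format, of "\<phi> q"]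
  by (cases "q \<in> U"; cases "dist (\<phi> p) (\<phi> q) \<le> e") (auto simp: \<beta>_def)
 have "\<beta> \<in> S"
  by (rule Cinf_extend[OF U(1) chart(2)[OF U(1)] smooth_on_subset[OF b(1)] 1]) (use 2 3 in \<open>auto simp: \<beta>_def\<close>)
 moreover have "open N" unfolding N_def using U by (intro open_chart_preimage) auto
 moreover have "p \<in> N" using U e by (simp add: N_def)
 moreover have "N \<subseteq> K" using inK e by (auto simp: N_def)
 moreover have "\<beta> q = 1" if "q \<in> N" for q using that b(2) by (auto simp: \<beta>_def N_def)
 ultimately show ?thesis using that 1 2 3 by blast
qed

lemma local_bump:
 assumes "open W" "p \<in> W"
 obtains \<beta> N where "\<beta> \<in> S" "\<And>q. q \<notin> W ==> \<beta> q = 0" "open N" "p \<in> N" "N \<subseteq> W" "\<And>q. q \<in> N ==> \<beta> q = 1"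
proof -
 obtain U \<phi> where U: "(U, \<phi>) \<in> A" "p \<in> U" by (rule chart_exists)
 obtain \<beta> K N where \<beta>: "\<beta> \<in> S" "compact K" "K \<subseteq> U \<inter> W" "\<And>q. q \<notin> K ==> \<beta> q = 0"
  "open N" "p \<in> N" "N \<subseteq> K" "\<And>q. q \<in> N ==> \<beta> q = 1"
  by (rule bump[OF U assms]) blast
 show ?thesis
  by (rule that[of \<beta> N]) (use \<beta> in blast)+
qed

text \<open>1/h is cut off by a bump function with compact support in the set where h has no
  zero.\<close>

lemma Cinf_local_inverse:
 assumes h: "h \<in> S" "h p \<noteq> 0"
 obtains k N where "k \<in> S" "open N" "p \<in> N" "\<And>q. q \<in> N ==> k q * h q = 1"
proof -
 obtain U \<phi> where U: "(U, \<phi>) \<in> A" "p \<in> U" by (rule chart_exists)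
 define W where "W = {q. h q \<noteq> 0}"
 have W: "open W" "p \<in> W" using open_nonzero[OF h(1)] h by (auto simp: W_def)
 obtain \<beta> K N where \<beta>: "\<beta> \<in> S" "compact K" "K \<subseteq> U \<inter> W" "\<And>q. q \<notin> K ==> \<beta> q = 0"
  "open N" "p \<in> N" "N \<subseteq> K" "\<And>q. q \<in> N ==> \<beta> q = 1"
  by (rule bump[OF U W]) blast
 have o: "open (\<phi> ` (U \<inter> W))"
  by (rule open_chart_image[OF U(1) W(1)])
 have "(\<lambda>q. \<beta> q * inverse (h q)) \<in> S"
 proof (rule Cinf_extend[OF U(1) o _ \<beta>(2)])
  have sub: "smooth_on (\<phi> ` (U \<inter> W)) (\<lambda>x. f (inv_into U \<phi> x))" if "f \<in> S" for f
   using CinfD[OF that U(1)] by (rule smooth_on_subset) auto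
  have "(\<lambda>x. h (inv_into U \<phi> x)) ` \<phi> ` (U \<inter> W) \<subseteq> - {0}"
   using U by (auto simp: W_def)
  thus "smooth_on (\<phi> ` (U \<inter> W)) (\<lambda>x. \<beta> (inv_into U \<phi> x) * inverse (h (inv_into U \<phi> x)))"
   by (intro smooth_on_mult[OF o sub[OF \<beta>(1)]]
     smooth_on_compose[OF o open_Compl[OF closed_singleton] _ sub[OF h(1)] smooth_on_inverse])
 qed (use \<beta> U in auto)
 thus ?thesis
  by (rule that[of _ N]) (use \<beta> in \<open>auto simp: W_def subset_iff\<close>)
qed

section \<open>Vector fields as derivations\<close>

lemma TC_iff: "X \<in> T \<longleftrightarrow> (\<forall>f. f \<notin> S \<longrightarrow> X f = (\<lambda>_. 0)) \<and> (\<forall>f\<in>S. X f \<in> S) \<and>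
  (\<forall>f\<in>S. \<forall>g\<in>S. \<forall>c p. X (\<lambda>q. f q + g q) p = X f p + X g p \<and> X (\<lambda>q. c * f q) p = c * X f p \<and>
      X (\<lambda>q. f q * g q) p = X f p * g p + f p * X g p)"
 by (simp add: TC_def)

lemma vf_out: "X \<in> T ==> f \<notin> S ==> X f = (\<lambda>_. 0)"
 unfolding TC_iff by blast

lemma vf_mem: "X \<in> T ==> X f \<in> S"
 by (cases "f \<in> S") (simp_all add: vf_out, simp add: TC_iff)

lemma vf_add: "X \<in> T ==> f \<in> S ==> g \<in> S ==> X (\<lambda>q. f q + g q) = (\<lambda>p. X f p + X g p)"
 and vf_cmult: "X \<in> T ==> f \<in> S ==> X (\<lambda>q. c * f q) = (\<lambda>p. c * X f p)"
 and vf_mult: "X \<in> T ==> f \<in> S ==> g \<in> S ==> X (\<lambda>q. f q * g q) = (\<lambda>p. X f p * g p + f p * X g p)"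
 unfolding TC_iff fun_eq_iff by blast+

lemma vf_const: "X \<in> T ==> X (\<lambda>_. c) = (\<lambda>_. 0)"
 using vf_mult[of X "\<lambda>_. 1" "\<lambda>_. 1"] vf_cmult[of X "\<lambda>_. 1" c] by (auto simp: fun_eq_iff)

lemma vf_diff: "X \<in> T ==> f \<in> S ==> g \<in> S ==> X (\<lambda>q. f q - g q) = (\<lambda>p. X f p - X g p)"
 using vf_add[of X f "\<lambda>q. (- 1) * g q"] vf_cmult[of X g "- 1"] Cinf_uminus[of g] by simp

lemma vf_sum: "X \<in> T ==> (\<And>i. i \<in> I ==> f i \<in> S) ==> X (\<lambda>q. \<Sum>i\<in>I. f i q) = (\<lambda>p. \<Sum>i\<in>I. X (f i) p)"
proof (induction I rule: infinite_finite_induct)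
 case (insert i I)
 thus ?case using vf_add[of X "f i" "\<lambda>q. \<Sum>i\<in>I. f i q"] by simp
qed (simp_all add: vf_const)

text \<open>With a bump function \<beta> at p supported in W, f - g = (1 - \<beta>)(f - g). Both
  factors vanish at p, so the Leibniz rule gives derivative 0 there.\<close>

lemma vf_local:
 assumes X: "X \<in> T" and f: "f \<in> S" "g \<in> S" and W: "open W" "p \<in> W" "\<And>q. q \<in> W ==> f q = g q"
 shows "X f p = X g p"
proof -
 obtain \<beta> N where \<beta>: "\<beta> \<in> S" "\<And>q. q \<notin> W ==> \<beta> q = 0" "p \<in> N" "\<And>q. q \<in> N ==> \<beta> q = 1"
  by (rule local_bump[OF W(1,2)]) blast
 have "(\<lambda>q. f q - g q) = (\<lambda>q. (1 - \<beta> q) * (f q - g q))"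
  using \<beta>(2) W(3) by (auto simp: fun_eq_iff)
 hence "X (\<lambda>q. f q - g q) p = X (\<lambda>q. (1 - \<beta> q) * (f q - g q)) p"
  by (rule arg_cong)
 also have "\<dots> = 0"
  using f \<beta> W by (simp add: vf_mult[OF X])
 finally show ?thesis using f by (simp add: vf_diff[OF X])
qed

lemma vf_eqI:
 assumes "X \<in> T" "Y \<in> T" "\<And>f p. f \<in> S ==> X f p = Y f p"
 shows "X = Y"
proof
 fix f
 show "X f = Y f"
 proof (cases "f \<in> S")
  case True
  show ?thesis by (rule ext) (rule assms(3)[OF True])
 next
  case False
  show ?thesis unfolding vf_out[OF assms(1) False] vf_out[OF assms(2) False] ..
 qed
qed

lemma TC_simps [simp]:
 "\<zero>\<^bsub>TC A\<^esub> = (\<lambda>f p. 0)" "X \<oplus>\<^bsub>TC A\<^esub> Y = (\<lambda>f p. X f p + Y f p)" "h \<odot>\<^bsub>TC A\<^esub> X = (\<lambda>f p. h p * X f p)"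
 by (simp_all add: TC_def)

lemma vf_zero_mem [simp]: "(\<lambda>f p. 0) \<in> T"
 by (simp add: TC_iff)

lemma vf_add_mem [simp]: "X \<in> T ==> Y \<in> T ==> (\<lambda>f p. X f p + Y f p) \<in> T"
 unfolding TC_iff by (simp add: algebra_simps fun_eq_iff)

lemma vf_smult_mem [simp]: "h \<in> S ==> X \<in> T ==> (\<lambda>f p. h p * X f p) \<in> T"
 unfolding TC_iff by (simp add: algebra_simps fun_eq_iff)

lemma vf_uminus_mem [simp]: "X \<in> T ==> (\<lambda>f p. - X f p) \<in> T"
 using vf_smult_mem[of "\<lambda>_. - 1" X] by simp

lemma vf_diff_mem [simp]: "X \<in> T ==> Y \<in> T ==> (\<lambda>f p. X f p - Y f p) \<in> T"
 using vf_add_mem[of X "\<lambda>f p. - Y f p"] by simp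

lemma vf_sum_mem [simp]: "(\<And>i. i \<in> I ==> X i \<in> T) ==> (\<lambda>f p. \<Sum>i\<in>I. X i f p) \<in> T"
 by (induction I rule: infinite_finite_induct) auto

lemma fun_module_TC: "fun_module S (TC A) (\<lambda>X. X)"
 by unfold_locales (auto intro: inj_onI)

sublocale TC: fun_module S "TC A" "\<lambda>X. X"
 by (rule fun_module_TC)

lemma lie_mem [simp]: "X \<in> T ==> Y \<in> T ==> lie X Y \<in> T"
 unfolding TC_iff[of "lie X Y"]
 by (auto simp: lie_def vf_out[of X] vf_out[of Y] vf_add[of X] vf_add[of Y] vf_cmult[of X] vf_cmult[of Y]
   vf_mult[of X] vf_mult[of Y] vf_mem[of X] vf_mem[of Y] vf_const[of X] vf_const[of Y] algebra_simps)

text \<open>Fields that are given pointwise by choice, or as locally finite series, are recognised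
  as vector fields by comparison with known ones near each point.\<close>

lemma vf_local_field:
 assumes "\<And>p. \<exists>U Y. open U \<and> p \<in> U \<and> Y \<in> T \<and> (\<forall>q\<in>U. \<forall>f. X f q = Y f q)"
 shows "X \<in> T"
 unfolding TC_iff
proof (intro conjI allI impI ballI)
 fix f assume "f \<notin> S"
 show "X f = (\<lambda>_. 0)"
 proof
  fix p
  obtain U Y where "open U" "p \<in> U" "Y \<in> T" "\<forall>q\<in>U. \<forall>f. X f q = Y f q"
   using assms[of p] by (elim exE conjE) (rule that)
  thus "X f p = 0" using vf_out[of Y f] \<open>f \<notin> S\<close> by simp
 qed
next
 fix f assume "f \<in> S"
 show "X f \<in> S"
 proof (rule Cinf_local)
  fix p
  obtain U Y where "open U" "p \<in> U" "Y \<in> T" "\<forall>q\<in>U. \<forall>f. X f q = Y f q"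
   using assms[of p] by (elim exE conjE) (rule that)
  with vf_mem[OF this(3), of f] show "\<exists>U g. open U \<and> p \<in> U \<and> g \<in> S \<and> (\<forall>q\<in>U. X f q = g q)"
   by (intro exI[of _ U] exI[of _ "Y f"] conjI ballI) simp_all
 qed
next
 fix f g c p assume fg: "f \<in> S" "g \<in> S"
 obtain U Y where "open U" "p \<in> U" "Y \<in> T" "\<forall>q\<in>U. \<forall>f. X f q = Y f q"
  using assms[of p] by (elim exE conjE) (rule that)
 thus "X (\<lambda>q. f q + g q) p = X f p + X g p" "X (\<lambda>q. c * f q) p = c * X f p"
   "X (\<lambda>q. f q * g q) p = X f p * g p + f p * X g p"
  using fg by (simp_all add: vf_add[of Y] vf_cmult[of Y] vf_mult[of Y])
qed

subsection \<open>Coordinates at a point\<close>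

lemma chart_vf:
 assumes U: "(U, \<phi>) \<in> A" and \<beta>: "\<beta> \<in> S" "compact K" "K \<subseteq> U" "\<And>q. q \<notin> K ==> \<beta> q = 0"
 shows "(\<lambda>f q. if f \<in> S \<and> q \<in> U then \<beta> q * frechet_derivative (\<lambda>x. f (inv_into U \<phi> x)) (at (\<phi> q)) b else 0) \<in> T"
  (is "?X \<in> T")
 unfolding TC_iff
proof (intro conjI ballI allI)
 note o = chart(2)[OF U]
 have d: "((\<lambda>x. f (inv_into U \<phi> x)) has_derivative frechet_derivative (\<lambda>x. f (inv_into U \<phi> x)) (at (\<phi> q))) (at (\<phi> q))"
  if "f \<in> S" "q \<in> U" for f q
  using that by (intro smooth_on_has_deriv[OF CinfD[OF _ U]]) auto
 fix f assume f: "f \<in> S"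
 show "?X f \<in> S"
 proof (rule Cinf_extend[OF U o _ \<beta>(2)])
  show "smooth_on (\<phi> ` U) (\<lambda>x. \<beta> (inv_into U \<phi> x) * frechet_derivative (\<lambda>x. f (inv_into U \<phi> x)) (at x) b)"
   by (intro smooth_on_mult[OF o] CinfD[OF \<beta>(1) U] smooth_on_frechet_derivative CinfD[OF f U])
 qed (use \<beta> f U in auto)
 fix g c p assume g: "g \<in> S"
 show "?X (\<lambda>q. f q + g q) p = ?X f p + ?X g p"
 proof (cases "p \<in> U")
  case True
  thus ?thesis
   using f g by (simp add: frechet_derivative_at[OF has_derivative_add[OF d[OF f True] d[OF g True]], symmetric]
     algebra_simps)
 qed simp
 show "?X (\<lambda>q. c * f q) p = c * ?X f p"
 proof (cases "p \<in> U")
  case True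
  thus ?thesis
   using f Cinf_mult[OF Cinf_const f, of c]
   by (simp add: frechet_derivative_at[OF has_derivative_mult_right[OF d[OF f True], of c], symmetric] algebra_simps)
 qed simp
 show "?X (\<lambda>q. f q * g q) p = ?X f p * g p + f p * ?X g p"
 proof (cases "p \<in> U")
  case True
  thus ?thesis
   using f g U by (simp add: frechet_derivative_at[OF has_derivative_mult[OF d[OF f True] d[OF g True]], symmetric]
     algebra_simps)
 qed simp
qed auto

text \<open>The coordinates and coordinate fields of a chart, cut off to become global. The
  expansion at p is Hadamard's lemma followed by the Leibniz rule; on functions that are not smooth
  both sides are 0 by convention.\<close>

lemma coordinates:
 obtains x and \<delta> where "\<And>b. b \<in> Basis ==> x (b::'e) \<in> S" "\<And>b. b \<in> Basis ==> \<delta> (b::'e) \<in> T"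
  "\<And>b c. b \<in> Basis ==> c \<in> Basis ==> \<delta> b (x c) p = (if b = c then 1 else 0)"
  "\<And>X f. X \<in> T ==> X f p = (\<Sum>b\<in>Basis. X (x b) p * \<delta> b f p)"
proof -
 obtain U \<phi> where U: "(U, \<phi>) \<in> A" "p \<in> U" by (rule chart_exists)
 obtain \<beta> K N where \<beta>: "\<beta> \<in> S" "compact K" "K \<subseteq> U \<inter> UNIV" "\<And>q. q \<notin> K ==> \<beta> q = 0"
  "open N" "p \<in> N" "N \<subseteq> K" "\<And>q. q \<in> N ==> \<beta> q = 1"
  by (rule bump[OF U open_UNIV]) auto
 define x where "x b q = (if q \<in> U then \<beta> q * (\<phi> q \<bullet> b) else 0)" for b q
 define \<delta> where "\<delta> b f q = (if f \<in> S \<and> q \<in> U then \<beta> q * frechet_derivative (\<lambda>x. f (inv_into U \<phi> x)) (at (\<phi> q)) b else 0)" for b f q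
 have x: "x b \<in> S" for b
 proof (rule Cinf_extend[OF U(1) chart(2)[OF U(1)] _ \<beta>(2)])
  show "smooth_on (\<phi> ` U) (\<lambda>y. \<beta> (inv_into U \<phi> y) * (y \<bullet> b))"
   by (intro smooth_on_mult smooth_on_inner smooth_on_id smooth_on_const CinfD[OF \<beta>(1) U(1)] chart(2)[OF U(1)])
 qed (use \<beta> U in \<open>auto simp: x_def\<close>)
 have \<delta>: "\<delta> b \<in> T" for b
  unfolding \<delta>_def[abs_def] using \<beta> U by (intro chart_vf) auto
 have NU: "N \<subseteq> U" using \<beta> by auto
 have oN: "open (\<phi> ` N)" using open_chart_image[OF U(1) \<beta>(5)] NU by (simp add: Int_absorb1)
 have dx: "\<delta> b (x c) p = b \<bullet> c" for b c
 proof -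
  have "((\<lambda>y. y \<bullet> c) has_derivative (\<lambda>v. v \<bullet> c)) (at (\<phi> p))"
   by (auto intro!: derivative_eq_intros)
  hence "((\<lambda>y. x c (inv_into U \<phi> y)) has_derivative (\<lambda>v. v \<bullet> c)) (at (\<phi> p))"
   using \<beta> NU U by (elim has_derivative_transform_within_open[OF _ oN]) (auto simp: x_def subset_iff)
  from frechet_derivative_at[OF this] show ?thesis
   using x \<beta>(6,8) U by (simp add: \<delta>_def fun_eq_iff)
 qed
 have "X f p = (\<Sum>b\<in>Basis. X (x b) p * \<delta> b f p)" if X: "X \<in> T" and f: "f \<in> S" for X f
 proof -
  obtain e where e: "e > 0" "ball (\<phi> p) e \<subseteq> \<phi> ` N"
   using oN \<beta>(6) unfolding open_contains_ball by (metis imageI)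
  define B where "B = ball (\<phi> p) e"
  have B: "open B" "convex B" "\<phi> p \<in> B" using e by (auto simp: B_def)
  have "smooth_on B (\<lambda>y. f (inv_into U \<phi> y))"
   using CinfD[OF f U(1)] by (rule smooth_on_subset) (use e NU B_def in auto)
  \<comment> \<open>Hadamard's coefficients g live on the ball B only; cut off by \<beta>' below
    they become the global functions G.\<close>
  from hadamard[OF B this] obtain g where g:
   "\<And>b. b \<in> Basis ==> smooth_on B (g b)"
   "\<And>b. b \<in> Basis ==> g b (\<phi> p) = frechet_derivative (\<lambda>y. f (inv_into U \<phi> y)) (at (\<phi> p)) b"
   "\<And>y. y \<in> B ==> f (inv_into U \<phi> y) = f (inv_into U \<phi> (\<phi> p)) + (\<Sum>b\<in>Basis. ((y - \<phi> p) \<bullet> b) * g b y)"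
   by blast
  define W where "W = {q \<in> U. \<phi> q \<in> B}"
  have W: "open W" "p \<in> W" using open_chart_preimage[OF U(1) B(1)] U B by (auto simp: W_def)
  obtain \<beta>' K' N' where \<beta>': "\<beta>' \<in> S" "compact K'" "K' \<subseteq> U \<inter> W" "\<And>q. q \<notin> K' ==> \<beta>' q = 0"
   "open N'" "p \<in> N'" "N' \<subseteq> K'" "\<And>q. q \<in> N' ==> \<beta>' q = 1"
   by (rule bump[OF U W]) blast
  define G where "G b q = (if q \<in> U then \<beta>' q * g b (\<phi> q) else 0)" for b q
  have G: "G b \<in> S" if b: "b \<in> Basis" for b
  proof (rule Cinf_extend[OF U(1) B(1) _ \<beta>'(2)])
   have "smooth_on B (\<lambda>y. \<beta>' (inv_into U \<phi> y))"
    using CinfD[OF \<beta>'(1) U(1)] by (rule smooth_on_subset) (use e NU B_def in auto)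
   thus "smooth_on B (\<lambda>y. \<beta>' (inv_into U \<phi> y) * g b y)"
    using g(1)[OF b] B(1) by (intro smooth_on_mult)
  qed (use \<beta>' U in \<open>auto simp: W_def G_def\<close>)
  \<comment> \<open>The support of \<beta>' lies in W; there \<beta> is 1, so the cut-off
    coordinates are the true ones.\<close>
  have WN: "W \<subseteq> N"
  proof
   fix q assume "q \<in> W"
   hence "q \<in> U" "\<phi> q \<in> \<phi> ` N" using e by (auto simp: W_def B_def)
   thus "q \<in> N" using chart_inv[OF U(1)] NU by (metis image_iff subset_iff)
  qed
  have eq: "f q = f p + (\<Sum>b\<in>Basis. (x b q - x b p) * G b q)" if q: "q \<in> N'" for q
  proof -
   have "q \<in> W" "q \<in> U" "\<beta>' q = 1" using q \<beta>' by auto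
   moreover from this have "\<beta> q = 1" "\<beta> p = 1" "\<phi> q \<in> B" using WN \<beta> by (auto simp: W_def)
   ultimately show ?thesis
    using g(3)[of "\<phi> q"] U by (simp add: x_def G_def inner_diff_left)
  qed
  \<comment> \<open>In each product the factor x_b - x_b(p) vanishes at p, so the Leibniz rule keeps
    only the term in which X hits this factor.\<close>
  have "X f p = X (\<lambda>q. f p + (\<Sum>b\<in>Basis. (x b q - x b p) * G b q)) p"
  proof (rule vf_local[OF X f _ \<beta>'(5,6)])
   show "(\<lambda>q. f p + (\<Sum>b\<in>Basis. (x b q - x b p) * G b q)) \<in> S"
    using x G by simp
  qed (rule eq)
  also have "\<dots> = (\<Sum>b\<in>Basis. X (\<lambda>q. (x b q - x b p) * G b q) p)"
   using x G by (simp add: vf_add[OF X] vf_sum[OF X] vf_const[OF X])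
  also have "\<dots> = (\<Sum>b\<in>Basis. X (x b) p * \<delta> b f p)"
  proof (rule sum.cong[OF refl])
   fix b :: 'e assume b: "b \<in> Basis"
   have "G b p = \<delta> b f p" using f U g(2)[OF b] \<beta>'(6,8) \<beta>(6,8) by (simp add: G_def \<delta>_def)
   thus "X (\<lambda>q. (x b q - x b p) * G b q) p = X (x b) p * \<delta> b f p"
    using x G[OF b] by (simp add: vf_mult[OF X] vf_diff[OF X] vf_const[OF X])
  qed
  finally show ?thesis .
 qed
 moreover have "X f p = (\<Sum>b\<in>Basis. X (x b) p * \<delta> b f p)" if X: "X \<in> T" and f: "f \<notin> S" for X f
  using vf_out[OF X f] f by (simp add: \<delta>_def)
 ultimately show ?thesis
  using x \<delta> dx by (intro that[of x \<delta>]) (auto simp: inner_Basis)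
qed

subsection \<open>Dual frames\<close>

text \<open>Gaussian elimination for function-valued functionals: \<open>ev \<mu> i\<close> is the
  value of \<mu> on the i-th frame element, and \<Lambda> is closed under \<mu> + f \<nu>.
  Separation at the single point p is enough, because a function that is nonzero at p is invertible
  near p. Applied to all covectors and a frame of the tangent bundle, and to covectors built from
  \<omega> and a frame of G.\<close>

lemma dual_frame:
 fixes ev :: "'l => nat => 'a => real"
 assumes ev: "\<And>\<mu> i. \<mu> \<in> \<Lambda> ==> i < r ==> ev \<mu> i \<in> S"
  and lin: "\<And>\<mu> \<nu> f. \<mu> \<in> \<Lambda> ==> \<nu> \<in> \<Lambda> ==> f \<in> S ==> \<exists>\<kappa>\<in>\<Lambda>. \<forall>i q. ev \<kappa> i q = ev \<mu> i q + f q * ev \<nu> i q"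
  and nondeg: "\<And>c. (\<And>\<mu>. \<mu> \<in> \<Lambda> ==> (\<Sum>i<r. c i * ev \<mu> i p) = 0) ==> (\<forall>i<r. c i = 0)"
 shows "\<exists>\<mu> N. open N \<and> p \<in> N \<and> (\<forall>j<r. \<mu> j \<in> \<Lambda>) \<and> (\<forall>q\<in>N. \<forall>i<r. \<forall>j<r. ev (\<mu> j) i q = (if i = j then 1 else 0))"
 using ev nondeg
proof (induction r)
 case 0
 show ?case by (rule exI, rule exI[of _ UNIV]) auto
next
 case (Suc r)
 have nd: "\<forall>i<r. c i = 0" if c: "\<And>\<mu>. \<mu> \<in> \<Lambda> ==> (\<Sum>i<r. c i * ev \<mu> i p) = 0" for c
 proof -
  have "\<forall>i<Suc r. (c(r := 0)) i = 0"
   by (rule Suc.prems(2)) (use c in simp)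
  thus ?thesis by (auto simp: less_Suc_eq)
 qed
 have "\<exists>\<mu> N. open N \<and> p \<in> N \<and> (\<forall>j<r. \<mu> j \<in> \<Lambda>) \<and>
   (\<forall>q\<in>N. \<forall>i<r. \<forall>j<r. ev (\<mu> j) i q = (if i = j then 1 else 0))"
  by (rule Suc.IH) (simp add: Suc.prems(1), rule nd)
 then obtain \<mu> N where \<mu>': "open N" "p \<in> N" "\<forall>j<r. \<mu> j \<in> \<Lambda>"
  "\<forall>q\<in>N. \<forall>i<r. \<forall>j<r. ev (\<mu> j) i q = (if i = j then 1 else 0)"
  by (elim exE conjE) (rule that)
 note \<mu> = \<mu>'(1,2) \<mu>'(3)[rule_format] \<mu>'(4)[rule_format]
 \<comment> \<open>Pairing \<nu> with this c gives, at p, the r-th value of \<nu> after its first r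
   values have been eliminated with the \<mu>_j; that reduced functional is \<kappa> below.\<close>
 define c where "c i = (if i = r then 1 else - ev (\<mu> i) r p)" for i
 have "\<exists>\<nu>\<in>\<Lambda>. (\<Sum>i<Suc r. c i * ev \<nu> i p) \<noteq> 0"
 proof (rule ccontr)
  assume *: "\<not> (\<exists>\<nu>\<in>\<Lambda>. (\<Sum>i<Suc r. c i * ev \<nu> i p) \<noteq> 0)"
  have "\<forall>i<Suc r. c i = 0"
   by (rule Suc.prems(2)) (use * in blast)
  hence "c r = 0" by blast
  thus False by (simp add: c_def)
 qed
 then obtain \<nu> where \<nu>: "\<nu> \<in> \<Lambda>" "(\<Sum>i<Suc r. c i * ev \<nu> i p) \<noteq> 0"
  by blast
 have "\<exists>\<kappa>\<in>\<Lambda>. \<forall>i q. ev \<kappa> i q = ev \<nu> i q - (\<Sum>j<m. ev \<nu> j q * ev (\<mu> j) i q)" if "m \<le> r" for m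
  using that
 proof (induction m)
  case (Suc m)
  then obtain \<kappa> where \<kappa>: "\<kappa> \<in> \<Lambda>" "\<And>i q. ev \<kappa> i q = ev \<nu> i q - (\<Sum>j<m. ev \<nu> j q * ev (\<mu> j) i q)"
   by auto
  have "(\<lambda>q. - ev \<nu> m q) \<in> S"
   using Suc.prems \<nu> \<open>\<And>\<mu> i. \<mu> \<in> \<Lambda> ==> i < Suc r ==> ev \<mu> i \<in> S\<close> by auto
  from lin[OF \<kappa>(1) \<mu>(3)[of m] this] Suc.prems
  obtain \<kappa>' where "\<kappa>' \<in> \<Lambda>" "\<And>i q. ev \<kappa>' i q = ev \<kappa> i q + - ev \<nu> m q * ev (\<mu> m) i q"
   by auto
  thus ?case
   by (intro bexI[of _ \<kappa>']) (simp_all add: \<kappa>)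
 qed (use \<nu> in auto)
 then obtain \<kappa> where \<kappa>: "\<kappa> \<in> \<Lambda>" "\<And>i q. ev \<kappa> i q = ev \<nu> i q - (\<Sum>j<r. ev \<nu> j q * ev (\<mu> j) i q)"
  by blast
 have 0: "ev \<kappa> i q = 0" if "q \<in> N" "i < r" for i q
 proof -
  have "(\<Sum>j<r. ev \<nu> j q * ev (\<mu> j) i q) = (\<Sum>j<r. if j = i then ev \<nu> i q else 0)"
   using \<mu>(4)[OF that(1)] that by (intro sum.cong) auto
  thus ?thesis using that by (simp add: \<kappa>)
 qed
 have "ev \<kappa> r p \<noteq> 0"
  using \<nu>(2) by (simp add: \<kappa> c_def sum_negf mult.commute)
 then obtain k N' where k: "k \<in> S" "open N'" "p \<in> N'" "\<And>q. q \<in> N' ==> k q * ev \<kappa> r q = 1"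
  using Cinf_local_inverse[of "ev \<kappa> r" p] Suc.prems(1)[OF \<kappa>(1)] by blast
 \<comment> \<open>The closure rule only offers \<mu> + f \<nu>; with f = k - 1 and both functionals
   equal to \<kappa> it yields k \<kappa>.\<close>
 have "\<exists>\<rho>\<in>\<Lambda>. \<forall>i q. ev \<rho> i q = ev \<kappa> i q + (k q - 1) * ev \<kappa> i q"
  using k(1) by (intro lin \<kappa>(1)) simp
 then obtain \<rho> where \<rho>: "\<rho> \<in> \<Lambda>" "\<And>i q. ev \<rho> i q = k q * ev \<kappa> i q"
  by (auto simp: left_diff_distrib)
 have "\<exists>\<sigma>\<in>\<Lambda>. \<forall>i q. ev \<sigma> i q = ev (\<mu> j) i q + - ev (\<mu> j) r q * ev \<rho> i q" if "j < r" for j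
  using Suc.prems(1)[OF \<mu>(3)[OF that], of r] by (intro lin \<mu>(3)[OF that] \<rho>(1) Cinf_uminus) simp
 then obtain \<sigma> where \<sigma>: "\<And>j. j < r ==> \<sigma> j \<in> \<Lambda>"
  "\<And>j i q. j < r ==> ev (\<sigma> j) i q = ev (\<mu> j) i q + - ev (\<mu> j) r q * ev \<rho> i q"
  by metis
 define \<tau> where "\<tau> j = (if j = r then \<rho> else \<sigma> j)" for j
 show ?case
 proof (intro exI[of _ \<tau>] exI[of _ "N \<inter> N'"] conjI allI impI ballI)
  fix q i j assume "q \<in> N \<inter> N'" "i < Suc r" "j < Suc r"
  thus "ev (\<tau> j) i q = (if i = j then 1 else 0)"
   using 0[of q i] k(4)[of q] \<mu>(4)[of q i j] by (auto simp: \<tau>_def \<rho> \<sigma> less_Suc_eq)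
 qed (use \<mu> k \<rho> \<sigma> in \<open>auto simp: \<tau>_def less_Suc_eq\<close>)
qed

subsection \<open>Partitions of unity\<close>

text \<open>With c_j the product of the 1 - \<beta>_i for i < j, the sum telescopes to 1 minus the
  product of all 1 - \<beta>_i with i < n. Where some \<beta>_m is 1 this product vanishes, and so
  does every c_j with j > m. Lindelof's theorem provides the countable cover. Q records what a
  cut-off function is good for, namely that a local problem is solved where it does not
  vanish.\<close>

lemma partition_of_unity:
 assumes "\<And>p. \<exists>\<beta>\<in>Q. \<exists>U. open U \<and> p \<in> U \<and> (\<forall>q\<in>U. \<beta> q = 1)" and Q: "Q \<subseteq> S"
 obtains \<beta> c :: "nat => 'a => real" where "\<And>j. \<beta> j \<in> Q" "\<And>j. c j \<in> S"
  "\<And>p. \<exists>U n. open U \<and> p \<in> U \<and> (\<forall>q\<in>U. (\<Sum>j<n. c j q * \<beta> j q) = 1 \<and> (\<forall>j\<ge>n. c j q = 0))"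
proof -
 obtain \<xi> U where \<xi>: "\<And>p. \<xi> p \<in> Q" "\<And>p. open (U p)" "\<And>p. p \<in> U p" "\<And>p q. q \<in> U p ==> \<xi> p q = 1"
  using assms(1) by metis
 have "\<exists>P. countable P \<and> (\<Union>p\<in>P. U p) = (UNIV :: 'a set)"
 proof -
  obtain F where F: "F \<subseteq> range U" "countable F" "\<Union>F = \<Union>(range U)"
   using Lindelof[of "range U"] \<xi> by auto
  have "countable (inv_into UNIV U ` F)" using F by auto
  moreover have "(\<Union>p\<in>inv_into UNIV U ` F. U p) = UNIV"
  proof -
   have "U (inv_into UNIV U V) = V" if "V \<in> F" for V
    using that F by (intro f_inv_into_f) auto
   hence "(\<Union>p\<in>inv_into UNIV U ` F. U p) = \<Union>F" by auto
   thus ?thesis using F \<xi>(3) by auto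
  qed
  ultimately show ?thesis by blast
 qed
 then obtain P where P: "countable P" "(\<Union>p\<in>P. U p) = UNIV" by blast
 hence "P \<noteq> {}" by auto
 define \<beta> where "\<beta> j = \<xi> (from_nat_into P j)" for j
 define c where "c j q = (\<Prod>i<j. 1 - \<beta> i q)" for j q
 have sum: "(\<Sum>j<n. c j q * \<beta> j q) = 1 - (\<Prod>i<n. 1 - \<beta> i q)" for n q
  by (induction n) (auto simp: c_def algebra_simps)
 show ?thesis
 proof (rule that[of \<beta> c])
  show "\<beta> j \<in> Q" for j by (simp add: \<beta>_def \<xi>)
  hence "\<beta> j \<in> S" for j using Q by auto
  thus "c j \<in> S" for j
   unfolding c_def[abs_def] by (intro Cinf_prod Cinf_diff Cinf_const)
  fix p
  obtain p' where p': "p' \<in> P" "p \<in> U p'" using P by blast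
  obtain m where m: "from_nat_into P m = p'" using from_nat_into_surj[OF P(1) p'(1)] by blast
  show "\<exists>U n. open U \<and> p \<in> U \<and> (\<forall>q\<in>U. (\<Sum>j<n. c j q * \<beta> j q) = 1 \<and> (\<forall>j\<ge>n. c j q = 0))"
  proof (intro exI[of _ "U p'"] exI[of _ "Suc m"] conjI ballI allI impI)
   fix q assume "q \<in> U p'"
   hence 1: "\<beta> m q = 1" using \<xi>(4) m by (simp add: \<beta>_def)
   thus "(\<Sum>j<Suc m. c j q * \<beta> j q) = 1"
    unfolding sum by simp
   fix j assume "Suc m \<le> j"
   thus "c j q = 0" using 1 by (auto simp: c_def intro!: bexI[of _ m])
  qed (use p' \<xi> in auto)
 qed
qed

end

section \<open>Local geometry of a pre-contact distribution\<close>

lemma basis_of_iff: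
 assumes "basis_of V r v"
 shows "u \<in> V \<longleftrightarrow> (\<exists>c. \<forall>f. u f = (\<Sum>i<r. c i * v i f))"
proof
 assume "u \<in> V"
 thus "\<exists>c. \<forall>f. u f = (\<Sum>i<r. c i * v i f)"
  using assms unfolding basis_of_def bij_betw_def by (auto simp: image_iff)
next
 assume "\<exists>c. \<forall>f. u f = (\<Sum>i<r. c i * v i f)"
 then obtain c where c: "u = (\<lambda>f. \<Sum>i<r. c i * v i f)" by auto
 have "u = (\<lambda>c f. \<Sum>i<r. c i * v i f) (restrict c {..<r})"
  unfolding c by (intro ext sum.cong) auto
 moreover have "restrict c {..<r} \<in> {..<r} \<rightarrow>\<^sub>E (UNIV :: real set)" by auto
 ultimately show "u \<in> V"
  using assms unfolding basis_of_def bij_betw_def by blast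
qed

lemma basis_of_indep:
 assumes "basis_of V r v" "\<And>f. (\<Sum>i<r. c i * v i f) = 0" "i < r"
 shows "c i = 0"
proof -
 have "(\<lambda>c f. \<Sum>i<r. c i * v i f) (restrict c {..<r}) = (\<lambda>c f. \<Sum>i<r. c i * v i f) (\<lambda>i\<in>{..<r}. 0)"
  using assms(2) by (simp add: fun_eq_iff)
 moreover have inj: "inj_on (\<lambda>c f. \<Sum>i<r. c i * v i f) ({..<r} \<rightarrow>\<^sub>E (UNIV :: real set))"
  using assms(1) by (simp add: basis_of_def bij_betw_def)
 ultimately have "restrict c {..<r} = (\<lambda>i\<in>{..<r}. 0)"
  using inj_onD[OF inj, of "restrict c {..<r}" "\<lambda>i\<in>{..<r}. 0"] by simp
 thus ?thesis using assms(3) by (metis lessThan_iff restrict_apply')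
qed

definition subspaces :: "'a distr => bool" where
 "subspaces E \<longleftrightarrow> (\<forall>p. (\<lambda>_. 0) \<in> E p \<and> (\<forall>u\<in>E p. \<forall>v\<in>E p. \<forall>c. (\<lambda>f. u f + c * v f) \<in> E p))"

lemma subspacesI:
 assumes "\<And>p. \<exists>r v. basis_of (E p) r v"
 shows "subspaces E"
 unfolding subspaces_def
proof (intro allI conjI ballI)
 fix p
 obtain r v where b: "basis_of (E p) r v" using assms by blast
 show "(\<lambda>_. 0) \<in> E p"
  unfolding basis_of_iff[OF b] by (intro exI[of _ "\<lambda>_. 0"]) simp
 fix u w c assume "u \<in> E p" "w \<in> E p"
 then obtain a a' where "\<forall>f. u f = (\<Sum>i<r. a i * v i f)" "\<forall>f. w f = (\<Sum>i<r. a' i * v i f)"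
  unfolding basis_of_iff[OF b] by blast
 thus "(\<lambda>f. u f + c * w f) \<in> E p"
  unfolding basis_of_iff[OF b]
  by (intro exI[of _ "\<lambda>i. a i + c * a' i"]) (simp add: sum.distrib sum_distrib_left algebra_simps)
qed

lemma subspace_zero: "subspaces E ==> (\<lambda>_. 0) \<in> E p"
 by (simp add: subspaces_def)

lemma subspace_axpy: "subspaces E ==> u \<in> E p ==> v \<in> E p ==> (\<lambda>f. u f + c * v f) \<in> E p"
 by (simp add: subspaces_def)

lemma subspace_scale: "subspaces E ==> v \<in> E p ==> (\<lambda>f. c * v f) \<in> E p"
 using subspace_axpy[of E "\<lambda>_. 0" p v c] subspace_zero[of E p] by simp

lemma subspace_sum: "subspaces E ==> (\<And>i. i \<in> I ==> v i \<in> E p) ==> (\<lambda>f. \<Sum>i\<in>I. c i * v i f) \<in> E p"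
proof (induction I rule: infinite_finite_induct)
 case (insert i I)
 thus ?case
  using subspace_axpy[of E "\<lambda>f. \<Sum>i\<in>I. c i * v i f" p "v i" "c i"] by (simp add: add.commute)
qed (simp_all add: subspace_zero)

context manifold
begin

section \<open>Sections of a family of subspaces\<close>

lemma sec_iff: "X \<in> sections A E \<longleftrightarrow> X \<in> T \<and> (\<forall>p. (\<lambda>f. X f p) \<in> E p)"
 by (simp add: sections_def at_point_def)

lemma sec_T: "X \<in> sections A E ==> X \<in> T"
 by (simp add: sec_iff)

lemma sections_zero: "subspaces E ==> (\<lambda>f p. 0) \<in> sections A E"
 by (simp add: sec_iff subspace_zero)

lemma sections_smult: "subspaces E ==> h \<in> S ==> X \<in> sections A E ==> (\<lambda>f p. h p * X f p) \<in> sections A E"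
 by (auto simp: sec_iff intro: subspace_scale)

lemma sections_axpy: "subspaces E ==> h \<in> S ==> X \<in> sections A E ==> Y \<in> sections A E ==>
  (\<lambda>f p. X f p + h p * Y f p) \<in> sections A E"
 by (auto simp: sec_iff intro: subspace_axpy)

lemma sections_add: "subspaces E ==> X \<in> sections A E ==> Y \<in> sections A E ==>
  (\<lambda>f p. X f p + Y f p) \<in> sections A E"
 using sections_axpy[of E "\<lambda>_. 1" X Y] by simp

lemma sections_diff: "subspaces E ==> X \<in> sections A E ==> Y \<in> sections A E ==>
  (\<lambda>f p. X f p - Y f p) \<in> sections A E"
 using sections_axpy[of E "\<lambda>_. - 1" X Y] by simp

lemma sections_sum: "subspaces E ==> (\<And>i. i \<in> I ==> h i \<in> S) ==> (\<And>i. i \<in> I ==> X i \<in> sections A E) ==>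
  (\<lambda>f p. \<Sum>i\<in>I. h i p * X i f p) \<in> sections A E"
 by (auto simp: sec_iff intro!: subspace_sum vf_sum_mem vf_smult_mem)

text \<open>Sections of the cotangent bundle, as tensorial maps on vector fields.\<close>

definition covector :: "('a vfield => 'a => real) => bool" where
 "covector \<mu> \<longleftrightarrow> (\<forall>X\<in>T. \<mu> X \<in> S) \<and> (\<forall>X\<in>T. \<forall>Y\<in>T. \<forall>h\<in>S. \<mu> (\<lambda>f p. X f p + h p * Y f p) = (\<lambda>p. \<mu> X p + h p * \<mu> Y p)) \<and>
   (\<forall>X\<in>T. \<forall>Y\<in>T. \<forall>p. (\<forall>f. X f p = Y f p) \<longrightarrow> \<mu> X p = \<mu> Y p)"

lemma covectorD:
 assumes "covector \<mu>"
 shows "X \<in> T ==> \<mu> X \<in> S"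
  and "X \<in> T ==> Y \<in> T ==> h \<in> S ==> \<mu> (\<lambda>f p. X f p + h p * Y f p) = (\<lambda>p. \<mu> X p + h p * \<mu> Y p)"
  and "X \<in> T ==> Y \<in> T ==> (\<And>f. X f p = Y f p) ==> \<mu> X p = \<mu> Y p"
 using assms unfolding covector_def by blast+

lemma covector_zero: "covector \<mu> ==> \<mu> (\<lambda>f p. 0) = (\<lambda>p. 0)"
 using covectorD(2)[of \<mu> "\<lambda>f p. 0" "\<lambda>f p. 0" "\<lambda>_. 1"] by (simp add: fun_eq_iff)

lemma covector_smult: "covector \<mu> ==> X \<in> T ==> h \<in> S ==> \<mu> (\<lambda>f p. h p * X f p) = (\<lambda>p. h p * \<mu> X p)"
 using covectorD(2)[of \<mu> "\<lambda>f p. 0" X h] by (simp add: covector_zero)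

lemma covector_diff: "covector \<mu> ==> X \<in> T ==> Y \<in> T ==> \<mu> (\<lambda>f p. X f p - Y f p) = (\<lambda>p. \<mu> X p - \<mu> Y p)"
 using covectorD(2)[of \<mu> X Y "\<lambda>_. - 1"] by simp

lemma covector_sum:
 assumes \<mu>: "covector \<mu>" and "\<And>i. i \<in> I ==> h i \<in> S" "\<And>i. i \<in> I ==> X i \<in> T"
 shows "\<mu> (\<lambda>f p. \<Sum>i\<in>I. h i p * X i f p) = (\<lambda>p. \<Sum>i\<in>I. h i p * \<mu> (X i) p)"
 using assms(2,3)
proof (induction I rule: infinite_finite_induct)
 case (insert i I)
 thus ?case
  using covectorD(2)[OF \<mu>, of "\<lambda>f p. \<Sum>i\<in>I. h i p * X i f p" "X i" "h i"] by (simp add: add.commute)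
qed (simp_all add: covector_zero[OF \<mu>])

lemma covector_eq_sum:
 assumes \<mu>: "covector \<mu>" and X: "X \<in> T" "\<And>i. i \<in> I ==> Y i \<in> T" and eq: "\<And>f. X f q = (\<Sum>i\<in>I. c i * Y i f q)"
 shows "\<mu> X q = (\<Sum>i\<in>I. c i * \<mu> (Y i) q)"
proof -
 have "\<mu> X q = \<mu> (\<lambda>f p. \<Sum>i\<in>I. c i * Y i f p) q"
  using assms by (intro covectorD(3)[OF \<mu>]) auto
 also have "\<dots> = (\<Sum>i\<in>I. c i * \<mu> (Y i) q)"
  using covector_sum[OF \<mu>, of I "\<lambda>i _. c i" Y] X by simp
 finally show ?thesis .
qed

lemma covector_eval: "f \<in> S ==> covector (\<lambda>X. X f)"
 unfolding covector_def by (auto intro: vf_mem)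

lemma covector_axpy:
 assumes "covector \<mu>" "covector \<nu>" "f \<in> S"
 shows "covector (\<lambda>X p. \<mu> X p + f p * \<nu> X p)"
 unfolding covector_def
proof (intro conjI ballI allI impI)
 fix X assume "X \<in> T"
 thus "(\<lambda>p. \<mu> X p + f p * \<nu> X p) \<in> S"
  using assms covectorD(1) by simp
next
 fix X Y h assume *: "X \<in> T" "Y \<in> T" "h \<in> S"
 show "(\<lambda>p. \<mu> (\<lambda>f p. X f p + h p * Y f p) p + f p * \<nu> (\<lambda>f p. X f p + h p * Y f p) p) =
  (\<lambda>p. \<mu> X p + f p * \<nu> X p + h p * (\<mu> Y p + f p * \<nu> Y p))"
  unfolding covectorD(2)[OF assms(1) *] covectorD(2)[OF assms(2) *] by (simp add: algebra_simps)
next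
 fix X Y p assume *: "X \<in> T" "Y \<in> T" "\<forall>f. X f p = Y f p"
 thus "\<mu> X p + f p * \<nu> X p = \<mu> Y p + f p * \<nu> Y p"
  using covectorD(3)[OF assms(1) *(1,2)] covectorD(3)[OF assms(2) *(1,2)] by simp
qed

definition dual_frames :: "'a set => (nat => 'a vfield) => (nat => 'a vfield => 'a => real) => nat => bool" where
 "dual_frames W g \<mu> n \<longleftrightarrow> open W \<and> (\<forall>i<n. g i \<in> T) \<and> (\<forall>i<n. covector (\<mu> i)) \<and>
   (\<forall>q\<in>W. \<forall>i<n. \<forall>j<n. \<mu> j (g i) q = (if i = j then 1 else 0))"

lemma dual_framesD:
 assumes "dual_frames W g \<mu> n"
 shows "open W" "\<And>i. i < n ==> g i \<in> T" "\<And>i. i < n ==> covector (\<mu> i)"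
  "\<And>q i j. q \<in> W ==> i < n ==> j < n ==> \<mu> j (g i) q = (if i = j then 1 else 0)"
 using assms by (simp_all add: dual_frames_def)

text \<open>In coordinates at q the fields g_i become vectors, and L sends the i-th basis vector to
  the i-th of them. The dual covectors make L injective, and equality of dimensions makes it onto;
  this gives the expansion, and the covectors read off its coefficients.\<close>

lemma coframe_spans:
 assumes g: "\<And>i. i < DIM('e) ==> g i \<in> T" and \<mu>: "\<And>i. i < DIM('e) ==> covector (\<mu> i)"
  and dual: "\<And>i j. i < DIM('e) ==> j < DIM('e) ==> \<mu> j (g i) q = (if i = j then 1 else 0)"
  and X: "X \<in> T"
 shows "X f q = (\<Sum>i<DIM('e). \<mu> i X q * g i f q)"
proof -
 obtain x \<delta> where x: "\<And>b. b \<in> Basis ==> x (b::'e) \<in> S" "\<And>b. b \<in> Basis ==> \<delta> (b::'e) \<in> T"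
  "\<And>b c. b \<in> Basis ==> c \<in> Basis ==> \<delta> b (x c) q = (if b = c then 1 else 0)"
  "\<And>X f. X \<in> T ==> X f q = (\<Sum>b\<in>Basis. X (x b) q * \<delta> b f q)"
  by (rule coordinates[of q]) (rule that)
 define w where "w X = (\<Sum>b\<in>Basis. X (x b) q *\<^sub>R b)" for X :: "'a vfield"
 have w: "w X \<bullet> b = X (x b) q" if "b \<in> Basis" for X b
  using that by (simp add: w_def)
 obtain h where h: "bij_betw h {..<DIM('e)} (Basis :: 'e set)"
  using ex_bij_betw_nat_finite[of "Basis :: 'e set"] by (auto simp: atLeast0LessThan)
 have hB: "h i \<in> Basis" if "i < DIM('e)" for i
  using h that by (auto simp: bij_betw_def)
 define L where "L v = (\<Sum>i<DIM('e). (v \<bullet> h i) *\<^sub>R w (g i))" for v :: 'e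
 have L: "linear L"
  unfolding L_def by (intro linearI) (simp_all add: inner_add_left scaleR_add_left sum.distrib scaleR_sum_right)
 have comb: "Y f q = (\<Sum>i<DIM('e). c i * g i f q)" if Y: "Y \<in> T" "w Y = (\<Sum>i<DIM('e). c i *\<^sub>R w (g i))" for Y c f
 proof -
  have Yx: "Y (x b) q = (\<Sum>i<DIM('e). c i * g i (x b) q)" if b: "b \<in> Basis" for b
  proof -
   have "Y (x b) q = w Y \<bullet> b" using w[OF b] by simp
   also have "\<dots> = (\<Sum>i<DIM('e). c i * g i (x b) q)"
    unfolding Y(2) inner_sum_left using b by (intro sum.cong refl) (simp add: w)
   finally show ?thesis .
  qed
  have "Y f q = (\<Sum>b\<in>Basis. (\<Sum>i<DIM('e). c i * g i (x b) q) * \<delta> b f q)"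
   unfolding x(4)[OF Y(1), of f] by (intro sum.cong refl) (simp add: Yx)
  also have "\<dots> = (\<Sum>i<DIM('e). c i * (\<Sum>b\<in>Basis. g i (x b) q * \<delta> b f q))"
   unfolding sum_distrib_right sum_distrib_left by (subst sum.swap) (simp add: mult.assoc)
  also have "\<dots> = (\<Sum>i<DIM('e). c i * g i f q)"
   by (intro sum.cong refl) (simp add: x(4)[OF g, symmetric])
  finally show ?thesis .
 qed
 have "inj L"
 proof (subst linear_injective_0[OF L], intro allI impI)
  fix v assume v: "L v = 0"
  have z0: "0 = (\<Sum>i<DIM('e). (v \<bullet> h i) * g i f q)" for f
   using comb[of "\<lambda>f p. 0" "\<lambda>i. v \<bullet> h i" f] v by (simp add: L_def w_def)
  have z: "\<mu> j (\<lambda>f p. 0) q = (\<Sum>i<DIM('e). (v \<bullet> h i) * \<mu> j (g i) q)" if "j < DIM('e)" for j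
   by (rule covector_eq_sum[OF \<mu>[OF that]], simp, rule g, simp, rule z0)
  have "v \<bullet> h j = 0" if j: "j < DIM('e)" for j
  proof -
   have "(\<Sum>i<DIM('e). (v \<bullet> h i) * \<mu> j (g i) q) = (\<Sum>i<DIM('e). if i = j then v \<bullet> h j else 0)"
    using dual j by (intro sum.cong) auto
   thus ?thesis
    using z[OF j] j covector_zero[OF \<mu>[OF j]] by simp
  qed
  moreover have "\<exists>j<DIM('e). b = h j" if "b \<in> Basis" for b
   using h that by (auto simp: bij_betw_def)
  ultimately have "v \<bullet> b = 0" if "b \<in> Basis" for b
   using that by blast
  thus "v = 0" by (simp add: euclidean_eq_iff[where 'a = 'e])
 qed
 hence "surj L" using L by (simp add: linear_injective_imp_surjective)
 then obtain v where v: "w X = L v" by (metis surjD)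
 define c where "c i = v \<bullet> h i" for i
 have X_eq: "X f q = (\<Sum>i<DIM('e). c i * g i f q)" for f
  by (rule comb[OF X]) (simp add: v L_def c_def)
 have "\<mu> j X q = c j" if j: "j < DIM('e)" for j
 proof -
  have "\<mu> j X q = (\<Sum>i<DIM('e). c i * \<mu> j (g i) q)"
   by (rule covector_eq_sum[OF \<mu>[OF j] X], rule g, simp, rule X_eq)
  also have "\<dots> = (\<Sum>i<DIM('e). if i = j then c j else 0)"
   using dual j by (intro sum.cong) auto
  finally show ?thesis using j by simp
 qed
 thus ?thesis unfolding X_eq by (intro sum.cong) auto
qed

lemma dual_frames_expand:
 assumes D: "dual_frames W g \<mu> DIM('e)" "q \<in> W" and X: "X \<in> T"
 shows "X f q = (\<Sum>i<DIM('e). \<mu> i X q * g i f q)"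
 by (rule coframe_spans[of g \<mu>, OF dual_framesD(2)[OF D(1)] dual_framesD(3)[OF D(1)] dual_framesD(4)[OF D] X])

text \<open>Multiplied by a bump function, the local expansion of X becomes an identity in E, to
  which linearity applies; the coefficients vanish at p. E is a parameter because the argument
  serves both all vector fields and the sections of \<xi>.\<close>

lemma tensorial:
 fixes n :: nat
 assumes E: "\<And>X. X \<in> E ==> X \<in> T" "\<And>X Y h. X \<in> E ==> Y \<in> E ==> h \<in> S ==> (\<lambda>f p. X f p + h p * Y f p) \<in> E"
  and \<phi>: "\<And>X Y h. X \<in> E ==> Y \<in> E ==> h \<in> S ==> \<phi> (\<lambda>f p. X f p + h p * Y f p) = (\<lambda>p. \<phi> X p + h p * \<phi> Y p)"
  and g: "\<And>i. i < n ==> g i \<in> E" and \<mu>: "\<And>i. i < n ==> covector (\<mu> i)"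
  and W: "open W" "p \<in> W" "\<And>q f. q \<in> W ==> X f q = (\<Sum>i<n. \<mu> i X q * g i f q)"
  and X: "X \<in> E" "\<And>f. X f p = 0"
 shows "\<phi> X p = (0::real)"
proof -
 have zero: "(\<lambda>f p. 0) \<in> E"
  using E(2)[OF X(1) X(1), of "\<lambda>_. - 1"] by simp
 have \<phi>0: "\<phi> (\<lambda>f p. 0) = (\<lambda>p. 0)"
  using \<phi>[OF zero zero, of "\<lambda>_. 1"] by (simp add: fun_eq_iff)
 have smult: "\<phi> (\<lambda>f p. h p * Y f p) = (\<lambda>p. h p * \<phi> Y p)" if "Y \<in> E" "h \<in> S" for Y h
  using \<phi>[OF zero that] by (simp add: \<phi>0)
 have mu0: "\<mu> i X p = 0" if "i < n" for i
  using covectorD(3)[OF \<mu>[OF that], of X "\<lambda>f p. 0" p] covector_zero[OF \<mu>[OF that]] X E(1) by simp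
 obtain \<beta> N where \<beta>: "\<beta> \<in> S" "\<And>q. q \<notin> W ==> \<beta> q = 0" "p \<in> N" "\<And>q. q \<in> N ==> \<beta> q = 1"
  by (rule local_bump[OF W(1,2)]) blast
 have mem: "(\<lambda>q. \<beta> q * \<mu> i X q) \<in> S" if "i < n" for i
  using \<beta>(1) covectorD(1)[OF \<mu>[OF that]] X(1) E(1) by simp
 have sum: "(\<lambda>f q. \<Sum>i<m. (\<beta> q * \<mu> i X q) * g i f q) \<in> E \<and>
   \<phi> (\<lambda>f q. \<Sum>i<m. (\<beta> q * \<mu> i X q) * g i f q) = (\<lambda>q. \<Sum>i<m. (\<beta> q * \<mu> i X q) * \<phi> (g i) q)" if "m \<le> n" for m
  using that
 proof (induction m)
  case (Suc m)
  thus ?case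
   using E(2)[OF _ g mem, of _ m m] \<phi>[OF _ g mem, of _ m m] by simp
 qed (simp add: zero \<phi>0)
 have "(\<lambda>f q. \<beta> q * X f q) = (\<lambda>f q. \<Sum>i<n. (\<beta> q * \<mu> i X q) * g i f q)"
 proof (intro ext)
  fix f q
  show "\<beta> q * X f q = (\<Sum>i<n. (\<beta> q * \<mu> i X q) * g i f q)"
  proof (cases "q \<in> W")
   case True
   thus ?thesis unfolding W(3)[OF True] by (simp add: sum_distrib_left mult.assoc)
  qed (simp add: \<beta>)
 qed
 hence "(\<lambda>q. \<beta> q * \<phi> X q) = (\<lambda>q. \<Sum>i<n. (\<beta> q * \<mu> i X q) * \<phi> (g i) q)"
  using sum[of n] smult[OF X(1) \<beta>(1)] by simp
 hence "\<beta> p * \<phi> X p = 0"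
  using mu0 by (simp add: fun_eq_iff)
 thus ?thesis using \<beta> by simp
qed

end

locale hyperplane = manifold A
 for A :: "('a::{second_countable_topology, t2_space}, 'e::euclidean_space) atlas" +
 fixes \<xi> :: "'a distr"
 assumes hyperplane: "hyperplane_distribution A \<xi>"
begin

abbreviation "X\<xi> \<equiv> sections A \<xi>"

lemma xi_subsp: "subspaces \<xi>"
 using hyperplane unfolding hyperplane_distribution_def subbundle_def
 by (intro subspacesI) blast

text \<open>A frame of \<xi> is completed by a coordinate field that leaves \<xi> at p, and
  \<open>dual_frame\<close> supplies the coframe. Its last member will be the local contact
  form.\<close>

lemma xi_frame:
 "\<exists>W g \<mu>. p \<in> W \<and> dual_frames W g \<mu> DIM('e) \<and> (\<forall>q\<in>W. basis_of (\<xi> q) (DIM('e) - 1) (\<lambda>i f. g i f q))"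
proof -
 define m where "m = DIM('e) - 1"
 have m: "DIM('e) = Suc m" using DIM_positive[where 'a = 'e] by (simp add: m_def)
 obtain U e where e: "open U" "p \<in> U" "\<forall>i<m. e i \<in> T" "\<forall>q\<in>U. basis_of (\<xi> q) m (\<lambda>i. at_point (e i) q)"
  using hyperplane unfolding hyperplane_distribution_def subbundle_def m_def by blast
 have b: "basis_of (\<xi> q) m (\<lambda>i f. e i f q)" if "q \<in> U" for q
  using e(4) that by (simp add: at_point_def)
 obtain x \<delta> where x: "\<And>b. b \<in> Basis ==> x (b::'e) \<in> S" "\<And>b. b \<in> Basis ==> \<delta> (b::'e) \<in> T"
  "\<And>b c. b \<in> Basis ==> c \<in> Basis ==> \<delta> b (x c) p = (if b = c then 1 else 0)"
  "\<And>X f. X \<in> T ==> X f p = (\<Sum>b\<in>Basis. X (x b) p * \<delta> b f p)"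
  by (rule coordinates[of p]) (rule that)
 \<comment> \<open>Otherwise all coordinate fields at p would be combinations of the m frame vectors
   of \<xi>, and m vectors would span a space of dimension m + 1.\<close>
 have "\<exists>b\<in>Basis. (\<lambda>f. \<delta> b f p) \<notin> \<xi> p"
 proof (rule ccontr)
  assume "\<not> (\<exists>b\<in>Basis. (\<lambda>f. \<delta> b f p) \<notin> \<xi> p)"
  hence "\<forall>b\<in>Basis. \<exists>c. \<forall>f. \<delta> b f p = (\<Sum>i<m. c i * e i f p)"
   using basis_of_iff[OF b[OF e(2)]] by simp
  then obtain c where c: "\<And>b f. b \<in> Basis ==> \<delta> b f p = (\<Sum>i<m. c b i * e i f p)"
   by metis
  define w where "w i = (\<Sum>b\<in>Basis. e i (x b) p *\<^sub>R b)" for i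
  have "b \<in> span (w ` {..<m})" if b: "b \<in> Basis" for b
  proof -
   have eq: "b = (\<Sum>i<m. c b i *\<^sub>R w i)"
   proof (rule euclidean_eqI)
    fix d :: 'e assume d: "d \<in> Basis"
    have "w i \<bullet> d = e i (x d) p" for i
     using d by (simp add: w_def)
    hence "(\<Sum>i<m. c b i *\<^sub>R w i) \<bullet> d = (\<Sum>i<m. c b i * e i (x d) p)"
     by (simp add: inner_sum_left)
    also have "\<dots> = b \<bullet> d"
     using c[OF b, of "x d"] x(3)[OF b d] b d by (simp add: inner_Basis)
    finally show "b \<bullet> d = (\<Sum>i<m. c b i *\<^sub>R w i) \<bullet> d" by simp
   qed
   have "(\<Sum>i<m. c b i *\<^sub>R w i) \<in> span (w ` {..<m})"
    by (intro span_sum span_scale span_base imageI) simp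
   thus ?thesis by (simp only: eq[symmetric])
  qed
  hence "span Basis \<subseteq> span (w ` {..<m})"
   by (intro span_minimal subspace_span) auto
  hence "dim (UNIV :: 'e set) \<le> card (w ` {..<m})"
   by (intro dim_le_card) auto
  also have "\<dots> \<le> m" using card_image_le[of "{..<m}" w] by simp
  finally show False using m by simp
 qed
 then obtain b0 where b0: "b0 \<in> Basis" "(\<lambda>f. \<delta> b0 f p) \<notin> \<xi> p" by blast
 define g where "g i = (if i = m then \<delta> b0 else e i)" for i
 have g: "g i \<in> T" if "i < Suc m" for i
  using that e(3) x(2)[OF b0(1)] by (auto simp: g_def less_Suc_eq)
 have "\<exists>\<mu> N. open N \<and> p \<in> N \<and> (\<forall>j<Suc m. \<mu> j \<in> {\<mu>. covector \<mu>}) \<and>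
   (\<forall>q\<in>N. \<forall>i<Suc m. \<forall>j<Suc m. \<mu> j (g i) q = (if i = j then 1 else 0))"
 proof (rule dual_frame[where ev = "\<lambda>\<mu> i. \<mu> (g i)"])
  show "\<mu> (g i) \<in> S" if "\<mu> \<in> {\<mu>. covector \<mu>}" "i < Suc m" for \<mu> i
   using that g covectorD(1) by blast
  show "\<exists>\<kappa>\<in>{\<mu>. covector \<mu>}. \<forall>i q. \<kappa> (g i) q = \<mu> (g i) q + f q * \<nu> (g i) q"
   if "\<mu> \<in> {\<mu>. covector \<mu>}" "\<nu> \<in> {\<mu>. covector \<mu>}" "f \<in> S" for \<mu> \<nu> f
   using that covector_axpy[of \<mu> \<nu> f] by (intro bexI[of _ "\<lambda>X p. \<mu> X p + f p * \<nu> X p"]) auto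
  fix c assume "\<And>\<mu>. \<mu> \<in> {\<mu>. covector \<mu>} ==> (\<Sum>i<Suc m. c i * \<mu> (g i) p) = 0"
  hence "(\<Sum>i<Suc m. c i * g i f p) = 0" if "f \<in> S" for f
   using covector_eval[OF that] by blast
  moreover have "(\<Sum>i<Suc m. c i * g i f p) = 0" if "f \<notin> S" for f
   using vf_out[OF g that] by simp
  ultimately have *: "(\<Sum>i<m. c i * e i f p) + c m * \<delta> b0 f p = 0" for f
   by (cases "f \<in> S") (auto simp: g_def)
  have cm: "c m = 0"
  proof (rule ccontr)
   assume cm: "c m \<noteq> 0"
   have "\<delta> b0 f p = (\<Sum>i<m. (- c i / c m) * e i f p)" for f
   proof -
    have "c m * \<delta> b0 f p = - (\<Sum>i<m. c i * e i f p)" using *[of f] by linarith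
    hence "\<delta> b0 f p = - (\<Sum>i<m. c i * e i f p) / c m" using cm by (simp add: field_simps)
    thus ?thesis by (simp add: sum_divide_distrib sum_negf)
   qed
   hence "(\<lambda>f. \<delta> b0 f p) \<in> \<xi> p"
    unfolding basis_of_iff[OF b[OF e(2)]] by (intro exI[of _ "\<lambda>i. - c i / c m"]) simp
   thus False using b0 by simp
  qed
  hence "\<forall>i<m. c i = 0"
   using basis_of_indep[OF b[OF e(2)], of c] * by auto
  with cm show "\<forall>i<Suc m. c i = 0" by (auto simp: less_Suc_eq)
 qed
 then obtain \<mu> N where \<mu>: "open N" "p \<in> N" "\<And>j. j < Suc m ==> covector (\<mu> j)"
  "\<And>q i j. q \<in> N ==> i < Suc m ==> j < Suc m ==> \<mu> j (g i) q = (if i = j then 1 else 0)"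
  by (elim exE conjE) (rule that, auto)
 have 1: "dual_frames (N \<inter> U) g \<mu> DIM('e)"
  using \<mu> e g m by (simp add: dual_frames_def open_Int)
 have "basis_of V m (\<lambda>i f. g i f q) \<longleftrightarrow> basis_of V m (\<lambda>i f. e i f q)" for V q
  unfolding basis_of_def by (intro arg_cong[of _ _ "\<lambda>h. bij_betw h _ _"] ext sum.cong refl) (simp add: g_def)
 hence 2: "\<forall>q\<in>N \<inter> U. basis_of (\<xi> q) (DIM('e) - 1) (\<lambda>i f. g i f q)"
  using b m by simp
 show ?thesis
  using 1 2 \<mu>(2) e(2) by (intro exI[of _ "N \<inter> U"] exI[of _ g] exI[of _ \<mu>] conjI IntI)
qed

text \<open>A local contact form \<open>\<alpha>\<close>, extended by zero, and a vector field \<open>Z\<close> with \<open>\<alpha>(Z) = 1\<close>.\<close>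

lemma contact_form:
 obtains \<alpha> Z W where "open W" "p \<in> W" "covector \<alpha>" "Z \<in> T" "\<And>X. X \<in> X\<xi> ==> \<alpha> X = (\<lambda>_. 0)"
  "\<And>q. q \<in> W ==> \<alpha> Z q = 1" "\<And>X q. q \<in> W ==> X \<in> T ==> \<alpha> X q = 0 \<longleftrightarrow> (\<lambda>f. X f q) \<in> \<xi> q"
proof -
 obtain W g \<mu> where D: "p \<in> W" "dual_frames W g \<mu> DIM('e)"
  "\<forall>q\<in>W. basis_of (\<xi> q) (DIM('e) - 1) (\<lambda>i f. g i f q)"
  using xi_frame[of p] by blast
 note F = dual_framesD(1)[OF D(2)] D(1) dual_framesD(2-)[OF D(2)] D(3)[rule_format]
 define m where "m = DIM('e) - 1"
 have m: "DIM('e) = Suc m" using DIM_positive[where 'a = 'e] by (simp add: m_def)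
 \<comment> \<open>The last member of the coframe is dual to the one frame field that does not
   belong to \<xi>, so its kernel is spanned by the others.\<close>
 have iff: "\<mu> m X q = 0 \<longleftrightarrow> (\<lambda>f. X f q) \<in> \<xi> q" if q: "q \<in> W" and X: "X \<in> T" for X q
 proof
  assume "\<mu> m X q = 0"
  hence "X f q = (\<Sum>i<m. \<mu> i X q * g i f q)" for f
   using dual_frames_expand[OF D(2) q X, of f] unfolding m by simp
  thus "(\<lambda>f. X f q) \<in> \<xi> q"
   unfolding basis_of_iff[OF F(6)[OF q]] m by (intro exI[of _ "\<lambda>i. \<mu> i X q"]) simp
 next
  assume "(\<lambda>f. X f q) \<in> \<xi> q"
  then obtain c where "\<forall>f. X f q = (\<Sum>i<m. c i * g i f q)"
   unfolding basis_of_iff[OF F(6)[OF q]] m diff_Suc_1 by (elim exE)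
  hence "\<mu> m X q = (\<Sum>i<m. c i * \<mu> m (g i) q)"
   using F(3) m by (intro covector_eq_sum[OF F(4) X]) simp_all
  thus "\<mu> m X q = 0"
   using F(5)[OF q, of _ m] m by simp
 qed
 obtain \<beta> N where \<beta>: "\<beta> \<in> S" "\<And>q. q \<notin> W ==> \<beta> q = 0" "open N" "p \<in> N" "N \<subseteq> W" "\<And>q. q \<in> N ==> \<beta> q = 1"
  by (rule local_bump[OF F(1,2)]) blast
 have cm: "covector (\<mu> m)" using F(4) m by simp
 have c0: "covector (\<lambda>X p. 0)" by (simp add: covector_def)
 show ?thesis
 proof (rule that[of N "\<lambda>X p. \<beta> p * \<mu> m X p" "g m"])
  show "covector (\<lambda>X p. \<beta> p * \<mu> m X p)"
   using covector_axpy[OF c0 cm \<beta>(1)] by simp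
  fix X assume "X \<in> X\<xi>"
  hence "\<beta> p * \<mu> m X p = 0" for p
   using iff[of p X] \<beta>(2)[of p] by (cases "p \<in> W") (auto simp: sec_iff)
  thus "(\<lambda>p. \<beta> p * \<mu> m X p) = (\<lambda>_. 0)" by auto
 next
  fix q assume q: "q \<in> N"
  thus "\<beta> q * \<mu> m (g m) q = 1"
   using \<beta> F(5)[of q m m] m by auto
  fix X assume "X \<in> T"
  thus "\<beta> q * \<mu> m X q = 0 \<longleftrightarrow> (\<lambda>f. X f q) \<in> \<xi> q"
   using iff[of q X] q \<beta> by auto
 qed (use \<beta> F(3) m in auto)
qed

lemma tensorial_T:
 assumes \<phi>: "\<And>X Y h. X \<in> T ==> Y \<in> T ==> h \<in> S ==> \<phi> (\<lambda>f p. X f p + h p * Y f p) = (\<lambda>p. \<phi> X p + h p * \<phi> Y p)"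
  and X: "X \<in> T" "\<And>f. X f p = 0"
 shows "\<phi> X p = (0::real)"
proof -
 obtain W g \<mu> where D: "p \<in> W" "dual_frames W g \<mu> DIM('e)"
  "\<forall>q\<in>W. basis_of (\<xi> q) (DIM('e) - 1) (\<lambda>i f. g i f q)"
  using xi_frame[of p] by blast
 note F = dual_framesD(1)[OF D(2)] D(1) dual_framesD(2-)[OF D(2)] D(3)[rule_format]
 show ?thesis
  by (rule tensorial[where E = T and \<phi> = \<phi> and g = g and \<mu> = \<mu> and n = "DIM('e)" and W = W])
   (use \<phi> X F dual_frames_expand[OF D(2) _ X(1)] in auto)
qed

text \<open>The frame of \<xi> is a local one; multiplied by a bump function it consists of global
  sections of \<xi> and is unchanged near p.\<close>

lemma tensorial_xi:
 assumes \<phi>: "\<And>X Y h. X \<in> X\<xi> ==> Y \<in> X\<xi> ==> h \<in> S ==> \<phi> (\<lambda>f p. X f p + h p * Y f p) = (\<lambda>p. \<phi> X p + h p * \<phi> Y p)"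
  and X: "X \<in> X\<xi>" "\<And>f. X f p = 0"
 shows "\<phi> X p = (0::real)"
proof -
 obtain W g \<mu> where D: "p \<in> W" "dual_frames W g \<mu> DIM('e)"
  "\<forall>q\<in>W. basis_of (\<xi> q) (DIM('e) - 1) (\<lambda>i f. g i f q)"
  using xi_frame[of p] by blast
 note F = dual_framesD(1)[OF D(2)] D(1) dual_framesD(2-)[OF D(2)] D(3)[rule_format]
 define m where "m = DIM('e) - 1"
 have m: "DIM('e) = Suc m" using DIM_positive[where 'a = 'e] by (simp add: m_def)
 obtain \<beta> N where \<beta>: "\<beta> \<in> S" "\<And>q. q \<notin> W ==> \<beta> q = 0" "open N" "p \<in> N" "N \<subseteq> W" "\<And>q. q \<in> N ==> \<beta> q = 1"
  by (rule local_bump[OF F(1,2)]) blast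
 have g\<xi>: "(\<lambda>f. g i f q) \<in> \<xi> q" if "i < m" "q \<in> W" for i q
 proof -
  have "(\<Sum>k<m. (if k = i then 1 else 0) * g k f q) = g i f q" for f
   using that by (simp add: if_distrib[of "\<lambda>c. c * _"] cong: if_cong)
  thus ?thesis
   unfolding basis_of_iff[OF F(6)[OF that(2)]] m diff_Suc_1
   by (intro exI[of _ "\<lambda>k. if k = i then 1 else 0"]) simp
 qed
 have X': "X f q = (\<Sum>i<m. \<mu> i X q * (\<beta> q * g i f q))" if q: "q \<in> N" for q f
 proof -
  have qW: "q \<in> W" using q \<beta> by auto
  have "(\<lambda>f. X f q) \<in> \<xi> q" using X by (simp add: sec_iff)
  then obtain c where "\<forall>f. X f q = (\<Sum>i<m. c i * g i f q)"
   unfolding basis_of_iff[OF F(6)[OF qW]] m diff_Suc_1 by (elim exE)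
  hence "\<mu> m X q = (\<Sum>i<m. c i * \<mu> m (g i) q)"
   using F(3) m by (intro covector_eq_sum[OF F(4) sec_T[OF X(1)]]) simp_all
  hence "\<mu> m X q = 0"
   using F(5)[OF qW, of _ m] m by simp
  thus ?thesis
   using dual_frames_expand[OF D(2) qW sec_T[OF X(1)], of f] \<beta>(6)[OF q] unfolding m by simp
 qed
 show ?thesis
 proof (rule tensorial[where E = X\<xi> and \<phi> = \<phi> and g = "\<lambda>i f q. \<beta> q * g i f q" and \<mu> = \<mu> and n = m and W = N])
  fix i assume i: "i < m"
  have "(\<lambda>f. \<beta> q * g i f q) \<in> \<xi> q" for q
   using subspace_scale[OF xi_subsp g\<xi>[OF i], of q "\<beta> q"] subspace_zero[OF xi_subsp, of q] \<beta>(2)[of q]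
   by (cases "q \<in> W") auto
  thus "(\<lambda>f q. \<beta> q * g i f q) \<in> X\<xi>"
   using F(3)[of i] \<beta>(1) i m by (simp add: sec_iff)
 qed (use X X' \<beta> F m \<phi> sections_axpy[OF xi_subsp] in \<open>auto simp: sec_T\<close>)
qed

end

context manifold
begin

section \<open>Brackets with function multiples, and locally finite sums\<close>

lemma lie_axpy_left:
 assumes X: "X \<in> T" and Y: "Y \<in> T" and Z: "Z \<in> T" and h: "h \<in> S"
 shows "lie (\<lambda>f p. X f p + h p * Y f p) Z = (\<lambda>f p. lie X Z f p + h p * lie Y Z f p - Z h p * Y f p)"
 using vf_mem[OF X] vf_mem[OF Y] h
 by (simp add: lie_def fun_eq_iff vf_add[OF Z] vf_mult[OF Z] algebra_simps)

lemma lie_axpy_right: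
 assumes X: "X \<in> T" and Y: "Y \<in> T" and Z: "Z \<in> T" and h: "h \<in> S"
 shows "lie Z (\<lambda>f p. X f p + h p * Y f p) = (\<lambda>f p. lie Z X f p + h p * lie Z Y f p + Z h p * Y f p)"
 using vf_mem[OF X] vf_mem[OF Y] h
 by (simp add: lie_def fun_eq_iff vf_add[OF Z] vf_mult[OF Z] algebra_simps)

lemma lie_swap: "lie Y X = (\<lambda>f p. - lie X Y f p)"
 by (simp add: lie_def)

lemma lie_local:
 assumes Z: "Z \<in> T" and X: "X \<in> T" "Y \<in> T" and U: "open U" "p \<in> U" "\<And>q f. q \<in> U ==> X f q = Y f q"
 shows "lie X Z f p = lie Y Z f p"
proof -
 have "Z (X f) p = Z (Y f) p"
  by (rule vf_local[OF Z vf_mem[OF X(1)] vf_mem[OF X(2)] U(1,2)]) (rule U(3))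
 thus ?thesis using U(3)[OF U(2)] by (simp add: lie_def)
qed

lemma lie_sum_left:
 assumes Z: "Z \<in> T" and X: "\<And>i. i \<in> I ==> X i \<in> T" and h: "\<And>i. i \<in> I ==> h i \<in> S"
 shows "lie (\<lambda>f p. \<Sum>i\<in>I. h i p * X i f p) Z = (\<lambda>f p. (\<Sum>i\<in>I. h i p * lie (X i) Z f p) - (\<Sum>i\<in>I. Z (h i) p * X i f p))"
 using X h
proof (induction I rule: infinite_finite_induct)
 case (insert i I)
 have "(\<lambda>f p. \<Sum>i\<in>I. h i p * X i f p) \<in> T"
  using insert.prems by (intro vf_sum_mem vf_smult_mem) auto
 from lie_axpy_left[OF this insert.prems(1)[of i] Z insert.prems(2)[of i]] insert
 show ?case by (simp add: fun_eq_iff algebra_simps)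
qed (simp_all add: lie_def fun_eq_iff vf_const[OF Z])

lemma covector_neg: "covector \<mu> ==> X \<in> T ==> \<mu> (\<lambda>f p. - X f p) = (\<lambda>p. - \<mu> X p)"
 using covector_smult[of \<mu> X "\<lambda>_. - 1"] by simp

definition locally_finite :: "(nat => 'a vfield) => bool" where
 "locally_finite V \<longleftrightarrow> (\<forall>p. \<exists>U n. open U \<and> p \<in> U \<and> (\<forall>q\<in>U. \<forall>j\<ge>n. \<forall>f. V j f q = 0))"

definition vf_suminf :: "(nat => 'a vfield) => 'a vfield" where
 "vf_suminf V f p = (\<Sum>j. V j f p)"

lemma vf_suminf_eq: "(\<And>j. j \<ge> n ==> V j f q = 0) ==> vf_suminf V f q = (\<Sum>j<n. V j f q)"
 unfolding vf_suminf_def by (rule suminf_finite) auto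

lemma vf_suminf_mem:
 assumes "locally_finite V" and V: "\<And>j. V j \<in> T"
 shows "vf_suminf V \<in> T"
proof (rule vf_local_field)
 fix p
 obtain U n where U: "open U" "p \<in> U" "\<forall>q\<in>U. \<forall>j\<ge>n. \<forall>f. V j f q = 0"
  using assms(1) unfolding locally_finite_def by blast
 hence "\<forall>q\<in>U. \<forall>f. vf_suminf V f q = (\<lambda>f p. \<Sum>j<n. V j f p) f q"
  by (auto intro!: vf_suminf_eq)
 moreover have "(\<lambda>f p. \<Sum>j<n. V j f p) \<in> T" by (intro vf_sum_mem V)
 ultimately show "\<exists>U Y. open U \<and> p \<in> U \<and> Y \<in> T \<and> (\<forall>q\<in>U. \<forall>f. vf_suminf V f q = Y f q)"
  using U(1,2) by blast
qed

end

lemma coset_eq: "H +>\<^bsub>M\<^esub> a = (\<lambda>h. h \<oplus>\<^bsub>M\<^esub> a) ` H"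
 by (auto simp: a_r_coset_def r_coset_def)

context hyperplane
begin

lemma xi_extend:
 assumes "u \<in> \<xi> p"
 obtains X where "X \<in> X\<xi>" "\<And>f. X f p = u f"
proof -
 obtain U e where e: "open U" "p \<in> U" "\<forall>i<DIM('e) - 1. e i \<in> T" "\<forall>q\<in>U. basis_of (\<xi> q) (DIM('e) - 1) (\<lambda>i. at_point (e i) q)"
  using hyperplane unfolding hyperplane_distribution_def subbundle_def by blast
 obtain c where c: "\<forall>f. u f = (\<Sum>i<DIM('e) - 1. c i * at_point (e i) p f)"
  using assms basis_of_iff[OF e(4)[rule_format, OF e(2)], of u] by blast
 obtain \<beta> N where \<beta>: "\<beta> \<in> S" "\<And>q. q \<notin> U ==> \<beta> q = 0" "p \<in> N" "\<And>q. q \<in> N ==> \<beta> q = 1"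
  by (rule local_bump[OF e(1,2)]) blast
 define X where "X f q = \<beta> q * (\<Sum>i<DIM('e) - 1. c i * e i f q)" for f q
 have "X \<in> T"
  unfolding X_def[abs_def] using e(3) \<beta>(1) by (intro vf_smult_mem vf_sum_mem) auto
 moreover have "(\<lambda>f. X f q) \<in> \<xi> q" for q
 proof (cases "q \<in> U")
  case True
  have "(\<lambda>f. \<Sum>i<DIM('e) - 1. c i * e i f q) \<in> \<xi> q"
   unfolding basis_of_iff[OF e(4)[rule_format, OF True]] by (intro exI[of _ c]) (simp add: at_point_def)
  thus ?thesis unfolding X_def by (rule subspace_scale[OF xi_subsp])
 qed (simp add: X_def \<beta> subspace_zero[OF xi_subsp])
 ultimately have "X \<in> X\<xi>" by (simp add: sec_iff)
 moreover have "X f p = u f" for f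
  using c \<beta> by (simp add: X_def at_point_def)
 ultimately show ?thesis by (rule that)
qed

lemma vanishes_iff:
 assumes "Z \<in> T"
 shows "vanishes_at \<xi> (theta A \<xi> Z) p \<longleftrightarrow> (\<lambda>f. Z f p) \<in> \<xi> p"
proof
 assume "vanishes_at \<xi> (theta A \<xi> Z) p"
 moreover have "Z \<in> theta A \<xi> Z"
  unfolding theta_def coset_eq using sections_zero[OF xi_subsp] by (force intro!: image_eqI)
 ultimately show "(\<lambda>f. Z f p) \<in> \<xi> p"
  by (auto simp: vanishes_at_def at_point_def)
next
 assume Z: "(\<lambda>f. Z f p) \<in> \<xi> p"
 have "(\<lambda>f. s f p + Z f p) \<in> \<xi> p" if "s \<in> X\<xi>" for s
  using subspace_axpy[OF xi_subsp _ Z, of "\<lambda>f. s f p" 1] that by (simp add: sec_iff)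
 thus "vanishes_at \<xi> (theta A \<xi> Z) p"
  by (auto simp: vanishes_at_def at_point_def theta_def coset_eq)
qed

section \<open>The characteristic distribution\<close>

abbreviation "\<F> \<equiv> char_dist A \<xi>"

lemma char_dist_iff:
 "u \<in> \<F> p \<longleftrightarrow> (\<exists>X\<in>X\<xi>. (\<forall>f. u f = X f p) \<and> (\<forall>Y\<in>X\<xi>. (\<lambda>f. lie X Y f p) \<in> \<xi> p))"
proof -
 have "(\<forall>Y\<in>X\<xi>. vanishes_at \<xi> (omega A \<xi> X Y) p) \<longleftrightarrow> (\<forall>Y\<in>X\<xi>. (\<lambda>f. lie X Y f p) \<in> \<xi> p)" if "X \<in> X\<xi>" for X
  using that by (intro ball_cong refl) (simp add: omega_def vanishes_iff sec_T)
 thus ?thesis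
  unfolding char_dist_def at_point_def by (auto simp: fun_eq_iff)
qed

lemma char_dist_subset: "u \<in> \<F> p ==> u \<in> \<xi> p"
proof -
 assume "u \<in> \<F> p"
 then obtain X where "X \<in> X\<xi>" "\<forall>f. u f = X f p" unfolding char_dist_iff by blast
 moreover from this have "u = (\<lambda>f. X f p)" by auto
 ultimately show ?thesis by (simp add: sec_iff)
qed

text \<open>The definition provides some section through a vector of T\<F> whose brackets stay in
  \<xi> at p. Since \<omega> is tensorial, every section of \<xi> with the same value at p has this
  property.\<close>

lemma char_dist_section:
 assumes X: "X \<in> X\<xi>"
 shows "(\<lambda>f. X f p) \<in> \<F> p \<longleftrightarrow> (\<forall>Y\<in>X\<xi>. (\<lambda>f. lie X Y f p) \<in> \<xi> p)"
proof
 assume "(\<lambda>f. X f p) \<in> \<F> p"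
 then obtain X' where X': "X' \<in> X\<xi>" "\<And>f. X f p = X' f p" "\<forall>Y\<in>X\<xi>. (\<lambda>f. lie X' Y f p) \<in> \<xi> p"
  unfolding char_dist_iff by blast
 obtain \<alpha> Z W where \<alpha>: "open W" "p \<in> W" "covector \<alpha>" "Z \<in> T" "\<And>X. X \<in> X\<xi> ==> \<alpha> X = (\<lambda>_. 0)"
  "\<And>q. q \<in> W ==> \<alpha> Z q = 1" "\<And>X q. q \<in> W ==> X \<in> T ==> \<alpha> X q = 0 \<longleftrightarrow> (\<lambda>f. X f q) \<in> \<xi> q"
  by (rule contact_form[of p]) blast
 define D where "D = (\<lambda>f p. X f p - X' f p)"
 have D: "D \<in> X\<xi>" unfolding D_def by (rule sections_diff[OF xi_subsp X X'(1)])
 show "\<forall>Y\<in>X\<xi>. (\<lambda>f. lie X Y f p) \<in> \<xi> p"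
 proof
  fix Y assume Y: "Y \<in> X\<xi>"
  \<comment> \<open>\<alpha>[U, Y] is linear over functions in U: the extra term -Y(h) V of the
    bracket lies in \<Gamma>(\<xi>), where \<alpha> vanishes.\<close>
  have lin: "\<alpha> (lie (\<lambda>f p. U f p + h p * V f p) Y) = (\<lambda>p. \<alpha> (lie U Y) p + h p * \<alpha> (lie V Y) p)"
   if UV: "U \<in> X\<xi>" "V \<in> X\<xi>" and h: "h \<in> S" for U V h
  proof -
   note UT = sec_T[OF UV(1)] sec_T[OF UV(2)] sec_T[OF Y]
   have "\<alpha> (lie (\<lambda>f p. U f p + h p * V f p) Y) =
     \<alpha> (\<lambda>f p. (lie U Y f p + h p * lie V Y f p) + (- Y h p) * V f p)"
    unfolding lie_axpy_left[OF UT h] by simp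
   also have "\<dots> = (\<lambda>p. \<alpha> (\<lambda>f p. lie U Y f p + h p * lie V Y f p) p + (- Y h p) * \<alpha> V p)"
    using UT h by (intro covectorD(2)[OF \<alpha>(3)]) (simp_all add: vf_mem)
   also have "\<dots> = (\<lambda>p. \<alpha> (lie U Y) p + h p * \<alpha> (lie V Y) p)"
    using covectorD(2)[OF \<alpha>(3), of "lie U Y" "lie V Y" h] UT h \<alpha>(5)[OF UV(2)] by simp
   finally show ?thesis .
  qed
  have "\<alpha> (lie D Y) p = 0"
   by (rule tensorial_xi[where \<phi> = "\<lambda>X. \<alpha> (lie X Y)", OF lin D]) (auto simp: D_def X')
  moreover have "lie X Y = lie (\<lambda>f p. X' f p + (\<lambda>_. 1) p * D f p) Y" by (simp add: D_def)
  hence "\<alpha> (lie X Y) = (\<lambda>p. \<alpha> (lie X' Y) p + \<alpha> (lie D Y) p)"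
   using lin[OF X'(1) D, of "\<lambda>_. 1"] by simp
  moreover have "\<alpha> (lie X' Y) p = 0"
   using X'(3) Y \<alpha>(7)[OF \<alpha>(2), of "lie X' Y"] sec_T[OF X'(1)] sec_T[OF Y] by simp
  ultimately show "(\<lambda>f. lie X Y f p) \<in> \<xi> p"
   using \<alpha>(7)[OF \<alpha>(2), of "lie X Y"] sec_T[OF X] sec_T[OF Y] by simp
 qed
next
 assume "\<forall>Y\<in>X\<xi>. (\<lambda>f. lie X Y f p) \<in> \<xi> p"
 thus "(\<lambda>f. X f p) \<in> \<F> p"
  unfolding char_dist_iff using X by blast
qed

abbreviation "XF \<equiv> sections A \<F>"

lemma XF_subset: "X \<in> XF ==> X \<in> X\<xi>"
 using char_dist_subset by (simp add: sec_iff)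

text \<open>The pointwise definition becomes a statement about modules of sections; in this form
  T\<F> enters the algebra.\<close>

lemma XF_iff: "X \<in> XF \<longleftrightarrow> X \<in> X\<xi> \<and> (\<forall>Y\<in>X\<xi>. lie X Y \<in> X\<xi>)"
proof (cases "X \<in> X\<xi>")
 case True
 have "X \<in> XF \<longleftrightarrow> (\<forall>p. (\<lambda>f. X f p) \<in> \<F> p)"
  using sec_T[OF True] by (simp add: sec_iff)
 also have "\<dots> \<longleftrightarrow> (\<forall>p. \<forall>Y\<in>X\<xi>. (\<lambda>f. lie X Y f p) \<in> \<xi> p)"
  using char_dist_section[OF True] by simp
 also have "\<dots> \<longleftrightarrow> (\<forall>Y\<in>X\<xi>. lie X Y \<in> X\<xi>)"
  using sec_T[OF True] sec_T by (auto simp: sec_iff)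
 finally show ?thesis using True by simp
qed (use XF_subset in blast)

text \<open>The differential of a contact form, \<open>d\<alpha>(X, Y)\<close> for \<open>Y \<in> \<Gamma>(\<xi>)\<close>.\<close>

definition dform :: "('a vfield => 'a => real) => 'a vfield => 'a vfield => 'a => real" where
 "dform \<alpha> Y X p = \<alpha> (lie Y X) p - Y (\<alpha> X) p"

text \<open>The derivative of the coefficient h appears once through the bracket and once through
  Y(\<alpha>(X)), and cancels.\<close>

lemma covector_dform:
 assumes \<alpha>: "covector \<alpha>" and Y: "Y \<in> T"
 shows "covector (dform \<alpha> Y)"
proof -
 have lin: "dform \<alpha> Y (\<lambda>f p. U f p + h p * V f p) = (\<lambda>p. dform \<alpha> Y U p + h p * dform \<alpha> Y V p)"
  if UV: "U \<in> T" "V \<in> T" and h: "h \<in> S" for U V h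
 proof -
  have "\<alpha> (lie Y (\<lambda>f p. U f p + h p * V f p)) = (\<lambda>p. \<alpha> (\<lambda>f p. lie Y U f p + h p * lie Y V f p) p + Y h p * \<alpha> V p)"
   unfolding lie_axpy_right[OF UV Y h] using UV h Y by (intro covectorD(2)[OF \<alpha>]) (simp_all add: vf_mem)
  moreover have "\<alpha> (\<lambda>f p. lie Y U f p + h p * lie Y V f p) = (\<lambda>p. \<alpha> (lie Y U) p + h p * \<alpha> (lie Y V) p)"
   using UV h Y by (intro covectorD(2)[OF \<alpha>]) simp_all
  moreover have "Y (\<alpha> (\<lambda>f p. U f p + h p * V f p)) = (\<lambda>p. Y (\<alpha> U) p + (Y h p * \<alpha> V p + h p * Y (\<alpha> V) p))"
   unfolding covectorD(2)[OF \<alpha> UV h]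
   using covectorD(1)[OF \<alpha>] UV h by (simp add: vf_add[OF Y] vf_mult[OF Y])
  ultimately show ?thesis by (simp add: dform_def fun_eq_iff algebra_simps)
 qed
 show ?thesis
  unfolding covector_def
 proof (intro conjI ballI allI impI)
  fix X assume X: "X \<in> T"
  show "dform \<alpha> Y X \<in> S"
   unfolding dform_def[abs_def] using covectorD(1)[OF \<alpha>] X Y vf_mem[OF Y] by simp
 next
  fix U V p assume UV: "U \<in> T" "V \<in> T" "\<forall>f. U f p = V f p"
  have "dform \<alpha> Y (\<lambda>f p. U f p + (\<lambda>_. - 1) p * V f p) p = 0"
   by (rule tensorial_T[where \<phi> = "dform \<alpha> Y", OF lin]) (use UV vf_diff_mem[OF UV(1,2)] in simp_all)
  thus "dform \<alpha> Y U p = dform \<alpha> Y V p"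
   using lin[OF UV(1,2), of "\<lambda>_. - 1"] by simp
 qed (rule lin)
qed

text \<open>\<open>P\<close> is a projector with kernel \<open>\<Gamma>(\<xi>)\<close>, so its image is isomorphic to \<open>\<Gamma>(\<ell>)\<close>; \<open>C\<close> is a connection on \<open>\<ell>\<close>.\<close>

lemma xi_projector_connection:
 obtains P and C :: "'a vfield => 'a vfield => 'a vfield" where
  "\<And>Y. Y \<in> T ==> P Y \<in> T"
  "\<And>Y Y' h. Y \<in> T ==> Y' \<in> T ==> h \<in> S ==> P (\<lambda>f p. Y f p + h p * Y' f p) = (\<lambda>f p. P Y f p + h p * P Y' f p)"
  "\<And>Y. Y \<in> T ==> (\<lambda>f p. P Y f p - Y f p) \<in> X\<xi>"
  "\<And>Y. Y \<in> X\<xi> ==> P Y = (\<lambda>f p. 0)"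
  "\<And>X Y. X \<in> T ==> Y \<in> T ==> C X Y \<in> T"
  "\<And>X Y Y' h. X \<in> T ==> Y \<in> T ==> Y' \<in> T ==> h \<in> S ==>
   C X (\<lambda>f p. Y f p + h p * Y' f p) = (\<lambda>f p. C X Y f p + h p * C X Y' f p + X h p * P Y' f p)"
  "\<And>X Y. X \<in> T ==> Y \<in> X\<xi> ==> C X Y = (\<lambda>f p. 0)"
proof -
 \<comment> \<open>\<beta> is good if it comes with a form \<alpha> that kills \<Gamma>(\<xi>) and a
   field Z such that \<alpha>(Y) Z = Y modulo \<xi> wherever \<beta> is nonzero.\<close>
 define R where "R \<beta> a \<longleftrightarrow> covector (fst a) \<and> snd a \<in> T \<and> (\<forall>X\<in>X\<xi>. fst a X = (\<lambda>_. 0)) \<and>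
   (\<forall>Y\<in>T. \<forall>q. (\<lambda>f. \<beta> q * (fst a Y q * snd a f q - Y f q)) \<in> \<xi> q)" for \<beta> and a :: "('a vfield => 'a => real) \<times> 'a vfield"
 define Q where "Q = {\<beta>\<in>S. \<exists>a. R \<beta> a}"
 have "\<exists>\<beta>\<in>Q. \<exists>U. open U \<and> p \<in> U \<and> (\<forall>q\<in>U. \<beta> q = 1)" for p
 proof -
  obtain \<alpha> Z W where \<alpha>: "open W" "p \<in> W" "covector \<alpha>" "Z \<in> T" "\<And>X. X \<in> X\<xi> ==> \<alpha> X = (\<lambda>_. 0)"
   "\<And>q. q \<in> W ==> \<alpha> Z q = 1" "\<And>X q. q \<in> W ==> X \<in> T ==> \<alpha> X q = 0 \<longleftrightarrow> (\<lambda>f. X f q) \<in> \<xi> q"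
   by (rule contact_form[of p]) blast
  obtain \<beta> N where \<beta>: "\<beta> \<in> S" "\<And>q. q \<notin> W ==> \<beta> q = 0" "open N" "p \<in> N" "N \<subseteq> W" "\<And>q. q \<in> N ==> \<beta> q = 1"
   by (rule local_bump[OF \<alpha>(1,2)]) blast
  have "(\<lambda>f. \<beta> q * (\<alpha> Y q * Z f q - Y f q)) \<in> \<xi> q" if Y: "Y \<in> T" for Y q
  proof (cases "q \<in> W")
   case True
   have m: "(\<lambda>f p. \<alpha> Y p * Z f p - Y f p) \<in> T"
    using covectorD(1)[OF \<alpha>(3) Y] \<alpha>(4) Y by simp
   have "\<alpha> (\<lambda>f p. \<alpha> Y p * Z f p - Y f p) q = 0"
    using covector_diff[OF \<alpha>(3), of "\<lambda>f p. \<alpha> Y p * Z f p" Y] covector_smult[OF \<alpha>(3,4), of "\<alpha> Y"]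
     covectorD(1)[OF \<alpha>(3) Y] \<alpha>(4) Y \<alpha>(6)[OF True] by simp
   hence "(\<lambda>f. \<alpha> Y q * Z f q - Y f q) \<in> \<xi> q"
    using \<alpha>(7)[OF True m] by simp
   thus ?thesis by (rule subspace_scale[OF xi_subsp])
  qed (simp add: \<beta> subspace_zero[OF xi_subsp])
  hence "R \<beta> (\<alpha>, Z)" using \<alpha>(3-5) by (simp add: R_def)
  hence "\<beta> \<in> Q" unfolding Q_def using \<beta>(1) by blast
  thus ?thesis using \<beta>(3,4,6) by blast
 qed
 moreover have "Q \<subseteq> S" by (auto simp: Q_def)
 ultimately obtain \<beta> c where \<beta>c: "\<And>j::nat. \<beta> j \<in> Q" "\<And>j. c j \<in> S"
  "\<And>p. \<exists>U n. open U \<and> p \<in> U \<and> (\<forall>q\<in>U. (\<Sum>j<n. c j q * \<beta> j q) = 1 \<and> (\<forall>j\<ge>n. c j q = 0))"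
  by (rule partition_of_unity) blast
 have \<beta>S: "\<beta> j \<in> S" for j using \<beta>c(1)[of j] by (simp add: Q_def)
 have "\<forall>j. \<exists>a. R (\<beta> j) a"
  using \<beta>c(1) unfolding Q_def by blast
 then obtain a where a: "\<forall>j. R (\<beta> j) (a j)"
  by (rule choice[THEN exE])
 define \<alpha> Z where "\<alpha> j = fst (a j)" and "Z j = snd (a j)" for j
 have \<alpha>: "\<And>j. covector (\<alpha> j)" "\<And>j. Z j \<in> T" "\<And>j. \<forall>X\<in>X\<xi>. \<alpha> j X = (\<lambda>_. 0)"
  "\<And>j. \<forall>Y\<in>T. \<forall>q. (\<lambda>f. \<beta> j q * (\<alpha> j Y q * Z j f q - Y f q)) \<in> \<xi> q"
  using a by (simp_all add: R_def \<alpha>_def Z_def)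
 define \<psi> where "\<psi> j p = c j p * \<beta> j p" for j p
 have \<psi>: "\<psi> j \<in> S" for j unfolding \<psi>_def[abs_def] using \<beta>c(2) \<beta>S by simp
 have fin: "\<exists>U n. open U \<and> p \<in> U \<and> (\<forall>q\<in>U. (\<Sum>j<n. \<psi> j q) = 1 \<and> (\<forall>j\<ge>n. \<psi> j q = 0))" for p
  using \<beta>c(3)[of p] unfolding \<psi>_def by (metis mult_zero_left)
 define sm where "sm k = vf_suminf (\<lambda>j f p. (\<psi> j p * k j p) * Z j f p)" for k
 \<comment> \<open>P(Y) is the sum of the \<psi>_j \<alpha>_j(Y) Z_j; it equals Y modulo \<xi>
   because the \<psi>_j add up to 1. C differentiates the coefficients \<alpha>_j(Y), so its Leibniz
   term is X(h) P(Y').\<close>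
 define P where "P Y = sm (\<lambda>j. \<alpha> j Y)" for Y
 define C where "C X Y = sm (\<lambda>j. X (\<alpha> j Y))" for X Y :: "'a vfield"
 have lf: "locally_finite (\<lambda>j f p. (\<psi> j p * k j p) * Z j f p)" for k
  unfolding locally_finite_def
 proof
  fix p
  obtain U n where "open U" "p \<in> U" "\<forall>q\<in>U. (\<Sum>j<n. \<psi> j q) = 1 \<and> (\<forall>j\<ge>n. \<psi> j q = 0)"
   using fin[of p] by blast
  thus "\<exists>U n. open U \<and> p \<in> U \<and> (\<forall>q\<in>U. \<forall>j\<ge>n. \<forall>f. \<psi> j q * k j q * Z j f q = 0)"
   by (intro exI[of _ U] exI[of _ n]) simp
 qed
 have sumeq: "\<exists>n. (\<Sum>j<n. \<psi> j p) = 1 \<and> (\<forall>k f. sm k f p = (\<Sum>j<n. (\<psi> j p * k j p) * Z j f p))" for p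
 proof -
  obtain U n where "p \<in> U" "\<forall>q\<in>U. (\<Sum>j<n. \<psi> j q) = 1 \<and> (\<forall>j\<ge>n. \<psi> j q = 0)"
   using fin[of p] by blast
  thus ?thesis by (intro exI[of _ n]) (auto simp: sm_def intro!: vf_suminf_eq)
 qed
 show ?thesis
 proof (rule that[of P C])
  show "P Y \<in> T" if "Y \<in> T" for Y
   unfolding P_def sm_def using covectorD(1)[OF \<alpha>(1) that] \<psi> \<alpha>(2) by (intro vf_suminf_mem lf) simp
  show "C X Y \<in> T" if "X \<in> T" "Y \<in> T" for X Y
   unfolding C_def sm_def using vf_mem[OF that(1)] \<psi> \<alpha>(2) by (intro vf_suminf_mem lf) simp
 next
  fix Y Y' h assume Y: "Y \<in> T" "Y' \<in> T" "h \<in> S"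
  show "P (\<lambda>f p. Y f p + h p * Y' f p) = (\<lambda>f p. P Y f p + h p * P Y' f p)"
  proof (intro ext)
   fix f p
   obtain n where n: "\<forall>k f. sm k f p = (\<Sum>j<n. (\<psi> j p * k j p) * Z j f p)"
    using sumeq[of p] by blast
   show "P (\<lambda>f p. Y f p + h p * Y' f p) f p = P Y f p + h p * P Y' f p"
    unfolding P_def covectorD(2)[OF \<alpha>(1) Y] n[rule_format]
    by (simp add: sum.distrib sum_distrib_left algebra_simps)
  qed
 next
  fix Y assume Y: "Y \<in> T"
  have "(\<lambda>f. P Y f p - Y f p) \<in> \<xi> p" for p
  proof -
   obtain n where n: "(\<Sum>j<n. \<psi> j p) = 1" "\<forall>k f. sm k f p = (\<Sum>j<n. (\<psi> j p * k j p) * Z j f p)"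
    using sumeq[of p] by blast
   have "P Y f p - Y f p = (\<Sum>j<n. c j p * (\<beta> j p * (\<alpha> j Y p * Z j f p - Y f p)))" for f
   proof -
    have "P Y f p - Y f p = (\<Sum>j<n. (\<psi> j p * \<alpha> j Y p) * Z j f p) - (\<Sum>j<n. \<psi> j p) * Y f p"
     using n by (simp add: P_def)
    thus ?thesis
     unfolding sum_distrib_right sum_subtractf[symmetric] by (simp add: \<psi>_def algebra_simps)
   qed
   hence eq: "(\<lambda>f. P Y f p - Y f p) = (\<lambda>f. \<Sum>j<n. c j p * (\<beta> j p * (\<alpha> j Y p * Z j f p - Y f p)))" by (rule ext)
   show ?thesis
    unfolding eq using \<alpha>(4) Y by (intro subspace_sum xi_subsp) blast
  qed
  moreover have "P Y \<in> T"
   unfolding P_def sm_def using covectorD(1)[OF \<alpha>(1) Y] \<psi> \<alpha>(2) by (intro vf_suminf_mem lf) simp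
  ultimately show "(\<lambda>f p. P Y f p - Y f p) \<in> X\<xi>"
   using Y by (simp add: sec_iff)
 next
  fix Y assume "Y \<in> X\<xi>"
  thus "P Y = (\<lambda>f p. 0)"
   using \<alpha>(3) by (simp add: P_def sm_def vf_suminf_def fun_eq_iff)
 next
  fix X Y assume X: "X \<in> T" and Y: "Y \<in> X\<xi>"
  have "\<alpha> j Y = (\<lambda>_. 0)" for j using \<alpha>(3) Y by blast
  thus "C X Y = (\<lambda>f p. 0)"
   by (intro ext) (simp add: C_def sm_def vf_suminf_def vf_const[OF X])
 next
  fix X Y Y' h assume X: "X \<in> T" and Y: "Y \<in> T" "Y' \<in> T" "h \<in> S"
  show "C X (\<lambda>f p. Y f p + h p * Y' f p) = (\<lambda>f p. C X Y f p + h p * C X Y' f p + X h p * P Y' f p)"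
  proof (intro ext)
   fix f p
   obtain n where n: "\<forall>k f. sm k f p = (\<Sum>j<n. (\<psi> j p * k j p) * Z j f p)"
    using sumeq[of p] by blast
   have "X (\<alpha> j (\<lambda>f p. Y f p + h p * Y' f p)) = (\<lambda>p. X (\<alpha> j Y) p + (X h p * \<alpha> j Y' p + h p * X (\<alpha> j Y') p))" for j
    unfolding covectorD(2)[OF \<alpha>(1) Y]
    using covectorD(1)[OF \<alpha>(1)] Y by (simp add: vf_add[OF X] vf_mult[OF X])
   thus "C X (\<lambda>f p. Y f p + h p * Y' f p) f p = C X Y f p + h p * C X Y' f p + X h p * P Y' f p"
    unfolding P_def C_def n[rule_format]
    by (simp add: sum.distrib sum_distrib_left algebra_simps)
  qed
 qed
qed

section \<open>Faithfulness and endomorphisms of the module of sections of \<ell>\<close>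

lemma xi_faithful:
 assumes "f \<in> S" "\<And>Y. Y \<in> T ==> (\<lambda>g p. f p * Y g p) \<in> X\<xi>"
 shows "f = (\<lambda>_. 0)"
proof
 fix p
 obtain \<alpha> Z W where \<alpha>: "open W" "p \<in> W" "covector \<alpha>" "Z \<in> T" "\<And>X. X \<in> X\<xi> ==> \<alpha> X = (\<lambda>_. 0)"
  "\<And>q. q \<in> W ==> \<alpha> Z q = 1" 
  by (rule contact_form[of p]) blast
 have "\<alpha> (\<lambda>g p. f p * Z g p) = (\<lambda>p. f p * \<alpha> Z p)"
  by (rule covector_smult[OF \<alpha>(3,4) assms(1)])
 hence "(\<lambda>p. f p * \<alpha> Z p) = (\<lambda>_. 0)" using \<alpha>(5)[OF assms(2)[OF \<alpha>(4)]] by simp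
 thus "f p = 0" using \<alpha>(6)[OF \<alpha>(2)] by (auto dest: fun_cong[of _ _ p])
qed

text \<open>The rank is one: near p every X is \<alpha>(X) Z modulo \<xi>, so \<phi> is
  multiplication by \<alpha>(\<phi>(Z)). The hypotheses hold modulo \<xi> because \<phi> will be a
  lift, by chosen representatives, of an endomorphism of \<ell>.\<close>

lemma xi_endomorphism:
 assumes \<phi>: "\<And>X. X \<in> T ==> \<phi> X \<in> T" "\<And>X. X \<in> X\<xi> ==> \<phi> X \<in> X\<xi>"
  "\<And>X Y h. X \<in> T ==> Y \<in> T ==> h \<in> S ==> (\<lambda>f p. \<phi> (\<lambda>f p. X f p + h p * Y f p) f p - (\<phi> X f p + h p * \<phi> Y f p)) \<in> X\<xi>"
 shows "\<exists>k\<in>S. \<forall>X\<in>T. (\<lambda>f p. \<phi> X f p - k p * X f p) \<in> X\<xi>"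
proof -
 have loc: "\<exists>U k. open U \<and> p \<in> U \<and> k \<in> S \<and> (\<forall>q\<in>U. \<forall>X\<in>T. (\<lambda>f. \<phi> X f q - k q * X f q) \<in> \<xi> q)" for p
 proof -
  obtain \<alpha> Z W where \<alpha>: "open W" "p \<in> W" "covector \<alpha>" "Z \<in> T" "\<And>X. X \<in> X\<xi> ==> \<alpha> X = (\<lambda>_. 0)"
   "\<And>q. q \<in> W ==> \<alpha> Z q = 1" "\<And>X q. q \<in> W ==> X \<in> T ==> \<alpha> X q = 0 \<longleftrightarrow> (\<lambda>f. X f q) \<in> \<xi> q"
   by (rule contact_form[of p]) blast
  obtain \<beta> N where \<beta>: "\<beta> \<in> S" "\<And>q. q \<notin> W ==> \<beta> q = 0" "open N" "p \<in> N" "N \<subseteq> W" "\<And>q. q \<in> N ==> \<beta> q = 1"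
   by (rule local_bump[OF \<alpha>(1,2)]) blast
  have axpy: "\<alpha> (\<phi> (\<lambda>f p. X f p + h p * Y f p)) = (\<lambda>p. \<alpha> (\<phi> X) p + h p * \<alpha> (\<phi> Y) p)"
   if "X \<in> T" "Y \<in> T" "h \<in> S" for X Y h
  proof -
   have m: "\<phi> (\<lambda>f p. X f p + h p * Y f p) \<in> T" "(\<lambda>f p. \<phi> X f p + h p * \<phi> Y f p) \<in> T"
    using that \<phi>(1) by simp_all
   show ?thesis
    using \<alpha>(5)[OF \<phi>(3)[OF that]] covector_diff[OF \<alpha>(3) m] covectorD(2)[OF \<alpha>(3) \<phi>(1) \<phi>(1), of X Y h] that
    by (simp add: fun_eq_iff)
  qed
  have "(\<lambda>f. \<phi> X f q - \<alpha> (\<phi> Z) q * X f q) \<in> \<xi> q" if q: "q \<in> N" and X: "X \<in> T" for q X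
  proof -
   \<comment> \<open>A global section of \<xi>, so \<alpha>(\<phi>(V)) = 0. This compares
     \<phi>(\<beta> X) with the multiple \<beta> \<alpha>(X) of \<phi>(Z).\<close>
   define V where "V = (\<lambda>f p. \<beta> p * (X f p - \<alpha> X p * Z f p))"
   have aS: "\<alpha> X \<in> S" by (rule covectorD(1)[OF \<alpha>(3) X])
   have mW: "(\<lambda>f p. X f p - \<alpha> X p * Z f p) \<in> T" using X \<alpha>(4) aS by simp
   have VT: "V \<in> T" unfolding V_def using mW \<beta>(1) by (rule vf_smult_mem[rotated])
   have "(\<lambda>f. V f r) \<in> \<xi> r" for r
   proof (cases "r \<in> W")
    case True
    have "\<alpha> (\<lambda>f p. X f p - \<alpha> X p * Z f p) r = 0"
     using covector_diff[OF \<alpha>(3) X, of "\<lambda>f p. \<alpha> X p * Z f p"] covector_smult[OF \<alpha>(3,4) aS] \<alpha>(4) aS \<alpha>(6)[OF True]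
     by simp
    hence "(\<lambda>f. X f r - \<alpha> X r * Z f r) \<in> \<xi> r" using \<alpha>(7)[OF True mW] by simp
    thus ?thesis unfolding V_def by (rule subspace_scale[OF xi_subsp])
   qed (simp add: V_def \<beta> subspace_zero[OF xi_subsp])
   hence "V \<in> X\<xi>" using VT by (simp add: sec_iff)
   hence V0: "\<alpha> (\<phi> V) = (\<lambda>_. 0)" by (intro \<alpha>(5) \<phi>(2))
   have bX: "(\<lambda>f p. V f p + (\<beta> p * \<alpha> X p) * Z f p) = (\<lambda>f p. (\<lambda>f p. 0) f p + \<beta> p * X f p)"
    by (simp add: V_def algebra_simps)
   have "\<alpha> (\<phi> (\<lambda>f p. V f p + (\<beta> p * \<alpha> X p) * Z f p)) = (\<lambda>p. \<alpha> (\<phi> V) p + (\<beta> p * \<alpha> X p) * \<alpha> (\<phi> Z) p)"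
    using axpy[OF VT \<alpha>(4), of "\<lambda>p. \<beta> p * \<alpha> X p"] \<beta>(1) aS by simp
   moreover have "\<alpha> (\<phi> (\<lambda>f p. (\<lambda>f p. 0) f p + \<beta> p * X f p)) = (\<lambda>p. \<alpha> (\<phi> (\<lambda>f p. 0)) p + \<beta> p * \<alpha> (\<phi> X) p)"
    by (rule axpy[OF vf_zero_mem X \<beta>(1)])
   moreover have "\<alpha> (\<phi> (\<lambda>f p. 0)) = (\<lambda>_. 0)"
    by (intro \<alpha>(5) \<phi>(2) sections_zero[OF xi_subsp])
   ultimately have "(\<lambda>p. (\<beta> p * \<alpha> X p) * \<alpha> (\<phi> Z) p) = (\<lambda>p. \<beta> p * \<alpha> (\<phi> X) p)"
    unfolding bX V0 by simp
   hence "\<alpha> X q * \<alpha> (\<phi> Z) q = \<alpha> (\<phi> X) q"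
    using \<beta>(6)[OF q] by (auto dest: fun_cong[of _ _ q])
   hence e: "\<alpha> (\<phi> X) q = \<alpha> (\<phi> Z) q * \<alpha> X q" by (simp add: mult.commute)
   have kS: "\<alpha> (\<phi> Z) \<in> S" by (intro covectorD(1)[OF \<alpha>(3)] \<phi>(1) \<alpha>(4))
   have m: "(\<lambda>f p. \<phi> X f p - \<alpha> (\<phi> Z) p * X f p) \<in> T"
    using \<phi>(1)[OF X] X kS by simp
   have "\<alpha> (\<lambda>f p. \<phi> X f p - \<alpha> (\<phi> Z) p * X f p) q = 0"
    using covector_diff[OF \<alpha>(3) \<phi>(1)[OF X], of "\<lambda>f p. \<alpha> (\<phi> Z) p * X f p"] covector_smult[OF \<alpha>(3) X kS] kS X e
    by simp
   thus ?thesis using \<alpha>(7)[OF _ m] q \<beta>(5) by auto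
  qed
  thus ?thesis
   using \<beta>(3,4) covectorD(1)[OF \<alpha>(3) \<phi>(1)[OF \<alpha>(4)]] by blast
 qed
 \<comment> \<open>The multiplier is chosen at each point separately. By uniqueness it agrees with
   the smooth local ones, so it is smooth.\<close>
 define k where "k q = (SOME c. \<forall>X\<in>T. (\<lambda>f. \<phi> X f q - c * X f q) \<in> \<xi> q)" for q
 have k: "(\<lambda>f. \<phi> X f q - k q * X f q) \<in> \<xi> q" if "X \<in> T" for X q
 proof -
  have "\<exists>c. \<forall>X\<in>T. (\<lambda>f. \<phi> X f q - c * X f q) \<in> \<xi> q" using loc[of q] by blast
  from someI_ex[OF this] that show ?thesis unfolding k_def by blast
 qed
 have uniq: "c = c'" if "\<forall>X\<in>T. (\<lambda>f. \<phi> X f q - c * X f q) \<in> \<xi> q" "\<forall>X\<in>T. (\<lambda>f. \<phi> X f q - c' * X f q) \<in> \<xi> q" for q c c'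
 proof -
  obtain \<alpha> Z W where \<alpha>: "open W" "q \<in> W" "covector \<alpha>" "Z \<in> T" "\<And>X. X \<in> X\<xi> ==> \<alpha> X = (\<lambda>_. 0)"
   "\<And>q. q \<in> W ==> \<alpha> Z q = 1" "\<And>X q. q \<in> W ==> X \<in> T ==> \<alpha> X q = 0 \<longleftrightarrow> (\<lambda>f. X f q) \<in> \<xi> q"
   by (rule contact_form[of q]) blast
  have *: "(\<lambda>f. \<phi> Z f q - c * Z f q) \<in> \<xi> q" "(\<lambda>f. \<phi> Z f q - c' * Z f q) \<in> \<xi> q"
   using that \<alpha>(4) by blast+
  have "(\<lambda>f. (\<phi> Z f q - c * Z f q) + (- 1) * (\<phi> Z f q - c' * Z f q)) \<in> \<xi> q"
   by (rule subspace_axpy[OF xi_subsp *])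
  hence "(\<lambda>f. (c' - c) * Z f q) \<in> \<xi> q" by (simp add: algebra_simps)
  hence "\<alpha> (\<lambda>f p. (c' - c) * Z f p) q = 0"
   using \<alpha>(7)[OF \<alpha>(2) vf_smult_mem[of "\<lambda>_. c' - c" Z]] \<alpha>(4) by simp
  thus ?thesis
   using covector_smult[OF \<alpha>(3,4), of "\<lambda>_. c' - c"] \<alpha>(6)[OF \<alpha>(2)] by simp
 qed
 have "k \<in> S"
 proof (rule Cinf_local)
  fix p
  obtain U k' where U: "open U" "p \<in> U" "k' \<in> S" "\<forall>q\<in>U. \<forall>X\<in>T. (\<lambda>f. \<phi> X f q - k' q * X f q) \<in> \<xi> q"
   using loc[of p] by blast
  have "\<forall>q\<in>U. k q = k' q"
   using U(4) k by (intro ballI uniq) blast+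
  thus "\<exists>U g. open U \<and> p \<in> U \<and> g \<in> S \<and> (\<forall>q\<in>U. k q = g q)"
   using U(1-3) by blast
 qed
 thus ?thesis
  using k \<phi>(1) by (intro bexI[of _ k]) (auto simp: sec_iff)
qed

end

section \<open>Pre-contact distributions with a complement\<close>

locale precontact_splitting = hyperplane A \<xi>
 for A :: "('a::{second_countable_topology, t2_space}, 'e::euclidean_space) atlas" and \<xi> :: "'a distr" +
 fixes G :: "'a distr"
 assumes precontact: "precontact A \<xi>" and complement: "complement_of_TF A \<xi> G"
begin

abbreviation "XG \<equiv> sections A G"

lemma F_subspaces: "subspaces \<F>"
 using precontact unfolding precontact_def by (intro subspacesI) blast

lemma G_frame:
 obtains r U g where "open U" "p \<in> U" "\<And>i. g i \<in> T" "\<And>q. q \<in> U ==> basis_of (G q) r (\<lambda>i f. g i f q)"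
proof -
 obtain r where "subbundle A r G" using complement unfolding complement_of_TF_def by blast
 then obtain U e where e: "open U" "p \<in> U" "\<forall>i<r. e i \<in> T" "\<forall>q\<in>U. basis_of (G q) r (\<lambda>i. at_point (e i) q)"
  unfolding subbundle_def by blast
 define g where "g i = (if i < r then e i else (\<lambda>f p. 0))" for i
 have 1: "g i \<in> T" for i using e(3) by (simp add: g_def)
 have "basis_of V r (\<lambda>i f. g i f q) \<longleftrightarrow> basis_of V r (\<lambda>i. at_point (e i) q)" for V q
  unfolding basis_of_def by (intro arg_cong[of _ _ "\<lambda>h. bij_betw h _ _"] ext sum.cong refl) (simp add: g_def at_point_def)
 hence 2: "basis_of (G q) r (\<lambda>i f. g i f q)" if "q \<in> U" for q
  using e(4) that by simp
 show ?thesis by (rule that[OF e(1,2) 1 2])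
qed

lemma G_subspaces: "subspaces G"
proof (rule subspacesI)
 fix p
 obtain r U and g :: "nat => 'a vfield" where "p \<in> U" "\<And>q. q \<in> U ==> basis_of (G q) r (\<lambda>i f. g i f q)"
  by (rule G_frame[of p]) blast
 thus "\<exists>r v. basis_of (G p) r v" by blast
qed

lemma decompose_at:
 assumes "X \<in> T"
 obtains u w where "u \<in> \<F> p" "w \<in> G p" "\<And>f. X f p = u f + w f"
proof -
 have "at_point X p \<in> tangent_space A p"
  using assms by (auto simp: tangent_space_def at_point_def vf_out vf_add[OF assms] vf_cmult[OF assms] vf_mult[OF assms])
 moreover have "tangent_space A p = (\<lambda>(u, w) f. u f + w f) ` (\<F> p \<times> G p)"
  using complement unfolding complement_of_TF_def bij_betw_def by simp
 ultimately obtain u w where "u \<in> \<F> p" "w \<in> G p" "at_point X p = (\<lambda>f. u f + w f)"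
  by auto
 thus ?thesis by (intro that[of u w]) (auto simp: at_point_def fun_eq_iff)
qed

lemma decompose_unique:
 assumes "u \<in> \<F> p" "w \<in> G p" "u' \<in> \<F> p" "w' \<in> G p" "\<And>f. u f + w f = u' f + w' f"
 shows "u = u'" "w = w'"
proof -
 have "inj_on (\<lambda>(u, w) f. u f + w f) (\<F> p \<times> G p)"
  using complement unfolding complement_of_TF_def bij_betw_def by simp
 from inj_onD[OF this, of "(u, w)" "(u', w')"] show "u = u'" "w = w'"
  using assms by auto
qed

lemma F_Int_G: "u \<in> \<F> p ==> u \<in> G p ==> u = (\<lambda>_. 0)"
 using decompose_unique(1)[of u p "\<lambda>_. 0" "\<lambda>_. 0" u] subspace_zero[OF F_subspaces] subspace_zero[OF G_subspaces] by simp

text \<open>The projection to G along T\<F> near a point, with coefficients \<mu>_i that on \<xi>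
  have the form \<omega>(Y_i, -), expressed by \<alpha>. This is nondegeneracy of \<omega> modulo
  T\<F> in a frame.\<close>

definition local_splitting ::
 "'a set => ('a vfield => 'a => real) => nat => (nat => 'a vfield) => (nat => 'a vfield => 'a => real) => (nat => 'a vfield) => bool" where
 "local_splitting N \<alpha> r g \<mu> Y \<longleftrightarrow> (\<forall>i. g i \<in> T) \<and> (\<forall>i<r. covector (\<mu> i)) \<and> (\<forall>i<r. Y i \<in> X\<xi>) \<and>
   (\<forall>i<r. \<forall>X\<in>X\<xi>. \<mu> i X = \<alpha> (lie (Y i) X)) \<and>
   (\<forall>q\<in>N. \<forall>X\<in>T. (\<lambda>f. \<Sum>i<r. \<mu> i X q * g i f q) \<in> G q \<and> (\<lambda>f. X f q - (\<Sum>i<r. \<mu> i X q * g i f q)) \<in> \<F> q)"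

text \<open>The covectors d\<alpha>(-, Y) + f \<alpha> with Y in \<Gamma>(\<xi>) have T\<F> as
  common kernel. Hence they separate the vectors of G, and \<open>dual_frame\<close> turns them into
  a family dual to a frame of G. A pair (f, Y) encodes such a covector.\<close>

lemma local_splitting_exists:
 assumes \<alpha>: "open W" "p \<in> W" "covector \<alpha>" "\<And>X. X \<in> X\<xi> ==> \<alpha> X = (\<lambda>_. 0)"
  "\<And>X q. q \<in> W ==> X \<in> T ==> \<alpha> X q = 0 \<longleftrightarrow> (\<lambda>f. X f q) \<in> \<xi> q"
 shows "\<exists>N r g \<mu> Y. open N \<and> p \<in> N \<and> N \<subseteq> W \<and> local_splitting N \<alpha> r g \<mu> Y"
proof -
 obtain r U g where g: "open U" "p \<in> U" "\<And>i. g i \<in> T" "\<And>q. q \<in> U ==> basis_of (G q) r (\<lambda>i f. g i f q)"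
  by (rule G_frame[of p]) blast
 define ev where "ev a = (\<lambda>X p. dform \<alpha> (snd a) X p + fst a p * \<alpha> X p)" for a :: "('a => real) \<times> 'a vfield"
 define \<Lambda> where "\<Lambda> = S \<times> X\<xi>"
 have cov: "covector (ev a)" if "a \<in> \<Lambda>" for a
  unfolding ev_def using that sec_T[of "snd a" \<xi>]
  by (intro covector_axpy covector_dform \<alpha>(3)) (auto simp: \<Lambda>_def)
 have ev\<xi>: "ev a X = \<alpha> (lie (snd a) X)" if "a \<in> \<Lambda>" "X \<in> X\<xi>" for a X
  using \<alpha>(4)[OF that(2)] sec_T[of "snd a" \<xi>] that(1)
  by (intro ext) (auto simp: ev_def dform_def \<Lambda>_def vf_const)
 have zero\<Lambda>: "(f, \<lambda>f p. 0) \<in> \<Lambda>" if "f \<in> S" for f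
  using that sections_zero[OF xi_subsp] by (simp add: \<Lambda>_def)
 \<comment> \<open>For a section of \<xi> the covector reduces to \<alpha>[Y, X], so the definition
   of T\<F> applies; equal values at q carry the result from X' to X.\<close>
 have evF: "ev a X q = 0" if a: "a \<in> \<Lambda>" and q: "q \<in> W" and X: "X \<in> T" "(\<lambda>f. X f q) \<in> \<F> q" for a X q
 proof -
  obtain X' where X': "X' \<in> X\<xi>" "\<forall>f. X f q = X' f q" "\<forall>Y\<in>X\<xi>. (\<lambda>f. lie X' Y f q) \<in> \<xi> q"
   using X(2) unfolding char_dist_iff by blast
  have s: "snd a \<in> X\<xi>" using a by (auto simp: \<Lambda>_def)
  have m: "lie X' (snd a) \<in> T" using sec_T[OF X'(1)] sec_T[OF s] by simp
  have "ev a X q = ev a X' q"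
   using X X' by (intro covectorD(3)[OF cov[OF a]]) (simp_all add: sec_T)
  also have "\<dots> = \<alpha> (\<lambda>f p. - lie X' (snd a) f p) q"
   unfolding ev\<xi>[OF a X'(1)] by (subst lie_swap) simp
  also have "\<dots> = 0"
   using covector_neg[OF \<alpha>(3) m] \<alpha>(5)[OF q m] X'(3) s by simp
  finally show ?thesis .
 qed
 have "\<exists>\<mu> N. open N \<and> p \<in> N \<and> (\<forall>j<r. \<mu> j \<in> \<Lambda>) \<and> (\<forall>q\<in>N. \<forall>i<r. \<forall>j<r. ev (\<mu> j) (g i) q = (if i = j then 1 else 0))"
 proof (rule dual_frame[where ev = "\<lambda>\<mu> i. ev \<mu> (g i)"])
  show "ev \<mu> (g i) \<in> S" if "\<mu> \<in> \<Lambda>" for \<mu> i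
   by (rule covectorD(1)[OF cov[OF that] g(3)])
  fix \<mu> \<nu> f assume *: "\<mu> \<in> \<Lambda>" "\<nu> \<in> \<Lambda>" "f \<in> S"
  define \<kappa> where "\<kappa> = (\<lambda>p. fst \<mu> p + f p * fst \<nu> p, \<lambda>h p. snd \<mu> h p + f p * snd \<nu> h p)"
  have s: "snd \<mu> \<in> X\<xi>" "snd \<nu> \<in> X\<xi>" "fst \<mu> \<in> S" "fst \<nu> \<in> S" using * by (auto simp: \<Lambda>_def)
  have "\<kappa> \<in> \<Lambda>"
   using s *(3) sections_axpy[OF xi_subsp *(3) s(1,2)] by (simp add: \<Lambda>_def \<kappa>_def)
  moreover have "ev \<kappa> X q = ev \<mu> X q + f q * ev \<nu> X q" if X: "X \<in> T" for X q
  proof -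
   note sT = sec_T[OF s(1)] sec_T[OF s(2)]
   have "\<alpha> (lie (\<lambda>h p. snd \<mu> h p + f p * snd \<nu> h p) X) =
     \<alpha> (\<lambda>h p. (lie (snd \<mu>) X h p + f p * lie (snd \<nu>) X h p) + (- X f p) * snd \<nu> h p)"
    unfolding lie_axpy_left[OF sT X *(3)] by simp
   also have "\<dots> = (\<lambda>p. \<alpha> (\<lambda>h p. lie (snd \<mu>) X h p + f p * lie (snd \<nu>) X h p) p + (- X f p) * \<alpha> (snd \<nu>) p)"
    using sT X *(3) by (intro covectorD(2)[OF \<alpha>(3)]) (simp_all add: vf_mem)
   also have "\<dots> = (\<lambda>p. \<alpha> (lie (snd \<mu>) X) p + f p * \<alpha> (lie (snd \<nu>) X) p)"
    using covectorD(2)[OF \<alpha>(3), of "lie (snd \<mu>) X" "lie (snd \<nu>) X" f] sT X *(3) \<alpha>(4)[OF s(2)] by simp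
   finally show ?thesis
    by (simp add: ev_def \<kappa>_def dform_def algebra_simps)
  qed
  ultimately show "\<exists>\<kappa>\<in>\<Lambda>. \<forall>i q. ev \<kappa> (g i) q = ev \<mu> (g i) q + f q * ev \<nu> (g i) q"
   using g(3) by blast
 next
  fix c assume c: "\<And>\<mu>. \<mu> \<in> \<Lambda> ==> (\<Sum>i<r. c i * ev \<mu> (g i) p) = 0"
  define V where "V = (\<lambda>f p. \<Sum>i<r. c i * g i f p)"
  have V: "V \<in> T" unfolding V_def using g(3) by (intro vf_sum_mem) (simp add: vf_smult_mem[of "\<lambda>_. _"])
  have evV: "ev a V p = 0" if "a \<in> \<Lambda>" for a
   using covector_eq_sum[OF cov[OF that] V, of "{..<r}" g p c] g(3) c[OF that] by (simp add: V_def)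
  \<comment> \<open>The covectors of the pairs (1, 0) and (0, 0) differ exactly by \<alpha>.\<close>
  have "\<alpha> V p = 0"
   using evV[OF zero\<Lambda>[OF Cinf_const[of 1]]] evV[OF zero\<Lambda>[OF Cinf_const[of 0]]] by (simp add: ev_def)
  hence "(\<lambda>f. V f p) \<in> \<xi> p" using \<alpha>(5)[OF \<alpha>(2) V] by simp
  then obtain V' where V': "V' \<in> X\<xi>" "\<And>f. V' f p = V f p" by (rule xi_extend) blast
  have "(\<lambda>f. lie V' Y f p) \<in> \<xi> p" if Y: "Y \<in> X\<xi>" for Y
  proof -
   have a: "(\<lambda>_. 0, Y) \<in> \<Lambda>" using Y by (simp add: \<Lambda>_def)
   have "ev (\<lambda>_. 0, Y) V' p = ev (\<lambda>_. 0, Y) V p"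
    by (rule covectorD(3)[OF cov[OF a] sec_T[OF V'(1)] V V'(2)])
   hence "\<alpha> (lie Y V') p = 0"
    using evV[OF a] ev\<xi>[OF a V'(1)] by simp
   moreover have m: "lie V' Y \<in> T" using sec_T[OF V'(1)] sec_T[OF Y] by simp
   ultimately have "\<alpha> (lie V' Y) p = 0"
    using covector_neg[OF \<alpha>(3) m] lie_swap[of Y V'] by simp
   thus ?thesis using \<alpha>(5)[OF \<alpha>(2) m] by simp
  qed
  hence "(\<lambda>f. V f p) \<in> \<F> p"
   using char_dist_section[OF V'(1), of p] V'(2) by simp
  moreover have "(\<lambda>f. V f p) \<in> G p"
   unfolding basis_of_iff[OF g(4)[OF g(2)]] by (intro exI[of _ c]) (simp add: V_def)
  ultimately have "(\<lambda>f. V f p) = (\<lambda>_. 0)" by (rule F_Int_G)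
  hence "(\<Sum>i<r. c i * g i f p) = 0" for f by (simp add: V_def fun_eq_iff)
  thus "\<forall>i<r. c i = 0" using basis_of_indep[OF g(4)[OF g(2)], of c] by blast
 qed
 then obtain \<mu> N where \<mu>: "open N" "p \<in> N" "\<forall>j<r. \<mu> j \<in> \<Lambda>"
  "\<forall>q\<in>N. \<forall>i<r. \<forall>j<r. ev (\<mu> j) (g i) q = (if i = j then 1 else 0)"
  by (elim exE conjE) (rule that)
 have split: "(\<lambda>f. \<Sum>i<r. ev (\<mu> i) X q * g i f q) \<in> G q \<and> (\<lambda>f. X f q - (\<Sum>i<r. ev (\<mu> i) X q * g i f q)) \<in> \<F> q"
  if q: "q \<in> N \<inter> U \<inter> W" and X: "X \<in> T" for q X
 proof -
  have qU: "q \<in> U" "q \<in> W" "q \<in> N" using q by auto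
  obtain u w where uw: "u \<in> \<F> q" "w \<in> G q" "\<And>f. X f q = u f + w f"
   by (rule decompose_at[OF X, of q]) blast
  obtain c where c: "\<forall>f. w f = (\<Sum>i<r. c i * g i f q)"
   using uw(2) basis_of_iff[OF g(4)[OF qU(1)]] by blast
  define V where "V = (\<lambda>f p. X f p - (\<Sum>i<r. c i * g i f p))"
  have s: "(\<lambda>f p. \<Sum>i<r. c i * g i f p) \<in> T" using g(3) by (intro vf_sum_mem) (simp add: vf_smult_mem[of "\<lambda>_. _"])
  have V: "V \<in> T" unfolding V_def using X s by simp
  have Vu: "(\<lambda>f. V f q) = u" using uw(3) c by (simp add: V_def)
  \<comment> \<open>The functionals vanish on T\<F>, hence see only the G-component w, whose
    coefficients they read off.\<close>
  have mu: "ev (\<mu> j) X q = c j" if j: "j < r" for j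
  proof -
   have a: "\<mu> j \<in> \<Lambda>" using \<mu>(3) j by simp
   have "ev (\<mu> j) V q = 0" using evF[OF a qU(2) V] Vu uw(1) by simp
   moreover have "ev (\<mu> j) V q = ev (\<mu> j) X q - ev (\<mu> j) (\<lambda>f p. \<Sum>i<r. c i * g i f p) q"
    unfolding V_def using covector_diff[OF cov[OF a] X s] by simp
   moreover have "ev (\<mu> j) (\<lambda>f p. \<Sum>i<r. c i * g i f p) q = (\<Sum>i<r. c i * ev (\<mu> j) (g i) q)"
    by (rule covector_eq_sum[OF cov[OF a] s]) (simp_all add: g(3))
   moreover have "(\<Sum>i<r. c i * ev (\<mu> j) (g i) q) = (\<Sum>i<r. if i = j then c j else 0)"
    using \<mu>(4) qU(3) j by (intro sum.cong) auto
   ultimately show ?thesis using j by simp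
  qed
  have e: "(\<Sum>i<r. ev (\<mu> i) X q * g i f q) = w f" for f
   using mu c by simp
  show ?thesis unfolding e uw(3) using uw(1,2) by simp
 qed
 have "local_splitting (N \<inter> U \<inter> W) \<alpha> r g (\<lambda>i. ev (\<mu> i)) (\<lambda>i. snd (\<mu> i))"
  unfolding local_splitting_def
  using g(3) cov \<mu>(3) ev\<xi> split by (auto simp: \<Lambda>_def mem_Times_iff)
 thus ?thesis
  using \<mu>(1,2) g(1,2) \<alpha>(1,2)
  by (intro exI[of _ "N \<inter> U \<inter> W"] exI[of _ r] exI[of _ g] exI[of _ "\<lambda>i. ev (\<mu> i)"] exI[of _ "\<lambda>i. snd (\<mu> i)"])
   (auto intro!: open_Int)
qed

text \<open>The G-component is chosen pointwise. It is smooth because near each point it coincides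
  with the combination of frame fields given by a local splitting.\<close>

lemma splitting:
 assumes X: "X \<in> T"
 obtains U V where "U \<in> XF" "V \<in> XG" "\<And>f p. X f p = U f p + V f p"
proof -
 have "\<forall>p. \<exists>w. w \<in> G p \<and> (\<lambda>f. X f p - w f) \<in> \<F> p"
 proof
  fix p
  obtain u w where "u \<in> \<F> p" "w \<in> G p" "\<And>f. X f p = u f + w f"
   by (rule decompose_at[OF X, of p]) blast
  thus "\<exists>w. w \<in> G p \<and> (\<lambda>f. X f p - w f) \<in> \<F> p" by (intro exI[of _ w]) simp
 qed
 then obtain w where w: "\<forall>p. w p \<in> G p \<and> (\<lambda>f. X f p - w p f) \<in> \<F> p"
  by (rule choice[THEN exE])
 define V where "V = (\<lambda>f p. w p f)"
 have VT: "V \<in> T"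
 proof (rule vf_local_field)
  fix p
  obtain \<alpha> Z W where \<alpha>: "open W" "p \<in> W" "covector \<alpha>" "Z \<in> T" "\<And>X. X \<in> X\<xi> ==> \<alpha> X = (\<lambda>_. 0)"
   "\<And>q. q \<in> W ==> \<alpha> Z q = 1" "\<And>X q. q \<in> W ==> X \<in> T ==> \<alpha> X q = 0 \<longleftrightarrow> (\<lambda>f. X f q) \<in> \<xi> q"
   by (rule contact_form[of p]) blast
  obtain N r g \<mu> Y where N: "open N" "p \<in> N" "local_splitting N \<alpha> r g \<mu> Y"
   using local_splitting_exists[OF \<alpha>(1,2,3,5,7)] by blast
  have "V f q = (\<Sum>i<r. \<mu> i X q * g i f q)" if q: "q \<in> N" for f q
  proof -
   have "(\<lambda>f. \<Sum>i<r. \<mu> i X q * g i f q) \<in> G q" "(\<lambda>f. X f q - (\<Sum>i<r. \<mu> i X q * g i f q)) \<in> \<F> q"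
    using N(3) q X unfolding local_splitting_def by blast+
   from decompose_unique(2)[OF this(2,1), of "\<lambda>f. X f q - w q f" "w q"] w
   have "(\<lambda>f. \<Sum>i<r. \<mu> i X q * g i f q) = w q" by simp
   from fun_cong[OF this, of f] show ?thesis by (simp add: V_def)
  qed
  moreover have "(\<lambda>f q. \<Sum>i<r. \<mu> i X q * g i f q) \<in> T"
   using N(3) covectorD(1) X unfolding local_splitting_def by (intro vf_sum_mem vf_smult_mem) auto
  ultimately show "\<exists>U Y. open U \<and> p \<in> U \<and> Y \<in> T \<and> (\<forall>q\<in>U. \<forall>f. V f q = Y f q)"
   using N(1,2) by blast
 qed
 have "V \<in> XG" using VT w by (simp add: sec_iff V_def)
 moreover have "(\<lambda>f p. X f p - V f p) \<in> XF" using VT X w by (simp add: sec_iff V_def)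
 ultimately show ?thesis by (intro that[of "\<lambda>f p. X f p - V f p" V]) auto
qed

lemma XF_Int_XG: "X \<in> XF ==> X \<in> XG ==> X = (\<lambda>f p. 0)"
 using F_Int_G[of "\<lambda>f. X f p" p for p] by (auto simp: sec_iff fun_eq_iff)

text \<open>A local splitting turns the equation \<omega>(X, -) = \<gamma> into linear algebra with
  an explicit solution, and a partition of unity combines the local solutions. The values of
  \<gamma> are vector fields read modulo \<xi>, which keeps the statement free of a choice of
  contact form.\<close>

lemma omega_nondegenerate:
 assumes \<gamma>: "\<And>Y. Y \<in> X\<xi> ==> \<gamma> Y \<in> T" "\<And>Y. Y \<in> XF ==> \<gamma> Y \<in> X\<xi>"
  "\<And>X Y h. X \<in> X\<xi> ==> Y \<in> X\<xi> ==> h \<in> S ==> (\<lambda>f p. \<gamma> (\<lambda>f p. X f p + h p * Y f p) f p - (\<gamma> X f p + h p * \<gamma> Y f p)) \<in> X\<xi>"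
 obtains X where "X \<in> X\<xi>" "\<And>Y. Y \<in> X\<xi> ==> (\<lambda>f p. lie X Y f p - \<gamma> Y f p) \<in> X\<xi>"
proof -
 define R where "R \<beta> X \<longleftrightarrow> X \<in> X\<xi> \<and> (\<forall>Y\<in>X\<xi>. \<forall>q. (\<lambda>f. \<beta> q * (lie X Y f q - \<gamma> Y f q)) \<in> \<xi> q)" for \<beta> X
 define Q where "Q = {\<beta>\<in>S. \<exists>X. R \<beta> X}"
 have "\<exists>\<beta>\<in>Q. \<exists>U. open U \<and> p \<in> U \<and> (\<forall>q\<in>U. \<beta> q = 1)" for p
 proof -
  obtain \<alpha> Z W where \<alpha>: "open W" "p \<in> W" "covector \<alpha>" "Z \<in> T" "\<And>X. X \<in> X\<xi> ==> \<alpha> X = (\<lambda>_. 0)"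
   "\<And>q. q \<in> W ==> \<alpha> Z q = 1" "\<And>X q. q \<in> W ==> X \<in> T ==> \<alpha> X q = 0 \<longleftrightarrow> (\<lambda>f. X f q) \<in> \<xi> q"
   by (rule contact_form[of p]) blast
  obtain N r g \<mu> Y where N: "open N" "p \<in> N" "N \<subseteq> W" "local_splitting N \<alpha> r g \<mu> Y"
   using local_splitting_exists[OF \<alpha>(1,2,3,5,7)] by blast
  have \<mu>: "\<And>i. g i \<in> T" "\<And>i. i < r ==> covector (\<mu> i)" "\<And>i. i < r ==> Y i \<in> X\<xi>"
   "\<And>i X. i < r ==> X \<in> X\<xi> ==> \<mu> i X = \<alpha> (lie (Y i) X)"
   "\<And>q X. q \<in> N ==> X \<in> T ==> (\<lambda>f. X f q - (\<Sum>i<r. \<mu> i X q * g i f q)) \<in> \<F> q"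
   using N(4) unfolding local_splitting_def by blast+
  obtain \<rho> M where \<rho>: "\<rho> \<in> S" "\<And>q. q \<notin> N ==> \<rho> q = 0" "open M" "p \<in> M" "M \<subseteq> N" "\<And>q. q \<in> M ==> \<rho> q = 1"
   by (rule local_bump[OF N(1,2)]) blast
  obtain \<beta> M' where \<beta>: "\<beta> \<in> S" "\<And>q. q \<notin> M ==> \<beta> q = 0" "open M'" "p \<in> M'" "M' \<subseteq> M" "\<And>q. q \<in> M' ==> \<beta> q = 1"
   by (rule local_bump[OF \<rho>(3,4)]) blast
  \<comment> \<open>The i-th frame field of G, corrected by a multiple of Z so that it lies in
    \<xi>, and cut off so that it is global.\<close>
  define b where "b i = (\<lambda>f q. \<rho> q * (g i f q - \<alpha> (g i) q * Z f q))" for i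
  have b: "b i \<in> X\<xi>" for i
  proof -
   have aS: "\<alpha> (g i) \<in> S" by (rule covectorD(1)[OF \<alpha>(3) \<mu>(1)])
   have m: "(\<lambda>f q. g i f q - \<alpha> (g i) q * Z f q) \<in> T" using \<mu>(1)[of i] \<alpha>(4) aS by simp
   have "(\<lambda>f. b i f q) \<in> \<xi> q" for q
   proof (cases "q \<in> N")
    case True
    have "\<alpha> (\<lambda>f q. g i f q - \<alpha> (g i) q * Z f q) q = 0"
     using covector_diff[OF \<alpha>(3) \<mu>(1), of "\<lambda>f q. \<alpha> (g i) q * Z f q"] covector_smult[OF \<alpha>(3,4) aS] \<alpha>(4) aS \<alpha>(6)[of q] True N(3)
     by auto
    hence "(\<lambda>f. g i f q - \<alpha> (g i) q * Z f q) \<in> \<xi> q" using \<alpha>(7)[OF _ m] True N(3) by auto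
    thus ?thesis unfolding b_def by (rule subspace_scale[OF xi_subsp])
   qed (simp add: b_def \<rho> subspace_zero[OF xi_subsp])
   moreover have "b i \<in> T" unfolding b_def using \<rho>(1) m by (rule vf_smult_mem)
   ultimately show ?thesis by (simp add: sec_iff)
  qed
  define \<phi> where "\<phi> X = \<alpha> (\<gamma> X)" for X
  have \<phi>S: "\<phi> X \<in> S" if "X \<in> X\<xi>" for X
   unfolding \<phi>_def using \<gamma>(1)[OF that] by (rule covectorD(1)[OF \<alpha>(3)])
  have lin: "\<phi> (\<lambda>f p. X f p + h p * X' f p) = (\<lambda>p. \<phi> X p + h p * \<phi> X' p)"
   if X: "X \<in> X\<xi>" "X' \<in> X\<xi>" "h \<in> S" for X X' h
  proof -
   have m: "\<gamma> (\<lambda>f p. X f p + h p * X' f p) \<in> T" "(\<lambda>f p. \<gamma> X f p + h p * \<gamma> X' f p) \<in> T"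
    using \<gamma>(1)[OF sections_axpy[OF xi_subsp X(3,1,2)]] \<gamma>(1)[OF X(1)] \<gamma>(1)[OF X(2)] X(3) by simp_all
   show ?thesis
    using \<alpha>(5)[OF \<gamma>(3)[OF X]] covector_diff[OF \<alpha>(3) m] covectorD(2)[OF \<alpha>(3) \<gamma>(1) \<gamma>(1), of X X' h] X
    by (simp add: \<phi>_def fun_eq_iff)
  qed
  have \<phi>F: "\<phi> X = (\<lambda>_. 0)" if "X \<in> XF" for X
   unfolding \<phi>_def using \<gamma>(2)[OF that] by (rule \<alpha>(5))
  \<comment> \<open>\<gamma> is controlled on global sections of T\<F>. Removing the T\<F>-part U
    leaves a section of \<xi> that vanishes at q, and tensoriality finishes.\<close>
  have \<phi>q: "\<phi> X q = 0" if X: "X \<in> X\<xi>" "(\<lambda>f. X f q) \<in> \<F> q" for X q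
  proof -
   obtain U V where UV: "U \<in> XF" "V \<in> XG" "\<And>f p. X f p = U f p + V f p"
    by (rule splitting[OF sec_T[OF X(1)]]) blast
   have "(\<lambda>f. V f q) = (\<lambda>_. 0)"
    using decompose_unique(2)[OF X(2) subspace_zero[OF G_subspaces], of "\<lambda>f. U f q" "\<lambda>f. V f q"] UV
    by (simp add: sec_iff)
   hence V0: "V f q = 0" for f by (rule fun_cong)
   have Veq: "V = (\<lambda>f p. X f p - U f p)" using UV(3) by (simp add: fun_eq_iff)
   have V\<xi>: "V \<in> X\<xi>" unfolding Veq by (rule sections_diff[OF xi_subsp X(1) XF_subset[OF UV(1)]])
   have "\<phi> V q = 0"
    by (rule tensorial_xi[where \<phi> = \<phi>, OF lin V\<xi> V0])
   moreover have "X = (\<lambda>f p. U f p + (\<lambda>_. 1) p * V f p)" using UV(3) by (simp add: fun_eq_iff)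
   hence "\<phi> X = (\<lambda>p. \<phi> U p + 1 * \<phi> V p)"
    using lin[OF XF_subset[OF UV(1)] V\<xi>, of "\<lambda>_. 1"] by simp
   ultimately show ?thesis using \<phi>F[OF UV(1)] by simp
  qed
  have linsum: "\<phi> (\<lambda>f p. X f p + (\<Sum>i<m. h i p * b i f p)) = (\<lambda>p. \<phi> X p + (\<Sum>i<m. h i p * \<phi> (b i) p))"
   if X: "X \<in> X\<xi>" and h: "\<And>i. i < m ==> h i \<in> S" for X h m
   using h
  proof (induction m)
   case (Suc m)
   have m: "(\<lambda>f p. X f p + (\<Sum>i<m. h i p * b i f p)) \<in> X\<xi>"
    using Suc.prems b by (intro sections_add xi_subsp X sections_sum) auto
   have "(\<lambda>f p. X f p + (\<Sum>i<Suc m. h i p * b i f p)) = (\<lambda>f p. (X f p + (\<Sum>i<m. h i p * b i f p)) + h m p * b m f p)"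
    by (simp add: add.assoc)
   thus ?case
    using lin[OF m b[of m] Suc.prems[of m]] Suc by (simp add: add.assoc)
  qed simp
  \<comment> \<open>On \<xi> the coefficients are \<mu>_i(V) = \<alpha>[Y_i, V], and \<alpha>(Y_i) =
    0; so this X has \<alpha>[X, V] equal to the sum of the \<phi>(b_i) \<mu>_i(V), which has to be
    \<phi>(V).\<close>
  define X where "X = (\<lambda>f p. \<Sum>i<r. \<phi> (b i) p * Y i f p)"
  have X\<xi>: "X \<in> X\<xi>" unfolding X_def using \<phi>S b \<mu>(3) by (intro sections_sum xi_subsp) auto
  have "(\<lambda>f. lie X V f q - \<gamma> V f q) \<in> \<xi> q" if q: "q \<in> M" and V: "V \<in> X\<xi>" for q V
  proof -
   have qN: "q \<in> N" "q \<in> W" "\<rho> q = 1" using q \<rho> N(3) by auto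
   note VT = sec_T[OF V]
   have \<mu>S: "\<mu> i V \<in> S" if "i < r" for i by (rule covectorD(1)[OF \<mu>(2)[OF that] VT])
   \<comment> \<open>V minus its components along the b_i. It lies in T\<F> at q: the multiples of Z
     add up to \<alpha> of the G-part of V, which is 0 because V and its T\<F>-part both lie in
     \<xi>.\<close>
   define V' where "V' = (\<lambda>f p. V f p + (\<Sum>i<r. (- \<mu> i V p) * b i f p))"
   have V': "V' \<in> X\<xi>" unfolding V'_def using b \<mu>S by (intro sections_add xi_subsp V sections_sum) auto
   have m: "(\<lambda>f p. \<Sum>i<r. \<mu> i V p * g i f p) \<in> T" using \<mu>(1) \<mu>S by (intro vf_sum_mem vf_smult_mem) auto
   have F: "(\<lambda>f. V f q - (\<Sum>i<r. \<mu> i V q * g i f q)) \<in> \<F> q" by (rule \<mu>(5)[OF qN(1) VT])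
   have "\<alpha> (\<lambda>f p. V f p - (\<Sum>i<r. \<mu> i V p * g i f p)) q = 0"
    using \<alpha>(7)[OF qN(2) vf_diff_mem[OF VT m]] char_dist_subset[OF F] by simp
   hence "\<alpha> (\<lambda>f p. \<Sum>i<r. \<mu> i V p * g i f p) q = 0"
    using covector_diff[OF \<alpha>(3) VT m] \<alpha>(5)[OF V] by simp
   hence z: "(\<Sum>i<r. \<mu> i V q * \<alpha> (g i) q) = 0"
    using covector_sum[OF \<alpha>(3), of "{..<r}" "\<lambda>i. \<mu> i V" g] \<mu>(1) \<mu>S by simp
   have "V' f q = V f q - (\<Sum>i<r. \<mu> i V q * g i f q) + (\<Sum>i<r. \<mu> i V q * \<alpha> (g i) q) * Z f q" for f
    by (simp add: V'_def b_def qN(3) sum_negf sum_subtractf sum_distrib_left algebra_simps)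
   hence "(\<lambda>f. V' f q) \<in> \<F> q" using F z by simp
   hence "\<phi> V' q = 0" by (rule \<phi>q[OF V'])
   moreover have "\<phi> V' = (\<lambda>p. \<phi> V p + (\<Sum>i<r. (- \<mu> i V p) * \<phi> (b i) p))"
    unfolding V'_def using \<mu>S by (intro linsum V) simp
   ultimately have e: "\<phi> V q = (\<Sum>i<r. \<mu> i V q * \<phi> (b i) q)" by (simp add: sum_negf)
   have YT: "Y i \<in> T" if "i < r" for i using sec_T[OF \<mu>(3)[OF that]] .
   have m1: "(\<lambda>f p. \<Sum>i<r. \<phi> (b i) p * lie (Y i) V f p) \<in> T" "(\<lambda>f p. \<Sum>i<r. V (\<phi> (b i)) p * Y i f p) \<in> T"
    using YT VT \<phi>S b vf_mem[OF VT] by (auto intro!: vf_sum_mem vf_smult_mem)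
   have lXV: "lie X V = (\<lambda>f p. (\<Sum>i<r. \<phi> (b i) p * lie (Y i) V f p) - (\<Sum>i<r. V (\<phi> (b i)) p * Y i f p))"
    unfolding X_def using YT \<phi>S b by (intro lie_sum_left VT) auto
   have "\<alpha> (lie X V) q = \<alpha> (\<lambda>f p. \<Sum>i<r. \<phi> (b i) p * lie (Y i) V f p) q - \<alpha> (\<lambda>f p. \<Sum>i<r. V (\<phi> (b i)) p * Y i f p) q"
    unfolding lXV using covector_diff[OF \<alpha>(3) m1] by simp
   also have "\<alpha> (\<lambda>f p. \<Sum>i<r. V (\<phi> (b i)) p * Y i f p) q = (\<Sum>i<r. V (\<phi> (b i)) q * \<alpha> (Y i) q)"
    using covector_sum[OF \<alpha>(3), of "{..<r}" "\<lambda>i. V (\<phi> (b i))" Y] YT vf_mem[OF VT] by simp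
   also have "\<dots> = 0" using \<alpha>(5)[OF \<mu>(3)] by simp
   also have "\<alpha> (\<lambda>f p. \<Sum>i<r. \<phi> (b i) p * lie (Y i) V f p) q = (\<Sum>i<r. \<phi> (b i) q * \<alpha> (lie (Y i) V) q)"
    using covector_sum[OF \<alpha>(3), of "{..<r}" "\<lambda>i. \<phi> (b i)" "\<lambda>i. lie (Y i) V"] YT VT \<phi>S b by simp
   also have "\<dots> = \<phi> V q" unfolding e using \<mu>(4)[OF _ V] by (intro sum.cong) (auto simp: mult.commute)
   finally have "\<alpha> (lie X V) q - \<alpha> (\<gamma> V) q = 0" by (simp add: \<phi>_def)
   moreover have m2: "lie X V \<in> T" "\<gamma> V \<in> T" using sec_T[OF X\<xi>] VT \<gamma>(1)[OF V] by simp_all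
   ultimately show ?thesis
    using covector_diff[OF \<alpha>(3) m2] \<alpha>(7)[OF qN(2) vf_diff_mem[OF m2]] by simp
  qed
  hence "(\<lambda>f. \<beta> q * (lie X V f q - \<gamma> V f q)) \<in> \<xi> q" if "V \<in> X\<xi>" for V q
   using that subspace_scale[OF xi_subsp] subspace_zero[OF xi_subsp] \<beta>(2)[of q]
   by (cases "q \<in> M") auto
  hence "R \<beta> X" using X\<xi> by (simp add: R_def)
  hence "\<beta> \<in> Q" unfolding Q_def using \<beta>(1) by blast
  thus ?thesis using \<beta>(3,4,6) by blast
 qed
 moreover have "Q \<subseteq> S" by (auto simp: Q_def)
 ultimately obtain \<beta> c where \<beta>c: "\<And>j::nat. \<beta> j \<in> Q" "\<And>j. c j \<in> S"
  "\<And>p. \<exists>U n. open U \<and> p \<in> U \<and> (\<forall>q\<in>U. (\<Sum>j<n. c j q * \<beta> j q) = 1 \<and> (\<forall>j\<ge>n. c j q = 0))"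
  by (rule partition_of_unity) blast
 have \<beta>S: "\<beta> j \<in> S" for j using \<beta>c(1)[of j] by (simp add: Q_def)
 have "\<forall>j. \<exists>a. R (\<beta> j) a"
  using \<beta>c(1) unfolding Q_def by blast
 then obtain X where "\<forall>j. R (\<beta> j) (X j)"
  by (rule choice[THEN exE])
 hence X: "\<And>j. X j \<in> X\<xi>" "\<And>j Y q. Y \<in> X\<xi> ==> (\<lambda>f. \<beta> j q * (lie (X j) Y f q - \<gamma> Y f q)) \<in> \<xi> q"
  unfolding R_def by blast+
 define \<psi> where "\<psi> j p = c j p * \<beta> j p" for j p
 have \<psi>: "\<psi> j \<in> S" for j unfolding \<psi>_def[abs_def] using \<beta>c(2) \<beta>S by simp
 have fin: "\<exists>U n. open U \<and> p \<in> U \<and> (\<forall>q\<in>U. (\<Sum>j<n. \<psi> j q) = 1 \<and> (\<forall>j\<ge>n. \<psi> j q = 0))" for p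
  using \<beta>c(3)[of p] unfolding \<psi>_def by (metis mult_zero_left)
 define V where "V = vf_suminf (\<lambda>j f p. \<psi> j p * X j f p)"
 have VU: "\<exists>U n. open U \<and> p \<in> U \<and> (\<Sum>j<n. \<psi> j p) = 1 \<and> (\<forall>q\<in>U. \<forall>f. V f q = (\<Sum>j<n. \<psi> j q * X j f q))" for p
 proof -
  obtain U n where U: "open U" "p \<in> U" "\<forall>q\<in>U. (\<Sum>j<n. \<psi> j q) = 1 \<and> (\<forall>j\<ge>n. \<psi> j q = 0)"
   using fin[of p] by blast
  hence "\<forall>q\<in>U. \<forall>f. V f q = (\<Sum>j<n. \<psi> j q * X j f q)"
   unfolding V_def by (auto intro!: vf_suminf_eq)
  with U show ?thesis by (intro exI[of _ U] exI[of _ n]) simp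
 qed
 have VT: "V \<in> T"
 proof (rule vf_local_field)
  fix p
  obtain U n where U: "open U" "p \<in> U" "\<forall>q\<in>U. \<forall>f. V f q = (\<Sum>j<n. \<psi> j q * X j f q)"
   using VU[of p] by blast
  moreover have "(\<lambda>f q. \<Sum>j<n. \<psi> j q * X j f q) \<in> T"
   using \<psi> sec_T[OF X(1)] by (intro vf_sum_mem vf_smult_mem) auto
  ultimately show "\<exists>U Y. open U \<and> p \<in> U \<and> Y \<in> T \<and> (\<forall>q\<in>U. \<forall>f. V f q = Y f q)" by blast
 qed
 have "(\<lambda>f. V f p) \<in> \<xi> p" for p
 proof -
  obtain U n where U: "p \<in> U" "\<forall>q\<in>U. \<forall>f. V f q = (\<Sum>j<n. \<psi> j q * X j f q)"
   using VU[of p] by blast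
  hence e: "(\<lambda>f. V f p) = (\<lambda>f. \<Sum>j<n. \<psi> j p * X j f p)" by auto
  show ?thesis unfolding e using X(1) by (intro subspace_sum xi_subsp) (simp add: sec_iff)
 qed
 hence V\<xi>: "V \<in> X\<xi>" using VT by (simp add: sec_iff)
 have "(\<lambda>f p. lie V Y f p - \<gamma> Y f p) \<in> X\<xi>" if Y: "Y \<in> X\<xi>" for Y
 proof -
  note YT = sec_T[OF Y]
  have "(\<lambda>f. lie V Y f p - \<gamma> Y f p) \<in> \<xi> p" for p
  proof -
   obtain U n where U: "open U" "p \<in> U" "(\<Sum>j<n. \<psi> j p) = 1" "\<forall>q\<in>U. \<forall>f. V f q = (\<Sum>j<n. \<psi> j q * X j f q)"
    using VU[of p] by blast
   have m: "(\<lambda>f q. \<Sum>j<n. \<psi> j q * X j f q) \<in> T"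
    using \<psi> sec_T[OF X(1)] by (intro vf_sum_mem vf_smult_mem) auto
   \<comment> \<open>Differentiating the partition of unity costs the terms Y(\<psi>_j) X_j, which
     lie in \<xi>.\<close>
   have 1: "lie V Y f p = (\<Sum>j<n. \<psi> j p * lie (X j) Y f p) - (\<Sum>j<n. Y (\<psi> j) p * X j f p)" for f
   proof -
    have "lie V Y f p = lie (\<lambda>f q. \<Sum>j<n. \<psi> j q * X j f q) Y f p"
     using U(4) by (intro lie_local[OF YT VT m U(1,2)]) simp
    thus ?thesis
     using lie_sum_left[OF YT, of "{..<n}" X \<psi>] sec_T[OF X(1)] \<psi> by simp
   qed
   have 2: "\<gamma> Y f p = (\<Sum>j<n. \<psi> j p * \<gamma> Y f p)" for f
    using U(3) by (simp add: sum_distrib_right[symmetric])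
   have "lie V Y f p - \<gamma> Y f p = (\<Sum>j<n. c j p * (\<beta> j p * (lie (X j) Y f p - \<gamma> Y f p))) + (- 1) * (\<Sum>j<n. Y (\<psi> j) p * X j f p)" for f
    unfolding 1 by (subst 2) (simp add: sum_subtractf right_diff_distrib \<psi>_def mult.assoc)
   hence e: "(\<lambda>f. lie V Y f p - \<gamma> Y f p) =
     (\<lambda>f. (\<Sum>j<n. c j p * (\<beta> j p * (lie (X j) Y f p - \<gamma> Y f p))) + (- 1) * (\<Sum>j<n. Y (\<psi> j) p * X j f p))"
    by (rule ext)
   show ?thesis
    unfolding e using X Y by (intro subspace_axpy subspace_sum xi_subsp) (simp_all add: sec_iff)
  qed
  thus ?thesis using VT YT \<gamma>(1)[OF Y] by (simp add: sec_iff)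
 qed
 with V\<xi> show ?thesis by (rule that)
qed

end

section \<open>Quotient modules\<close>

text \<open>A linear \<kappa> with kernel exactly H descends to an injective map on cosets, which is
  what \<open>fun_module\<close> asks of the quotient.\<close>

locale quot_fun_module = fun_module S M \<iota>
 for S :: "('a => real) set" and M :: "('a => real, 'm) module" (structure) and \<iota> :: "'m => 'i => 'a => real" +
 fixes H :: "'m set" and \<kappa> :: "'m => 'j => 'a => real"
 assumes sub: "H \<subseteq> carrier M"
  and \<kappa>_add: "x \<in> carrier M ==> y \<in> carrier M ==> \<kappa> (x \<oplus> y) i p = \<kappa> x i p + \<kappa> y i p"
  and \<kappa>_smult: "r \<in> S ==> x \<in> carrier M ==> \<kappa> (r \<odot> x) i p = r p * \<kappa> x i p"
  and \<kappa>_kernel: "x \<in> carrier M ==> x \<in> H \<longleftrightarrow> (\<forall>i p. \<kappa> x i p = 0)"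
begin

lemma \<kappa>_H: "h \<in> H ==> \<kappa> h i p = 0"
 using \<kappa>_kernel[of h] sub by auto

lemma \<kappa>_zero: "\<kappa> \<zero> i p = 0"
 using \<kappa>_add[of \<zero> \<zero> i p] by simp

lemma \<kappa>_diff: "x \<in> carrier M ==> y \<in> carrier M ==> \<kappa> (x \<ominus> y) i p = \<kappa> x i p - \<kappa> y i p"
 using \<kappa>_add[of "x \<ominus> y" y i p] by (simp add: a_minus_def a_assoc l_neg)

lemma diff_H: "x \<in> carrier M ==> y \<in> carrier M ==> x \<ominus> y \<in> H \<longleftrightarrow> (\<forall>i p. \<kappa> x i p = \<kappa> y i p)"
 using \<kappa>_kernel[of "x \<ominus> y"] by (simp add: \<kappa>_diff)

lemma coset_iff:
 assumes x: "x \<in> carrier M"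
 shows "z \<in> H +> x \<longleftrightarrow> z \<in> carrier M \<and> (\<forall>i p. \<kappa> z i p = \<kappa> x i p)"
proof
 assume "z \<in> H +> x"
 thus "z \<in> carrier M \<and> (\<forall>i p. \<kappa> z i p = \<kappa> x i p)"
  using x sub by (auto simp: coset_eq \<kappa>_add \<kappa>_H subset_iff)
next
 assume z: "z \<in> carrier M \<and> (\<forall>i p. \<kappa> z i p = \<kappa> x i p)"
 hence "z \<ominus> x \<in> H" using x diff_H[of z x] by simp
 moreover have "z = (z \<ominus> x) \<oplus> x" using x z by (intro eqI) auto
 ultimately show "z \<in> H +> x" unfolding coset_eq by blast
qed

lemma coset_eq_iff:
 "x \<in> carrier M ==> y \<in> carrier M ==> H +> x = H +> y \<longleftrightarrow> (\<forall>i p. \<kappa> x i p = \<kappa> y i p)"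
 using coset_iff[of x] coset_iff[of y] by (metis (no_types, lifting) subsetI subset_antisym)

lemma coset_eq_diff: "x \<in> carrier M ==> y \<in> carrier M ==> H +> x = H +> y \<longleftrightarrow> x \<ominus> y \<in> H"
 by (simp add: coset_eq_iff diff_H)

text \<open>\<open>induced\<close> is meaningful only if the map is constant on the coset; each use
  of it is justified through this rule.\<close>

lemma induced_coset:
 assumes x: "x \<in> carrier M" and f: "\<And>y. y \<in> carrier M ==> y \<ominus> x \<in> H ==> f y = f x"
 shows "induced f (H +> x) = f x"
proof -
 have "f ` (H +> x) = (\<lambda>_. f x) ` (H +> x)"
  using x by (intro image_cong refl f) (simp_all add: coset_iff diff_H)
 also have "\<dots> = {f x}"
 proof -
  have "x \<in> H +> x" using x by (simp add: coset_iff)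
  thus ?thesis by auto
 qed
 finally have "f ` (H +> x) = {f x}" .
 thus ?thesis by (simp add: induced_def)
qed

lemma quot_carrier: "carrier (quot_module M H) = (\<lambda>x. H +> x) ` carrier M"
 by (auto simp: quot_module_def A_RCOSETS_def RCOSETS_def a_r_coset_def)

lemma quot_zero: "\<zero>\<^bsub>quot_module M H\<^esub> = H +> \<zero>"
 using sub by (auto simp: quot_module_def coset_iff \<kappa>_zero \<kappa>_kernel)

lemma quot_add:
 assumes "x \<in> carrier M" "y \<in> carrier M"
 shows "(H +> x) \<oplus>\<^bsub>quot_module M H\<^esub> (H +> y) = H +> (x \<oplus> y)"
proof -
 have "set_add M (H +> x) (H +> y) = H +> (x \<oplus> y)"
 proof (intro Set.set_eqI iffI)
  fix z assume "z \<in> set_add M (H +> x) (H +> y)"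
  then obtain a b where "a \<in> H +> x" "b \<in> H +> y" "z = a \<oplus> b"
   by (auto simp: set_add_def set_mult_def)
  thus "z \<in> H +> (x \<oplus> y)" using assms by (simp add: coset_iff \<kappa>_add)
 next
  fix z assume z: "z \<in> H +> (x \<oplus> y)"
  hence "z \<ominus> y \<in> H +> x" "y \<in> H +> y" "z = (z \<ominus> y) \<oplus> y"
   using assms by (auto simp: coset_iff \<kappa>_add \<kappa>_diff intro!: eqI)
  thus "z \<in> set_add M (H +> x) (H +> y)" by (auto simp: set_add_def set_mult_def)
 qed
 thus ?thesis by (simp add: quot_module_def)
qed

lemma quot_smult:
 assumes "r \<in> S" "x \<in> carrier M"
 shows "r \<odot>\<^bsub>quot_module M H\<^esub> (H +> x) = H +> (r \<odot> x)"
proof -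
 have "(\<Union>y\<in>H +> x. H +> (r \<odot> y)) = (\<Union>y\<in>H +> x. H +> (r \<odot> x))"
  using assms by (intro SUP_cong refl) (simp add: coset_iff coset_eq_iff \<kappa>_smult)
 also have "\<dots> = H +> (r \<odot> x)"
 proof -
  have "x \<in> H +> x" using assms by (simp add: coset_iff)
  thus ?thesis by auto
 qed
 finally show ?thesis by (simp add: quot_module_def)
qed

lemma fun_module_quot: "fun_module S (quot_module M H) (induced \<kappa>)"
proof -
 have ind: "induced \<kappa> (H +> x) = \<kappa> x" if "x \<in> carrier M" for x
  using that by (intro induced_coset ext) (simp_all add: diff_H)
 have "inj_on (induced \<kappa>) (carrier (quot_module M H))"
 proof (rule inj_onI)
  fix B C assume "B \<in> carrier (quot_module M H)" "C \<in> carrier (quot_module M H)" and eq: "induced \<kappa> B = induced \<kappa> C"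
  then obtain x y where xy: "x \<in> carrier M" "B = H +> x" "y \<in> carrier M" "C = H +> y"
   by (auto simp: quot_carrier)
  hence "\<kappa> x = \<kappa> y" using eq by (simp add: ind)
  thus "B = C" using xy coset_eq_iff[of x y] by simp
 qed
 thus ?thesis
  by unfold_locales
   (auto simp: quot_carrier quot_zero quot_add quot_smult ind const_mem \<kappa>_zero \<kappa>_add \<kappa>_smult)
qed

end

section \<open>The line bundle and the normal bundle\<close>

context precontact_splitting
begin

abbreviation "\<L> \<equiv> ell A \<xi>"
abbreviation (input) l_add (infixl "+\<^sub>l" 65) where "s +\<^sub>l t \<equiv> s \<oplus>\<^bsub>\<L>\<^esub> t"
abbreviation (input) l_diff (infixl "-\<^sub>l" 65) where "s -\<^sub>l t \<equiv> s \<ominus>\<^bsub>\<L>\<^esub> t"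
abbreviation (input) l_neg ("-\<^sub>l _" [81] 80) where "-\<^sub>l s \<equiv> \<ominus>\<^bsub>\<L>\<^esub> s"
abbreviation (input) l_smult (infixl "*\<^sub>l" 70) where "f *\<^sub>l s \<equiv> f \<odot>\<^bsub>\<L>\<^esub> s"
abbreviation (input) l_zero ("0\<^sub>l") where "0\<^sub>l \<equiv> \<zero>\<^bsub>\<L>\<^esub>"
abbreviation "Sec \<equiv> carrier \<L>"
abbreviation "TFm \<equiv> TF A \<xi>"
abbreviation "th \<equiv> theta A \<xi>"
abbreviation "nf \<equiv> mod_TF A \<xi>"

text \<open>Bundles the conditions so that one pair can be fixed as constants: the realisation of
  \<ell> is a parameter of the sublocale and must not vary from lemma to lemma.\<close>

definition proj_conn :: "('a vfield => 'a vfield) \<times> ('a vfield => 'a vfield => 'a vfield) => bool" where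
 "proj_conn = (\<lambda>(P, C).
  (\<forall>Y\<in>T. P Y \<in> T) \<and>
  (\<forall>Y\<in>T. \<forall>Y'\<in>T. \<forall>h\<in>S. P (\<lambda>f p. Y f p + h p * Y' f p) = (\<lambda>f p. P Y f p + h p * P Y' f p)) \<and>
  (\<forall>Y\<in>T. (\<lambda>f p. P Y f p - Y f p) \<in> X\<xi>) \<and> (\<forall>Y\<in>X\<xi>. P Y = (\<lambda>f p. 0)) \<and>
  (\<forall>X\<in>T. \<forall>Y\<in>T. C X Y \<in> T) \<and>
  (\<forall>X\<in>T. \<forall>Y\<in>T. \<forall>Y'\<in>T. \<forall>h\<in>S.
   C X (\<lambda>f p. Y f p + h p * Y' f p) = (\<lambda>f p. C X Y f p + h p * C X Y' f p + X h p * P Y' f p)) \<and>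
  (\<forall>X\<in>T. \<forall>Y\<in>X\<xi>. C X Y = (\<lambda>f p. 0)))"

definition ellP :: "'a vfield => 'a vfield" where "ellP = fst (SOME PC. proj_conn PC)"
definition ellC :: "'a vfield => 'a vfield => 'a vfield" where "ellC = snd (SOME PC. proj_conn PC)"

lemma proj_conn: "proj_conn (ellP, ellC)"
proof -
 have "\<exists>PC. proj_conn PC"
 proof (rule xi_projector_connection)
  fix P C
  assume a: "\<And>Y. Y \<in> T ==> P Y \<in> T"
   "\<And>Y Y' h. Y \<in> T ==> Y' \<in> T ==> h \<in> S ==> P (\<lambda>f p. Y f p + h p * Y' f p) = (\<lambda>f p. P Y f p + h p * P Y' f p)"
   "\<And>Y. Y \<in> T ==> (\<lambda>f p. P Y f p - Y f p) \<in> X\<xi>"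
   "\<And>Y. Y \<in> X\<xi> ==> P Y = (\<lambda>f p. 0)"
   "\<And>X Y. X \<in> T ==> Y \<in> T ==> C X Y \<in> T"
   "\<And>X Y Y' h. X \<in> T ==> Y \<in> T ==> Y' \<in> T ==> h \<in> S ==>
    C X (\<lambda>f p. Y f p + h p * Y' f p) = (\<lambda>f p. C X Y f p + h p * C X Y' f p + X h p * P Y' f p)"
   "\<And>X Y. X \<in> T ==> Y \<in> X\<xi> ==> C X Y = (\<lambda>f p. 0)"
  have "proj_conn (P, C)"
   unfolding proj_conn_def prod.case by (intro conjI ballI a)
  thus ?thesis by blast
 qed
 hence "proj_conn (SOME PC. proj_conn PC)" by (rule someI_ex)
 thus ?thesis by (simp add: ellP_def ellC_def)
qed

lemma ellP:
 shows "Y \<in> T ==> ellP Y \<in> T"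
  and "Y \<in> T ==> Y' \<in> T ==> h \<in> S ==> ellP (\<lambda>f p. Y f p + h p * Y' f p) = (\<lambda>f p. ellP Y f p + h p * ellP Y' f p)"
  and "Y \<in> T ==> (\<lambda>f p. ellP Y f p - Y f p) \<in> X\<xi>"
  and "Y \<in> X\<xi> ==> ellP Y = (\<lambda>f p. 0)"
 using proj_conn unfolding proj_conn_def prod.case by blast+

lemma ellC:
 shows "X \<in> T ==> Y \<in> T ==> ellC X Y \<in> T"
  and "X \<in> T ==> Y \<in> T ==> Y' \<in> T ==> h \<in> S ==>
   ellC X (\<lambda>f p. Y f p + h p * Y' f p) = (\<lambda>f p. ellC X Y f p + h p * ellC X Y' f p + X h p * ellP Y' f p)"
  and "X \<in> T ==> Y \<in> X\<xi> ==> ellC X Y = (\<lambda>f p. 0)"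
 using proj_conn unfolding proj_conn_def prod.case by blast+

lemma TC_minus [simp]: "X \<in> T ==> Y \<in> T ==> X \<ominus>\<^bsub>TC A\<^esub> Y = (\<lambda>f p. X f p - Y f p)"
 by (intro ext TC.minus_val)

lemma quot_ell: "quot_fun_module S (TC A) (\<lambda>X. X) X\<xi> ellP"
proof unfold_locales
 show "X\<xi> \<subseteq> T" using sec_T by blast
 have z: "ellP (\<lambda>f p. 0) = (\<lambda>f p. 0)" by (rule ellP(4)[OF sections_zero[OF xi_subsp]])
 fix x y i p r
 show "ellP (x \<oplus>\<^bsub>TC A\<^esub> y) i p = ellP x i p + ellP y i p" if "x \<in> T" "y \<in> T"
  using ellP(2)[OF that, of "\<lambda>_. 1"] by simp
 show "ellP (r \<odot>\<^bsub>TC A\<^esub> x) i p = r p * ellP x i p" if "r \<in> S" "x \<in> T"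
  using ellP(2)[of "\<lambda>f p. 0" x r] that z by simp
 show "x \<in> X\<xi> \<longleftrightarrow> (\<forall>i p. ellP x i p = 0)" if "x \<in> T"
 proof
  assume "\<forall>i p. ellP x i p = 0"
  hence "(\<lambda>f p. - x f p) \<in> X\<xi>" using ellP(3)[OF that] by simp
  hence "(\<lambda>f p. - 1 * (- x f p)) \<in> X\<xi>"
   using sections_smult[OF xi_subsp, of "\<lambda>_. - 1" "\<lambda>f p. - x f p"] by simp
  thus "x \<in> X\<xi>" by simp
 qed (simp add: ellP(4))
qed

sublocale qell: quot_fun_module S "TC A" "\<lambda>X. X" X\<xi> ellP
 by (rule quot_ell)

sublocale ell: fun_module S \<L> "induced ellP"
 unfolding ell_def by (rule qell.fun_module_quot)

lemma th_mem [simp]: "X \<in> T ==> th X \<in> Sec"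
 by (simp add: ell_def qell.quot_carrier theta_def)

lemma ell_cases:
 assumes "s \<in> Sec"
 obtains X where "X \<in> T" "s = th X"
 using assms by (auto simp: ell_def qell.quot_carrier theta_def)

lemma th_eq_iff: "X \<in> T ==> Y \<in> T ==> th X = th Y \<longleftrightarrow> (\<lambda>f p. X f p - Y f p) \<in> X\<xi>"
 using qell.coset_eq_diff[of X Y] by (simp add: theta_def)

lemma th_eq: "X \<in> T ==> Y \<in> T ==> (\<lambda>f p. X f p - Y f p) \<in> X\<xi> ==> th X = th Y"
 by (simp add: th_eq_iff)

lemma th_add: "X \<in> T ==> Y \<in> T ==> th X +\<^sub>l th Y = th (\<lambda>f p. X f p + Y f p)"
 using qell.quot_add[of X Y] by (simp add: theta_def ell_def)

lemma th_smult: "h \<in> S ==> X \<in> T ==> h *\<^sub>l th X = th (\<lambda>f p. h p * X f p)"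
 using qell.quot_smult[of h X] by (simp add: theta_def ell_def)

lemma ell_zero: "0\<^sub>l = th (\<lambda>f p. 0)"
 using qell.quot_zero by (simp add: theta_def ell_def)

lemma th_zero_iff: "X \<in> T ==> th X = 0\<^sub>l \<longleftrightarrow> X \<in> X\<xi>"
 by (simp add: ell_zero th_eq_iff)

lemma th_minus: "X \<in> T ==> Y \<in> T ==> th X -\<^sub>l th Y = th (\<lambda>f p. X f p - Y f p)"
proof (rule ell.eqI)
 assume XY: "X \<in> T" "Y \<in> T"
 have "th X = th (\<lambda>f p. X f p - Y f p) +\<^sub>l th Y" using XY by (simp add: th_add)
 thus "induced ellP (th X -\<^sub>l th Y) i p = induced ellP (th (\<lambda>f p. X f p - Y f p)) i p" for i p
  using XY by simp
qed simp_all

lemma induced_th: "X \<in> T ==> (\<And>Y. Y \<in> T ==> (\<lambda>f p. Y f p - X f p) \<in> X\<xi> ==> f Y = f X) ==> induced f (th X) = f X"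
 unfolding theta_def by (rule qell.induced_coset) simp_all

section \<open>The normal bundle of the foliation\<close>

definition projG :: "'a vfield => 'a vfield" where
 "projG X = (THE V. V \<in> XG \<and> (\<lambda>f p. X f p - V f p) \<in> XF)"

lemma projG_unique:
 assumes "V \<in> XG" "V' \<in> XG" "(\<lambda>f p. X f p - V f p) \<in> XF" "(\<lambda>f p. X f p - V' f p) \<in> XF"
 shows "V = V'"
proof -
 have "(\<lambda>f p. V f p - V' f p) \<in> XG" by (rule sections_diff[OF G_subspaces assms(1,2)])
 moreover have "(\<lambda>f p. (X f p - V' f p) - (X f p - V f p)) \<in> XF"
  by (rule sections_diff[OF F_subspaces assms(4,3)])
 ultimately have "(\<lambda>f p. V f p - V' f p) = (\<lambda>f p. 0)" by (intro XF_Int_XG) simp_all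
 thus ?thesis by (simp add: fun_eq_iff)
qed

lemma projG:
 assumes "X \<in> T"
 shows "projG X \<in> XG" "(\<lambda>f p. X f p - projG X f p) \<in> XF"
proof -
 obtain U V where UV: "U \<in> XF" "V \<in> XG" "\<And>f p. X f p = U f p + V f p"
  by (rule splitting[OF assms]) blast
 hence "(\<lambda>f p. X f p - V f p) = U" by (simp add: fun_eq_iff)
 hence "V \<in> XG \<and> (\<lambda>f p. X f p - V f p) \<in> XF" using UV by simp
 hence "\<exists>!V. V \<in> XG \<and> (\<lambda>f p. X f p - V f p) \<in> XF"
  using projG_unique by blast
 from theI'[OF this] have "projG X \<in> XG \<and> (\<lambda>f p. X f p - projG X f p) \<in> XF"
  unfolding projG_def .
 thus "projG X \<in> XG" "(\<lambda>f p. X f p - projG X f p) \<in> XF" by auto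
qed

lemma projG_eq: "X \<in> T ==> V \<in> XG ==> (\<lambda>f p. X f p - V f p) \<in> XF ==> projG X = V"
 using projG[of X] projG_unique by blast

lemma projG_axpy:
 assumes "X \<in> T" "Y \<in> T" "h \<in> S"
 shows "projG (\<lambda>f p. X f p + h p * Y f p) = (\<lambda>f p. projG X f p + h p * projG Y f p)"
proof (rule projG_eq)
 show "(\<lambda>f p. projG X f p + h p * projG Y f p) \<in> XG"
  using projG assms by (intro sections_axpy G_subspaces)
 have "(\<lambda>f p. (X f p - projG X f p) + h p * (Y f p - projG Y f p)) \<in> XF"
  using projG assms by (intro sections_axpy F_subspaces)
 thus "(\<lambda>f p. X f p + h p * Y f p - (projG X f p + h p * projG Y f p)) \<in> XF"
  by (simp add: algebra_simps)
qed (use assms in simp)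

lemma projG_F: "X \<in> XF ==> projG X = (\<lambda>f p. 0)"
 by (intro projG_eq sections_zero G_subspaces) (simp_all add: sec_T)

lemma projG_G: "X \<in> XG ==> projG X = X"
 by (intro projG_eq) (simp_all add: sec_T sections_zero[OF F_subspaces])

lemma quot_NF: "quot_fun_module S (TC A) (\<lambda>X. X) XF projG"
proof unfold_locales
 show "XF \<subseteq> T" using sec_T by blast
 have z: "projG (\<lambda>f p. 0) = (\<lambda>f p. 0)" by (rule projG_F[OF sections_zero[OF F_subspaces]])
 fix x y i p r
 show "projG (x \<oplus>\<^bsub>TC A\<^esub> y) i p = projG x i p + projG y i p" if "x \<in> T" "y \<in> T"
  using projG_axpy[OF that, of "\<lambda>_. 1"] by simp
 show "projG (r \<odot>\<^bsub>TC A\<^esub> x) i p = r p * projG x i p" if "r \<in> S" "x \<in> T"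
  using projG_axpy[of "\<lambda>f p. 0" x r] that z by simp
 show "x \<in> XF \<longleftrightarrow> (\<forall>i p. projG x i p = 0)" if "x \<in> T"
  using projG(2)[OF that] by (auto simp: projG_F)
qed

sublocale qNF: quot_fun_module S "TC A" "\<lambda>X. X" XF projG
 by (rule quot_NF)

lemma TF_carrier [simp]: "carrier (TFm) = XF"
 by (simp add: TF_def)

lemma TF_ops: "\<zero>\<^bsub>TFm\<^esub> = (\<lambda>f p. 0)" "X \<oplus>\<^bsub>TFm\<^esub> Y = (\<lambda>f p. X f p + Y f p)" "h \<odot>\<^bsub>TFm\<^esub> X = (\<lambda>f p. h p * X f p)"
 using TC_simps by (simp_all add: TF_def)

sublocale NF: fun_module S "NF A \<xi>" "induced projG"
 unfolding NF_def TF_carrier by (rule qNF.fun_module_quot)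

sublocale TF: fun_module S "TFm" "\<lambda>X. X"
 unfolding TF_def using sec_T sections_zero[OF F_subspaces] sections_add[OF F_subspaces] sections_smult[OF F_subspaces]
 by (intro TC.sub) auto

lemma nf_mem [simp]: "X \<in> T ==> nf X \<in> carrier (NF A \<xi>)"
 by (simp add: NF_def qNF.quot_carrier mod_TF_def)

lemma NF_cases:
 assumes "s \<in> carrier (NF A \<xi>)"
 obtains X where "X \<in> T" "s = nf X"
 using assms by (auto simp: NF_def qNF.quot_carrier mod_TF_def)

lemma nf_eq_iff: "X \<in> T ==> Y \<in> T ==> nf X = nf Y \<longleftrightarrow> (\<lambda>f p. X f p - Y f p) \<in> XF"
 using qNF.coset_eq_diff[of X Y] by (simp add: mod_TF_def)

lemma nf_add: "X \<in> T ==> Y \<in> T ==> nf X \<oplus>\<^bsub>NF A \<xi>\<^esub> nf Y = nf (\<lambda>f p. X f p + Y f p)"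
 using qNF.quot_add[of X Y] by (simp add: mod_TF_def NF_def)

lemma nf_smult: "h \<in> S ==> X \<in> T ==> h \<odot>\<^bsub>NF A \<xi>\<^esub> nf X = nf (\<lambda>f p. h p * X f p)"
 using qNF.quot_smult[of h X] by (simp add: mod_TF_def NF_def)

lemma nf_minus: "X \<in> T ==> Y \<in> T ==> nf X \<ominus>\<^bsub>NF A \<xi>\<^esub> nf Y = nf (\<lambda>f p. X f p - Y f p)"
proof (rule NF.eqI)
 assume XY: "X \<in> T" "Y \<in> T"
 have "nf X = nf (\<lambda>f p. X f p - Y f p) \<oplus>\<^bsub>NF A \<xi>\<^esub> nf Y" using XY by (simp add: nf_add)
 thus "induced projG (nf X \<ominus>\<^bsub>NF A \<xi>\<^esub> nf Y) i p = induced projG (nf (\<lambda>f p. X f p - Y f p)) i p" for i p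
  using XY by simp
qed simp_all

lemma induced_nf: "X \<in> T ==> (\<And>Y. Y \<in> T ==> (\<lambda>f p. Y f p - X f p) \<in> XF ==> f Y = f X) ==> induced f (nf X) = f X"
 unfolding mod_TF_def TF_carrier by (rule qNF.induced_coset) simp_all

subsection \<open>Bott connections\<close>

lemma lie_add_left: "X \<in> T ==> Y \<in> T ==> Z \<in> T ==> lie (\<lambda>f p. X f p + Y f p) Z = (\<lambda>f p. lie X Z f p + lie Y Z f p)"
 using lie_axpy_left[of X Y Z "\<lambda>_. 1"] by (simp add: vf_const)

lemma lie_add_right: "X \<in> T ==> Y \<in> T ==> Z \<in> T ==> lie Z (\<lambda>f p. X f p + Y f p) = (\<lambda>f p. lie Z X f p + lie Z Y f p)"
 using lie_axpy_right[of X Y Z "\<lambda>_. 1"] by (simp add: vf_const)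

lemma lie_diff_right: "X \<in> T ==> Y \<in> T ==> Z \<in> T ==> lie Z (\<lambda>f p. X f p - Y f p) = (\<lambda>f p. lie Z X f p - lie Z Y f p)"
 using lie_axpy_right[of X Y Z "\<lambda>_. - 1"] by (simp add: vf_const)

lemma lie_zero_right: "X \<in> T ==> lie X (\<lambda>f p. 0) = (\<lambda>f p. 0)"
 by (simp add: lie_def vf_const)

lemma lie_smult_right: "h \<in> S ==> Y \<in> T ==> Z \<in> T ==> lie Z (\<lambda>f p. h p * Y f p) = (\<lambda>f p. h p * lie Z Y f p + Z h p * Y f p)"
 using lie_axpy_right[of "\<lambda>f p. 0" Y Z h] by (simp add: lie_zero_right)

lemma lie_smult_left: "h \<in> S ==> X \<in> T ==> Z \<in> T ==> lie (\<lambda>f p. h p * X f p) Z = (\<lambda>f p. h p * lie X Z f p - Z h p * X f p)"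
 using lie_axpy_left[of "\<lambda>f p. 0" X Z h] lie_swap[of "\<lambda>f p. 0" Z] by (simp add: lie_zero_right)

lemma lie_jacobi:
 assumes "X \<in> T" "Y \<in> T" "Z \<in> T"
 shows "lie X (lie Y Z) = (\<lambda>f p. lie (lie X Y) Z f p + lie Y (lie X Z) f p)"
 using assms vf_mem by (simp add: lie_def fun_eq_iff vf_diff[of X] vf_diff[of Y] vf_diff[of Z])

lemma lie_lie:
 assumes "X \<in> T" "Y \<in> T" "Z \<in> T"
 shows "lie (lie X Y) Z = (\<lambda>f p. lie X (lie Y Z) f p - lie Y (lie X Z) f p)"
 using lie_jacobi[OF assms] by (simp add: fun_eq_iff)

text \<open>By the Jacobi identity the fields that preserve \<Gamma>(\<xi>) are closed under the
  bracket; this is involutivity of T\<F>.\<close>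

lemma lie_XF:
 assumes X: "X \<in> XF" and Y: "Y \<in> XF"
 shows "lie X Y \<in> XF"
proof -
 have XY: "X \<in> X\<xi>" "Y \<in> X\<xi>" "X \<in> T" "Y \<in> T" using X Y XF_subset sec_T by blast+
 have "lie (lie X Y) Z \<in> X\<xi>" if Z: "Z \<in> X\<xi>" for Z
 proof -
  have "lie X (lie Y Z) \<in> X\<xi>" "lie Y (lie X Z) \<in> X\<xi>" using X Y Z by (auto simp: XF_iff)
  from sections_diff[OF xi_subsp this] show ?thesis
   using lie_jacobi[OF XY(3,4) sec_T[OF Z]] by (simp add: fun_eq_iff)
 qed
 thus ?thesis using X XY by (auto simp: XF_iff)
qed

text \<open>The Bott connection is well defined on cosets because brackets with sections of T\<F>
  preserve \<Gamma>(\<xi>).\<close>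

lemma nabla_ell_th:
 assumes "X \<in> XF" "Y \<in> T"
 shows "nabla_ell A \<xi> X (th Y) = th (lie X Y)"
 unfolding nabla_ell_def
proof (rule induced_th)
 fix Y' assume *: "Y' \<in> T" "(\<lambda>f p. Y' f p - Y f p) \<in> X\<xi>"
 have "lie X (\<lambda>f p. Y' f p - Y f p) \<in> X\<xi>" using assms(1) *(2) by (simp add: XF_iff)
 thus "th (lie X Y') = th (lie X Y)"
  using assms * sec_T[OF assms(1)] by (simp add: th_eq_iff lie_diff_right)
qed (rule assms)

lemma nabla_NF_nf:
 assumes "X \<in> XF" "Y \<in> T"
 shows "nabla_NF A \<xi> X (nf Y) = nf (lie X Y)"
 unfolding nabla_NF_def
proof (rule induced_nf)
 fix Y' assume *: "Y' \<in> T" "(\<lambda>f p. Y' f p - Y f p) \<in> XF"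
 have "lie X (\<lambda>f p. Y' f p - Y f p) \<in> XF" using assms(1) *(2) by (rule lie_XF)
 thus "nf (lie X Y') = nf (lie X Y)"
  using assms * sec_T[OF assms(1)] by (simp add: nf_eq_iff lie_diff_right)
qed (rule assms)

lemma TF_bracket:
 shows "X \<in> XF ==> Y \<in> XF ==> Z \<in> XF ==> lie (X \<oplus>\<^bsub>TFm\<^esub> Y) Z = lie X Z \<oplus>\<^bsub>TFm\<^esub> lie Y Z"
  and "X \<in> XF ==> lie X X = \<zero>\<^bsub>TFm\<^esub>"
  and "X \<in> XF ==> Y \<in> XF ==> Z \<in> XF ==> lie X (Y \<oplus>\<^bsub>TFm\<^esub> Z) = lie X Y \<oplus>\<^bsub>TFm\<^esub> lie X Z"
  and "h \<in> S ==> X \<in> XF ==> Y \<in> XF ==> lie X (h \<odot>\<^bsub>TFm\<^esub> Y) = h \<odot>\<^bsub>TFm\<^esub> lie X Y \<oplus>\<^bsub>TFm\<^esub> X h \<odot>\<^bsub>TFm\<^esub> Y"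
  and "X \<in> XF ==> Y \<in> XF ==> Z \<in> XF ==> lie X (lie Y Z) = lie (lie X Y) Z \<oplus>\<^bsub>TFm\<^esub> lie Y (lie X Z)"
proof -
 show "X \<in> XF ==> lie X X = \<zero>\<^bsub>TFm\<^esub>" unfolding TF_ops by (simp add: lie_def)
qed (unfold TF_ops, (rule lie_add_left lie_add_right lie_smult_right lie_jacobi; (assumption | erule sec_T))+)

lemma lie_rep_TF_ell: "lie_rep S (TFm) (\<lambda>X. X) \<L> (induced ellP) lie (\<lambda>X. X) (nabla_ell A \<xi>)"
proof (unfold_locales, unfold TF_carrier, goal_cases)
 case (1 x y) thus ?case by (rule lie_XF)
next
 case (2 x y z) thus ?case by (rule TF_bracket)
next
 case (3 x) thus ?case by (rule TF_bracket)
next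
 case (4 x y z) thus ?case by (rule TF_bracket)
next
 case (5 r x y) thus ?case by (rule TF_bracket)
next
 case (6 x y z) thus ?case by (rule TF_bracket)
next
 case (7 x r) thus ?case using vf_mem[OF sec_T] by simp
next
 case (8 x c) thus ?case using vf_const[OF sec_T] by simp
next
 case (9 x e) 
 thus ?case using sec_T[OF 9(1)] by (auto elim!: ell_cases simp: nabla_ell_th)
next
 case (10 x y e)
 thus ?case
  using sec_T[OF 10(1)] sec_T[OF 10(2)] sections_add[OF F_subspaces 10(1,2)]
  by (auto elim!: ell_cases simp: nabla_ell_th TF_ops th_add lie_add_left)
next
 case (11 r x e)
 from 11(3) obtain Z where Z: "Z \<in> T" "e = th Z" by (rule ell_cases)
 have T: "x \<in> T" using 11 sec_T by blast
 \<comment> \<open>Linearity over functions in x: the error term -Z(r) x of the bracket is a section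
   of T\<F>, hence of \<xi>, and vanishes in \<ell>.\<close>
 have "(\<lambda>f p. - Z r p * x f p) \<in> X\<xi>"
  using sections_smult[OF xi_subsp _ XF_subset[OF 11(2)], of "\<lambda>p. - Z r p"] vf_mem[OF Z(1)] by simp
 hence "th (\<lambda>f p. r p * lie x Z f p - Z r p * x f p) = th (\<lambda>f p. r p * lie x Z f p)"
  using T Z 11 vf_mem[OF Z(1)] by (intro th_eq) simp_all
 thus ?case
  using T Z 11 sections_smult[OF F_subspaces 11(1,2)]
  by (simp add: nabla_ell_th TF_ops th_smult lie_smult_left)
next
 case (12 x e f)
 thus ?case
  using sec_T[OF 12(1)] by (auto elim!: ell_cases simp: nabla_ell_th th_add lie_add_right)
next
 case (13 x e r)
 thus ?case
  using sec_T[OF 13(1)] vf_mem[OF sec_T[OF 13(1)]]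
  by (auto elim!: ell_cases simp: nabla_ell_th th_add th_smult lie_smult_right)
next
 case (14 x y e)
 thus ?case
  using sec_T[OF 14(1)] sec_T[OF 14(2)] lie_XF[OF 14(1,2)]
  by (auto elim!: ell_cases simp: nabla_ell_th th_minus lie_lie)
qed

lemma lie_rep_TF_NF: "lie_rep S (TFm) (\<lambda>X. X) (NF A \<xi>) (induced projG) lie (\<lambda>X. X) (nabla_NF A \<xi>)"
proof (unfold_locales, unfold TF_carrier, goal_cases)
 case (1 x y) thus ?case by (rule lie_XF)
next
 case (2 x y z) thus ?case by (rule TF_bracket)
next
 case (3 x) thus ?case by (rule TF_bracket)
next
 case (4 x y z) thus ?case by (rule TF_bracket)
next
 case (5 r x y) thus ?case by (rule TF_bracket)
next
 case (6 x y z) thus ?case by (rule TF_bracket)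
next
 case (7 x r) thus ?case using vf_mem[OF sec_T] by simp
next
 case (8 x c) thus ?case using vf_const[OF sec_T] by simp
next
 case (9 x e) 
 thus ?case using sec_T[OF 9(1)] by (auto elim!: NF_cases simp: nabla_NF_nf)
next
 case (10 x y e)
 thus ?case
  using sec_T[OF 10(1)] sec_T[OF 10(2)] sections_add[OF F_subspaces 10(1,2)]
  by (auto elim!: NF_cases simp: nabla_NF_nf TF_ops nf_add lie_add_left)
next
 case (11 r x e)
 from 11(3) obtain Z where Z: "Z \<in> T" "e = nf Z" by (rule NF_cases)
 have T: "x \<in> T" using 11 sec_T by blast
 have "(\<lambda>f p. - Z r p * x f p) \<in> XF"
  using sections_smult[OF F_subspaces _ 11(2), of "\<lambda>p. - Z r p"] vf_mem[OF Z(1)] by simp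
 hence "nf (\<lambda>f p. r p * lie x Z f p - Z r p * x f p) = nf (\<lambda>f p. r p * lie x Z f p)"
  using T Z 11 vf_mem[OF Z(1)] by (subst nf_eq_iff) simp_all
 thus ?case
  using T Z 11 sections_smult[OF F_subspaces 11(1,2)]
  by (simp add: nabla_NF_nf TF_ops nf_smult lie_smult_left)
next
 case (12 x e f)
 thus ?case
  using sec_T[OF 12(1)] by (auto elim!: NF_cases simp: nabla_NF_nf nf_add lie_add_right)
next
 case (13 x e r)
 thus ?case
  using sec_T[OF 13(1)] vf_mem[OF sec_T[OF 13(1)]]
  by (auto elim!: NF_cases simp: nabla_NF_nf nf_add nf_smult lie_smult_right)
next
 case (14 x y e)
 thus ?case
  using sec_T[OF 14(1)] sec_T[OF 14(2)] lie_XF[OF 14(1,2)]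
  by (auto elim!: NF_cases simp: nabla_NF_nf nf_minus lie_lie)
qed

end

section \<open>The Atiyah algebroid\<close>

text \<open>With the bare \<open>\<lambda>D s. D s\<close> as action, the rewrite rules of
  \<open>lie_rep\<close> would have a variable in head position; a named constant avoids
  this.\<close>

definition app :: "('x => 'y) => 'x => 'y" where "app D s = D s"

lemma app_eq: "(\<lambda>D s. D s) = app"
 by (simp add: app_def fun_eq_iff)

context precontact_splitting
begin

abbreviation "\<A> \<equiv> Dell A \<xi>"
abbreviation (input) d_add (infixl "+\<^sub>d" 65) where "s +\<^sub>d t \<equiv> s \<oplus>\<^bsub>\<A>\<^esub> t"
abbreviation (input) d_diff (infixl "-\<^sub>d" 65) where "s -\<^sub>d t \<equiv> s \<ominus>\<^bsub>\<A>\<^esub> t"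
abbreviation (input) d_neg ("-\<^sub>d _" [81] 80) where "-\<^sub>d s \<equiv> \<ominus>\<^bsub>\<A>\<^esub> s"
abbreviation (input) d_smult (infixl "*\<^sub>d" 70) where "f *\<^sub>d s \<equiv> f \<odot>\<^bsub>\<A>\<^esub> s"
abbreviation (input) d_zero ("0\<^sub>d") where "0\<^sub>d \<equiv> \<zero>\<^bsub>\<A>\<^esub>"
abbreviation "Der \<equiv> carrier \<A>"
abbreviation "\<sigma> \<equiv> symbol A \<xi>"
abbreviation "l\<iota> \<equiv> induced ellP"
abbreviation "comm \<equiv> commutator A \<xi>"

lemma ell_smult_zero: "f \<in> S ==> f *\<^sub>l 0\<^sub>l = 0\<^sub>l"
 by (intro ell.eqI) simp_all

lemma ell_neg_zero: "-\<^sub>l 0\<^sub>l = 0\<^sub>l"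
 by (intro ell.eqI) simp_all

lemma Dell_ops:
 "0\<^sub>d = (\<lambda>s\<in>Sec. 0\<^sub>l)"
 "D +\<^sub>d D' = (\<lambda>s\<in>Sec. D s +\<^sub>l D' s)"
 "f *\<^sub>d D = (\<lambda>s\<in>Sec. f *\<^sub>l D s)"
 by (simp_all add: Dell_def Let_def)

text \<open>By the Leibniz rule X f and Y f have the same products with all sections of \<ell>, and
  this module is faithful.\<close>

lemma is_symbol_unique:
 assumes D: "\<And>s. s \<in> Sec ==> D s \<in> Sec" and X: "is_symbol A \<xi> D X" and Y: "is_symbol A \<xi> D Y"
 shows "X = Y"
proof (rule vf_eqI)
 show XT: "X \<in> T" and YT: "Y \<in> T" using X Y by (simp_all add: is_symbol_def)
 fix f p assume f: "f \<in> S"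
 have m: "X f \<in> S" "Y f \<in> S" using vf_mem XT YT by blast+
 have "(\<lambda>p. X f p - Y f p) = (\<lambda>_. 0)"
 proof (rule xi_faithful)
  fix Z assume Z: "Z \<in> T"
  have "X f *\<^sub>l th Z +\<^sub>l f *\<^sub>l D (th Z) = Y f *\<^sub>l th Z +\<^sub>l f *\<^sub>l D (th Z)"
   using X Y f Z unfolding is_symbol_def by (metis th_mem)
  hence "X f *\<^sub>l th Z = Y f *\<^sub>l th Z"
   using m f Z D by simp
  hence "th (\<lambda>g p. X f p * Z g p) = th (\<lambda>g p. Y f p * Z g p)"
   using m Z by (simp add: th_smult)
  thus "(\<lambda>g p. (X f p - Y f p) * Z g p) \<in> X\<xi>"
   using m Z th_eq_iff[of "\<lambda>g p. X f p * Z g p" "\<lambda>g p. Y f p * Z g p"] by (simp add: left_diff_distrib)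
 qed (use m in simp)
 from fun_cong[OF this, of p] show "X f p = Y f p" by simp
qed

text \<open>Linearity over the reals comes from the Leibniz rule, since X kills constants;
  uniqueness of the symbol is \<open>is_symbol_unique\<close>.\<close>

lemma DellI:
 assumes ext: "D \<in> extensional (Sec)" and D: "\<And>s. s \<in> Sec ==> D s \<in> Sec"
  and add: "\<And>s t. s \<in> Sec ==> t \<in> Sec ==> D (s +\<^sub>l t) = D s +\<^sub>l D t"
  and X: "X \<in> T" and leib: "\<And>f s. f \<in> S ==> s \<in> Sec ==> D (f *\<^sub>l s) = X f *\<^sub>l s +\<^sub>l f *\<^sub>l D s"
 shows "D \<in> Der" "\<sigma> D = X"
proof -
 have s: "is_symbol A \<xi> D X" using X leib by (simp add: is_symbol_def)
 have uniq: "\<exists>!X. is_symbol A \<xi> D X"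
  using s is_symbol_unique[of D] D by blast
 have "D ((\<lambda>_. c) *\<^sub>l s) = (\<lambda>_. c) *\<^sub>l D s" if "s \<in> Sec" for c s
  using leib[OF Cinf_const that, of c] that D[OF that] by (simp add: vf_const[OF X]) (intro ell.eqI; simp)
 hence "real_linear \<L> \<L> D"
  unfolding real_linear_def using D add by auto
 thus "D \<in> Der"
  using ext uniq by (simp add: Dell_def Let_def)
 show "\<sigma> D = X"
  unfolding symbol_def by (rule the1_equality[where P = "is_symbol A \<xi> D", OF uniq s])
qed

lemma Dell_iff: "D \<in> Der \<longleftrightarrow> D \<in> extensional (Sec) \<and> real_linear \<L> \<L> D \<and> (\<exists>!X. is_symbol A \<xi> D X)"
 by (simp add: Dell_def Let_def)

lemma DellD:
 assumes "D \<in> Der"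
 shows "D \<in> extensional (Sec)"
  and "s \<in> Sec ==> D s \<in> Sec"
  and "s \<in> Sec ==> t \<in> Sec ==> D (s +\<^sub>l t) = D s +\<^sub>l D t"
  and "\<sigma> D \<in> T"
  and "f \<in> S ==> s \<in> Sec ==> D (f *\<^sub>l s) = \<sigma> D f *\<^sub>l s +\<^sub>l f *\<^sub>l D s"
proof -
 have "is_symbol A \<xi> D (\<sigma> D)"
  using assms theI'[of "is_symbol A \<xi> D"] by (simp add: Dell_iff symbol_def)
 thus "\<sigma> D \<in> T" "f \<in> S ==> s \<in> Sec ==> D (f *\<^sub>l s) = \<sigma> D f *\<^sub>l s +\<^sub>l f *\<^sub>l D s"
  by (simp_all add: is_symbol_def)
 show "D \<in> extensional (Sec)" using assms by (simp add: Dell_iff)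
 have "real_linear \<L> \<L> D" using assms by (simp add: Dell_iff)
 thus "s \<in> Sec ==> D s \<in> Sec" "s \<in> Sec ==> t \<in> Sec ==> D (s +\<^sub>l t) = D s +\<^sub>l D t"
  unfolding real_linear_def by blast+
qed

lemma symbol_T [simp]: "D \<in> Der ==> \<sigma> D \<in> T"
 by (rule DellD)

lemma symbol_S [simp]: "D \<in> Der ==> \<sigma> D f \<in> S"
 by (rule vf_mem[OF symbol_T])

lemma Dell_eqI:
 assumes "D \<in> Der" "D' \<in> Der" "\<And>X. X \<in> T ==> D (th X) = D' (th X)"
 shows "D = D'"
 by (rule extensionalityI[OF DellD(1)[OF assms(1)] DellD(1)[OF assms(2)]]) (metis assms(3) ell_cases)

lemma Dell_minus:
 assumes D: "D \<in> Der" and st: "s \<in> Sec" "t \<in> Sec"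
 shows "D (s -\<^sub>l t) = D s -\<^sub>l D t"
proof -
 have "D s = D ((s -\<^sub>l t) +\<^sub>l t)"
  using st by (intro arg_cong[of _ _ D] ell.eqI) simp_all
 also have "\<dots> = D (s -\<^sub>l t) +\<^sub>l D t"
  using st by (intro DellD(3)[OF D]) simp_all
 finally show ?thesis
  using st DellD(2)[OF D] by (intro ell.eqI) simp_all
qed

lemma Dell_zero: "0\<^sub>d \<in> Der" "\<sigma> 0\<^sub>d = (\<lambda>f p. 0)"
proof -
 have 1: "0\<^sub>d (s +\<^sub>l t) = 0\<^sub>d s +\<^sub>l 0\<^sub>d t" if "s \<in> Sec" "t \<in> Sec" for s t
  using that by (simp add: Dell_ops)
 have 2: "0\<^sub>d (f *\<^sub>l s) = (\<lambda>p. 0) *\<^sub>l s +\<^sub>l f *\<^sub>l 0\<^sub>d s" if "f \<in> S" "s \<in> Sec" for f s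
  using that by (simp add: Dell_ops) (intro ell.eqI; simp)
 show "0\<^sub>d \<in> Der" "\<sigma> 0\<^sub>d = (\<lambda>f p. 0)"
  by (rule DellI[OF _ _ 1 _ 2]; simp add: Dell_ops extensional_def)+
qed

lemma Dell_add:
 assumes D: "D \<in> Der" "D' \<in> Der"
 shows "D +\<^sub>d D' \<in> Der" "\<sigma> (D +\<^sub>d D') = (\<lambda>f p. \<sigma> D f p + \<sigma> D' f p)"
proof -
 note m = DellD(2)[OF D(1)] DellD(2)[OF D(2)]
 have 1: "(D +\<^sub>d D') (s +\<^sub>l t) = (D +\<^sub>d D') s +\<^sub>l (D +\<^sub>d D') t"
  if "s \<in> Sec" "t \<in> Sec" for s t
  using that m D by (simp add: Dell_ops DellD(3)) (intro ell.eqI; simp)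
 have 2: "(D +\<^sub>d D') (f *\<^sub>l s) = (\<lambda>p. \<sigma> D f p + \<sigma> D' f p) *\<^sub>l s +\<^sub>l f *\<^sub>l (D +\<^sub>d D') s"
  if "f \<in> S" "s \<in> Sec" for f s
  using that m D by (simp add: Dell_ops DellD(5)) (intro ell.eqI; simp add: algebra_simps)
 show "D +\<^sub>d D' \<in> Der" "\<sigma> (D +\<^sub>d D') = (\<lambda>f p. \<sigma> D f p + \<sigma> D' f p)"
  by (rule DellI[OF _ _ 1 _ 2]; use m D in \<open>simp add: Dell_ops extensional_def\<close>)+
qed

lemma Dell_smult:
 assumes h: "h \<in> S" and D: "D \<in> Der"
 shows "h *\<^sub>d D \<in> Der" "\<sigma> (h *\<^sub>d D) = (\<lambda>f p. h p * \<sigma> D f p)"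
proof -
 note m = DellD(2)[OF D]
 have 1: "(h *\<^sub>d D) (s +\<^sub>l t) = (h *\<^sub>d D) s +\<^sub>l (h *\<^sub>d D) t"
  if "s \<in> Sec" "t \<in> Sec" for s t
  using that m D h by (simp add: Dell_ops DellD(3)) (intro ell.eqI; simp add: algebra_simps)
 have 2: "(h *\<^sub>d D) (f *\<^sub>l s) = (\<lambda>p. h p * \<sigma> D f p) *\<^sub>l s +\<^sub>l f *\<^sub>l (h *\<^sub>d D) s"
  if "f \<in> S" "s \<in> Sec" for f s
  using that m D h by (simp add: Dell_ops DellD(5)) (intro ell.eqI; simp add: algebra_simps)
 show "h *\<^sub>d D \<in> Der" "\<sigma> (h *\<^sub>d D) = (\<lambda>f p. h p * \<sigma> D f p)"
  by (rule DellI[OF _ _ 1 _ 2]; use m D h in \<open>simp add: Dell_ops extensional_def\<close>)+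
qed

definition d\<iota> :: "'a derivation => 'a vfield set \<times> ('a => real) => 'a => real" where
 "d\<iota> D = (\<lambda>(s, f) p. if s \<in> Sec then l\<iota> (D s) f p else 0)"

lemma Dell_apply:
 assumes "s \<in> Sec"
 shows "0\<^sub>d s = 0\<^sub>l" "(D +\<^sub>d D') s = D s +\<^sub>l D' s" "(f *\<^sub>d D) s = f *\<^sub>l D s"
 using assms by (simp_all add: Dell_ops)

lemma fun_module_Dell: "fun_module S \<A> d\<iota>"
proof unfold_locales
 show "inj_on d\<iota> (Der)"
 proof (rule inj_onI)
  fix D D' assume D: "D \<in> Der" "D' \<in> Der" and eq: "d\<iota> D = d\<iota> D'"
  show "D = D'"
  proof (rule extensionalityI[OF DellD(1)[OF D(1)] DellD(1)[OF D(2)]])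
   fix s assume s: "s \<in> Sec"
   have "l\<iota> (D s) f p = l\<iota> (D' s) f p" for f p
    using fun_cong[OF fun_cong[OF eq, of "(s, f)"], of p] s by (simp add: d\<iota>_def)
   thus "D s = D' s" using s DellD(2)[OF D(1)] DellD(2)[OF D(2)] by (intro ell.eqI)
  qed
 qed
qed (auto simp: Dell_zero Dell_add Dell_smult d\<iota>_def Dell_apply DellD(2) split: prod.splits)

sublocale Dell: fun_module S \<A> d\<iota>
 by (rule fun_module_Dell)

lemma symbol_minus:
 assumes D: "D \<in> Der" "D' \<in> Der"
 shows "\<sigma> (D -\<^sub>d D') = (\<lambda>f p. \<sigma> D f p - \<sigma> D' f p)"
proof -
 have "D = (D -\<^sub>d D') +\<^sub>d D'" using D by (intro Dell.eqI) simp_all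
 from arg_cong[OF this, of \<sigma>] have "\<sigma> D = (\<lambda>f p. \<sigma> (D -\<^sub>d D') f p + \<sigma> D' f p)"
  unfolding Dell_add(2)[OF Dell.minus_closed[OF D] D(2)] .
 thus ?thesis by (simp add: fun_eq_iff)
qed

lemma comm_apply: "s \<in> Sec ==> comm D D' s = D (D' s) -\<^sub>l D' (D s)"
 by (simp add: commutator_def)

lemma comm_mem:
 assumes D: "D \<in> Der" "D' \<in> Der"
 shows "comm D D' \<in> Der" "\<sigma> (comm D D') = lie (\<sigma> D) (\<sigma> D')"
proof -
 note m = DellD(2)[OF D(1)] DellD(2)[OF D(2)]
 have 1: "comm D D' (s +\<^sub>l t) = comm D D' s +\<^sub>l comm D D' t"
  if "s \<in> Sec" "t \<in> Sec" for s t
  using that m D by (simp add: comm_apply DellD(3)) (intro ell.eqI; simp)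
 have 2: "comm D D' (f *\<^sub>l s) = lie (\<sigma> D) (\<sigma> D') f *\<^sub>l s +\<^sub>l f *\<^sub>l comm D D' s"
  if fs: "f \<in> S" "s \<in> Sec" for f s
 proof -
  have lm: "lie (\<sigma> D) (\<sigma> D') f \<in> S" using D by (intro vf_mem lie_mem) simp_all
  have x: "D (D' (f *\<^sub>l s)) =
    (\<sigma> D (\<sigma> D' f) *\<^sub>l s +\<^sub>l \<sigma> D' f *\<^sub>l D s) +\<^sub>l (\<sigma> D f *\<^sub>l D' s +\<^sub>l f *\<^sub>l D (D' s))"
   if D: "D \<in> Der" "D' \<in> Der" for D D'
   using fs D DellD(2)[OF D(2)] by (simp add: DellD(5)[OF D(2)] DellD(3)[OF D(1)] DellD(5)[OF D(1)])
  show ?thesis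
   using fs D m lm by (simp add: comm_apply x[OF D] x[OF D(2,1)]) (intro ell.eqI; simp add: lie_def algebra_simps)
 qed
 show "comm D D' \<in> Der" "\<sigma> (comm D D') = lie (\<sigma> D) (\<sigma> D')"
  by (rule DellI[OF _ _ 1 _ 2]; use m D in \<open>simp add: commutator_def extensional_def\<close>)+
qed

lemma Dell_eqI':
 assumes "D \<in> Der" "D' \<in> Der" "\<And>s. s \<in> Sec ==> D s = D' s"
 shows "D = D'"
 by (rule Dell_eqI[OF assms(1,2)]) (simp add: assms(3))

lemma lie_rep_Dell: "lie_rep S \<A> d\<iota> \<L> l\<iota> comm \<sigma> app"
proof (unfold_locales, goal_cases)
 case (1 x y) thus ?case by (rule comm_mem)
next
 case (2 x y z)
 thus ?case
  using DellD(2)[of x] DellD(2)[of y] DellD(2)[of z]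
  by (intro Dell_eqI') (simp_all add: comm_mem Dell_add Dell_apply comm_apply DellD(3)[of z], (intro ell.eqI; simp)?)
next
 case (3 x)
 thus ?case
  using DellD(2)[of x] by (intro Dell_eqI') (simp_all add: comm_mem Dell_zero Dell_apply comm_apply, (intro ell.eqI; simp)?)
next
 case (4 x y z)
 thus ?case
  using DellD(2)[of x] DellD(2)[of y] DellD(2)[of z]
  by (intro Dell_eqI') (simp_all add: comm_mem Dell_add Dell_apply comm_apply DellD(3)[of x], (intro ell.eqI; simp)?)
next
 case (5 r x y)
 thus ?case
  using DellD(2)[of x] DellD(2)[of y] DellD(2)[of z]
  by (intro Dell_eqI') (simp_all add: comm_mem Dell_add Dell_smult Dell_apply comm_apply DellD(5)[of x], (intro ell.eqI; simp add: algebra_simps)?)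
next
 case (6 x y z)
 thus ?case
  using DellD(2)[of x] DellD(2)[of y] DellD(2)[of z]
  by (intro Dell_eqI') (simp_all add: comm_mem Dell_add Dell_apply comm_apply Dell_minus[of x] Dell_minus[of y] Dell_minus[of z], (intro ell.eqI; simp)?)
next
 case (7 x r) thus ?case by simp
next
 case (8 x c) thus ?case by (simp add: vf_const[OF symbol_T])
next
 case (9 x e) thus ?case by (simp add: app_def DellD(2))
next
 case (10 x y e) thus ?case by (simp add: app_def Dell_apply)
next
 case (11 r x e) thus ?case by (simp add: app_def Dell_apply)
next
 case (12 x e f) thus ?case by (simp add: app_def DellD(3))
next
 case (13 x e r)
 thus ?case using DellD(2)[OF 13(1)] by (simp add: app_def DellD(5)[OF 13(1)]) (intro ell.eqI; simp)
next
 case (14 x y e) thus ?case by (simp add: app_def comm_apply)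
qed

sublocale LD: lie_rep S \<A> d\<iota> \<L> l\<iota> comm \<sigma> app
 by (rule lie_rep_Dell)

lemma d_D_eq: "d_D A \<xi> n = koszul \<A> comm \<L> app n"
 by (simp add: d_D_def app_eq)

text \<open>E prescribes a derivation on representatives. Vanishing on \<Gamma>(\<xi>) makes it
  descend to \<ell>, and its modified linearity becomes the Leibniz rule with symbol X. Connections,
  lifts of T\<F> to K and preimages under \<varpi>^\<flat> are built this way.\<close>

lemma derivation_exists:
 assumes E: "\<And>Y. Y \<in> T ==> E Y \<in> Sec" "\<And>Y. Y \<in> X\<xi> ==> E Y = 0\<^sub>l" and X: "X \<in> T"
  and lin: "\<And>Y Y' h. Y \<in> T ==> Y' \<in> T ==> h \<in> S ==>
   E (\<lambda>f p. Y f p + h p * Y' f p) = (E Y +\<^sub>l h *\<^sub>l E Y') +\<^sub>l X h *\<^sub>l th Y'"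
 shows "\<exists>D\<in>Der. \<sigma> D = X \<and> (\<forall>Y\<in>T. D (th Y) = E Y)"
proof -
 have XS: "X h \<in> S" for h by (rule vf_mem[OF X])
 have ind: "induced E (th Y) = E Y" if Y: "Y \<in> T" for Y
 proof (rule induced_th[OF Y])
  fix Y' assume Y': "Y' \<in> T" "(\<lambda>f p. Y' f p - Y f p) \<in> X\<xi>"
  have "Y' = (\<lambda>f p. Y f p + (\<lambda>_. 1) p * (\<lambda>f p. Y' f p - Y f p) f p)" by simp
  hence "E Y' = (E Y +\<^sub>l (\<lambda>_. 1) *\<^sub>l E (\<lambda>f p. Y' f p - Y f p)) +\<^sub>l X (\<lambda>_. 1) *\<^sub>l th (\<lambda>f p. Y' f p - Y f p)"
   using lin[OF Y vf_diff_mem[OF Y'(1) Y] Cinf_const[of 1]] by metis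
  thus "E Y' = E Y"
   using Y Y' E(1)[OF Y] by (intro ell.eqI; simp add: E(2) vf_const[OF X])
 qed
 define D where "D = (\<lambda>s\<in>Sec. induced E s)"
 have D: "D (th Y) = E Y" if "Y \<in> T" for Y using that by (simp add: D_def ind)
 have add: "D (s +\<^sub>l t) = D s +\<^sub>l D t" if st: "s \<in> Sec" "t \<in> Sec" for s t
 proof -
  obtain Y Y' where Y: "Y \<in> T" "s = th Y" "Y' \<in> T" "t = th Y'" using st ell_cases by metis
  thus ?thesis
   using lin[OF Y(1,3) Cinf_const[of 1]] E(1) by (simp add: th_add D vf_const[OF X]) (intro ell.eqI; simp)
 qed
 have leib: "D (f *\<^sub>l s) = X f *\<^sub>l s +\<^sub>l f *\<^sub>l D s" if fs: "f \<in> S" "s \<in> Sec" for f s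
 proof -
  obtain Y where Y: "Y \<in> T" "s = th Y" using fs(2) by (rule ell_cases)
  have "E (\<lambda>f p. 0) = 0\<^sub>l" by (rule E(2)[OF sections_zero[OF xi_subsp]])
  thus ?thesis
   using lin[OF vf_zero_mem Y(1) fs(1)] E(1) Y fs XS by (simp add: th_smult D) (intro ell.eqI; simp)
 qed
 have mem: "D s \<in> Sec" if "s \<in> Sec" for s
  using that by (rule ell_cases) (simp add: D E(1))
 have ext: "D \<in> extensional (Sec)" by (simp add: D_def)
 show ?thesis
  using DellI[OF ext mem add X leib] D by blast
qed

text \<open>Chosen separately for each X, so nothing is said about linearity in X; later arguments
  use its symbol only.\<close>

definition conn :: "'a vfield => 'a derivation" where
 "conn X = (SOME D. D \<in> Der \<and> \<sigma> D = X)"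

lemma conn:
 assumes X: "X \<in> T"
 shows "conn X \<in> Der" "\<sigma> (conn X) = X"
proof -
 have p: "th (ellP Y) = th Y" if "Y \<in> T" for Y
  using that ellP by (intro th_eq) auto
 have "\<exists>D\<in>Der. \<sigma> D = X \<and> (\<forall>Y\<in>T. D (th Y) = th (ellC X Y))"
 proof (rule derivation_exists)
  fix Y Y' h assume *: "Y \<in> T" "Y' \<in> T" "h \<in> S"
  have "th (ellC X (\<lambda>f p. Y f p + h p * Y' f p)) = (th (ellC X Y) +\<^sub>l h *\<^sub>l th (ellC X Y')) +\<^sub>l X h *\<^sub>l th (ellP Y')"
   using * X ellC vf_mem[OF X] ellP(1) by (simp add: th_add th_smult)
  thus "th (ellC X (\<lambda>f p. Y f p + h p * Y' f p)) = (th (ellC X Y) +\<^sub>l h *\<^sub>l th (ellC X Y')) +\<^sub>l X h *\<^sub>l th Y'"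
   unfolding p[OF *(2)] .
 qed (use X ellC in \<open>simp_all add: ell_zero\<close>)
 hence "\<exists>D. D \<in> Der \<and> \<sigma> D = X" by blast
 from someI_ex[OF this] have "conn X \<in> Der \<and> \<sigma> (conn X) = X"
  unfolding conn_def .
 thus "conn X \<in> Der" "\<sigma> (conn X) = X" by auto
qed

definition idD :: "'a derivation" where "idD = (\<lambda>s\<in>Sec. s)"

lemma idD: "idD \<in> Der" "\<sigma> idD = (\<lambda>f p. 0)" "s \<in> Sec ==> idD s = s"
proof -
 show id: "s \<in> Sec ==> idD s = s" for s by (simp add: idD_def)
 have "idD (f *\<^sub>l s) = (\<lambda>p. 0) *\<^sub>l s +\<^sub>l f *\<^sub>l idD s" if "f \<in> S" "s \<in> Sec" for f s
  using that by (simp add: id) (intro ell.eqI; simp)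
 from DellI[OF _ _ _ _ this] show "idD \<in> Der" "\<sigma> idD = (\<lambda>f p. 0)"
  by (simp_all add: id) (simp_all add: idD_def extensional_def)
qed

text \<open>With symbol 0 the Leibniz rule is linearity over functions. Chosen representatives turn
  D into a map of vector fields that is linear modulo \<xi>, and \<open>xi_endomorphism\<close>
  makes it a multiplication.\<close>

lemma symbol_kernel:
 assumes D: "D \<in> Der" "\<sigma> D = (\<lambda>f p. 0)"
 shows "\<exists>k\<in>S. D = k *\<^sub>d idD"
proof -
 define \<phi> where "\<phi> X = (SOME Y. Y \<in> T \<and> th Y = D (th X))" for X
 have \<phi>: "\<phi> X \<in> T" "th (\<phi> X) = D (th X)" if "X \<in> T" for X
 proof -
  have "\<exists>Y. Y \<in> T \<and> th Y = D (th X)" using DellD(2)[OF D(1) th_mem[OF that]] ell_cases by metis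
  hence "\<phi> X \<in> T \<and> th (\<phi> X) = D (th X)" unfolding \<phi>_def by (rule someI_ex)
  thus "\<phi> X \<in> T" "th (\<phi> X) = D (th X)" by auto
 qed
 have lin: "D (f *\<^sub>l s) = f *\<^sub>l D s" if "f \<in> S" "s \<in> Sec" for f s
  using DellD(5)[OF D(1) that] DellD(2)[OF D(1) that(2)] that D(2) by (intro ell.eqI; simp)
 have "\<exists>k\<in>S. \<forall>X\<in>T. (\<lambda>f p. \<phi> X f p - k p * X f p) \<in> X\<xi>"
 proof (rule xi_endomorphism)
  show "\<phi> X \<in> T" if "X \<in> T" for X using \<phi> that by blast
  have D0: "D 0\<^sub>l = 0\<^sub>l"
   using Dell_minus[OF D(1), of "0\<^sub>l" "0\<^sub>l"] DellD(2)[OF D(1), of "0\<^sub>l"] by (simp add: a_minus_def ell.r_neg)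
  show "\<phi> X \<in> X\<xi>" if X: "X \<in> X\<xi>" for X
  proof -
   have "th X = 0\<^sub>l" using X sec_T th_zero_iff by blast
   thus ?thesis using \<phi>[OF sec_T[OF X]] D0 th_zero_iff by metis
  qed
  fix X Y h assume *: "X \<in> T" "Y \<in> T" "h \<in> S"
  have "th (\<phi> (\<lambda>f p. X f p + h p * Y f p)) = D (th X +\<^sub>l h *\<^sub>l th Y)"
   using * \<phi>(2)[of "\<lambda>f p. X f p + h p * Y f p"] by (simp add: th_add th_smult)
  also have "\<dots> = th (\<phi> X) +\<^sub>l h *\<^sub>l th (\<phi> Y)"
   using * \<phi> by (simp add: DellD(3)[OF D(1)] lin)
  also have "\<dots> = th (\<lambda>f p. \<phi> X f p + h p * \<phi> Y f p)"
   using * \<phi>(1)[of X] \<phi>(1)[of Y] by (simp add: th_add th_smult)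
  finally show "(\<lambda>f p. \<phi> (\<lambda>f p. X f p + h p * Y f p) f p - (\<phi> X f p + h p * \<phi> Y f p)) \<in> X\<xi>"
   using * \<phi>(1) by (subst (asm) th_eq_iff) simp_all
 qed
 then obtain k where k: "k \<in> S" "\<And>X. X \<in> T ==> (\<lambda>f p. \<phi> X f p - k p * X f p) \<in> X\<xi>" by blast
 have "D = k *\<^sub>d idD"
 proof (rule Dell_eqI[OF D(1) Dell_smult(1)[OF k(1) idD(1)]])
  fix X assume X: "X \<in> T"
  have "D (th X) = th (\<lambda>f p. k p * X f p)"
   using th_eq[OF \<phi>(1)[OF X] _ k(2)[OF X]] \<phi>(2)[OF X] X k(1) by simp
  thus "D (th X) = (k *\<^sub>d idD) (th X)" using X k(1) by (simp add: Dell_apply idD(3) th_smult)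
 qed
 with k(1) show ?thesis by blast
qed

section \<open>The form \<open>\<varpi>\<close> and its kernel\<close>

definition thetaD :: "'a derivation list => 'a vfield set" where
 "thetaD = pullback \<A> 1 \<sigma> (\<lambda>Xs\<in>tuples (TC A) 1. th (Xs ! 0))"

lemma thetaD_single: "D \<in> Der ==> thetaD [D] = th (\<sigma> D)"
 by (simp add: thetaD_def pullback_def tuples_def)

lemma altform_thetaD: "LD.altform 1 thetaD"
 by (auto simp: thetaD_single Dell_add Dell_smult th_add th_smult)

lemma varpi_koszul: "varpi A \<xi> = koszul \<A> comm \<L> app 1 thetaD"
 by (simp add: varpi_def d_D_eq thetaD_def)

lemma altform_varpi: "LD.altform 2 (varpi A \<xi>)"
proof -
 have "koszul \<A> comm \<L> app 1 thetaD \<in> carrier (forms (Cinf A) \<A> \<L> (Suc 1))"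
  by (rule LD.koszul_forms[OF altform_thetaD refl])
 thus ?thesis
  unfolding varpi_koszul by (simp add: LD.forms_iff[OF refl] numeral_2_eq_2)
qed

lemma varpi_mem [simp]: "D \<in> Der ==> D' \<in> Der ==> varpi A \<xi> [D, D'] \<in> Sec"
 using LD.altform_mem[OF altform_varpi, of "[D, D']"] by (simp add: tuples_def)

lemma varpi_linear:
 assumes "D \<in> Der" "D' \<in> Der" "D'' \<in> Der"
 shows "varpi A \<xi> [D +\<^sub>d D', D''] = varpi A \<xi> [D, D''] +\<^sub>l varpi A \<xi> [D', D'']"
  and "varpi A \<xi> [D, D' +\<^sub>d D''] = varpi A \<xi> [D, D'] +\<^sub>l varpi A \<xi> [D, D'']"
  and "f \<in> S ==> varpi A \<xi> [f *\<^sub>d D, D''] = f *\<^sub>l varpi A \<xi> [D, D'']"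
  and "f \<in> S ==> varpi A \<xi> [D, f *\<^sub>d D''] = f *\<^sub>l varpi A \<xi> [D, D'']"
  and "varpi A \<xi> [D, D'] = -\<^sub>l varpi A \<xi> [D', D]"
 using altform_varpi LD.altform_swap[of 0 "varpi A \<xi>" D D' "[]"] assms by (simp_all add: numeral_2_eq_2)

lemma varpi_eq:
 assumes D: "D \<in> Der" "D' \<in> Der"
 shows "varpi A \<xi> [D, D'] = (D (th (\<sigma> D')) -\<^sub>l D' (th (\<sigma> D))) -\<^sub>l th (lie (\<sigma> D) (\<sigma> D'))"
proof -
 have "varpi A \<xi> [D, D'] = LD.dif [D, D'] thetaD"
  unfolding varpi_koszul using D by (intro LD.koszul_eq_dif[OF altform_thetaD]) (simp add: tuples_def)
 thus ?thesis
  using D DellD(2) by (simp add: thetaD_single comm_mem app_def) (intro ell.eqI; simp)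
qed

section \<open>The kernel K\<close>

abbreviation "\<K> \<equiv> KK A \<xi>"
abbreviation "KS \<equiv> carrier \<K>"

text \<open>Pairing with the identity says that \<sigma>(\<Delta>) lies in \<xi>. Pairing with a
  derivation of symbol Y then says \<Delta> \<theta>(Y) = \<theta>[\<sigma>(\<Delta>), Y]. For Y in
  \<xi> the left side is \<Delta>(0) = 0, so \<sigma>(\<Delta>) preserves \<Gamma>(\<xi>) and lies
  in T\<F>. Thus K is the Bott connection on \<ell>, seen as a set of derivations.\<close>

lemma K_iff: "\<Delta> \<in> KS \<longleftrightarrow> \<Delta> \<in> Der \<and> \<sigma> \<Delta> \<in> XF \<and> (\<forall>Y\<in>T. \<Delta> (th Y) = th (lie (\<sigma> \<Delta>) Y))"
proof -
 have "\<Delta> \<in> KS \<longleftrightarrow> \<Delta> \<in> Der \<and> (\<forall>D\<in>Der. varpi A \<xi> [\<Delta>, D] = 0\<^sub>l)"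
  by (auto simp: KK_def varpi_flat_def Dell_dual_def hom_module_def fun_eq_iff restrict_def)
 also have "\<dots> \<longleftrightarrow> \<Delta> \<in> Der \<and> \<sigma> \<Delta> \<in> XF \<and> (\<forall>Y\<in>T. \<Delta> (th Y) = th (lie (\<sigma> \<Delta>) Y))"
 proof (intro conj_cong refl iffI)
  assume \<Delta>: "\<Delta> \<in> Der" and *: "\<forall>D\<in>Der. varpi A \<xi> [\<Delta>, D] = 0\<^sub>l"
  have z: "th (\<lambda>f p. 0) = 0\<^sub>l" by (simp add: ell_zero)
  have "\<Delta> 0\<^sub>l = 0\<^sub>l" using LD.nab_zero[OF \<Delta>] by (simp add: app_def)
  hence "0\<^sub>l = (0\<^sub>l -\<^sub>l th (\<sigma> \<Delta>)) -\<^sub>l 0\<^sub>l"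
   using *[rule_format, OF idD(1)] varpi_eq[OF \<Delta> idD(1)] \<Delta> by (simp add: idD lie_zero_right z)
  hence t0: "th (\<sigma> \<Delta>) = 0\<^sub>l"
   using \<Delta> by (intro ell.eqI) (auto dest!: arg_cong[of _ _ l\<iota>] simp: fun_eq_iff)
  hence x: "\<sigma> \<Delta> \<in> X\<xi>" using \<Delta> th_zero_iff by simp
  have act: "\<Delta> (th Y) = th (lie (\<sigma> \<Delta>) Y)" if Y: "Y \<in> T" for Y
  proof -
   have "conn Y 0\<^sub>l = 0\<^sub>l" using LD.nab_zero[OF conn(1)[OF Y]] by (simp add: app_def)
   hence "0\<^sub>l = (\<Delta> (th Y) -\<^sub>l 0\<^sub>l) -\<^sub>l th (lie (\<sigma> \<Delta>) Y)"
    using *[rule_format, OF conn(1)[OF Y]] varpi_eq[OF \<Delta> conn(1)[OF Y]] by (simp add: conn[OF Y] t0)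
   thus ?thesis
    using \<Delta> Y DellD(2)[OF \<Delta>] by (intro ell.eqI) (auto dest!: arg_cong[of _ _ l\<iota>] simp: fun_eq_iff)
  qed
  have "lie (\<sigma> \<Delta>) Y \<in> X\<xi>" if Y: "Y \<in> X\<xi>" for Y
  proof -
   have "th Y = 0\<^sub>l" using Y sec_T th_zero_iff by blast
   hence "th (lie (\<sigma> \<Delta>) Y) = 0\<^sub>l" using act[OF sec_T[OF Y]] \<open>\<Delta> 0\<^sub>l = 0\<^sub>l\<close> by simp
   thus ?thesis using th_zero_iff[of "lie (\<sigma> \<Delta>) Y"] \<Delta> sec_T[OF Y] by simp
  qed
  hence "\<sigma> \<Delta> \<in> XF" using x by (simp add: XF_iff)
  with act show "\<sigma> \<Delta> \<in> XF \<and> (\<forall>Y\<in>T. \<Delta> (th Y) = th (lie (\<sigma> \<Delta>) Y))" by blast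
 next
  assume \<Delta>: "\<Delta> \<in> Der" and *: "\<sigma> \<Delta> \<in> XF \<and> (\<forall>Y\<in>T. \<Delta> (th Y) = th (lie (\<sigma> \<Delta>) Y))"
  show "\<forall>D\<in>Der. varpi A \<xi> [\<Delta>, D] = 0\<^sub>l"
  proof
   fix D assume D: "D \<in> Der"
   have "th (\<sigma> \<Delta>) = 0\<^sub>l" using * \<Delta> XF_subset by (simp add: th_zero_iff)
   moreover have "D 0\<^sub>l = 0\<^sub>l" using LD.nab_zero[OF D] by (simp add: app_def)
   ultimately show "varpi A \<xi> [\<Delta>, D] = 0\<^sub>l"
    using varpi_eq[OF \<Delta> D] * \<Delta> D by (intro ell.eqI; simp)
  qed
 qed
 finally show ?thesis .
qed

lemma K_A [simp]: "\<Delta> \<in> KS ==> \<Delta> \<in> Der"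
 and K_symbol: "\<Delta> \<in> KS ==> \<sigma> \<Delta> \<in> XF"
 and K_th: "\<Delta> \<in> KS ==> Y \<in> T ==> \<Delta> (th Y) = th (lie (\<sigma> \<Delta>) Y)"
 by (simp_all add: K_iff)

lemma K_ops: "\<zero>\<^bsub>\<K>\<^esub> = 0\<^sub>d" "D \<oplus>\<^bsub>\<K>\<^esub> D' = D +\<^sub>d D'" "f \<odot>\<^bsub>\<K>\<^esub> D = f *\<^sub>d D"
 by (simp_all add: KK_def del: K_A)

text \<open>An element of K acts as the Bott derivative along its symbol.\<close>

lemma K_eqI: "\<Delta> \<in> KS ==> \<Delta>' \<in> KS ==> \<sigma> \<Delta> = \<sigma> \<Delta>' ==> \<Delta> = \<Delta>'"
 by (rule Dell_eqI) (simp_all add: K_th)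

lemma K_lift:
 assumes X: "X \<in> XF"
 shows "\<exists>\<Delta>\<in>KS. \<sigma> \<Delta> = X"
proof -
 have XT: "X \<in> T" using X by (rule sec_T)
 have "\<exists>D\<in>Der. \<sigma> D = X \<and> (\<forall>Y\<in>T. D (th Y) = th (lie X Y))"
 proof (rule derivation_exists)
  show "th (lie X Y) = 0\<^sub>l" if "Y \<in> X\<xi>" for Y
   using X that sec_T[OF that] XT th_zero_iff[of "lie X Y"] by (simp add: XF_iff)
  show "th (lie X (\<lambda>f p. Y f p + h p * Y' f p)) = (th (lie X Y) +\<^sub>l h *\<^sub>l th (lie X Y')) +\<^sub>l X h *\<^sub>l th Y'"
   if "Y \<in> T" "Y' \<in> T" "h \<in> S" for Y Y' h
   using that XT vf_mem[OF XT] by (simp add: lie_axpy_right th_add th_smult)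
 qed (use XT in simp_all)
 thus ?thesis using X K_iff by auto
qed

lemma symbolK_inv: "X \<in> XF ==> symbolK_inv A \<xi> X \<in> KS" "X \<in> XF ==> \<sigma> (symbolK_inv A \<xi> X) = X"
proof -
 assume "X \<in> XF"
 hence "X \<in> \<sigma> ` KS" using K_lift[of X] by blast
 thus "symbolK_inv A \<xi> X \<in> KS" "\<sigma> (symbolK_inv A \<xi> X) = X"
  unfolding symbolK_inv_def by (rule inv_into_into, rule f_inv_into_f)
qed

lemma symbolK_inv_symbol: "\<Delta> \<in> KS ==> symbolK_inv A \<xi> (\<sigma> \<Delta>) = \<Delta>"
 by (intro K_eqI symbolK_inv K_symbol) simp_all

lemma K_zero: "0\<^sub>d \<in> KS"
 and K_add: "\<Delta> \<in> KS ==> \<Delta>' \<in> KS ==> \<Delta> +\<^sub>d \<Delta>' \<in> KS"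
 and K_smult: "f \<in> S ==> \<Delta> \<in> KS ==> f *\<^sub>d \<Delta> \<in> KS"
proof -
 have iff: "\<Delta> \<in> KS \<longleftrightarrow> \<Delta> \<in> Der \<and> (\<forall>D\<in>Der. varpi A \<xi> [\<Delta>, D] = 0\<^sub>l)" for \<Delta>
  by (auto simp del: K_A simp: KK_def varpi_flat_def Dell_dual_def hom_module_def fun_eq_iff restrict_def)
 show "\<Delta> \<in> KS ==> \<Delta>' \<in> KS ==> \<Delta> +\<^sub>d \<Delta>' \<in> KS"
  "f \<in> S ==> \<Delta> \<in> KS ==> f *\<^sub>d \<Delta> \<in> KS"
  unfolding iff by (simp_all add: varpi_linear(1,3) Dell_add Dell_smult ell_smult_zero)
 obtain \<Delta> where "\<Delta> \<in> KS" "\<sigma> \<Delta> = (\<lambda>f p. 0)"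
  using K_lift[OF sections_zero[OF F_subspaces]] by blast
 hence "\<Delta> = 0\<^sub>d"
  by (intro Dell_eqI) (simp_all add: K_th Dell_apply lie_swap[of "\<lambda>f p. 0"] lie_zero_right ell_zero)
 thus "0\<^sub>d \<in> KS" using \<open>\<Delta> \<in> KS\<close> by simp
qed

lemma fun_module_K: "fun_module S \<K> d\<iota>"
proof -
 have "\<K> = \<A>\<lparr>carrier := KS\<rparr>" by (simp add: KK_def del: K_A)
 moreover have "fun_module S (\<A>\<lparr>carrier := KS\<rparr>) d\<iota>"
  by (rule Dell.sub) (auto simp: K_zero K_add K_smult)
 ultimately show ?thesis by simp
qed

sublocale K: fun_module S \<K> d\<iota>
 by (rule fun_module_K)

lemma K_comm:
 assumes \<Delta>: "\<Delta> \<in> KS" "\<Delta>' \<in> KS"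
 shows "comm \<Delta> \<Delta>' \<in> KS"
 unfolding K_iff
proof (intro conjI ballI)
 show "\<sigma> (comm \<Delta> \<Delta>') \<in> XF" using \<Delta> by (simp add: comm_mem lie_XF K_symbol)
 fix Y assume Y: "Y \<in> T"
 thus "comm \<Delta> \<Delta>' (th Y) = th (lie (\<sigma> (comm \<Delta> \<Delta>')) Y)"
  using \<Delta> by (simp add: comm_apply comm_mem K_th th_minus lie_lie)
qed (use \<Delta> comm_mem in simp)

lemma varpi_K_left: "\<Delta> \<in> KS ==> D \<in> Der ==> varpi A \<xi> [\<Delta>, D] = 0\<^sub>l"
 by (auto simp del: K_A simp: KK_def varpi_flat_def Dell_dual_def hom_module_def dest: fun_cong[of _ _ D])

lemma varpi_K_right: "\<Delta> \<in> KS ==> D \<in> Der ==> varpi A \<xi> [D, \<Delta>] = 0\<^sub>l"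
 using varpi_linear(5)[of D \<Delta> D] varpi_K_left[of \<Delta> D] by (simp add: ell_neg_zero)

text \<open>Both d\<varpi> = 0 and \<iota>_\<Delta> \<varpi> = 0, so \<L>_\<Delta> \<varpi> = 0 by
  Cartan's formula.\<close>

lemma varpi_invariant:
 assumes \<Delta>: "\<Delta> \<in> KS" and D: "D \<in> Der" "D' \<in> Der"
 shows "\<Delta> (varpi A \<xi> [D, D']) -\<^sub>l varpi A \<xi> [D, comm \<Delta> D'] = varpi A \<xi> [comm \<Delta> D, D']"
proof -
 have t: "[\<Delta>, D, D'] \<in> tuples \<A> (Suc (Suc 1))" using \<Delta> D by simp
 have "LD.dif [\<Delta>, D, D'] (varpi A \<xi>) = LD.dif [\<Delta>, D, D'] (\<lambda>zs. LD.dif zs thetaD)"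
  using t unfolding varpi_koszul by (intro LD.dif_cong[of 2] LD.koszul_eq_dif[OF altform_thetaD]) (simp_all add: numeral_2_eq_2)
 also have "\<dots> = 0\<^sub>l" by (rule LD.dif_dif[OF altform_thetaD t])
 finally have "LD.dif [\<Delta>, D, D'] (varpi A \<xi>) = 0\<^sub>l" .
 moreover have "LD.dif [D, D'] (\<lambda>zs. varpi A \<xi> (\<Delta> # zs)) = LD.dif [D, D'] (\<lambda>zs. 0\<^sub>l)"
  using \<Delta> D by (intro LD.dif_cong[of 1]) (auto elim!: tup_SucE simp: varpi_K_left)
 ultimately have "LD.lieD \<Delta> [D, D'] (varpi A \<xi>) -\<^sub>l 0\<^sub>l = 0\<^sub>l"
  using D LD.dif_zero[of "[D, D']"] by (simp del: LD.lieD.simps LD.dif.simps add: LD.dif.simps(2)[of \<Delta>])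
 thus ?thesis
  using \<Delta> D DellD(2)[OF K_A[OF \<Delta>]]
  by (intro ell.eqI) (auto dest!: arg_cong[of _ _ l\<iota>] simp: fun_eq_iff app_def comm_mem)
qed

end

context precontact_splitting
begin

section \<open>The splitting of the Atiyah algebroid\<close>

abbreviation "\<G> \<equiv> Gt A \<xi> G"
abbreviation "GS \<equiv> carrier \<G>"
abbreviation "pK \<equiv> prK A \<xi> G"
abbreviation "pG D \<equiv> D -\<^sub>d prK A \<xi> G D"

lemma Gt_iff: "D \<in> GS \<longleftrightarrow> D \<in> Der \<and> \<sigma> D \<in> XG"
 by (simp add: Gt_def)

lemma prK_unique:
 assumes D: "D \<in> Der" and "\<Delta> \<in> KS" "\<Delta>' \<in> KS"
  and "D -\<^sub>d \<Delta> \<in> GS" "D -\<^sub>d \<Delta>' \<in> GS"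
 shows "\<Delta> = \<Delta>'"
proof -
 have "\<sigma> (D -\<^sub>d \<Delta>) = \<sigma> (D -\<^sub>d \<Delta>')"
  using assms K_symbol by (intro projG_unique[of _ _ "\<sigma> D"]) (auto simp: Gt_iff symbol_minus)
 hence "\<sigma> \<Delta> = \<sigma> \<Delta>'"
  using assms by (simp add: symbol_minus fun_eq_iff)
 thus ?thesis by (rule K_eqI[OF assms(2,3)])
qed

lemma prK:
 assumes D: "D \<in> Der"
 shows "pK D \<in> KS" "pG D \<in> GS" "\<sigma> (pK D) = (\<lambda>f p. \<sigma> D f p - projG (\<sigma> D) f p)"
proof -
 obtain \<Delta> where \<Delta>: "\<Delta> \<in> KS" "\<sigma> \<Delta> = (\<lambda>f p. \<sigma> D f p - projG (\<sigma> D) f p)"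
  using K_lift[OF projG(2)[OF symbol_T[OF D]]] by blast
 moreover have "D -\<^sub>d \<Delta> \<in> GS"
  using \<Delta> D projG(1)[OF symbol_T[OF D]] by (simp add: Gt_iff symbol_minus)
 ultimately have *: "\<Delta> \<in> KS \<and> D -\<^sub>d \<Delta> \<in> GS" by blast
 have "pK D = \<Delta>"
  unfolding prK_def using * prK_unique[OF D] by (intro the_equality) blast+
 thus "pK D \<in> KS" "pG D \<in> GS" "\<sigma> (pK D) = (\<lambda>f p. \<sigma> D f p - projG (\<sigma> D) f p)"
  using * \<Delta> by simp_all
qed

lemma prK_A [simp]: "D \<in> Der ==> pK D \<in> Der"
 by (rule K_A[OF prK(1)])

lemma Gt_A: "D \<in> GS ==> D \<in> Der"
 by (simp add: Gt_iff)

lemma prK_add: "D \<in> Der ==> D' \<in> Der ==> pK (D +\<^sub>d D') = pK D +\<^sub>d pK D'"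
 using projG_axpy[of "\<sigma> D" "\<sigma> D'" "\<lambda>_. 1"] by (intro K_eqI K_add prK) (simp_all add: prK Dell_add algebra_simps)

lemma prK_smult: 
 assumes f: "f \<in> S" and D: "D \<in> Der"
 shows "pK (f *\<^sub>d D) = f *\<^sub>d pK D"
proof (intro K_eqI K_smult prK f D)
 have "projG (\<lambda>g p. 0 + f p * \<sigma> D g p) = (\<lambda>g p. projG (\<lambda>g p. 0) g p + f p * projG (\<sigma> D) g p)"
  using f D by (intro projG_axpy) simp_all
 thus "\<sigma> (pK (f *\<^sub>d D)) = \<sigma> (f *\<^sub>d pK D)"
  using f D by (simp add: prK Dell_smult projG_F[OF sections_zero[OF F_subspaces]] right_diff_distrib)
qed (use f D in simp)

lemma prK_K: "\<Delta> \<in> KS ==> pK \<Delta> = \<Delta>"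
 by (intro K_eqI prK) (simp_all add: prK projG_F K_symbol)

lemma prK_Gt: "D \<in> GS ==> pK D = 0\<^sub>d"
 by (intro K_eqI prK K_zero) (simp_all add: prK Gt_A projG_G Gt_iff Dell_zero)

lemma pG_Gt: "D \<in> GS ==> pG D = D"
 by (simp add: prK_Gt) (intro Dell.eqI; simp add: Gt_A)

lemma pG_K: "\<Delta> \<in> KS ==> pG \<Delta> = 0\<^sub>d"
 by (simp add: prK_K) (intro Dell.eqI; simp)

lemma pG_add: "D \<in> Der ==> D' \<in> Der ==> pG (D +\<^sub>d D') = pG D +\<^sub>d pG D'"
 by (simp add: prK_add) (intro Dell.eqI; simp)

lemma pG_smult: "f \<in> S ==> D \<in> Der ==> pG (f *\<^sub>d D) = f *\<^sub>d pG D"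
 by (simp add: prK_smult) (intro Dell.eqI; simp add: right_diff_distrib)

lemma prK_split: "D \<in> Der ==> D = pG D +\<^sub>d pK D"
 by (intro Dell.eqI) simp_all

lemma quot_Dperp: "quot_fun_module S \<A> d\<iota> (KS) (\<lambda>D. d\<iota> (pG D))"
proof unfold_locales
 show "KS \<subseteq> Der" by auto
 fix x y i p r
 show "d\<iota> (pG (x +\<^sub>d y)) i p = d\<iota> (pG x) i p + d\<iota> (pG y) i p" if "x \<in> Der" "y \<in> Der"
  using that unfolding pG_add[OF that] by simp
 show "d\<iota> (pG (r *\<^sub>d x)) i p = r p * d\<iota> (pG x) i p" if "r \<in> S" "x \<in> Der"
  using that unfolding pG_smult[OF that] by simp
 show "x \<in> KS \<longleftrightarrow> (\<forall>i p. d\<iota> (pG x) i p = 0)" if x: "x \<in> Der"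
 proof
  assume *: "\<forall>i p. d\<iota> (pG x) i p = 0"
  have "d\<iota> x i p = d\<iota> (pK x) i p" for i p using *[rule_format, of i p] x by simp
  hence "x = pK x" using x by (intro Dell.eqI) simp_all
  thus "x \<in> KS" using prK(1)[OF x] by simp
 qed (simp add: pG_K)
qed

sublocale qDp: quot_fun_module S \<A> d\<iota> "KS" "\<lambda>D. d\<iota> (pG D)"
 by (rule quot_Dperp)

abbreviation "mK \<equiv> mod_K A \<xi>"

lemma induced_mK:
 "D \<in> Der ==> (\<And>D'. D' \<in> Der ==> D' -\<^sub>d D \<in> KS ==> f D' = f D) ==> induced f (mK D) = f D"
 unfolding mod_K_def by (rule qDp.induced_coset)

lemma mK_eq_iff: "D \<in> Der ==> D' \<in> Der ==> mK D = mK D' \<longleftrightarrow> D -\<^sub>d D' \<in> KS"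
 unfolding mod_K_def by (rule qDp.coset_eq_diff)

text \<open>Well defined on cosets because K is closed under commutators.\<close>

lemma nabla_Dperp_mK:
 assumes \<Delta>: "\<Delta> \<in> KS" and D: "D \<in> Der"
 shows "nabla_Dperp A \<xi> \<Delta> (mK D) = mK (comm \<Delta> D)"
 unfolding nabla_Dperp_def
proof (rule induced_mK[OF D])
 fix D' assume *: "D' \<in> Der" "D' -\<^sub>d D \<in> KS"
 have "comm \<Delta> ((D' -\<^sub>d D) +\<^sub>d D) = comm \<Delta> (D' -\<^sub>d D) +\<^sub>d comm \<Delta> D"
  using \<Delta> D * by (intro LD.br_add_right) simp_all
 moreover have "(D' -\<^sub>d D) +\<^sub>d D = D'" using D * by (intro Dell.eqI) simp_all
 ultimately have e: "comm \<Delta> D' = comm \<Delta> (D' -\<^sub>d D) +\<^sub>d comm \<Delta> D" by simp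
 have "comm \<Delta> D' -\<^sub>d comm \<Delta> D = comm \<Delta> (D' -\<^sub>d D)"
  using \<Delta> D * unfolding e by (intro Dell.eqI) simp_all
 thus "mK (comm \<Delta> D') = mK (comm \<Delta> D)"
  using \<Delta> D * K_comm[OF \<Delta> *(2)] by (simp add: mK_eq_iff)
qed

section \<open>The representation of \<open>K\<close> on \<open>J\<^sup>1\<^sub>\<bottom>\<ell>\<close>\<close>

abbreviation "\<J> \<equiv> J1perp A \<xi>"
abbreviation (input) j_add (infixl "+\<^sub>j" 65) where "s +\<^sub>j t \<equiv> s \<oplus>\<^bsub>\<J>\<^esub> t"
abbreviation (input) j_diff (infixl "-\<^sub>j" 65) where "s -\<^sub>j t \<equiv> s \<ominus>\<^bsub>\<J>\<^esub> t"
abbreviation (input) j_neg ("-\<^sub>j _" [81] 80) where "-\<^sub>j s \<equiv> \<ominus>\<^bsub>\<J>\<^esub> s"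
abbreviation (input) j_smult (infixl "*\<^sub>j" 70) where "f *\<^sub>j s \<equiv> f \<odot>\<^bsub>\<J>\<^esub> s"
abbreviation (input) j_zero ("0\<^sub>j") where "0\<^sub>j \<equiv> \<zero>\<^bsub>\<J>\<^esub>"
abbreviation "JS \<equiv> carrier \<J>"

lemma J_iff: "\<alpha> \<in> JS \<longleftrightarrow> \<alpha> \<in> extensional (Der) \<and> (\<forall>D\<in>Der. \<alpha> D \<in> Sec) \<and>
  (\<forall>D\<in>Der. \<forall>D'\<in>Der. \<alpha> (D +\<^sub>d D') = \<alpha> D +\<^sub>l \<alpha> D') \<and>
  (\<forall>f\<in>S. \<forall>D\<in>Der. \<alpha> (f *\<^sub>d D) = f *\<^sub>l \<alpha> D) \<and> (\<forall>\<Delta>\<in>KS. \<alpha> \<Delta> = 0\<^sub>l)"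
 by (auto simp: J1perp_def Dell_dual_def hom_module_def PiE_def)

lemma J_ops: "0\<^sub>j = (\<lambda>D\<in>Der. 0\<^sub>l)" "\<alpha> +\<^sub>j \<beta> = (\<lambda>D\<in>Der. \<alpha> D +\<^sub>l \<beta> D)"
 "f *\<^sub>j \<alpha> = (\<lambda>D\<in>Der. f *\<^sub>l \<alpha> D)"
 by (simp_all add: J1perp_def Dell_dual_def hom_module_def)

lemma J_apply: "D \<in> Der ==> 0\<^sub>j D = 0\<^sub>l" "D \<in> Der ==> (\<alpha> +\<^sub>j \<beta>) D = \<alpha> D +\<^sub>l \<beta> D"
 "D \<in> Der ==> (f *\<^sub>j \<alpha>) D = f *\<^sub>l \<alpha> D"
 by (simp_all add: J_ops)

lemma JD:
 assumes "\<alpha> \<in> JS"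
 shows "D \<in> Der ==> \<alpha> D \<in> Sec"
  and "D \<in> Der ==> D' \<in> Der ==> \<alpha> (D +\<^sub>d D') = \<alpha> D +\<^sub>l \<alpha> D'"
  and "f \<in> S ==> D \<in> Der ==> \<alpha> (f *\<^sub>d D) = f *\<^sub>l \<alpha> D"
  and "D \<in> KS ==> \<alpha> D = 0\<^sub>l"
 using assms unfolding J_iff by blast+

lemma J_eqI: "\<alpha> \<in> JS ==> \<beta> \<in> JS ==> (\<And>D. D \<in> Der ==> \<alpha> D = \<beta> D) ==> \<alpha> = \<beta>"
 by (rule extensionalityI[of _ "Der"]) (simp_all add: J_iff)

lemma J_pG:
 assumes \<alpha>: "\<alpha> \<in> JS" and D: "D \<in> Der"
 shows "\<alpha> (pG D) = \<alpha> D"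
proof -
 have "\<alpha> D = \<alpha> (pG D) +\<^sub>l \<alpha> (pK D)"
  using JD(2)[OF \<alpha>, of "pG D" "pK D"] D prK_split[OF D] by simp
 thus ?thesis using JD(4)[OF \<alpha> prK(1)[OF D]] JD(1)[OF \<alpha>, of "pG D"] D by simp
qed

lemma J_eqI_Gt: "\<alpha> \<in> JS ==> \<beta> \<in> JS ==> (\<And>D. D \<in> GS ==> \<alpha> D = \<beta> D) ==> \<alpha> = \<beta>"
 using J_pG prK(2) by (intro J_eqI) metis+

lemma J_zero: "0\<^sub>j \<in> JS"
 unfolding J_iff by (simp add: J_apply Dell_add Dell_smult ell_smult_zero) (simp add: J_ops)

lemma J_add: assumes "\<alpha> \<in> JS" "\<beta> \<in> JS" shows "\<alpha> +\<^sub>j \<beta> \<in> JS"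
proof -
 note JD[OF assms(1)] JD[OF assms(2)]
 moreover have "(a +\<^sub>l b) +\<^sub>l (c +\<^sub>l d) = (a +\<^sub>l c) +\<^sub>l (b +\<^sub>l d)"
  if "a \<in> Sec" "b \<in> Sec" "c \<in> Sec" "d \<in> Sec" for a b c d
  using that by (intro ell.eqI) simp_all
 moreover have "f *\<^sub>l a +\<^sub>l f *\<^sub>l b = f *\<^sub>l (a +\<^sub>l b)"
  if "f \<in> S" "a \<in> Sec" "b \<in> Sec" for a b f
  using that by (intro ell.eqI) (simp_all add: algebra_simps)
 ultimately show ?thesis
  unfolding J_iff by (simp add: J_apply Dell_add Dell_smult) (simp add: J_ops)
qed

lemma J_smult: assumes r: "r \<in> S" and "\<alpha> \<in> JS" shows "r *\<^sub>j \<alpha> \<in> JS"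
proof -
 note JD[OF assms(2)] r
 moreover have "r *\<^sub>l (a +\<^sub>l b) = r *\<^sub>l a +\<^sub>l r *\<^sub>l b"
  if "a \<in> Sec" "b \<in> Sec" for a b
  using that r by (intro ell.eqI) (simp_all add: algebra_simps)
 moreover have "r *\<^sub>l (f *\<^sub>l a) = f *\<^sub>l (r *\<^sub>l a)"
  if "f \<in> S" "a \<in> Sec" for a f
  using that r by (intro ell.eqI) (simp_all add: algebra_simps)
 ultimately show ?thesis
  unfolding J_iff by (simp add: J_apply Dell_add Dell_smult ell_smult_zero) (simp add: J_ops)
qed

definition j\<iota> :: "('a derivation => 'a vfield set) => 'a derivation \<times> ('a => real) => 'a => real" where
 "j\<iota> \<alpha> = (\<lambda>(D, f) p. if D \<in> Der then l\<iota> (\<alpha> D) f p else 0)"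

lemma fun_module_J: "fun_module S \<J> j\<iota>"
proof unfold_locales
 show "inj_on j\<iota> (JS)"
 proof (rule inj_onI)
  fix \<alpha> \<beta> assume \<alpha>: "\<alpha> \<in> JS" "\<beta> \<in> JS" and eq: "j\<iota> \<alpha> = j\<iota> \<beta>"
  show "\<alpha> = \<beta>"
  proof (rule J_eqI[OF \<alpha>])
   fix D assume D: "D \<in> Der"
   have "l\<iota> (\<alpha> D) f p = l\<iota> (\<beta> D) f p" for f p
    using fun_cong[OF fun_cong[OF eq, of "(D, f)"], of p] D by (simp add: j\<iota>_def)
   thus "\<alpha> D = \<beta> D" using JD(1)[OF \<alpha>(1) D] JD(1)[OF \<alpha>(2) D] by (intro ell.eqI)
  qed
 qed
qed (auto simp: J_zero J_add J_smult j\<iota>_def J_apply JD(1) split: prod.splits)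

sublocale J: fun_module S \<J> j\<iota>
 by (rule fun_module_J)

lemma J_val: "D \<in> Der ==> j\<iota> \<alpha> (D, f) p = l\<iota> (\<alpha> D) f p"
 by (simp add: j\<iota>_def)

lemma J_neg_apply: 
 assumes \<alpha>: "\<alpha> \<in> JS" and D: "D \<in> Der"
 shows "(-\<^sub>j \<alpha>) D = -\<^sub>l \<alpha> D"
proof (rule ell.eqI)
 fix f p
 show "l\<iota> ((-\<^sub>j \<alpha>) D) f p = l\<iota> (-\<^sub>l \<alpha> D) f p"
  using J.neg_val[OF \<alpha>, of "(D, f)" p] JD(1)[OF \<alpha> D] by (simp add: J_val[OF D])
qed (use JD(1)[OF J.a_inv_closed[OF \<alpha>] D] JD(1)[OF \<alpha> D] in simp_all)

lemma J_minus_apply: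
 "\<alpha> \<in> JS ==> \<beta> \<in> JS ==> D \<in> Der ==> (\<alpha> -\<^sub>j \<beta>) D = \<alpha> D -\<^sub>l \<beta> D"
 by (simp add: a_minus_def J_apply J_neg_apply)

lemma pairing_mK:
 assumes \<alpha>: "\<alpha> \<in> JS" and D: "D \<in> Der"
 shows "pairing \<alpha> (mK D) = \<alpha> D"
 unfolding pairing_def
proof (rule induced_mK[OF D])
 fix D' assume *: "D' \<in> Der" "D' -\<^sub>d D \<in> KS"
 have "(D' -\<^sub>d D) +\<^sub>d D = D'" using D * by (intro Dell.eqI) simp_all
 hence "\<alpha> D' = \<alpha> (D' -\<^sub>d D) +\<^sub>l \<alpha> D"
  using JD(2)[OF \<alpha>, of "D' -\<^sub>d D" D] D * by simp
 thus "\<alpha> D' = \<alpha> D" using JD(4)[OF \<alpha> *(2)] JD(1)[OF \<alpha> D] by simp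
qed

abbreviation "nJ \<equiv> nabla_J1perp A \<xi>"

lemma nabla_J_apply:
 "\<Delta> \<in> KS ==> \<alpha> \<in> JS ==> D \<in> Der ==> nJ \<Delta> \<alpha> D = \<Delta> (\<alpha> D) -\<^sub>l \<alpha> (comm \<Delta> D)"
 by (simp add: nabla_J1perp_def pairing_mK nabla_Dperp_mK)

lemma nabla_J_mem:
 assumes \<Delta>: "\<Delta> \<in> KS" and \<alpha>: "\<alpha> \<in> JS"
 shows "nJ \<Delta> \<alpha> \<in> JS"
 unfolding J_iff
proof (intro conjI ballI)
 note \<Delta>A = K_A[OF \<Delta>]
 show "nJ \<Delta> \<alpha> \<in> extensional (Der)" by (simp add: nabla_J1perp_def)
 fix D assume D: "D \<in> Der"
 note m = JD(1)[OF \<alpha> D] JD(1)[OF \<alpha> LD.br_mem[OF \<Delta>A D]]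
 show "nJ \<Delta> \<alpha> D \<in> Sec"
  using m DellD(2)[OF \<Delta>A] \<Delta> \<alpha> D by (simp add: nabla_J_apply)
 show "nJ \<Delta> \<alpha> (D +\<^sub>d D') = nJ \<Delta> \<alpha> D +\<^sub>l nJ \<Delta> \<alpha> D'" if D': "D' \<in> Der" for D'
  using m DellD(2)[OF \<Delta>A] JD(1)[OF \<alpha> D'] JD(1)[OF \<alpha> LD.br_mem[OF \<Delta>A D']] \<Delta> \<alpha> \<Delta>A D D'
  by (simp add: nabla_J_apply JD(2)[OF \<alpha>] DellD(3)[OF \<Delta>A]) (intro ell.eqI; simp)
 show "nJ \<Delta> \<alpha> (f *\<^sub>d D) = f *\<^sub>l nJ \<Delta> \<alpha> D" if f: "f \<in> S" for f
  using m DellD(2)[OF \<Delta>A] \<Delta> \<alpha> \<Delta>A D f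
  by (simp add: nabla_J_apply JD(2,3)[OF \<alpha>] DellD(5)[OF \<Delta>A]) (intro ell.eqI; simp add: algebra_simps)
next
 fix \<Delta>' assume \<Delta>': "\<Delta>' \<in> KS"
 show "nJ \<Delta> \<alpha> \<Delta>' = 0\<^sub>l"
  using \<Delta> \<alpha> \<Delta>' K_comm[OF \<Delta> \<Delta>'] LD.nab_zero[OF K_A[OF \<Delta>]]
  by (simp add: nabla_J_apply JD(4)[OF \<alpha>] app_def) (intro ell.eqI; simp)
qed

lemma lie_rep_KJ: "lie_rep S \<K> d\<iota> \<J> j\<iota> comm \<sigma> nJ"
proof (unfold_locales, unfold K_ops, goal_cases)
 case (1 x y) thus ?case by (rule K_comm)
next
 case (2 x y z) thus ?case by (intro LD.br_add_left) simp_all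
next
 case (3 x) thus ?case by (intro LD.br_self) simp_all
next
 case (4 x y z) thus ?case by (intro LD.br_add_right) simp_all
next
 case (5 r x y) thus ?case by (intro LD.br_smult) simp_all
next
 case (6 x y z) thus ?case by (intro LD.jacobi) simp_all
next
 case (7 x r) thus ?case by simp
next
 case (8 x c) thus ?case by (simp add: vf_const[OF symbol_T])
next
 case (9 x e) thus ?case by (rule nabla_J_mem)
next
 case (10 x y e)
 note A = 10(1,2)[THEN K_A]
 show ?case
 proof (rule J_eqI)
  fix D assume D: "D \<in> Der"
  note m = JD(1)[OF 10(3) D] JD(1)[OF 10(3) LD.br_mem[OF A(1) D]] JD(1)[OF 10(3) LD.br_mem[OF A(2) D]]
  show "nJ (x +\<^sub>d y) e D = (nJ x e +\<^sub>j nJ y e) D"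
   using 10 A D m DellD(2)[OF A(1) m(1)] DellD(2)[OF A(2) m(1)]
   by (simp add: nabla_J_apply J_apply K_add JD(2)[OF 10(3)] Dell_apply) (intro ell.eqI; simp)
 qed (use 10 in \<open>simp_all add: nabla_J_mem K_add\<close>)
next
 case (11 r x e)
 note A = K_A[OF 11(2)]
 show ?case
 proof (rule J_eqI)
  fix D assume D: "D \<in> Der"
  note m = JD(1)[OF 11(3) D] JD(1)[OF 11(3) LD.br_mem[OF A D]]
  \<comment> \<open>\<open>br_smult_left\<close> writes [r x, D] as r [x, D] plus -1 times D(r) x;
    the second term lies in K, where e vanishes.\<close>
  have "(\<lambda>_. - 1) \<in> S" by (rule Cinf_const)
  thus "nJ (r *\<^sub>d x) e D = (r *\<^sub>j nJ x e) D"
   using 11 A D m DellD(2)[OF A m(1)]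
   by (simp add: nabla_J_apply J_apply K_smult JD(2,3,4)[OF 11(3)] Dell_apply LD.br_smult_left) (intro ell.eqI; simp add: algebra_simps)
 qed (use 11 in \<open>simp_all add: nabla_J_mem K_smult\<close>)
next
 case (12 x e f)
 note A = K_A[OF 12(1)]
 show ?case
 proof (rule J_eqI)
  fix D assume D: "D \<in> Der"
  note m = JD(1)[OF 12(2) D] JD(1)[OF 12(2) LD.br_mem[OF A D]] JD(1)[OF 12(3) D] JD(1)[OF 12(3) LD.br_mem[OF A D]]
  show "nJ x (e +\<^sub>j f) D = (nJ x e +\<^sub>j nJ x f) D"
   using 12 A D m DellD(2)[OF A]
   by (simp add: nabla_J_apply J_apply DellD(3)[OF A]) (intro ell.eqI; simp)
 qed (use 12 in \<open>simp_all add: nabla_J_mem\<close>)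
next
 case (13 x e r)
 note A = K_A[OF 13(1)]
 show ?case
 proof (rule J_eqI)
  fix D assume D: "D \<in> Der"
  note m = JD(1)[OF 13(2) D] JD(1)[OF 13(2) LD.br_mem[OF A D]]
  show "nJ x (r *\<^sub>j e) D = (r *\<^sub>j nJ x e +\<^sub>j \<sigma> x r *\<^sub>j e) D"
   using 13 A D m DellD(2)[OF A]
   by (simp add: nabla_J_apply J_apply DellD(5)[OF A]) (intro ell.eqI; simp add: algebra_simps)
 qed (use 13 A in \<open>simp_all add: nabla_J_mem\<close>)
next
 case (14 x y e)
 note A = 14(1,2)[THEN K_A]
 show ?case
 proof (rule J_eqI)
  fix D assume D: "D \<in> Der"
  note m = JD(1)[OF 14(3)]
  note B = LD.br_mem[OF A(1) D] LD.br_mem[OF A(2) D]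
  have j: "e (comm x (comm y D)) = e (comm (comm x y) D) +\<^sub>l e (comm y (comm x D))"
   using LD.jacobi[OF A D] JD(2)[OF 14(3), of "comm (comm x y) D" "comm y (comm x D)"] A B D by simp
  have c: "(comm x y) (e D) = x (y (e D)) -\<^sub>l y (x (e D))"
   by (rule comm_apply[OF m[OF D]])
  show "nJ (comm x y) e D = (nJ x (nJ y e) -\<^sub>j nJ y (nJ x e)) D"
   using 14 A D B m[OF D] m[OF B(1)] m[OF B(2)] m[OF LD.br_mem[OF A(1) B(2)]] m[OF LD.br_mem[OF A(2) B(1)]] 
    m[OF LD.br_mem[OF LD.br_mem[OF A] D]] DellD(2)[OF A(1)] DellD(2)[OF A(2)]
   by (simp add: nabla_J_apply nabla_J_mem K_comm J_minus_apply Dell_minus[OF A(1)] Dell_minus[OF A(2)] j c del: LD.br_add_left)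
    (intro ell.eqI; simp)
 qed (use 14 in \<open>simp_all add: nabla_J_mem K_comm\<close>)
qed

section \<open>The isomorphism \<open>\<varpi>\<^sup>\<flat>\<close>\<close>

abbreviation "vf\<beta> \<equiv> varpi_flat A \<xi>"

lemma vflat_apply: "D' \<in> Der ==> vf\<beta> D D' = varpi A \<xi> [D, D']"
 by (simp add: varpi_flat_def)

lemma varpi_flat_J: "D \<in> Der ==> vf\<beta> D \<in> JS"
 unfolding J_iff
 by (simp add: vflat_apply Dell_add Dell_smult varpi_linear(2,4) varpi_K_right) (simp add: varpi_flat_def)

lemma varpi_flat_add: "D \<in> Der ==> D' \<in> Der ==> vf\<beta> (D +\<^sub>d D') = vf\<beta> D +\<^sub>j vf\<beta> D'"
 by (rule J_eqI) (simp_all add: varpi_flat_J vflat_apply J_apply varpi_linear(1))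

lemma varpi_flat_smult: "f \<in> S ==> D \<in> Der ==> vf\<beta> (f *\<^sub>d D) = f *\<^sub>j vf\<beta> D"
 by (rule J_eqI) (simp_all add: varpi_flat_J vflat_apply J_apply varpi_linear(3))

lemma varpi_flat_K: "D \<in> Der ==> vf\<beta> D = 0\<^sub>j \<longleftrightarrow> D \<in> KS"
 by (simp add: KK_def J1perp_def del: K_A)

lemma varpi_flat_equivariant:
 assumes \<Delta>: "\<Delta> \<in> KS" and D: "D \<in> Der"
 shows "nJ \<Delta> (vf\<beta> D) = vf\<beta> (comm \<Delta> D)"
 using \<Delta> D varpi_invariant[OF \<Delta> D]
 by (intro J_eqI) (simp_all add: varpi_flat_J nabla_J_mem nabla_J_apply vflat_apply)

text \<open>The equation to solve for D is D \<theta>(\<sigma>(D')) - D' \<theta>(\<sigma>(D)) -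
  \<theta>[\<sigma>(D), \<sigma>(D')] = \<alpha>(D') for all D'. Taking D' = id forces
  \<theta>(\<sigma>(D)) = -\<alpha>(id), which determines \<sigma>(D) up to a section of \<xi>; Y0
  is one candidate. The freedom in \<xi> is then spent on making D well defined on \<ell>.\<close>

lemma varpi_flat_surj:
 assumes \<alpha>: "\<alpha> \<in> JS"
 shows "\<exists>D\<in>Der. vf\<beta> D = \<alpha>"
proof -
 note am = JD(1)[OF \<alpha>]
 obtain Y0 where Y0: "Y0 \<in> T" "-\<^sub>l \<alpha> idD = th Y0"
  using am[OF idD(1)] ell_cases[of "-\<^sub>l \<alpha> idD"] by auto
 \<comment> \<open>The equation now reads D \<theta>(Y) = F(D') + \<theta>[\<sigma>(D), Y] with Y =
   \<sigma>(D').\<close>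
 define F where "F D = \<alpha> D +\<^sub>l D (th Y0)" for D
 have Fm [simp]: "F D \<in> Sec" if "D \<in> Der" for D
  using that am Y0 DellD(2) by (simp add: F_def)
 have Fadd: "F (D +\<^sub>d D') = F D +\<^sub>l F D'" if D: "D \<in> Der" "D' \<in> Der" for D D'
  using D am[OF D(1)] am[OF D(2)] Y0 DellD(2)[OF D(1) th_mem[OF Y0(1)]] DellD(2)[OF D(2) th_mem[OF Y0(1)]]
  by (simp add: F_def JD(2)[OF \<alpha>] Dell_apply) (intro ell.eqI; simp)
 have Fsm: "F (h *\<^sub>d D) = h *\<^sub>l F D" if D: "h \<in> S" "D \<in> Der" for D h
  using D am[OF D(2)] Y0 DellD(2)[OF D(2) th_mem[OF Y0(1)]]
  by (simp add: F_def JD(3)[OF \<alpha>] Dell_apply) (intro ell.eqI; simp add: algebra_simps)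
 have Fid: "F idD = 0\<^sub>l"
  using am[OF idD(1)] Y0(1) by (simp add: F_def idD(3) flip: Y0(2)) (intro ell.eqI; simp)
 have Fsym: "F D = F D'" if D: "D \<in> Der" "D' \<in> Der" "\<sigma> D = \<sigma> D'" for D D'
 proof -
  have "\<sigma> (D -\<^sub>d D') = (\<lambda>f p. 0)" using D by (simp add: symbol_minus)
  then obtain k where k: "k \<in> S" "D -\<^sub>d D' = k *\<^sub>d idD"
   using symbol_kernel[of "D -\<^sub>d D'"] D by auto
  have "F (D -\<^sub>d D') = 0\<^sub>l" unfolding k(2) using k(1) idD(1) by (simp add: Fsm Fid ell_smult_zero)
  moreover have "F D = F ((D -\<^sub>d D') +\<^sub>d D')"
   using D by (intro arg_cong[of _ _ F] Dell.eqI) simp_all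
  ultimately show ?thesis using D by (simp add: Fadd)
 qed
 \<comment> \<open>F is linear over functions and vanishes on the identity, hence on the kernel of
   the symbol; so it is a function of the symbol.\<close>
 define FT where "FT Y = F (conn Y)" for Y
 have FTm [simp]: "FT Y \<in> Sec" if "Y \<in> T" for Y using conn(1)[OF that] by (simp add: FT_def)
 have FT: "F D = FT (\<sigma> D)" if "D \<in> Der" for D
  unfolding FT_def using that by (intro Fsym conn) (simp_all add: conn)
 have FTlin: "FT (\<lambda>f p. Y f p + h p * Y' f p) = FT Y +\<^sub>l h *\<^sub>l FT Y'" if Y: "Y \<in> T" "Y' \<in> T" "h \<in> S" for Y Y' h
 proof -
  note c = conn[OF Y(1)] conn[OF Y(2)]
  have "F (conn Y +\<^sub>d h *\<^sub>d conn Y') = FT Y +\<^sub>l h *\<^sub>l FT Y'"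
   using c Y(3) by (simp add: Fadd Fsm Dell_smult FT_def)
  moreover have "F (conn Y +\<^sub>d h *\<^sub>d conn Y') = FT (\<sigma> (conn Y +\<^sub>d h *\<^sub>d conn Y'))"
   using c Y(3) by (intro FT) (simp add: Dell_add Dell_smult)
  ultimately show ?thesis using c Y(3) by (simp add: Dell_add Dell_smult)
 qed
 have "\<exists>Z. Z \<in> T \<and> th Z = -\<^sub>l (FT Y +\<^sub>l th (lie Y0 Y))" if Y: "Y \<in> T" for Y
 proof -
  have "-\<^sub>l (FT Y +\<^sub>l th (lie Y0 Y)) \<in> Sec" using Y Y0(1) by simp
  thus ?thesis by (metis ell_cases)
 qed
 then obtain \<gamma> where \<gamma>: "\<And>Y. Y \<in> T ==> \<gamma> Y \<in> T" "\<And>Y. Y \<in> T ==> th (\<gamma> Y) = -\<^sub>l (FT Y +\<^sub>l th (lie Y0 Y))"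
  by metis
 obtain X' where X': "X' \<in> X\<xi>" "\<And>Y. Y \<in> X\<xi> ==> (\<lambda>f p. lie X' Y f p - \<gamma> Y f p) \<in> X\<xi>"
 proof -
  have 1: "\<gamma> Y \<in> T" if "Y \<in> X\<xi>" for Y using \<gamma>(1) sec_T[OF that] .
  \<comment> \<open>F is evaluated on the element of K over Y: there \<alpha> vanishes, and the Bott
    derivative of \<theta>(Y0) cancels \<theta>[Y0, Y].\<close>
  have 2: "\<gamma> Y \<in> X\<xi>" if Y: "Y \<in> XF" for Y
  proof -
   have YT: "Y \<in> T" using Y by (rule sec_T)
   obtain \<Delta> where \<Delta>: "\<Delta> \<in> KS" "\<sigma> \<Delta> = Y" using K_lift[OF Y] by blast
   have "FT Y = th (lie Y Y0)"
    using FT[OF K_A[OF \<Delta>(1)]] \<Delta> Y0 YT by (simp add: F_def JD(4)[OF \<alpha>] K_th)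
   moreover have "lie Y0 Y = (\<lambda>f p. - lie Y Y0 f p)" by (simp add: lie_def)
   ultimately have "th (\<gamma> Y) = -\<^sub>l (th (\<lambda>f p. 0))"
    using \<gamma>(2)[OF YT] YT Y0(1) th_add[of "lie Y Y0" "lie Y0 Y"] by simp
   hence "th (\<gamma> Y) = 0\<^sub>l" by (simp add: ell_neg_zero flip: ell_zero)
   thus ?thesis using th_zero_iff[OF \<gamma>(1)[OF YT]] by simp
  qed
  have 3: "(\<lambda>f p. \<gamma> (\<lambda>f p. X f p + h p * Y f p) f p - (\<gamma> X f p + h p * \<gamma> Y f p)) \<in> X\<xi>"
   if XY: "X \<in> X\<xi>" "Y \<in> X\<xi>" "h \<in> S" for X Y h
  proof -
  have T: "X \<in> T" "Y \<in> T" using XY sec_T by blast+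
  define H where "H = (\<lambda>f p. X f p + h p * Y f p)"
  have H: "H \<in> T" using T XY by (simp add: H_def)
  have y: "th Y = 0\<^sub>l" using XY T th_zero_iff by blast
  have "th (lie Y0 H) = (th (lie Y0 X) +\<^sub>l h *\<^sub>l th (lie Y0 Y)) +\<^sub>l Y0 h *\<^sub>l th Y"
   using T XY Y0(1) vf_mem[OF Y0(1)] by (simp add: H_def lie_axpy_right th_add th_smult)
  also have "\<dots> = th (lie Y0 X) +\<^sub>l h *\<^sub>l th (lie Y0 Y)"
   unfolding y using T XY Y0(1) vf_mem[OF Y0(1)] by (simp add: ell_smult_zero)
  finally have l: "th (lie Y0 H) = th (lie Y0 X) +\<^sub>l h *\<^sub>l th (lie Y0 Y)" .
  have "th (\<gamma> H) = th (\<gamma> X) +\<^sub>l h *\<^sub>l th (\<gamma> Y)"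
   unfolding \<gamma>(2)[OF H] \<gamma>(2)[OF T(1)] \<gamma>(2)[OF T(2)] l using FTlin[OF T XY(3)] T Y0(1) XY(3)
   by (simp add: H_def[symmetric]) (intro ell.eqI; simp add: algebra_simps)
  also have "\<dots> = th (\<lambda>f p. \<gamma> X f p + h p * \<gamma> Y f p)"
   using T XY(3) \<gamma>(1)[OF T(1)] \<gamma>(1)[OF T(2)] by (simp add: th_add th_smult)
  finally show "(\<lambda>f p. \<gamma> (\<lambda>f p. X f p + h p * Y f p) f p - (\<gamma> X f p + h p * \<gamma> Y f p)) \<in> X\<xi>"
   using \<gamma>(1)[OF H] \<gamma>(1)[OF T(1)] \<gamma>(1)[OF T(2)] XY(3) unfolding H_def by (subst (asm) th_eq_iff) simp_all
  qed
  obtain X' where "X' \<in> X\<xi>" "\<forall>Y\<in>X\<xi>. (\<lambda>f p. lie X' Y f p - \<gamma> Y f p) \<in> X\<xi>"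
   by (rule omega_nondegenerate[of \<gamma>, OF 1 2 3]) blast+
  thus thesis using that by blast
 qed
 \<comment> \<open>Adding the section X' of \<xi> does not change \<theta>(Y0), and it adjusts
   \<theta>[X, Y] so that D kills \<Gamma>(\<xi>).\<close>
 define X where "X = (\<lambda>f p. Y0 f p + X' f p)"
 have X'T: "X' \<in> T" using X'(1) by (rule sec_T)
 have XT: "X \<in> T" using Y0(1) X'T by (simp add: X_def)
 have thX: "th X = th Y0"
  using th_eq[of X Y0] XT Y0(1) X'(1) by (simp add: X_def)
 have "\<exists>D\<in>Der. \<sigma> D = X \<and> (\<forall>Y\<in>T. D (th Y) = FT Y +\<^sub>l th (lie X Y))"
 proof (rule derivation_exists)
  show "FT Y +\<^sub>l th (lie X Y) = 0\<^sub>l" if Y: "Y \<in> X\<xi>" for Y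
  proof -
   have YT: "Y \<in> T" using Y by (rule sec_T)
   have "th (lie X' Y) = th (\<gamma> Y)" using X'(2)[OF Y] X'T YT \<gamma>(1)[OF YT] by (simp add: th_eq_iff)
   moreover have "th (lie X Y) = th (lie Y0 Y) +\<^sub>l th (lie X' Y)"
    using YT Y0(1) X'T by (simp add: X_def lie_add_left th_add)
   ultimately show ?thesis
    using YT Y0(1) \<gamma>(2)[OF YT] by simp (intro ell.eqI; simp)
  qed
  fix Y Y' h assume *: "Y \<in> T" "Y' \<in> T" "h \<in> S"
  have "th (lie X (\<lambda>f p. Y f p + h p * Y' f p)) = (th (lie X Y) +\<^sub>l h *\<^sub>l th (lie X Y')) +\<^sub>l X h *\<^sub>l th Y'"
   using * XT vf_mem[OF XT] by (simp add: lie_axpy_right th_add th_smult)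
  thus "FT (\<lambda>f p. Y f p + h p * Y' f p) +\<^sub>l th (lie X (\<lambda>f p. Y f p + h p * Y' f p)) =
   ((FT Y +\<^sub>l th (lie X Y)) +\<^sub>l h *\<^sub>l (FT Y' +\<^sub>l th (lie X Y'))) +\<^sub>l X h *\<^sub>l th Y'"
   using * XT vf_mem[OF XT] FTlin[OF *] by simp (intro ell.eqI; simp add: algebra_simps)
 qed (use XT in simp_all)
 then obtain D where D: "D \<in> Der" "\<sigma> D = X" "\<And>Y. Y \<in> T ==> D (th Y) = FT Y +\<^sub>l th (lie X Y)" by blast
 have "vf\<beta> D = \<alpha>"
 proof (rule J_eqI[OF varpi_flat_J[OF D(1)] \<alpha>])
  fix D' assume D': "D' \<in> Der"
  have "FT (\<sigma> D') = \<alpha> D' +\<^sub>l D' (th Y0)" using FT[OF D'] by (simp add: F_def)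
  thus "vf\<beta> D D' = \<alpha> D'"
   using D D' XT Y0(1) am[OF D'] DellD(2)[OF D' th_mem[OF Y0(1)]]
   by (simp add: vflat_apply varpi_eq thX) (intro ell.eqI; simp)
 qed
 with D(1) show ?thesis by blast
qed

definition \<rho> :: "('a derivation => 'a vfield set) => 'a vfield set" where
 "\<rho> \<alpha> = symbol_perp A \<xi> (varpi_sharp_perp A \<xi> \<alpha>)"

lemma varpi_flat_eq_iff:
 assumes D: "D \<in> Der" "D' \<in> Der"
 shows "vf\<beta> D = vf\<beta> D' \<longleftrightarrow> D -\<^sub>d D' \<in> KS"
proof -
 have "vf\<beta> D = vf\<beta> ((D -\<^sub>d D') +\<^sub>d D')"
  using D by (intro arg_cong[of _ _ vf\<beta>] Dell.eqI) simp_all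
 also have "\<dots> = vf\<beta> (D -\<^sub>d D') +\<^sub>j vf\<beta> D'"
  using D by (simp add: varpi_flat_add)
 finally have e: "vf\<beta> D = vf\<beta> (D -\<^sub>d D') +\<^sub>j vf\<beta> D'" .
 have "vf\<beta> D = vf\<beta> D' \<longleftrightarrow> vf\<beta> (D -\<^sub>d D') = 0\<^sub>j"
  unfolding e using D varpi_flat_J[of "D -\<^sub>d D'"] varpi_flat_J[OF D(2)] by simp
 thus ?thesis using D by (simp add: varpi_flat_K)
qed

text \<open>Together with surjectivity of \<varpi>^\<flat> this removes the inverse and the cosets:
  each property of \<rho> becomes one of the symbol.\<close>

lemma \<rho>_varpi:
 assumes D: "D \<in> Der"
 shows "\<rho> (vf\<beta> D) = nf (\<sigma> D)"
proof -
 have p: "varpi_flat_perp A \<xi> (mK D) = vf\<beta> D" if D: "D \<in> Der" for D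
  unfolding varpi_flat_perp_def using D by (intro induced_mK) (simp_all add: varpi_flat_eq_iff)
 have c: "carrier (Dperp A \<xi>) = mK ` Der"
  by (auto simp: Dperp_def qDp.quot_carrier mod_K_def)
 have "inj_on (varpi_flat_perp A \<xi>) (carrier (Dperp A \<xi>))"
  unfolding c by (intro inj_onI) (elim imageE, simp add: p varpi_flat_eq_iff mK_eq_iff)
 hence "varpi_sharp_perp A \<xi> (vf\<beta> D) = mK D"
  unfolding varpi_sharp_perp_def using D c by (intro inv_into_f_eq) (auto simp: p)
 moreover have "symbol_perp A \<xi> (mK D) = nf (\<sigma> D)"
  unfolding symbol_perp_def
 proof (rule induced_mK[OF D])
  fix D' assume "D' \<in> Der" "D' -\<^sub>d D \<in> KS"
  thus "nf (\<sigma> D') = nf (\<sigma> D)" using D K_symbol[of "D' -\<^sub>d D"] by (simp add: nf_eq_iff symbol_minus)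
 qed
 ultimately show ?thesis by (simp add: \<rho>_def)
qed

lemma J_cases:
 assumes "\<alpha> \<in> JS"
 obtains D where "D \<in> Der" "\<alpha> = vf\<beta> D"
 using varpi_flat_surj[OF assms] by blast

lemma \<rho>_mem [simp]: "\<alpha> \<in> JS ==> \<rho> \<alpha> \<in> carrier (NF A \<xi>)"
 by (erule J_cases) (simp add: \<rho>_varpi)

lemma \<rho>_add: "\<alpha> \<in> JS ==> \<beta> \<in> JS ==> \<rho> (\<alpha> +\<^sub>j \<beta>) = \<rho> \<alpha> \<oplus>\<^bsub>NF A \<xi>\<^esub> \<rho> \<beta>"
 by (erule J_cases, erule J_cases) (simp add: \<rho>_varpi Dell_add nf_add flip: varpi_flat_add)

lemma \<rho>_smult: "f \<in> S ==> \<alpha> \<in> JS ==> \<rho> (f *\<^sub>j \<alpha>) = f \<odot>\<^bsub>NF A \<xi>\<^esub> \<rho> \<alpha>"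
 by (erule J_cases) (simp add: \<rho>_varpi Dell_smult nf_smult flip: varpi_flat_smult)

lemma \<rho>_equivariant:
 "\<Delta> \<in> KS ==> \<alpha> \<in> JS ==> \<rho> (nJ \<Delta> \<alpha>) = nabla_NF A \<xi> (\<sigma> \<Delta>) (\<rho> \<alpha>)"
 by (erule J_cases) (simp add: varpi_flat_equivariant \<rho>_varpi comm_mem nabla_NF_nf K_symbol)

end

section \<open>Naturality of the Koszul differential\<close>

locale natural_forms = a: fm_pair S L \<kappa> E \<iota> + b: fm_pair S L' \<kappa>' E' \<iota>'
 for S :: "('a => real) set" and L :: "('a => real, 'x) module" and \<kappa> :: "'x => 'j => 'a => real"
  and E :: "('a => real, 'y) module" and \<iota> :: "'y => 'i => 'a => real"
  and L' :: "('a => real, 'z) module" and \<kappa>' :: "'z => 'k => 'a => real"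
  and E' :: "('a => real, 'w) module" and \<iota>' :: "'w => 'l => 'a => real" +
 fixes g :: "'z => 'x" and \<phi> :: "'y => 'w"
 assumes g_mem: "x \<in> carrier L' ==> g x \<in> carrier L"
  and g_add: "x \<in> carrier L' ==> y \<in> carrier L' ==> g (x \<oplus>\<^bsub>L'\<^esub> y) = g x \<oplus>\<^bsub>L\<^esub> g y"
  and g_smult: "r \<in> S ==> x \<in> carrier L' ==> g (r \<odot>\<^bsub>L'\<^esub> x) = r \<odot>\<^bsub>L\<^esub> g x"
  and \<phi>_mem: "e \<in> carrier E ==> \<phi> e \<in> carrier E'"
  and \<phi>_add: "e \<in> carrier E ==> f \<in> carrier E ==> \<phi> (e \<oplus>\<^bsub>E\<^esub> f) = \<phi> e \<oplus>\<^bsub>E'\<^esub> \<phi> f"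
  and \<phi>_smult: "r \<in> S ==> e \<in> carrier E ==> \<phi> (r \<odot>\<^bsub>E\<^esub> e) = r \<odot>\<^bsub>E'\<^esub> \<phi> e"
begin

lemma \<phi>_zero: "\<phi> \<zero>\<^bsub>E\<^esub> = \<zero>\<^bsub>E'\<^esub>"
proof -
 have "\<phi> \<zero>\<^bsub>E\<^esub> = \<phi> \<zero>\<^bsub>E\<^esub> \<oplus>\<^bsub>E'\<^esub> \<phi> \<zero>\<^bsub>E\<^esub>" using \<phi>_add[of "\<zero>\<^bsub>E\<^esub>" "\<zero>\<^bsub>E\<^esub>"] by simp
 thus ?thesis using \<phi>_mem[of "\<zero>\<^bsub>E\<^esub>"] by (metis b.E.add.r_cancel_one a.E.zero_closed)
qed

lemma map_g: "xs \<in> tuples L' n ==> map g xs \<in> tuples L n"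
 by (auto simp: tuples_def g_mem)

lemma altform_natural: "a.altform n \<eta> ==> b.altform n (\<lambda>xs. \<phi> (\<eta> (map g xs)))"
proof (induction n arbitrary: \<eta>)
 case (Suc n)
 have m: "\<eta> (x # map g xs) \<in> carrier E" if "x \<in> carrier L" "xs \<in> tuples L' n" for x xs
  using that map_g a.altform_mem[OF Suc.prems] by simp
 have "\<phi> (\<eta> (g x # g x # map g xs)) = \<zero>\<^bsub>E'\<^esub>" if "x \<in> carrier L'" "x # xs \<in> tuples L' n" for x xs
  using that Suc.prems map_g[OF that(2)] g_mem by (simp add: \<phi>_zero)
 thus ?case
  using Suc.prems Suc.IH[OF a.altform_Cons[OF Suc.prems g_mem]] m map_g
  by (simp add: g_add g_smult \<phi>_add \<phi>_smult g_mem)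
qed (simp add: \<phi>_mem)

end

text \<open>The comparison concerns arguments from B, a set closed under the bracket. The symbol
  intertwines the action of D\<ell> on \<ell> with the Bott connection on K only, so there B is K
  inside D\<ell>.\<close>

locale natural_rep = a: lie_rep S L \<kappa> E \<iota> br anc nab + b: lie_rep S L' \<kappa>' E' \<iota>' br' anc' nab'
 for S :: "('a => real) set" and L :: "('a => real, 'x) module" and \<kappa> :: "'x => 'j => 'a => real"
  and E :: "('a => real, 'y) module" and \<iota> :: "'y => 'i => 'a => real" and br anc nab
  and L' :: "('a => real, 'z) module" and \<kappa>' :: "'z => 'k => 'a => real"
  and E' :: "('a => real, 'w) module" and \<iota>' :: "'w => 'l => 'a => real" and br' anc' nab' +
 fixes B :: "'z set" and g :: "'z => 'x" and \<phi> :: "'y => 'w"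
 assumes B: "B \<subseteq> carrier L'"
  and br_B: "x \<in> B ==> y \<in> B ==> br' x y \<in> B"
  and g_B: "x \<in> B ==> g x \<in> carrier L"
  and g_br: "x \<in> B ==> y \<in> B ==> g (br' x y) = br (g x) (g y)"
  and \<phi>_mem': "e \<in> carrier E ==> \<phi> e \<in> carrier E'"
  and \<phi>_add': "e \<in> carrier E ==> f \<in> carrier E ==> \<phi> (e \<oplus>\<^bsub>E\<^esub> f) = \<phi> e \<oplus>\<^bsub>E'\<^esub> \<phi> f"
  and \<phi>_nab: "x \<in> B ==> e \<in> carrier E ==> nab' x (\<phi> e) = \<phi> (nab (g x) e)"
begin

lemma \<phi>_diff:
 assumes e: "e \<in> carrier E" "f \<in> carrier E"
 shows "\<phi> (e \<ominus>\<^bsub>E\<^esub> f) = \<phi> e \<ominus>\<^bsub>E'\<^esub> \<phi> f"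
proof -
 have "\<phi> e = \<phi> ((e \<ominus>\<^bsub>E\<^esub> f) \<oplus>\<^bsub>E\<^esub> f)" using e by (intro arg_cong[of _ _ \<phi>] a.E.eqI) simp_all
 also have "\<dots> = \<phi> (e \<ominus>\<^bsub>E\<^esub> f) \<oplus>\<^bsub>E'\<^esub> \<phi> f" using e by (simp add: \<phi>_add')
 finally show ?thesis using e by (intro b.E.eqI) (simp_all add: \<phi>_mem')
qed

lemma map_B: "set xs \<subseteq> B ==> length xs = n ==> map g xs \<in> tuples L n"
 by (auto simp: tuples_def g_B)

lemma lieD_natural:
 assumes "a.E_valued n \<eta>" "x \<in> B" "set xs \<subseteq> B" "length xs = n"
  and "\<And>ys. set ys \<subseteq> B ==> length ys = n ==> \<zeta> ys = \<phi> (\<eta> (map g ys))"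
 shows "b.lieD x xs \<zeta> = \<phi> (a.lieD (g x) (map g xs) \<eta>)"
 using assms
proof (induction xs arbitrary: n \<eta> \<zeta>)
 case Nil
 thus ?case by (simp add: a.E_valued_def \<phi>_nab)
next
 case (Cons y ys)
 obtain m where n: "n = Suc m" "length ys = m" using Cons.prems(4) by auto
 have y: "y \<in> B" "set ys \<subseteq> B" using Cons.prems(3) by auto
 have v: "a.E_valued m (\<lambda>zs. \<eta> (g y # zs))" using Cons.prems(1) n g_B[OF y(1)] by simp
 have "b.lieD x ys (\<lambda>zs. \<zeta> (y # zs)) = \<phi> (a.lieD (g x) (map g ys) (\<lambda>zs. \<eta> (g y # zs)))"
  using v Cons.prems(2) y n Cons.prems(5) by (intro Cons.IH[of m]) simp_all
 moreover have "\<zeta> (br' x y # ys) = \<phi> (\<eta> (br (g x) (g y) # map g ys))"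
  using Cons.prems(2,5) y n br_B by (simp add: g_br)
 moreover have "\<eta> (br (g x) (g y) # map g ys) \<in> carrier E"
  using Cons.prems(1,2) n y g_B map_B[OF y(2) n(2)] by (simp add: a.E_valuedD)
 moreover have "a.lieD (g x) (map g ys) (\<lambda>zs. \<eta> (g y # zs)) \<in> carrier E"
  using v map_B[OF y(2) n(2)] g_B[OF Cons.prems(2)] by simp
 ultimately show ?case by (simp add: \<phi>_diff)
qed

lemma dif_natural:
 assumes "a.E_valued n \<eta>" "set xs \<subseteq> B" "length xs = Suc n"
  and "\<And>ys. set ys \<subseteq> B ==> length ys = n ==> \<zeta> ys = \<phi> (\<eta> (map g ys))"
 shows "b.dif xs \<zeta> = \<phi> (a.dif (map g xs) \<eta>)"
 using assms
proof (induction n arbitrary: xs \<eta> \<zeta>)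
 case 0
 then obtain x where x: "xs = [x]" by (auto simp: length_Suc_conv)
 have m: "nab (g x) (\<eta> []) \<in> carrier E" using 0 x g_B by (simp add: a.E_valued_def)
 have "\<phi> (nab (g x) (\<eta> [])) = \<phi> (nab (g x) (\<eta> []) \<ominus>\<^bsub>E\<^esub> \<zero>\<^bsub>E\<^esub>)"
  using m by (intro arg_cong[of _ _ \<phi>] a.E.eqI) simp_all
 moreover have "\<phi> (nab (g x) (\<eta> [])) = \<phi> (nab (g x) (\<eta> [])) \<ominus>\<^bsub>E'\<^esub> \<zero>\<^bsub>E'\<^esub>"
  using m \<phi>_mem' by (intro b.E.eqI) simp_all
 moreover have "nab' x (\<zeta> []) = \<phi> (nab (g x) (\<eta> []))"
  using 0 x by (simp add: a.E_valued_def \<phi>_nab)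
 ultimately show ?case using x by simp
next
 case (Suc n)
 then obtain y ys where y: "xs = y # ys" "y \<in> B" "set ys \<subseteq> B" "length ys = Suc n"
  by (cases xs) auto
 have v: "a.E_valued n (\<lambda>zs. \<eta> (g y # zs))" using Suc.prems(1) g_B[OF y(2)] by simp
 have "b.dif ys (\<lambda>zs. \<zeta> (y # zs)) = \<phi> (a.dif (map g ys) (\<lambda>zs. \<eta> (g y # zs)))"
  using v y Suc.prems(4) by (intro Suc.IH) simp_all
 moreover have "b.lieD y ys \<zeta> = \<phi> (a.lieD (g y) (map g ys) \<eta>)"
  using y Suc.prems by (intro lieD_natural[of "Suc n"]) simp_all
 moreover have "a.dif (map g ys) (\<lambda>zs. \<eta> (g y # zs)) \<in> carrier E"
  using v map_B[OF y(3,4)] by simp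
 moreover have "a.lieD (g y) (map g ys) \<eta> \<in> carrier E"
  using Suc.prems(1) map_B[OF y(3,4)] g_B[OF y(2)] by simp
 ultimately show ?case using y(1) by (simp add: \<phi>_diff)
qed

lemma koszul_natural:
 assumes "a.altform n \<eta>" "b.altform n \<zeta>" "set xs \<subseteq> B" "length xs = Suc n"
  and "\<And>ys. set ys \<subseteq> B ==> length ys = n ==> \<zeta> ys = \<phi> (\<eta> (map g ys))"
 shows "koszul L' br' E' nab' n \<zeta> xs = \<phi> (koszul L br E nab n \<eta> (map g xs))"
proof -
 have "xs \<in> tuples L' (Suc n)" using assms(3,4) B by (auto simp: tuples_def)
 thus ?thesis
  using dif_natural[OF a.altform_valued[OF assms(1)] assms(3,4,5)] assms(1,2) map_B[OF assms(3,4)]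
  by (simp add: a.koszul_eq_dif b.koszul_eq_dif)
qed

end

text \<open>Negation in a module of forms is an abstract additive inverse, so its values are read
  off in the realisation. M is a parameter because the forms of bidegree (1, b) use this rule
  too.\<close>

lemma (in fm_pair) neg_apply:
 assumes M: "fun_module S M (\<lambda>\<eta> (xs, i) p. if xs \<in> tuples L n then \<iota> (\<eta> xs) i p else 0)"
  and mem: "\<And>\<eta>. \<eta> \<in> carrier M ==> \<eta> xs \<in> carrier E" and \<eta>: "\<eta> \<in> carrier M" and xs: "xs \<in> tuples L n"
 shows "(\<ominus>\<^bsub>M\<^esub> \<eta>) xs = \<ominus>\<^bsub>E\<^esub> \<eta> xs"
proof -
 interpret M: fun_module S M "\<lambda>\<eta> (xs, i) p. if xs \<in> tuples L n then \<iota> (\<eta> xs) i p else 0" by (rule M)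
 show ?thesis
 proof (rule E.eqI)
  show "\<iota> ((\<ominus>\<^bsub>M\<^esub> \<eta>) xs) i p = \<iota> (\<ominus>\<^bsub>E\<^esub> \<eta> xs) i p" for i p
   using M.neg_val[OF \<eta>, of "(xs, i)" p] xs mem[OF \<eta>] by simp
 qed (use mem M.a_inv_closed \<eta> in auto)
qed

section \<open>Generalities on complexes and chain maps\<close>

lemma cochain_complex_neg_diff:
 assumes M: "\<And>n. fun_module S (M n) (j n)" and d: "cochain_complex M d"
 shows "cochain_complex M (neg_diff M d)"
 unfolding cochain_complex_def real_linear_def
proof (intro allI conjI ballI)
 fix n
 interpret M: fun_module S "M m" "j m" for m by (rule M)
 have lin: "real_linear (M n) (M (Suc n)) (d n)" and dd: "x \<in> carrier (M n) ==> d (Suc n) (d n x) = \<zero>\<^bsub>M (Suc (Suc n))\<^esub>" for n x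
  using d unfolding cochain_complex_def by blast+
 have mem: "d n x \<in> carrier (M (Suc n))" if "x \<in> carrier (M n)" for n x
  using lin[of n] that unfolding real_linear_def by blast
 have add: "d n (x \<oplus>\<^bsub>M n\<^esub> y) = d n x \<oplus>\<^bsub>M (Suc n)\<^esub> d n y" if "x \<in> carrier (M n)" "y \<in> carrier (M n)" for n x y
  using lin[of n] that unfolding real_linear_def by blast
 have sm: "d n ((\<lambda>_. c) \<odot>\<^bsub>M n\<^esub> x) = (\<lambda>_. c) \<odot>\<^bsub>M (Suc n)\<^esub> d n x" if "x \<in> carrier (M n)" for n x c
  using lin[of n] that unfolding real_linear_def by blast
 show "neg_diff M d n \<in> carrier (M n) \<rightarrow> carrier (M (Suc n))"
  using mem by (simp add: neg_diff_def)
 fix x assume x: "x \<in> carrier (M n)"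
 show "neg_diff M d n (x \<oplus>\<^bsub>M n\<^esub> y) = neg_diff M d n x \<oplus>\<^bsub>M (Suc n)\<^esub> neg_diff M d n y"
  if y: "y \<in> carrier (M n)" for y
  using mem[OF x] mem[OF y] by (simp add: neg_diff_def add[OF x y]) (rule M.eqI[where m = "Suc n"]; simp)
 show "neg_diff M d n ((\<lambda>_. c) \<odot>\<^bsub>M n\<^esub> x) = (\<lambda>_. c) \<odot>\<^bsub>M (Suc n)\<^esub> neg_diff M d n x" for c
  using mem[OF x] M.const_mem[of c] by (simp add: neg_diff_def sm[OF x]) (rule M.eqI[where m = "Suc n"]; simp)
 have "\<ominus>\<^bsub>M (Suc n)\<^esub> d n x = (\<lambda>_. - 1) \<odot>\<^bsub>M (Suc n)\<^esub> d n x"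
  using mem[OF x] M.const_mem[of "- 1"] by (intro M.eqI[where m = "Suc n"]) simp_all
 hence "neg_diff M d (Suc n) (neg_diff M d n x) = \<ominus>\<^bsub>M (Suc (Suc n))\<^esub> ((\<lambda>_. - 1) \<odot>\<^bsub>M (Suc (Suc n))\<^esub> \<zero>\<^bsub>M (Suc (Suc n))\<^esub>)"
  by (simp add: neg_diff_def sm[OF mem[OF x]] dd[OF x])
 thus "neg_diff M d (Suc n) (neg_diff M d n x) = \<zero>\<^bsub>M (Suc (Suc n))\<^esub>"
  using M.const_mem[of "- 1"] by simp (rule M.eqI[where m = "Suc (Suc n)"]; simp)
qed

lemma chain_map_comp:
 assumes "chain_map M d N e F" "chain_map N e P f H"
 shows "chain_map M d P f (\<lambda>n x. H n (F n x))"
proof -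
 have F: "F n x \<in> carrier (N n)" if "x \<in> carrier (M n)" for n x
  using assms(1) that unfolding chain_map_def real_linear_def by blast
 have "real_linear (M n) (P n) (\<lambda>x. H n (F n x))" for n
  using assms F[of _ n] unfolding chain_map_def real_linear_def by (simp add: Pi_iff)
 moreover have "H (Suc n) (F (Suc n) (d n x)) = f n (H n (F n x))" if "x \<in> carrier (M n)" for n x
  using assms F[OF that] that unfolding chain_map_def by simp
 ultimately show ?thesis using assms unfolding chain_map_def by blast
qed

text \<open>The formula for \<Phi>_G as a composite holds on forms, so equality of the two families
  of maps is available on carriers only.\<close>

lemma chain_map_cong:
 assumes F: "chain_map M d N e F" and M: "\<And>n. fun_module S (M n) (j n)"
  and eq: "\<And>n x. x \<in> carrier (M n) ==> F' n x = F n x"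
 shows "chain_map M d N e F'"
proof -
 interpret M: fun_module S "M n" "j n" for n by (rule M)
 have "d n x \<in> carrier (M (Suc n))" if "x \<in> carrier (M n)" for n x
  using F that unfolding chain_map_def cochain_complex_def real_linear_def by blast
 moreover have "real_linear (M n) (N n) (F' n)" for n
  using F M.const_mem unfolding chain_map_def real_linear_def by (simp add: eq Pi_iff)
 ultimately show ?thesis using F unfolding chain_map_def by (simp add: eq)
qed

lemma (in fm_pair) altform_zero_entry:
 assumes "altform n \<eta>" "xs \<in> tuples L n" "j < n" "xs ! j = \<zero>\<^bsub>L\<^esub>"
 shows "\<eta> xs = \<zero>\<^bsub>E\<^esub>"
proof -
 have "\<eta> (xs[j := \<zero>\<^bsub>L\<^esub> \<oplus>\<^bsub>L\<^esub> \<zero>\<^bsub>L\<^esub>]) = \<eta> (xs[j := \<zero>\<^bsub>L\<^esub>]) \<oplus>\<^bsub>E\<^esub> \<eta> (xs[j := \<zero>\<^bsub>L\<^esub>])"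
  using assms by (intro altform_list_update_add) simp_all
 moreover have "xs[j := \<zero>\<^bsub>L\<^esub>] = xs" using assms(4) by (metis list_update_id)
 ultimately have "\<eta> xs = \<eta> xs \<oplus>\<^bsub>E\<^esub> \<eta> xs" by simp
 thus ?thesis using altform_mem[OF assms(1,2)] by (metis E.add.r_cancel_one)
qed

context precontact_splitting
begin

section \<open>Forms of bidegree \<open>(1, b)\<close>\<close>

sublocale KJ: lie_rep S \<K> d\<iota> \<J> j\<iota> comm \<sigma> nJ
 by (rule lie_rep_KJ)

lemma tuples_K_A: "xs \<in> tuples \<K> n ==> xs \<in> tuples \<A> n"
 by (auto simp: tuples_def)

lemma map_pK: "xs \<in> tuples \<A> n ==> map pK xs \<in> tuples \<K> n"
 by (auto simp: tuples_def prK)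

lemma map_pK_A [simp]: "xs \<in> tuples \<A> n ==> map pK xs \<in> tuples \<A> n"
 by (rule tuples_K_A[OF map_pK])

lemma map_pK_K: "xs \<in> tuples \<K> n ==> map pK xs = xs"
 by (rule map_idI) (auto simp: tuples_def prK_K)

text \<open>The component of bidegree (1, n), organised by where the argument from \<sigma>^(-1)(G)
  stands: in front, or further on. The recursion replaces the sum over index sets in
  \<open>component\<close> and fits the recursion of \<open>altform\<close>.\<close>

primrec c1 :: "'a derivation list => ('a derivation list => 'a vfield set) => 'a vfield set" where
 "c1 [] \<zeta> = 0\<^sub>l"
| "c1 (x # xs) \<zeta> = \<zeta> (pG x # map pK xs) +\<^sub>l c1 xs (\<lambda>zs. \<zeta> (pK x # zs))"

lemma c1_mem [simp]: "LD.E_valued n \<zeta> ==> xs \<in> tuples \<A> n ==> c1 xs \<zeta> \<in> Sec"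
proof (induction n arbitrary: \<zeta> xs)
 case (Suc n)
 from Suc.prems(2) obtain z zs where xs: "xs = z # zs" "z \<in> Der" "zs \<in> tuples \<A> n"
  by (rule tup_SucE)
 show ?case
  using Suc.prems(1) xs Suc.IH[of "\<lambda>zs. \<zeta> (pK z # zs)" zs] LD.E_valuedD[OF Suc.prems(1)] by simp
qed simp

lemma c1_cong: "(\<And>ys. ys \<in> tuples \<A> n ==> \<zeta> ys = \<zeta>' ys) ==> xs \<in> tuples \<A> n ==> c1 xs \<zeta> = c1 xs \<zeta>'"
proof (induction n arbitrary: \<zeta> \<zeta>' xs)
 case (Suc n)
 from Suc.prems(2) obtain z zs where xs: "xs = z # zs" "z \<in> Der" "zs \<in> tuples \<A> n"
  by (rule tup_SucE)
 have "c1 zs (\<lambda>zs. \<zeta> (pK z # zs)) = c1 zs (\<lambda>zs. \<zeta>' (pK z # zs))"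
  using Suc.prems(1) xs by (intro Suc.IH) simp_all
 thus ?case using Suc.prems(1)[of "pG z # map pK zs"] xs by simp
qed simp

lemma c1_zero: "c1 xs (\<lambda>_. 0\<^sub>l) = 0\<^sub>l"
 by (induction xs) simp_all

lemma c1_add: "LD.E_valued n \<zeta> ==> LD.E_valued n \<zeta>' ==> xs \<in> tuples \<A> n ==>
  c1 xs (\<lambda>zs. \<zeta> zs +\<^sub>l \<zeta>' zs) = c1 xs \<zeta> +\<^sub>l c1 xs \<zeta>'"
proof (induction n arbitrary: \<zeta> \<zeta>' xs)
 case (Suc n)
 from Suc.prems(3) obtain z zs where xs: "xs = z # zs" "z \<in> Der" "zs \<in> tuples \<A> n"
  by (rule tup_SucE)
 note v = LD.E_valued_Cons[OF Suc.prems(1) prK_A[OF xs(2)]] LD.E_valued_Cons[OF Suc.prems(2) prK_A[OF xs(2)]]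
 show ?case
  using xs LD.E_valuedD[OF Suc.prems(1), of "pG z # map pK zs"] LD.E_valuedD[OF Suc.prems(2), of "pG z # map pK zs"]
   Suc.IH[OF v xs(3)] c1_mem[OF v(1) xs(3)] c1_mem[OF v(2) xs(3)]
  by simp (intro ell.eqI; simp)
qed simp

lemma c1_smult: "LD.E_valued n \<zeta> ==> r \<in> S ==> xs \<in> tuples \<A> n ==>
  c1 xs (\<lambda>zs. r *\<^sub>l \<zeta> zs) = r *\<^sub>l c1 xs \<zeta>"
proof (induction n arbitrary: \<zeta> xs)
 case (Suc n)
 from Suc.prems(3) obtain z zs where xs: "xs = z # zs" "z \<in> Der" "zs \<in> tuples \<A> n"
  by (rule tup_SucE)
 note v = LD.E_valued_Cons[OF Suc.prems(1) prK_A[OF xs(2)]]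
 show ?case
  using xs Suc.prems(2) LD.E_valuedD[OF Suc.prems(1), of "pG z # map pK zs"] Suc.IH[OF v _ xs(3)] c1_mem[OF v xs(3)]
  by simp (intro ell.eqI; simp add: algebra_simps)
qed (simp add: ell_smult_zero)

lemma natural_pK: "natural_forms S \<A> d\<iota> \<L> l\<iota> \<A> d\<iota> \<L> l\<iota> pK (\<lambda>e. e)"
 by unfold_locales (simp_all add: prK_add prK_smult)

lemma altform_pK: "LD.altform n \<zeta> ==> LD.altform n (\<lambda>xs. \<zeta> (map pK xs))"
 by (rule natural_forms.altform_natural[OF natural_pK])

lemma altform_c1: "LD.altform n \<zeta> ==> LD.altform n (\<lambda>xs. c1 xs \<zeta>)"
proof (induction n arbitrary: \<zeta>)
 case (Suc n)
 note ac = LD.altform_Cons[OF Suc.prems]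
 note m = LD.altform_mem[OF Suc.prems]
 have v: "LD.E_valued n (\<lambda>zs. \<zeta> (D # zs))" if "D \<in> Der" for D
  by (rule LD.altform_valued[OF ac[OF that]])
 note cm = c1_mem[OF v]
 have 1: "LD.altform n (\<lambda>xs. c1 (x # xs) \<zeta>)" if x: "x \<in> Der" for x
  unfolding c1.simps using x by (intro LD.altform_add altform_pK[OF ac] Suc.IH ac) simp_all
 have 2: "c1 ((x +\<^sub>d y) # xs) \<zeta> = c1 (x # xs) \<zeta> +\<^sub>l c1 (y # xs) \<zeta>"
  if x: "x \<in> Der" "y \<in> Der" "xs \<in> tuples \<A> n" for x y xs
 proof -
  have "c1 xs (\<lambda>zs. \<zeta> (pK (x +\<^sub>d y) # zs)) = c1 xs (\<lambda>zs. \<zeta> (pK x # zs) +\<^sub>l \<zeta> (pK y # zs))"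
   using x Suc.prems by (intro c1_cong[of n]) (simp_all add: prK_add)
  also have "\<dots> = c1 xs (\<lambda>zs. \<zeta> (pK x # zs)) +\<^sub>l c1 xs (\<lambda>zs. \<zeta> (pK y # zs))"
   using x by (intro c1_add[of n] v) simp_all
  finally have e: "c1 xs (\<lambda>zs. \<zeta> (pK (x +\<^sub>d y) # zs)) = c1 xs (\<lambda>zs. \<zeta> (pK x # zs)) +\<^sub>l c1 xs (\<lambda>zs. \<zeta> (pK y # zs))" .
  have "\<zeta> (pG (x +\<^sub>d y) # map pK xs) = \<zeta> (pG x # map pK xs) +\<^sub>l \<zeta> (pG y # map pK xs)"
   unfolding pG_add[OF x(1,2)] using x Suc.prems by simp
  thus ?thesis
   unfolding c1.simps e using x m[of "pG x # map pK xs"] m[of "pG y # map pK xs"] cm[of "pK x" xs] cm[of "pK y" xs]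
   by simp (intro ell.eqI; simp)
 qed
 have 3: "c1 ((r *\<^sub>d x) # xs) \<zeta> = r *\<^sub>l c1 (x # xs) \<zeta>"
  if x: "x \<in> Der" "r \<in> S" "xs \<in> tuples \<A> n" for x r xs
 proof -
  have "c1 xs (\<lambda>zs. \<zeta> (pK (r *\<^sub>d x) # zs)) = c1 xs (\<lambda>zs. r *\<^sub>l \<zeta> (pK x # zs))"
   using x Suc.prems by (intro c1_cong[of n]) (simp_all add: prK_smult)
  also have "\<dots> = r *\<^sub>l c1 xs (\<lambda>zs. \<zeta> (pK x # zs))"
   using x by (intro c1_smult[of n] v) simp_all
  finally have e: "c1 xs (\<lambda>zs. \<zeta> (pK (r *\<^sub>d x) # zs)) = r *\<^sub>l c1 xs (\<lambda>zs. \<zeta> (pK x # zs))" .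
  have "\<zeta> (pG (r *\<^sub>d x) # map pK xs) = r *\<^sub>l \<zeta> (pG x # map pK xs)"
   unfolding pG_smult[OF x(2,1)] using x Suc.prems by simp
  thus ?thesis
   unfolding c1.simps e using x m[of "pG x # map pK xs"] cm[of "pK x" xs]
   by simp (intro ell.eqI; simp add: algebra_simps)
 qed
 \<comment> \<open>The two terms with the G-part in one of the equal slots cancel by skew symmetry;
   all others contain \<open>pK x\<close> twice.\<close>
 have 4: "c1 (x # x # xs) \<zeta> = 0\<^sub>l" if x: "x \<in> Der" "x # xs \<in> tuples \<A> n" for x xs
 proof -
  obtain k where n: "n = Suc k" "xs \<in> tuples \<A> k" using x(2) by (cases n) auto
  have "c1 xs (\<lambda>zs. \<zeta> (pK x # pK x # zs)) = c1 xs (\<lambda>zs. 0\<^sub>l)"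
   using x n Suc.prems by (intro c1_cong[of k]) simp_all
  moreover have "\<zeta> (pG x # pK x # map pK xs) = -\<^sub>l \<zeta> (pK x # pG x # map pK xs)"
   using x n Suc.prems by (intro LD.altform_swap[of k]) simp_all
  moreover have "\<zeta> (pK x # pG x # map pK xs) \<in> Sec"
   using x n by (intro m) simp
  ultimately show ?thesis by (simp add: c1_zero) (intro ell.eqI; simp)
 qed
 show ?case
  unfolding LD.altform.simps by (intro conjI ballI allI impI; rule 1 2 3 4; assumption)
qed simp

lemma c1_val: "LD.E_valued n \<zeta> ==> xs \<in> tuples \<A> n ==>
  l\<iota> (c1 xs \<zeta>) f p = (\<Sum>k<n. l\<iota> (\<zeta> ((map pK xs)[k := pG (xs ! k)])) f p)"
proof (induction n arbitrary: \<zeta> xs)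
 case (Suc n)
 from Suc.prems(2) obtain z zs where xs: "xs = z # zs" "z \<in> Der" "zs \<in> tuples \<A> n"
  by (rule tup_SucE)
 note v = LD.E_valued_Cons[OF Suc.prems(1) prK_A[OF xs(2)]]
 show ?case
  using xs LD.E_valuedD[OF Suc.prems(1), of "pG z # map pK zs"] Suc.IH[OF v xs(3)] c1_mem[OF v xs(3)]
  by (simp add: sum.lessThan_Suc_shift del: sum.lessThan_Suc)
qed simp

lemma component_eq:
 assumes v: "LD.E_valued (Suc n) \<zeta>"
 shows "component A \<xi> G 1 n \<zeta> = (\<lambda>xs\<in>tuples \<A> (Suc n). c1 xs \<zeta>)"
proof (rule ext)
 fix xs
 show "component A \<xi> G 1 n \<zeta> xs = (\<lambda>xs\<in>tuples \<A> (Suc n). c1 xs \<zeta>) xs"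
 proof (cases "xs \<in> tuples \<A> (Suc n)")
  case xs: True
  have len: "length xs = Suc n" using xs by (simp add: tuples_def)
  define t where "t I = map (\<lambda>i. if i \<in> I then pK (xs ! i) else pG (xs ! i)) [0..<1 + n]" for I
  let ?I = "{I. I \<subseteq> {..<1 + n} \<and> card I = n}"
  \<comment> \<open>A set of n among n + 1 positions is the complement of one position k, the place
    of the G-part.\<close>
  have I: "?I = (\<lambda>k. {..<Suc n} - {k}) ` {..<Suc n}"
  proof (intro Set.set_eqI iffI)
   fix I assume "I \<in> ?I"
   hence "I \<subseteq> {..<Suc n}" "card ({..<Suc n} - I) = 1" by (auto simp: card_Diff_subset finite_subset)
   moreover then obtain k where "{..<Suc n} - I = {k}" by (meson card_1_singletonE)
   ultimately have "I = {..<Suc n} - {k} \<and> k < Suc n" by blast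
   thus "I \<in> (\<lambda>k. {..<Suc n} - {k}) ` {..<Suc n}" by blast
  qed auto
  have inj: "inj_on (\<lambda>k. {..<Suc n} - {k}) {..<Suc n}" by (auto simp: inj_on_def)
  have t: "t ({..<Suc n} - {k}) = (map pK xs)[k := pG (xs ! k)]" if "k < Suc n" for k
   using that len by (intro nth_equalityI) (auto simp: t_def nth_list_update simp del: upt_Suc)
  have tm: "\<zeta> (t I) \<in> Sec" if I': "I \<in> ?I" for I
  proof -
   obtain k where k: "I = {..<Suc n} - {k}" "k < Suc n" using I' unfolding I by blast
   have "(map pK xs)[k := pG (xs ! k)] \<in> tuples \<A> (Suc n)"
    using xs k(2) by (intro LD.list_update_tuples map_pK_A) simp_all
   thus ?thesis using LD.E_valuedD[OF v] unfolding k(1) t[OF k(2)] by blast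
  qed
  have "component A \<xi> G 1 n \<zeta> xs = (\<Oplus>\<^bsub>\<L>\<^esub>I\<in>?I. \<zeta> (t I))"
   using xs by (simp add: component_def t_def del: upt_Suc)
  also have "\<dots> = c1 xs \<zeta>"
  proof (rule ell.eqI)
   show "(\<Oplus>\<^bsub>\<L>\<^esub>I\<in>?I. \<zeta> (t I)) \<in> Sec" using tm by (intro ell.finsum_closed) blast
   show "c1 xs \<zeta> \<in> Sec" using v xs by simp
   fix f p
   have "l\<iota> (\<Oplus>\<^bsub>\<L>\<^esub>I\<in>?I. \<zeta> (t I)) f p = (\<Sum>I\<in>?I. l\<iota> (\<zeta> (t I)) f p)"
    using tm by (intro ell.finsum_val) auto
   also have "\<dots> = (\<Sum>k<Suc n. l\<iota> (\<zeta> (t ({..<Suc n} - {k}))) f p)"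
    unfolding I sum.reindex[OF inj] by (simp add: comp_def)
   also have "\<dots> = l\<iota> (c1 xs \<zeta>) f p"
    unfolding c1_val[OF v xs] by (intro sum.cong refl) (simp add: t)
   finally show "l\<iota> (\<Oplus>\<^bsub>\<L>\<^esub>I\<in>?I. \<zeta> (t I)) f p = l\<iota> (c1 xs \<zeta>) f p" .
  qed
  finally show ?thesis using xs by simp
 qed (simp add: component_def)
qed

text \<open>Term k projects slot k to \<sigma>^(-1)(G) and all other slots to K. Unless the entries
  have exactly these types, some projection is 0; with the wrong number of K-entries this happens
  for every k.\<close>

lemma c1_vanish:
 assumes a: "LD.altform (Suc b) \<zeta>" and xs: "xs \<in> tuples \<A> (Suc b)" and I: "I \<subseteq> {..<Suc b}" "card I \<noteq> b"
  and t: "\<And>i. i < Suc b ==> xs ! i \<in> carrier (if i \<in> I then \<K> else \<G>)"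
 shows "c1 xs \<zeta> = 0\<^sub>l"
proof (rule ell.eqI)
 show "c1 xs \<zeta> \<in> Sec" using LD.altform_valued[OF a] xs by simp
 fix f p
 have "\<zeta> ((map pK xs)[k := pG (xs ! k)]) = 0\<^sub>l" if k: "k < Suc b" for k
 proof -
  have m: "(map pK xs)[k := pG (xs ! k)] \<in> tuples \<A> (Suc b)"
   using xs k by (intro LD.list_update_tuples map_pK_A) simp_all
  have len: "length xs = Suc b" using xs by (simp add: tuples_def)
  show ?thesis
  proof (cases "k \<in> I")
   case True
   hence "xs ! k \<in> KS" using t[OF k] by simp
   thus ?thesis using k len by (intro LD.altform_zero_entry[OF a m k]) (simp add: pG_K)
  next
   case False
   \<comment> \<open>A second entry from \<sigma>^(-1)(G) exists by counting: otherwise I would be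
     the complement of k and have b elements.\<close>
   have "card ({..<Suc b} - {k}) = b" using k by simp
   hence "I \<noteq> {..<Suc b} - {k}" using I(2) by metis
   then obtain j where j: "j < Suc b" "j \<noteq> k" "j \<notin> I" using I(1) False by blast
   hence "xs ! j \<in> GS" using t[OF j(1)] by simp
   thus ?thesis using j len by (intro LD.altform_zero_entry[OF a m j(1)]) (simp add: prK_Gt)
  qed
 qed
 thus "l\<iota> (c1 xs \<zeta>) f p = l\<iota> 0\<^sub>l f p"
  unfolding c1_val[OF LD.altform_valued[OF a] xs] by simp
qed simp

abbreviation "Bi b \<equiv> Omega_D_bi A \<xi> G 1 b"

lemma Bi_iff:
 "\<eta> \<in> carrier (Bi b) \<longleftrightarrow> \<eta> \<in> extensional (tuples \<A> (Suc b)) \<and> LD.altform (Suc b) \<eta> \<and>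
   (\<forall>I \<subseteq> {..<Suc b}. \<forall>xs\<in>tuples \<A> (Suc b).
    (\<forall>i<Suc b. xs ! i \<in> carrier (if i \<in> I then \<K> else \<G>)) \<and> card I \<noteq> b \<longrightarrow> \<eta> xs = 0\<^sub>l)"
 by (simp add: Omega_D_bi_def Omega_D_def LD.forms_iff[OF refl] del: LD.altform.simps)

lemma Bi_altform: "\<eta> \<in> carrier (Bi b) ==> LD.altform (Suc b) \<eta>"
 unfolding Bi_iff by blast

lemma component_Bi:
 assumes a: "LD.altform (Suc b) \<zeta>"
 shows "component A \<xi> G 1 b \<zeta> \<in> carrier (Bi b)"
proof -
 have "LD.altform (Suc b) (\<lambda>xs\<in>tuples \<A> (Suc b). c1 xs \<zeta>) \<longleftrightarrow> LD.altform (Suc b) (\<lambda>xs. c1 xs \<zeta>)"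
  by (rule LD.altform_cong) simp
 hence "LD.altform (Suc b) (\<lambda>xs\<in>tuples \<A> (Suc b). c1 xs \<zeta>)" using altform_c1[OF a] by blast
 moreover have "c1 xs \<zeta> = 0\<^sub>l" if "I \<subseteq> {..<Suc b}" "xs \<in> tuples \<A> (Suc b)"
  "(\<forall>i<Suc b. xs ! i \<in> carrier (if i \<in> I then \<K> else \<G>)) \<and> card I \<noteq> b" for I xs
  using that by (intro c1_vanish[OF a, of _ I]) simp_all
 ultimately show ?thesis
  unfolding component_eq[OF LD.altform_valued[OF a]] Bi_iff by simp
qed

text \<open>On one section of \<sigma>^(-1)(G) followed by sections of K only the first term of
  \<open>c1\<close> survives. So on such arguments \<open>d01\<close> and \<open>d10\<close> can be
  computed with the full differential.\<close>

lemma component_apply: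
 assumes a: "LD.altform (Suc b) \<zeta>" and D: "D \<in> GS" and Ks: "Ks \<in> tuples \<K> b"
 shows "component A \<xi> G 1 b \<zeta> (D # Ks) = \<zeta> (D # Ks)"
proof -
 have DA: "D \<in> Der" "Ks \<in> tuples \<A> b" using Gt_A[OF D] tuples_K_A[OF Ks] .
 have "c1 Ks (\<lambda>zs. \<zeta> (pK D # zs)) = c1 Ks (\<lambda>zs. 0\<^sub>l)"
  unfolding prK_Gt[OF D] using DA by (intro c1_cong[of b] LD.altform_zero_entry[OF a, of _ 0]) simp_all
 thus ?thesis
  unfolding component_eq[OF LD.altform_valued[OF a]]
  using DA Ks LD.altform_mem[OF a, of "D # Ks"] by (simp add: c1_zero pG_Gt[OF D] map_pK_K[OF Ks])
qed

lemma ell_minus_eq_zero: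
 assumes st: "s \<in> Sec" "t \<in> Sec" and eq: "s -\<^sub>l t = 0\<^sub>l"
 shows "s = t"
proof (rule ell.eqI[OF st])
 show "l\<iota> s f p = l\<iota> t f p" for f p using arg_cong[OF eq, of "\<lambda>s. l\<iota> s f p"] st by simp
qed

text \<open>Each argument is the sum of its two parts, so multilinearity reduces vanishing to lists
  of homogeneous entries.\<close>

lemma altform_split_zero:
 "LD.altform n \<eta> ==> (\<And>xs. xs \<in> tuples \<A> n ==> set xs \<subseteq> KS \<union> GS ==> \<eta> xs = 0\<^sub>l) ==>
  xs \<in> tuples \<A> n ==> \<eta> xs = 0\<^sub>l"
proof (induction n arbitrary: \<eta> xs)
 case (Suc n)
 from Suc.prems(3) obtain z zs where xs: "xs = z # zs" "z \<in> Der" "zs \<in> tuples \<A> n"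
  by (rule tup_SucE)
 have "\<eta> (y # zs) = 0\<^sub>l" if y: "y \<in> Der" "y \<in> KS \<union> GS" for y
 proof (rule Suc.IH[of "\<lambda>zs. \<eta> (y # zs)", OF LD.altform_Cons[OF Suc.prems(1) y(1)] _ xs(3)])
  fix ys assume "ys \<in> tuples \<A> n" "set ys \<subseteq> KS \<union> GS"
  thus "\<eta> (y # ys) = 0\<^sub>l" using y by (intro Suc.prems(2)) simp_all
 qed
 from this[of "pG z"] this[of "pK z"] have "\<eta> (pG z # zs) = 0\<^sub>l" "\<eta> (pK z # zs) = 0\<^sub>l"
  using prK[OF xs(2)] xs(2) by simp_all
 moreover have "\<eta> ((pG z +\<^sub>d pK z) # zs) = \<eta> (pG z # zs) +\<^sub>l \<eta> (pK z # zs)"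
  using Suc.prems(1) xs by simp
 moreover have "pG z +\<^sub>d pK z = z" using prK_split[OF xs(2)] by simp
 ultimately show ?case using xs(1) by simp
qed (simp add: tuples_0)

text \<open>Such a form is its own component. On homogeneous lists both sides vanish unless exactly
  one entry fails to lie in K, and then only the term at its position survives.\<close>

lemma Bi_c1:
 assumes \<eta>: "\<eta> \<in> carrier (Bi b)" and xs: "xs \<in> tuples \<A> (Suc b)"
 shows "\<eta> xs = c1 xs \<eta>"
proof -
 have a: "LD.altform (Suc b) \<eta>" using \<eta> by (rule Bi_altform)
 note v = LD.altform_valued[OF a]
 have "\<eta> xs -\<^sub>l c1 xs \<eta> = 0\<^sub>l"
 proof (rule altform_split_zero[where \<eta> = "\<lambda>xs. \<eta> xs -\<^sub>l c1 xs \<eta>", OF _ _ xs])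
  show "LD.altform (Suc b) (\<lambda>xs. \<eta> xs -\<^sub>l c1 xs \<eta>)" by (intro LD.altform_diff altform_c1 a)
  fix xs assume xs: "xs \<in> tuples \<A> (Suc b)" and s: "set xs \<subseteq> KS \<union> GS"
  have len: "length xs = Suc b" using xs by (simp add: tuples_def)
  define I where "I = {i. i < Suc b \<and> xs ! i \<in> KS}"
  have I: "I \<subseteq> {..<Suc b}" by (auto simp: I_def)
  have t: "xs ! i \<in> carrier (if i \<in> I then \<K> else \<G>)" if "i < Suc b" for i
  proof -
   have "xs ! i \<in> KS \<union> GS" using s len that by (intro subsetD[OF s] nth_mem) simp
   thus ?thesis using that by (auto simp: I_def)
  qed
  show "\<eta> xs -\<^sub>l c1 xs \<eta> = 0\<^sub>l"
  proof (cases "card I = b")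
   case False
   have "\<eta> xs = 0\<^sub>l" using \<eta> I xs t False unfolding Bi_iff by blast
   thus ?thesis using c1_vanish[OF a xs I False t] by (simp add: a_minus_def ell_neg_zero)
  next
   case True
   have "card ({..<Suc b} - I) = 1" using True I by (simp add: card_Diff_subset finite_subset)
   then obtain k where k: "{..<Suc b} - I = {k}" by (meson card_1_singletonE)
   hence k': "k < Suc b" "k \<notin> I" by auto
   have kk: "i \<in> I" if "i < Suc b" "i \<noteq> k" for i using k that by blast
   have id: "(map pK xs)[k := pG (xs ! k)] = xs"
   proof (rule nth_equalityI)
    fix i assume i: "i < length ((map pK xs)[k := pG (xs ! k)])"
    show "(map pK xs)[k := pG (xs ! k)] ! i = xs ! i"
    proof (cases "i = k")
     case True
     thus ?thesis using t[OF k'(1)] k' len by (simp add: pG_Gt)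
    next
     case False
     thus ?thesis using t[of i] kk[of i] i len by (simp add: prK_K)
    qed
   qed simp
   have z: "\<eta> ((map pK xs)[j := pG (xs ! j)]) = 0\<^sub>l" if j: "j < Suc b" "j \<noteq> k" for j
   proof -
    have m: "(map pK xs)[j := pG (xs ! j)] \<in> tuples \<A> (Suc b)"
     using xs j by (intro LD.list_update_tuples map_pK_A) simp_all
    have "xs ! j \<in> KS" using t[OF j(1)] kk[OF j] by simp
    thus ?thesis using j len by (intro LD.altform_zero_entry[OF a m j(1)]) (simp add: pG_K)
   qed
   have "l\<iota> (c1 xs \<eta>) f p = l\<iota> (\<eta> xs) f p" for f p
   proof -
    have "l\<iota> (c1 xs \<eta>) f p = l\<iota> (\<eta> ((map pK xs)[k := pG (xs ! k)])) f p +
      (\<Sum>j\<in>{..<Suc b} - {k}. l\<iota> (\<eta> ((map pK xs)[j := pG (xs ! j)])) f p)"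
     unfolding c1_val[OF v xs] using k'(1) by (intro sum.remove) simp_all
    also have "(\<Sum>j\<in>{..<Suc b} - {k}. l\<iota> (\<eta> ((map pK xs)[j := pG (xs ! j)])) f p) = 0"
     by (intro sum.neutral) (auto simp: z)
    finally show ?thesis by (simp add: id)
   qed
   thus ?thesis using LD.altform_mem[OF a xs] c1_mem[OF v xs] by (intro ell.eqI) simp_all
  qed
 qed
 thus ?thesis by (rule ell_minus_eq_zero[OF LD.altform_mem[OF a xs] c1_mem[OF v xs]])
qed

text \<open>Every term of \<open>c1\<close> has a single G-part, which
  \<open>altform_list_update\<close> moves to the front.\<close>

lemma Bi_eqI:
 assumes \<eta>: "\<eta> \<in> carrier (Bi b)" "\<eta>' \<in> carrier (Bi b)"
  and eq: "\<And>D Ks. D \<in> GS ==> Ks \<in> tuples \<K> b ==> \<eta> (D # Ks) = \<eta>' (D # Ks)"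
 shows "\<eta> = \<eta>'"
proof (rule extensionalityI[of _ "tuples \<A> (Suc b)"])
 fix xs assume xs: "xs \<in> tuples \<A> (Suc b)"
 have a: "LD.altform (Suc b) \<eta>" "LD.altform (Suc b) \<eta>'" using \<eta> by (blast dest: Bi_altform)+
 note v = LD.altform_valued[OF a(1)] LD.altform_valued[OF a(2)]
 have "\<eta> ((map pK xs)[k := pG (xs ! k)]) = \<eta>' ((map pK xs)[k := pG (xs ! k)])" if k: "k < Suc b" for k
 proof -
  have "pG (xs ! k) \<in> Der" "pG (xs ! k) \<in> GS" using xs k prK by simp_all
  moreover have "omit k (map pK xs) \<in> tuples \<K> b" using map_pK[OF xs] k by (intro KJ.omit_tuples) simp_all
  ultimately show ?thesis
   using LD.altform_list_update[OF a(1) map_pK_A[OF xs] k, of "pG (xs ! k)"]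
    LD.altform_list_update[OF a(2) map_pK_A[OF xs] k, of "pG (xs ! k)"] eq by simp
 qed
 hence "l\<iota> (c1 xs \<eta>) f p = l\<iota> (c1 xs \<eta>') f p" for f p
  unfolding c1_val[OF v(1) xs] c1_val[OF v(2) xs] by (intro sum.cong refl) simp
 thus "\<eta> xs = \<eta>' xs"
  unfolding Bi_c1[OF \<eta>(1) xs] Bi_c1[OF \<eta>(2) xs] using c1_mem[OF v(1) xs] c1_mem[OF v(2) xs] by (intro ell.eqI)
qed (use \<eta> in \<open>(unfold Bi_iff, blast)+\<close>)

lemma Bi_K_zero:
 assumes \<eta>: "\<eta> \<in> carrier (Bi b)" and Ks: "Ks \<in> tuples \<K> (Suc b)"
 shows "\<eta> Ks = 0\<^sub>l"
proof -
 have "card {..<Suc b} \<noteq> b" "\<forall>i<Suc b. Ks ! i \<in> carrier (if i \<in> {..<Suc b} then \<K> else \<G>)"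
  using Ks by simp_all
 thus ?thesis using \<eta> tuples_K_A[OF Ks] unfolding Bi_iff by blast
qed

end

lemma forms_ops:
 "\<zero>\<^bsub>forms R L E n\<^esub> = (\<lambda>xs\<in>tuples L n. \<zero>\<^bsub>E\<^esub>)"
 "\<eta> \<oplus>\<^bsub>forms R L E n\<^esub> \<zeta> = (\<lambda>xs\<in>tuples L n. \<eta> xs \<oplus>\<^bsub>E\<^esub> \<zeta> xs)"
 "r \<odot>\<^bsub>forms R L E n\<^esub> \<eta> = (\<lambda>xs\<in>tuples L n. r \<odot>\<^bsub>E\<^esub> \<eta> xs)"
 by (simp_all add: forms_def)

context precontact_splitting
begin

lemma Bi_ops:
 "\<zero>\<^bsub>Bi b\<^esub> = (\<lambda>xs\<in>tuples \<A> (Suc b). 0\<^sub>l)"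
 "\<eta> \<oplus>\<^bsub>Bi b\<^esub> \<zeta> = (\<lambda>xs\<in>tuples \<A> (Suc b). \<eta> xs +\<^sub>l \<zeta> xs)"
 "r \<odot>\<^bsub>Bi b\<^esub> \<eta> = (\<lambda>xs\<in>tuples \<A> (Suc b). r *\<^sub>l \<eta> xs)"
 by (simp_all add: Omega_D_bi_def Omega_D_def forms_def)

text \<open>The simplifier writes the first bidegree \<open>1\<close> as \<open>Suc 0\<close>; the
  rules are needed in that form too.\<close>

lemmas Bi_ops' = Bi_ops[unfolded One_nat_def]

definition f\<iota> :: "nat => ('a derivation list => 'a vfield set) => 'a derivation list \<times> ('a => real) => 'a => real" where
 "f\<iota> n \<eta> = (\<lambda>(xs, i) p. if xs \<in> tuples \<A> n then l\<iota> (\<eta> xs) i p else 0)"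

lemma fun_module_Bi: "fun_module S (Bi b) (f\<iota> (Suc b))"
proof -
 define F where "F = forms (Cinf A) \<A> \<L> (Suc b)"
 interpret F: fun_module S F "f\<iota> (Suc b)"
  unfolding F_def f\<iota>_def by (rule LD.fun_module_forms[OF refl])
 define V where "V \<eta> \<longleftrightarrow> (\<forall>I \<subseteq> {..<Suc b}. \<forall>xs\<in>tuples \<A> (Suc b).
    (\<forall>i<Suc b. xs ! i \<in> carrier (if i \<in> I then \<K> else \<G>)) \<and> card I \<noteq> b \<longrightarrow> \<eta> xs = 0\<^sub>l)" for \<eta> :: "'a derivation list => 'a vfield set"
 have iff: "\<eta> \<in> carrier (Bi b) \<longleftrightarrow> \<eta> \<in> carrier F \<and> V \<eta>" for \<eta>
  unfolding Bi_iff V_def F_def LD.forms_iff[OF refl] by blast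
 have "Bi b = F\<lparr>carrier := carrier (Bi b)\<rparr>"
  by (simp add: Omega_D_bi_def Omega_D_def F_def)
 moreover have "fun_module S (F\<lparr>carrier := carrier (Bi b)\<rparr>) (f\<iota> (Suc b))"
 proof (rule F.sub)
  show "carrier (Bi b) \<subseteq> carrier F" using iff by blast
  have "V \<zero>\<^bsub>F\<^esub>" by (simp add: V_def F_def forms_ops)
  thus "\<zero>\<^bsub>F\<^esub> \<in> carrier (Bi b)" by (simp only: iff F.zero_closed)
  fix \<eta> \<zeta> r
  show "\<eta> \<oplus>\<^bsub>F\<^esub> \<zeta> \<in> carrier (Bi b)" if "\<eta> \<in> carrier (Bi b)" "\<zeta> \<in> carrier (Bi b)"
  proof -
   have "V (\<eta> \<oplus>\<^bsub>F\<^esub> \<zeta>)" using that unfolding iff by (simp add: V_def F_def forms_ops)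
   thus ?thesis using that by (simp only: iff F.a_closed)
  qed
  show "r \<odot>\<^bsub>F\<^esub> \<eta> \<in> carrier (Bi b)" if "r \<in> S" "\<eta> \<in> carrier (Bi b)"
  proof -
   have "V (r \<odot>\<^bsub>F\<^esub> \<eta>)" using that unfolding iff by (simp add: V_def F_def forms_ops ell_smult_zero)
   thus ?thesis using that by (simp only: iff F.smult_mem)
  qed
 qed
 ultimately show ?thesis by simp
qed

lemma Bi_mem: "\<eta> \<in> carrier (Bi b) ==> xs \<in> tuples \<A> (Suc b) ==> \<eta> xs \<in> Sec"
 by (rule LD.altform_mem[OF Bi_altform])

lemma Bi_neg_apply: "\<eta> \<in> carrier (Bi b) ==> xs \<in> tuples \<A> (Suc b) ==> (\<ominus>\<^bsub>Bi b\<^esub> \<eta>) xs = -\<^sub>l \<eta> xs"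
 by (rule LD.neg_apply[OF fun_module_Bi[of b, unfolded f\<iota>_def] Bi_mem])

section \<open>The map \<open>\<tau>\<close>\<close>

lemma altform_d_D: "LD.altform n \<eta> ==> LD.altform (Suc n) (d_D A \<xi> n \<eta>)"
 using LD.koszul_forms[OF _ refl, of n \<eta>] unfolding d_D_eq LD.forms_iff[OF refl] by blast

lemma d_D_dif: "LD.altform n \<eta> ==> xs \<in> tuples \<A> (Suc n) ==> d_D A \<xi> n \<eta> xs = LD.dif xs \<eta>"
 unfolding d_D_eq by (rule LD.koszul_eq_dif)

lemma GK_tuples: "D \<in> GS ==> Ks \<in> tuples \<K> b ==> D # Ks \<in> tuples \<A> (Suc b)"
 using Gt_A tuples_K_A by simp

abbreviation "dB \<equiv> d01 A \<xi> G 1"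
abbreviation "\<Omega>J \<equiv> Omega_K_J1perp A \<xi>"
abbreviation "dJ \<equiv> d_K_J1perp A \<xi>"
abbreviation "ndB \<equiv> neg_diff (Omega_D_bi A \<xi> G 1) dB"

lemma d01_Bi:
 assumes \<eta>: "\<eta> \<in> carrier (Bi b)"
 shows "dB b \<eta> \<in> carrier (Bi (Suc b))"
  and "D \<in> GS ==> Ks \<in> tuples \<K> (Suc b) ==> dB b \<eta> (D # Ks) = LD.dif (D # Ks) \<eta>"
proof -
 note a = Bi_altform[OF \<eta>] altform_d_D[OF Bi_altform[OF \<eta>]]
 have e: "dB b \<eta> = component A \<xi> G 1 (Suc b) (d_D A \<xi> (Suc b) \<eta>)" by (simp add: d01_def)
 show "dB b \<eta> \<in> carrier (Bi (Suc b))" unfolding e by (rule component_Bi[OF a(2)])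
 show "dB b \<eta> (D # Ks) = LD.dif (D # Ks) \<eta>" if "D \<in> GS" "Ks \<in> tuples \<K> (Suc b)"
  unfolding e component_apply[OF a(2) that] by (rule d_D_dif[OF a(1) GK_tuples[OF that]])
qed

abbreviation "tB \<equiv> tau A \<xi> G"

text \<open>The \<alpha> described by \<open>tau\<close> is \<eta>(-, Ks) itself: it vanishes on K
  because \<eta> vanishes on K-arguments alone, hence lies in J, and elements of J are determined on
  \<sigma>^(-1)(G).\<close>

lemma tau_apply:
 assumes \<eta>: "\<eta> \<in> carrier (Bi b)" and Ks: "Ks \<in> tuples \<K> b"
 shows "tB b \<eta> Ks \<in> JS" "D \<in> Der ==> tB b \<eta> Ks D = \<eta> (D # Ks)"
proof -
 define \<alpha> where "\<alpha> = (\<lambda>D\<in>Der. \<eta> (D # Ks))"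
 have \<alpha>: "\<alpha> D = \<eta> (D # Ks)" if "D \<in> Der" for D using that by (simp add: \<alpha>_def)
 have "\<alpha> \<in> extensional (Der)" by (simp add: \<alpha>_def)
 moreover have "\<alpha> \<Delta> = 0\<^sub>l" if "\<Delta> \<in> KS" for \<Delta>
  using that Ks by (simp add: \<alpha>) (intro Bi_K_zero[OF \<eta>]; simp)
 ultimately have J: "\<alpha> \<in> JS"
  using Bi_altform[OF \<eta>] Bi_mem[OF \<eta>] tuples_K_A[OF Ks] unfolding J_iff
  by (simp add: \<alpha> Dell_add Dell_smult)
 have "tB b \<eta> Ks = \<alpha>"
  unfolding tau_def restrict_apply'[OF Ks]
 proof (rule the_equality)
  show "\<alpha> \<in> JS \<and> (\<forall>D\<in>GS. \<eta> (D # Ks) = pairing \<alpha> (mK D))"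
   using J by (simp add: pairing_mK Gt_A \<alpha>)
  fix \<beta> assume "\<beta> \<in> JS \<and> (\<forall>D\<in>GS. \<eta> (D # Ks) = pairing \<beta> (mK D))"
  thus "\<beta> = \<alpha>" using J by (intro J_eqI_Gt) (simp_all add: pairing_mK Gt_A \<alpha>)
 qed
 thus "tB b \<eta> Ks \<in> JS" "D \<in> Der ==> tB b \<eta> Ks D = \<eta> (D # Ks)"
  using J \<alpha> by simp_all
qed

text \<open>Equations in J are checked at each D. The evaluations H D may be forms on all of
  D\<ell>, so contractions of \<eta> qualify as they stand.\<close>

lemma KJ_altformI:
 "(\<And>Ks. Ks \<in> tuples \<K> n ==> F Ks \<in> JS) ==> (\<And>D. D \<in> Der ==> LD.altform n (H D)) ==>
  (\<And>D Ks. D \<in> Der ==> Ks \<in> tuples \<K> n ==> F Ks D = H D Ks) ==> KJ.altform n F"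
proof (induction n arbitrary: F H)
 case (Suc n)
 note m = Suc.prems(1) and a = Suc.prems(2) and e = Suc.prems(3)
 have 1: "KJ.altform n (\<lambda>xs. F (x # xs))" if x: "x \<in> KS" for x
 proof (rule Suc.IH[of "\<lambda>xs. F (x # xs)" "\<lambda>D xs. H D (x # xs)"])
  show "LD.altform n (\<lambda>xs. H D (x # xs))" if "D \<in> Der" for D
   by (rule LD.altform_Cons[OF a[OF that] K_A[OF x]])
 qed (use x m e in simp_all)
 have 2: "F ((x \<oplus>\<^bsub>\<K>\<^esub> y) # xs) = F (x # xs) +\<^sub>j F (y # xs)"
  if x: "x \<in> KS" "y \<in> KS" "xs \<in> tuples \<K> n" for x y xs
 proof (rule J_eqI)
  fix D assume D: "D \<in> Der"
  have "H D ((x +\<^sub>d y) # xs) = H D (x # xs) +\<^sub>l H D (y # xs)"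
   using a[OF D] x tuples_K_A by simp
  thus "F ((x \<oplus>\<^bsub>\<K>\<^esub> y) # xs) D = (F (x # xs) +\<^sub>j F (y # xs)) D"
   using x D K_add by (simp add: e J_apply K_ops)
 qed (use x m in simp_all)
 have 3: "F ((r \<odot>\<^bsub>\<K>\<^esub> x) # xs) = r *\<^sub>j F (x # xs)"
  if x: "x \<in> KS" "r \<in> S" "xs \<in> tuples \<K> n" for x r xs
 proof (rule J_eqI)
  fix D assume D: "D \<in> Der"
  have "H D ((r *\<^sub>d x) # xs) = r *\<^sub>l H D (x # xs)"
   using a[OF D] x tuples_K_A by simp
  thus "F ((r \<odot>\<^bsub>\<K>\<^esub> x) # xs) D = (r *\<^sub>j F (x # xs)) D"
   using x D K_smult by (simp add: e J_apply K_ops)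
 qed (use x m in simp_all)
 have 4: "F (x # x # xs) = 0\<^sub>j" if x: "x \<in> KS" "x # xs \<in> tuples \<K> n" for x xs
 proof (rule J_eqI)
  fix D assume D: "D \<in> Der"
  have "H D (x # x # xs) = 0\<^sub>l" using a[OF D] x tuples_K_A[OF x(2)] by simp
  thus "F (x # x # xs) D = 0\<^sub>j D" using x D by (simp add: e J_apply)
 qed (use x m in simp_all)
 show ?case
  unfolding KJ.altform.simps by (intro conjI ballI allI impI; rule 1 2 3 4; assumption)
qed simp

lemma tau_forms:
 assumes \<eta>: "\<eta> \<in> carrier (Bi b)"
 shows "KJ.altform b (tB b \<eta>)" "tB b \<eta> \<in> carrier (\<Omega>J b)"
proof -
 show "KJ.altform b (tB b \<eta>)"
 proof (rule KJ_altformI[where H = "\<lambda>D Ks. \<eta> (D # Ks)"])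
  show "LD.altform b (\<lambda>Ks. \<eta> (D # Ks))" if "D \<in> Der" for D
   by (rule LD.altform_Cons[OF Bi_altform[OF \<eta>] that])
 qed (use tau_apply[OF \<eta>] in simp_all)
 thus "tB b \<eta> \<in> carrier (\<Omega>J b)"
  unfolding Omega_K_J1perp_def KJ.forms_iff[OF refl] by (simp add: tau_def)
qed

text \<open>By Cartan's formula d\<eta>(D, ...) is \<L>_D \<eta> - d(\<iota>_D \<eta>). On
  K-arguments d(\<iota>_D \<eta>) gives the terms of the left side except those of the dual
  connection that bracket \<Delta> with D, and these make up \<L>_D \<eta>. The overall sign is why
  \<tau> starts from the negated differential.\<close>

lemma tau_d01:
 assumes \<eta>: "\<eta> \<in> carrier (Bi b)" and Ks: "Ks \<in> tuples \<K> (Suc b)" and D: "D \<in> GS"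
 shows "dJ b (tB b \<eta>) Ks D = -\<^sub>l LD.dif (D # Ks) \<eta>"
proof -
 have DA: "D \<in> Der" and \<Delta>A: "Ks \<in> tuples \<A> (Suc b)" using Gt_A[OF D] tuples_K_A[OF Ks] .
 note a = Bi_altform[OF \<eta>]
 note aD = LD.altform_Cons[OF a DA]
 have i: "Ks ! i \<in> KS" "Ks ! i \<in> Der" "omit i Ks \<in> tuples \<K> b" "omit i Ks \<in> tuples \<A> b" if "i < Suc b" for i
  using that Ks KJ.omit_tuples[OF Ks, of i] tuples_K_A by simp_all
 have lm: "LD.lieD D Ks \<eta> \<in> Sec"
  using LD.altform_valued[OF a] DA \<Delta>A by (rule LD.lieD_mem)
 have dm: "LD.dif Ks (\<lambda>zs. \<eta> (D # zs)) \<in> Sec"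
  using LD.altform_valued[OF aD] \<Delta>A by (rule LD.dif_mem)
 have c: "\<eta> (comm (Ks ! k) D # omit k Ks) \<in> Sec" if "k < Suc b" for k
  using i[OF that] DA by (intro Bi_mem[OF \<eta>]) simp
 \<comment> \<open>\<eta> vanishes on K-arguments alone, so the term in which D acts drops out. Each
   bracket is moved to the front and reversed.\<close>
 have lie: "l\<iota> (LD.lieD D Ks \<eta>) f p = (\<Sum>k<Suc b. (- 1) ^ k * l\<iota> (\<eta> (comm (Ks ! k) D # omit k Ks)) f p)" for f p
 proof -
  have "l\<iota> (\<eta> (Ks[k := comm D (Ks ! k)])) f p = - ((- 1) ^ k * l\<iota> (\<eta> (comm (Ks ! k) D # omit k Ks)) f p)" if k: "k < Suc b" for k
  proof -
   have "comm D (Ks ! k) = (\<lambda>_. - 1) *\<^sub>d comm (Ks ! k) D"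
    unfolding LD.br_swap[OF i(2)[OF k] DA] using i(2)[OF k] DA by (intro LD.L_neg_smult) simp
   hence "\<eta> (comm D (Ks ! k) # omit k Ks) = (\<lambda>_. - 1) *\<^sub>l \<eta> (comm (Ks ! k) D # omit k Ks)"
    using a i[OF k] DA Cinf_const[of "- 1"] by simp
   hence "\<eta> (Ks[k := comm D (Ks ! k)]) = signed \<L> k ((\<lambda>_. - 1) *\<^sub>l \<eta> (comm (Ks ! k) D # omit k Ks))"
    using LD.altform_list_update[OF a \<Delta>A k LD.br_mem[OF DA i(2)[OF k]]] by simp
   thus ?thesis using c[OF k] Cinf_const[of "- 1"] by simp
  qed
  moreover have "app D (\<eta> Ks) = 0\<^sub>l" unfolding Bi_K_zero[OF \<eta> Ks] by (rule LD.nab_zero[OF DA])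
  ultimately show ?thesis
   unfolding LD.lieD_eq[OF a DA \<Delta>A] by (simp add: sum_negf del: sum.lessThan_Suc)
 qed
 have dif: "l\<iota> (LD.dif Ks (\<lambda>zs. \<eta> (D # zs))) f p =
   (\<Sum>i\<le>b. (- 1) ^ i * l\<iota> ((Ks ! i) (\<eta> (D # omit i Ks))) f p) +
   (\<Sum>j\<le>b. \<Sum>i<j. (- 1) ^ (i + j) * l\<iota> (\<eta> (D # comm (Ks ! i) (Ks ! j) # omit i (omit j Ks))) f p)" for f p
  using LD.koszul_val(2)[OF aD \<Delta>A] unfolding LD.koszul_eq_dif[OF aD \<Delta>A] by (simp add: app_def)
 have kJ: "koszul \<K> comm \<J> nJ b (tB b \<eta>) Ks \<in> JS"
  by (rule KJ.koszul_val(1)[OF tau_forms(1)[OF \<eta>] Ks])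
 have "l\<iota> (koszul \<K> comm \<J> nJ b (tB b \<eta>) Ks D) f p =
   (\<Sum>i\<le>b. (- 1) ^ i * (l\<iota> ((Ks ! i) (\<eta> (D # omit i Ks))) f p - l\<iota> (\<eta> (comm (Ks ! i) D # omit i Ks)) f p)) +
   (\<Sum>j\<le>b. \<Sum>i<j. (- 1) ^ (i + j) * l\<iota> (\<eta> (D # comm (Ks ! i) (Ks ! j) # omit i (omit j Ks))) f p)" for f p
 proof -
  have 1: "j\<iota> (nJ (Ks ! k) (tB b \<eta> (omit k Ks))) (D, f) p =
    l\<iota> ((Ks ! k) (\<eta> (D # omit k Ks))) f p - l\<iota> (\<eta> (comm (Ks ! k) D # omit k Ks)) f p" if k: "k < Suc b" for k
  proof -
   have "(Ks ! k) (\<eta> (D # omit k Ks)) \<in> Sec"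
    using i[OF k] DA by (intro DellD(2)[OF i(2)[OF k]] Bi_mem[OF \<eta>]) simp
   thus ?thesis
    using i[OF k] DA c[OF k] tau_apply[OF \<eta> i(3)[OF k]] by (simp add: J_val nabla_J_apply)
  qed
  have 2: "j\<iota> (tB b \<eta> (comm (Ks ! k) (Ks ! j) # omit k (omit j Ks))) (D, f) p =
    l\<iota> (\<eta> (D # comm (Ks ! k) (Ks ! j) # omit k (omit j Ks))) f p" if k: "k < j" "j < Suc b" for k j
  proof -
   have "comm (Ks ! k) (Ks ! j) # omit k (omit j Ks) \<in> tuples \<K> b"
    using k i by (intro KJ.br_Cons_omit_tuples[OF Ks] KJ.br_mem) simp_all
   thus ?thesis using tau_apply(2)[OF \<eta> _ DA] by (simp add: J_val[OF DA])
  qed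
  show ?thesis
   unfolding J_val[OF DA, symmetric] KJ.koszul_val(2)[OF tau_forms(1)[OF \<eta>] Ks, of "(D, f)" p]
   by (simp add: 1 2 J_val[OF DA, symmetric])
 qed
 note kos = this
 show ?thesis
  unfolding d_K_J1perp_def
 proof (rule ell.eqI)
  show "koszul \<K> comm \<J> nJ b (tB b \<eta>) Ks D \<in> Sec" by (rule JD(1)[OF kJ DA])
  show "-\<^sub>l LD.dif (D # Ks) \<eta> \<in> Sec" using lm dm by simp
  show "l\<iota> (koszul \<K> comm \<J> nJ b (tB b \<eta>) Ks D) f p = l\<iota> (-\<^sub>l LD.dif (D # Ks) \<eta>) f p" for f p
   using lm dm unfolding LD.dif.simps kos
   by (simp add: lie dif sum_subtractf right_diff_distrib lessThan_Suc_atMost del: sum.lessThan_Suc)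
 qed
qed

lemma Bi_neg_d01_apply:
 assumes \<eta>: "\<eta> \<in> carrier (Bi b)" and "D \<in> GS" "Ks \<in> tuples \<K> (Suc b)"
 shows "ndB b \<eta> (D # Ks) = -\<^sub>l LD.dif (D # Ks) \<eta>"
 unfolding neg_diff_def Bi_neg_apply[OF d01_Bi(1)[OF \<eta>] GK_tuples[OF assms(2,3)]] d01_Bi(2)[OF assms] ..

lemma neg_d01_Bi:
 assumes \<eta>: "\<eta> \<in> carrier (Bi b)"
 shows "ndB b \<eta> \<in> carrier (Bi (Suc b))"
proof -
 interpret B: fun_module S "Bi (Suc b)" "f\<iota> (Suc (Suc b))" by (rule fun_module_Bi)
 show ?thesis unfolding neg_diff_def using d01_Bi(1)[OF \<eta>] by (rule B.a_inv_closed)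
qed

lemma d_K_mem:
 assumes "KJ.altform b F"
 shows "dJ b F \<in> carrier (\<Omega>J (Suc b))"
 using KJ.koszul_forms[OF assms refl] by (simp add: Omega_K_J1perp_def d_K_J1perp_def)

lemma tau_chain:
 assumes \<eta>: "\<eta> \<in> carrier (Bi b)"
 shows "tB (Suc b) (ndB b \<eta>) = dJ b (tB b \<eta>)"
proof (rule extensionalityI[of _ "tuples \<K> (Suc b)"])
 note N = neg_d01_Bi[OF \<eta>]
 show "tB (Suc b) (ndB b \<eta>) \<in> extensional (tuples \<K> (Suc b))" by (simp add: tau_def)
 show "dJ b (tB b \<eta>) \<in> extensional (tuples \<K> (Suc b))" by (simp add: d_K_J1perp_def koszul_def)
 fix Ks assume Ks: "Ks \<in> tuples \<K> (Suc b)"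
 show "tB (Suc b) (ndB b \<eta>) Ks = dJ b (tB b \<eta>) Ks"
 proof (rule J_eqI_Gt)
  show "tB (Suc b) (ndB b \<eta>) Ks \<in> JS" by (rule tau_apply(1)[OF N Ks])
  show "dJ b (tB b \<eta>) Ks \<in> JS"
   unfolding d_K_J1perp_def by (rule KJ.koszul_val(1)[OF tau_forms(1)[OF \<eta>] Ks])
  fix D assume D: "D \<in> GS"
  show "tB (Suc b) (ndB b \<eta>) Ks D = dJ b (tB b \<eta>) Ks D"
   unfolding tau_apply(2)[OF N Ks Gt_A[OF D]] Bi_neg_d01_apply[OF \<eta> D Ks] tau_d01[OF \<eta> Ks D] ..
 qed
qed

lemma cochain_complex_K_J: "cochain_complex \<Omega>J dJ"
proof -
 have "\<Omega>J = forms (Cinf A) \<K> \<J>" "dJ = koszul \<K> comm \<J> nJ"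
  by (simp_all add: Omega_K_J1perp_def d_K_J1perp_def fun_eq_iff)
 thus ?thesis using KJ.cochain_complex_koszul[OF refl] by simp
qed

lemma dif_add_Bi:
 assumes "\<eta> \<in> carrier (Bi b)" "\<zeta> \<in> carrier (Bi b)" "xs \<in> tuples \<A> (Suc (Suc b))"
 shows "LD.dif xs (\<eta> \<oplus>\<^bsub>Bi b\<^esub> \<zeta>) = LD.dif xs \<eta> +\<^sub>l LD.dif xs \<zeta>"
proof -
 have "LD.dif xs (\<eta> \<oplus>\<^bsub>Bi b\<^esub> \<zeta>) = LD.dif xs (\<lambda>zs. \<eta> zs +\<^sub>l \<zeta> zs)"
  using assms(3) by (intro LD.dif_cong[of "Suc b"]) (simp_all add: Bi_ops')
 thus ?thesis
  using LD.dif_add[OF LD.altform_valued[OF Bi_altform[OF assms(1)]] LD.altform_valued[OF Bi_altform[OF assms(2)]] assms(3)]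
  by simp
qed

lemma dif_const:
 assumes a: "LD.altform n \<eta>" and xs: "xs \<in> tuples \<A> (Suc n)" and e: "\<And>zs. zs \<in> tuples \<A> n ==> \<zeta> zs = (\<lambda>_. c) *\<^sub>l \<eta> zs"
 shows "LD.dif xs \<zeta> = (\<lambda>_. c) *\<^sub>l LD.dif xs \<eta>"
proof -
 have "LD.dif xs \<zeta> = LD.dif xs (\<lambda>zs. (\<lambda>_. c) *\<^sub>l \<eta> zs)"
  using xs by (intro LD.dif_cong[of n] e)
 thus ?thesis
  using LD.dif_smult[OF LD.altform_valued[OF a] Cinf_const xs, of c] LD.wedge_const[OF LD.altform_valued[OF a] xs, of c]
   LD.dif_mem[OF LD.altform_valued[OF a] xs] Cinf_const[of c] by simp
qed

text \<open>That the square is zero is inherited from K acting on J: \<tau> intertwines the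
  differentials, a form of bidegree (1, b) is determined by its image under \<tau>, and the two
  signs of the negated differential cancel.\<close>

lemma cochain_complex_Bi: "cochain_complex (Omega_D_bi A \<xi> G 1) dB"
 unfolding cochain_complex_def real_linear_def
proof (intro allI conjI ballI)
 fix b
 interpret B: fun_module S "Bi m" "f\<iota> (Suc m)" for m by (rule fun_module_Bi)
 show "dB b \<in> carrier (Bi b) \<rightarrow> carrier (Bi (Suc b))" using d01_Bi(1) by blast
 fix \<eta> assume \<eta>: "\<eta> \<in> carrier (Bi b)"
 note d\<eta> = d01_Bi(1)[OF \<eta>]
 show "dB b (\<eta> \<oplus>\<^bsub>Bi b\<^esub> \<zeta>) = dB b \<eta> \<oplus>\<^bsub>Bi (Suc b)\<^esub> dB b \<zeta>" if \<zeta>: "\<zeta> \<in> carrier (Bi b)" for \<zeta>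
 proof (rule Bi_eqI)
  have s: "\<eta> \<oplus>\<^bsub>Bi b\<^esub> \<zeta> \<in> carrier (Bi b)" using \<eta> \<zeta> by (rule B.a_closed)
  show "dB b (\<eta> \<oplus>\<^bsub>Bi b\<^esub> \<zeta>) \<in> carrier (Bi (Suc b))" by (rule d01_Bi(1)[OF s])
  show "dB b \<eta> \<oplus>\<^bsub>Bi (Suc b)\<^esub> dB b \<zeta> \<in> carrier (Bi (Suc b))" using d\<eta> d01_Bi(1)[OF \<zeta>] by (rule B.a_closed)
  fix D Ks assume D: "D \<in> GS" "Ks \<in> tuples \<K> (Suc b)"
  show "dB b (\<eta> \<oplus>\<^bsub>Bi b\<^esub> \<zeta>) (D # Ks) = (dB b \<eta> \<oplus>\<^bsub>Bi (Suc b)\<^esub> dB b \<zeta>) (D # Ks)"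
   unfolding d01_Bi(2)[OF s D] dif_add_Bi[OF \<eta> \<zeta> GK_tuples[OF D]]
   unfolding Bi_ops restrict_apply'[OF GK_tuples[OF D]] d01_Bi(2)[OF \<eta> D] d01_Bi(2)[OF \<zeta> D] ..
 qed
 have sm: "dB b ((\<lambda>_. c) \<odot>\<^bsub>Bi b\<^esub> \<eta>) = (\<lambda>_. c) \<odot>\<^bsub>Bi (Suc b)\<^esub> dB b \<eta>" if \<eta>: "\<eta> \<in> carrier (Bi b)" for c b \<eta>
 proof (rule Bi_eqI)
  have s: "(\<lambda>_. c) \<odot>\<^bsub>Bi b\<^esub> \<eta> \<in> carrier (Bi b)" using Cinf_const \<eta> by (rule B.smult_mem)
  show "dB b ((\<lambda>_. c) \<odot>\<^bsub>Bi b\<^esub> \<eta>) \<in> carrier (Bi (Suc b))" by (rule d01_Bi(1)[OF s])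
  show "(\<lambda>_. c) \<odot>\<^bsub>Bi (Suc b)\<^esub> dB b \<eta> \<in> carrier (Bi (Suc b))" using Cinf_const d01_Bi(1)[OF \<eta>] by (rule B.smult_mem)
  fix D Ks assume D: "D \<in> GS" "Ks \<in> tuples \<K> (Suc b)"
  have "LD.dif (D # Ks) ((\<lambda>_. c) \<odot>\<^bsub>Bi b\<^esub> \<eta>) = (\<lambda>_. c) *\<^sub>l LD.dif (D # Ks) \<eta>"
   by (rule dif_const[OF Bi_altform[OF \<eta>] GK_tuples[OF D]]) (simp add: Bi_ops')
  thus "dB b ((\<lambda>_. c) \<odot>\<^bsub>Bi b\<^esub> \<eta>) (D # Ks) = ((\<lambda>_. c) \<odot>\<^bsub>Bi (Suc b)\<^esub> dB b \<eta>) (D # Ks)"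
   unfolding d01_Bi(2)[OF s D] unfolding Bi_ops restrict_apply'[OF GK_tuples[OF D]] d01_Bi(2)[OF \<eta> D] .
 qed
 thus "dB b ((\<lambda>_. c) \<odot>\<^bsub>Bi b\<^esub> \<eta>) = (\<lambda>_. c) \<odot>\<^bsub>Bi (Suc b)\<^esub> dB b \<eta>" for c using \<eta> .
 let ?N = "ndB"
 have neg: "\<ominus>\<^bsub>Bi m\<^esub> \<zeta> = (\<lambda>_. - 1) \<odot>\<^bsub>Bi m\<^esub> \<zeta>" if "\<zeta> \<in> carrier (Bi m)" for \<zeta> m
  using that B.a_inv_closed[OF that] B.smult_mem[OF Cinf_const that, of "- 1"] B.neg_val[OF that] B.smult_val[OF Cinf_const that, of "- 1"]
  by (intro B.eqI[of _ m]) simp_all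
 have "?N (Suc b) (?N b \<eta>) = \<ominus>\<^bsub>Bi (Suc (Suc b))\<^esub> (\<ominus>\<^bsub>Bi (Suc (Suc b))\<^esub> dB (Suc b) (dB b \<eta>))"
  unfolding neg_diff_def neg[OF d\<eta>] sm[OF d\<eta>] neg[OF d01_Bi(1)[OF d\<eta>]] ..
 also have "\<dots> = dB (Suc b) (dB b \<eta>)" by (rule B.minus_minus[OF d01_Bi(1)[OF d\<eta>]])
 finally have NN: "?N (Suc b) (?N b \<eta>) = dB (Suc b) (dB b \<eta>)" .
 have "dJ (Suc b) (dJ b (tB b \<eta>)) = \<zero>\<^bsub>\<Omega>J (Suc (Suc b))\<^esub>"
  using cochain_complex_K_J tau_forms(2)[OF \<eta>] unfolding cochain_complex_def by blast
 hence t: "tB (Suc (Suc b)) (dB (Suc b) (dB b \<eta>)) = \<zero>\<^bsub>\<Omega>J (Suc (Suc b))\<^esub>"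
  using tau_chain[OF neg_d01_Bi[OF \<eta>]] unfolding tau_chain[OF \<eta>] NN by simp
 show "dB (Suc b) (dB b \<eta>) = \<zero>\<^bsub>Bi (Suc (Suc b))\<^esub>"
 proof (rule Bi_eqI[OF d01_Bi(1)[OF d\<eta>] B.zero_closed])
  fix D Ks assume D: "D \<in> GS" "Ks \<in> tuples \<K> (Suc (Suc b))"
  have "dB (Suc b) (dB b \<eta>) (D # Ks) = \<zero>\<^bsub>\<Omega>J (Suc (Suc b))\<^esub> Ks D"
   unfolding t[symmetric] by (rule tau_apply(2)[OF d01_Bi(1)[OF d\<eta>] D(2) Gt_A[OF D(1)], symmetric])
  also have "\<dots> = 0\<^sub>l"
   using D Gt_A by (simp add: Omega_K_J1perp_def forms_ops J_apply)
  finally show "dB (Suc b) (dB b \<eta>) (D # Ks) = \<zero>\<^bsub>Bi (Suc (Suc b))\<^esub> (D # Ks)"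
   unfolding Bi_ops restrict_apply'[OF GK_tuples[OF D]] .
 qed
qed

lemma cochain_complex_neg_Bi: "cochain_complex (Omega_D_bi A \<xi> G 1) (ndB)"
 using fun_module_Bi cochain_complex_Bi by (rule cochain_complex_neg_diff)

lemma chain_map_tau:
 "chain_map (Omega_D_bi A \<xi> G 1) (ndB) \<Omega>J dJ tB"
 unfolding chain_map_def real_linear_def
proof (intro conjI allI ballI cochain_complex_neg_Bi cochain_complex_K_J tau_chain)
 fix b
 interpret B: fun_module S "Bi m" "f\<iota> (Suc m)" for m by (rule fun_module_Bi)
 show "tB b \<in> carrier (Bi b) \<rightarrow> carrier (\<Omega>J b)" using tau_forms(2) by blast
 fix \<eta> assume \<eta>: "\<eta> \<in> carrier (Bi b)"
 show "tB b (\<eta> \<oplus>\<^bsub>Bi b\<^esub> \<zeta>) = tB b \<eta> \<oplus>\<^bsub>\<Omega>J b\<^esub> tB b \<zeta>" if \<zeta>: "\<zeta> \<in> carrier (Bi b)" for \<zeta>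
 proof (rule extensionalityI[of _ "tuples \<K> b"])
  have s: "\<eta> \<oplus>\<^bsub>Bi b\<^esub> \<zeta> \<in> carrier (Bi b)" using \<eta> \<zeta> by (rule B.a_closed)
  fix Ks assume Ks: "Ks \<in> tuples \<K> b"
  show "tB b (\<eta> \<oplus>\<^bsub>Bi b\<^esub> \<zeta>) Ks = (tB b \<eta> \<oplus>\<^bsub>\<Omega>J b\<^esub> tB b \<zeta>) Ks"
   unfolding Omega_K_J1perp_def forms_ops restrict_apply'[OF Ks]
   using tau_apply[OF s Ks] tau_apply[OF \<eta> Ks] tau_apply[OF \<zeta> Ks] tuples_K_A[OF Ks]
   by (intro J_eqI) (simp_all add: J_apply Bi_ops')
 qed (simp_all add: tau_def Omega_K_J1perp_def forms_ops)
 show "tB b ((\<lambda>_. c) \<odot>\<^bsub>Bi b\<^esub> \<eta>) = (\<lambda>_. c) \<odot>\<^bsub>\<Omega>J b\<^esub> tB b \<eta>" for c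
 proof (rule extensionalityI[of _ "tuples \<K> b"])
  have s: "(\<lambda>_. c) \<odot>\<^bsub>Bi b\<^esub> \<eta> \<in> carrier (Bi b)" using Cinf_const \<eta> by (rule B.smult_mem)
  fix Ks assume Ks: "Ks \<in> tuples \<K> b"
  show "tB b ((\<lambda>_. c) \<odot>\<^bsub>Bi b\<^esub> \<eta>) Ks = ((\<lambda>_. c) \<odot>\<^bsub>\<Omega>J b\<^esub> tB b \<eta>) Ks"
   unfolding Omega_K_J1perp_def forms_ops restrict_apply'[OF Ks]
   using tau_apply[OF s Ks] tau_apply[OF \<eta> Ks] tuples_K_A[OF Ks] Cinf_const[of c]
   by (intro J_eqI) (simp_all add: J_apply Bi_ops')
 qed (simp_all add: tau_def Omega_K_J1perp_def forms_ops)
qed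

end

context precontact_splitting
begin

section \<open>The map \<open>d\<^sub>1\<^sub>0 \<circ> (\<sigma>|\<^sub>K)\<^sup>*\<close>\<close>

lemma pair_TF_ell: "fm_pair S (TFm) (\<lambda>X. X) \<L> l\<iota>"
 by unfold_locales

lemma pair_TF_NF: "fm_pair S (TFm) (\<lambda>X. X) (NF A \<xi>) (induced projG)"
 by unfold_locales

abbreviation "\<Omega>N \<equiv> Omega_F_NF A \<xi>"
abbreviation "\<Omega>l \<equiv> Omega_F_ell A \<xi>"
abbreviation "dN \<equiv> d_F_NF A \<xi>"
abbreviation "dl \<equiv> d_F_ell A \<xi>"
abbreviation "Rm \<equiv> Rmap A \<xi>"
abbreviation "TL_altform \<equiv> fm_pair.altform S (TFm) \<L>"
abbreviation "TN_altform \<equiv> fm_pair.altform S (TFm) (NF A \<xi>)"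

lemma Omega_F_ell_iff: "\<eta> \<in> carrier (\<Omega>l n) \<longleftrightarrow> \<eta> \<in> extensional (tuples (TFm) n) \<and> TL_altform n \<eta>"
 unfolding Omega_F_ell_def by (rule fm_pair.forms_iff[OF pair_TF_ell refl])

lemma Omega_F_NF_iff: "\<eta> \<in> carrier (\<Omega>N n) \<longleftrightarrow> \<eta> \<in> extensional (tuples (TFm) n) \<and> TN_altform n \<eta>"
 unfolding Omega_F_NF_def by (rule fm_pair.forms_iff[OF pair_TF_NF refl])

lemma map_symbol: "Ks \<in> tuples \<K> n ==> map \<sigma> Ks \<in> tuples (TFm) n"
 by (auto simp: tuples_def K_symbol)

lemma natural_symbol_pK: "natural_forms S (TFm) (\<lambda>X. X) \<L> l\<iota> \<A> d\<iota> \<L> l\<iota> (\<lambda>D. \<sigma> (pK D)) (\<lambda>e. e)"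
 by unfold_locales (simp_all add: K_symbol prK(1) prK_add prK_smult Dell_add Dell_smult TF_ops)

lemma natural_rep_symbol:
 "natural_rep S (TFm) (\<lambda>X. X) \<L> l\<iota> lie (\<lambda>X. X) (nabla_ell A \<xi>) \<A> d\<iota> \<L> l\<iota> comm \<sigma> app (KS) \<sigma> (\<lambda>e. e)"
proof -
 interpret a: lie_rep S "TFm" "\<lambda>X. X" \<L> l\<iota> lie "\<lambda>X. X" "nabla_ell A \<xi>" by (rule lie_rep_TF_ell)
 show ?thesis
 proof unfold_locales
  show "app x e = nabla_ell A \<xi> (\<sigma> x) e" if "x \<in> KS" "e \<in> Sec" for x e
   using that(2) by (rule ell_cases) (simp add: app_def K_th[OF that(1)] nabla_ell_th K_symbol[OF that(1)])
 qed (auto simp: K_comm K_symbol comm_mem)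
qed

definition PK :: "nat => ('a vfield list => 'a vfield set) => 'a derivation list => 'a vfield set" where
 "PK n \<eta> = prK_pull A \<xi> G n (symbolK_pull A \<xi> n \<eta>)"

lemma PK_apply: "xs \<in> tuples \<A> n ==> PK n \<eta> xs = \<eta> (map \<sigma> (map pK xs))"
 using map_pK[of xs n] by (simp add: PK_def prK_pull_def symbolK_pull_def pullback_def del: map_map)

lemma PK_K: "Ks \<in> tuples \<K> n ==> PK n \<eta> Ks = \<eta> (map \<sigma> Ks)"
 using PK_apply[OF tuples_K_A, of Ks n \<eta>] by (simp add: map_pK_K del: map_map)

lemma altform_PK:
 assumes "TL_altform n \<eta>"
 shows "LD.altform n (PK n \<eta>)"
proof -
 have "LD.altform n (\<lambda>xs. \<eta> (map (\<lambda>D. \<sigma> (pK D)) xs))"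
  by (rule natural_forms.altform_natural[OF natural_symbol_pK assms])
 moreover have "LD.altform n (PK n \<eta>) \<longleftrightarrow> LD.altform n (\<lambda>xs. \<eta> (map (\<lambda>D. \<sigma> (pK D)) xs))"
  by (rule LD.altform_cong) (simp add: PK_apply comp_def)
 ultimately show ?thesis by blast
qed

text \<open>On K the symbol respects brackets and carries the action on \<ell> to the Bott
  connection, so naturality applies.\<close>

lemma d_F_ell_symbol:
 assumes a: "TL_altform n \<eta>" and Ks: "Ks \<in> tuples \<K> (Suc n)"
 shows "d_D A \<xi> n (PK n \<eta>) Ks = dl n \<eta> (map \<sigma> Ks)"
 unfolding d_D_eq d_F_ell_def
proof (rule natural_rep.koszul_natural[OF natural_rep_symbol a altform_PK[OF a]])
 show "set Ks \<subseteq> KS" "length Ks = Suc n" using Ks by (simp_all add: tuples_def)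
 show "PK n \<eta> ys = \<eta> (map \<sigma> ys)" if "set ys \<subseteq> KS" "length ys = n" for ys
  using that by (intro PK_K) (simp add: tuples_def)
qed

abbreviation "dS \<equiv> d10_symbolK_pull A \<xi> G"

lemma d10_Bi:
 assumes a: "TL_altform n \<eta>"
 shows "dS n \<eta> \<in> carrier (Bi n)"
  and "D \<in> GS ==> Ks \<in> tuples \<K> n ==> dS n \<eta> (D # Ks) = LD.dif (D # Ks) (PK n \<eta>)"
  and "xs \<in> tuples \<A> (Suc n) ==> dS n \<eta> xs = c1 xs (d_D A \<xi> n (PK n \<eta>))"
proof -
 note b = altform_d_D[OF altform_PK[OF a]]
 have e: "dS n \<eta> = component A \<xi> G 1 n (d_D A \<xi> n (PK n \<eta>))"
  by (simp add: d10_symbolK_pull_def d10_def PK_def)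
 show "dS n \<eta> \<in> carrier (Bi n)" unfolding e by (rule component_Bi[OF b])
 show "dS n \<eta> (D # Ks) = LD.dif (D # Ks) (PK n \<eta>)" if "D \<in> GS" "Ks \<in> tuples \<K> n"
  unfolding e component_apply[OF b that] by (rule d_D_dif[OF altform_PK[OF a] GK_tuples[OF that]])
 show "dS n \<eta> xs = c1 xs (d_D A \<xi> n (PK n \<eta>))" if "xs \<in> tuples \<A> (Suc n)"
  unfolding e component_eq[OF LD.altform_valued[OF b]] using that by simp
qed

lemma natural_rep_K: "natural_rep S \<A> d\<iota> \<L> l\<iota> comm \<sigma> app \<A> d\<iota> \<L> l\<iota> comm \<sigma> app (KS) (\<lambda>D. D) (\<lambda>e. e)"
 by unfold_locales (auto simp: K_comm)

text \<open>K is closed under commutators, so on K-arguments the differential involves values on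
  K-arguments only.\<close>

lemma dif_K_zero:
 assumes "\<And>ys. ys \<in> tuples \<K> n ==> \<theta> ys = 0\<^sub>l" and xs: "xs \<in> tuples \<K> (Suc n)"
 shows "LD.dif xs \<theta> = 0\<^sub>l"
proof -
 have "LD.dif xs \<theta> = LD.dif (map (\<lambda>D. D) xs) (\<lambda>_. 0\<^sub>l)"
  using assms by (intro natural_rep.dif_natural[OF natural_rep_K, of n])
   (simp_all add: tuples_def LD.E_valued_def)
 thus ?thesis using tuples_K_A[OF xs] by (simp add: tuples_def)
qed

text \<open>The component of bidegree \<open>(2, n - 1)\<close> of a form does not contribute to the component of bidegree
 \<open>(1, n + 1)\<close> of its differential.\<close>

lemma dif_zero_of_vanishing:
 assumes a: "LD.altform (Suc n) \<theta>" and z: "\<And>X Ks. X \<in> Der ==> Ks \<in> tuples \<K> n ==> \<theta> (X # Ks) = 0\<^sub>l"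
  and D: "D \<in> Der" and Ks: "Ks \<in> tuples \<K> (Suc n)"
 shows "LD.dif (D # Ks) \<theta> = 0\<^sub>l"
proof -
 note \<Delta>A = tuples_K_A[OF Ks]
 have "LD.dif Ks (\<lambda>zs. \<theta> (D # zs)) = 0\<^sub>l" using z[OF D] Ks by (rule dif_K_zero)
 moreover have "LD.lieD D Ks \<theta> = 0\<^sub>l"
 proof (rule ell.eqI)
  show "LD.lieD D Ks \<theta> \<in> Sec" using LD.altform_valued[OF a] D \<Delta>A by (rule LD.lieD_mem)
  fix f p
  have "\<theta> (Ks[i := comm D (Ks ! i)]) = 0\<^sub>l" if i: "i < Suc n" for i
  proof -
   have m: "comm D (Ks ! i) \<in> Der" using D \<Delta>A i by simp
   have "\<theta> (comm D (Ks ! i) # omit i Ks) = 0\<^sub>l"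
    using i by (intro z m KJ.omit_tuples[OF Ks]) simp
   thus ?thesis
    unfolding LD.altform_list_update[OF a \<Delta>A i m] by (simp add: signed_def ell_neg_zero)
  qed
  moreover have "\<theta> Ks = 0\<^sub>l" using Ks z by (elim tup_SucE) simp
  ultimately show "l\<iota> (LD.lieD D Ks \<theta>) f p = l\<iota> 0\<^sub>l f p"
   unfolding LD.lieD_eq[OF a D \<Delta>A] by (simp add: LD.nab_zero[OF D] del: sum.lessThan_Suc)
 qed simp
 ultimately show ?thesis by (simp add: a_minus_def ell_neg_zero)
qed

lemma c1_K_zero:
 assumes a: "LD.altform n \<theta>" and Ks: "Ks \<in> tuples \<K> n"
 shows "c1 Ks \<theta> = 0\<^sub>l"
proof (cases n)
 case (Suc b)
 show ?thesis
  using Ks a unfolding Suc by (intro c1_vanish[of b _ _ "{..<Suc b}"] tuples_K_A) simp_all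
qed (use Ks in simp)

text \<open>The differential \<zeta> of the pulled back form splits by the number of G-parts. The
  part \<zeta>0 without any is the pullback of the leafwise differential, and \<zeta>1 with one is
  the image under the first map. On (D, Ks) the identity d\<zeta> = 0 leaves d\<zeta>0 + d\<zeta>1 =
  0, which is the claim with its sign.\<close>

lemma d10_symbol_chain:
 assumes a: "TL_altform n \<eta>" and a': "TL_altform (Suc n) (dl n \<eta>)"
 shows "dS (Suc n) (dl n \<eta>) = ndB n (dS n \<eta>)"
proof (rule Bi_eqI[OF d10_Bi(1)[OF a'] neg_d01_Bi[OF d10_Bi(1)[OF a]]])
 fix D Ks assume D: "D \<in> GS" and Ks: "Ks \<in> tuples \<K> (Suc n)"
 define \<zeta> where "\<zeta> = d_D A \<xi> n (PK n \<eta>)"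
 have \<zeta>: "LD.altform (Suc n) \<zeta>" unfolding \<zeta>_def by (rule altform_d_D[OF altform_PK[OF a]])
 define \<zeta>0 where "\<zeta>0 = (\<lambda>xs. \<zeta> (map pK xs))"
 define \<zeta>1 where "\<zeta>1 = (\<lambda>xs. c1 xs \<zeta>)"
 have \<zeta>0: "LD.altform (Suc n) \<zeta>0" unfolding \<zeta>0_def by (rule altform_pK[OF \<zeta>])
 have \<zeta>1: "LD.altform (Suc n) \<zeta>1" unfolding \<zeta>1_def by (rule altform_c1[OF \<zeta>])
 let ?xs = "D # Ks"
 have xs: "?xs \<in> tuples \<A> (Suc (Suc n))" by (rule GK_tuples[OF D Ks])
 have DA: "D \<in> Der" by (rule Gt_A[OF D])
 note v = LD.altform_valued[OF \<zeta>] LD.altform_valued[OF \<zeta>0] LD.altform_valued[OF \<zeta>1]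
 note d = LD.dif_mem[OF v(1) xs] LD.dif_mem[OF v(2) xs] LD.dif_mem[OF v(3) xs]
 have "LD.dif ?xs \<zeta> = LD.dif ?xs (\<lambda>zs. LD.dif zs (PK n \<eta>))"
  unfolding \<zeta>_def using xs by (intro LD.dif_cong[of "Suc n"] d_D_dif[OF altform_PK[OF a]])
 also have "\<dots> = 0\<^sub>l" by (rule LD.dif_dif[OF altform_PK[OF a] xs])
 finally have 1: "LD.dif ?xs \<zeta> = 0\<^sub>l" .
 \<comment> \<open>The difference vanishes as soon as all arguments but the first lie in K, so
   \<open>dif_zero_of_vanishing\<close> applies.\<close>
 have "LD.dif ?xs (\<lambda>zs. (\<zeta> zs -\<^sub>l \<zeta>0 zs) -\<^sub>l \<zeta>1 zs) = 0\<^sub>l"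
 proof (rule dif_zero_of_vanishing[OF _ _ DA Ks])
  show "LD.altform (Suc n) (\<lambda>zs. (\<zeta> zs -\<^sub>l \<zeta>0 zs) -\<^sub>l \<zeta>1 zs)" by (intro LD.altform_diff \<zeta> \<zeta>0 \<zeta>1)
  fix X Ks assume X: "X \<in> Der" and Ks: "Ks \<in> tuples \<K> n"
  note \<Delta>A = tuples_K_A[OF Ks]
  have m: "\<zeta> (pG X # Ks) \<in> Sec" "\<zeta> (pK X # Ks) \<in> Sec"
   using X \<Delta>A by (auto intro!: LD.altform_mem[OF \<zeta>] simp del: LD.altform.simps)
  have "\<zeta> ((pG X +\<^sub>d pK X) # Ks) = \<zeta> (pG X # Ks) +\<^sub>l \<zeta> (pK X # Ks)"
   using \<zeta> X \<Delta>A by simp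
  moreover have "pG X +\<^sub>d pK X = X" using prK_split[OF X] by simp
  ultimately have "\<zeta> (X # Ks) = \<zeta> (pG X # Ks) +\<^sub>l \<zeta> (pK X # Ks)" by simp
  moreover have "\<zeta>0 (X # Ks) = \<zeta> (pK X # Ks)" by (simp add: \<zeta>0_def map_pK_K[OF Ks])
  moreover have "\<zeta>1 (X # Ks) = \<zeta> (pG X # Ks) +\<^sub>l 0\<^sub>l"
   using c1_K_zero[OF LD.altform_Cons[OF \<zeta> prK_A[OF X]] Ks] by (simp add: \<zeta>1_def map_pK_K[OF Ks])
  ultimately show "(\<zeta> (X # Ks) -\<^sub>l \<zeta>0 (X # Ks)) -\<^sub>l \<zeta>1 (X # Ks) = 0\<^sub>l"
   using m by (intro ell.eqI) simp_all
 qed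
 moreover have "LD.dif ?xs (\<lambda>zs. (\<zeta> zs -\<^sub>l \<zeta>0 zs) -\<^sub>l \<zeta>1 zs) = (LD.dif ?xs \<zeta> -\<^sub>l LD.dif ?xs \<zeta>0) -\<^sub>l LD.dif ?xs \<zeta>1"
  unfolding LD.dif_diff[OF LD.altform_valued[OF LD.altform_diff[OF \<zeta> \<zeta>0]] v(3) xs] LD.dif_diff[OF v(1,2) xs] ..
 ultimately have 2: "(0\<^sub>l -\<^sub>l LD.dif ?xs \<zeta>0) -\<^sub>l LD.dif ?xs \<zeta>1 = 0\<^sub>l" unfolding 1 by simp
 have 3: "LD.dif ?xs \<zeta>0 = -\<^sub>l LD.dif ?xs \<zeta>1"
 proof (rule ell.eqI)
  show "l\<iota> (LD.dif ?xs \<zeta>0) f p = l\<iota> (-\<^sub>l LD.dif ?xs \<zeta>1) f p" for f p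
   using arg_cong[OF 2, of "\<lambda>s. l\<iota> s f p"] d by (simp del: LD.dif.simps)
 qed (use d in \<open>simp_all del: LD.dif.simps\<close>)
 \<comment> \<open>Projecting all arguments to K before evaluating \<zeta> gives the leafwise
   differential of \<eta> on their symbols.\<close>
 have "LD.dif ?xs (PK (Suc n) (dl n \<eta>)) = LD.dif ?xs \<zeta>0"
 proof (rule LD.dif_cong[OF _ xs])
  fix ys assume ys: "ys \<in> tuples \<A> (Suc n)"
  show "PK (Suc n) (dl n \<eta>) ys = \<zeta>0 ys"
   unfolding PK_apply[OF ys] \<zeta>0_def \<zeta>_def d_F_ell_symbol[OF a map_pK[OF ys]] ..
 qed
 moreover have "LD.dif ?xs (dS n \<eta>) = LD.dif ?xs \<zeta>1"
  unfolding \<zeta>1_def \<zeta>_def using d10_Bi(3)[OF a] by (rule LD.dif_cong[OF _ xs])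
 ultimately show "dS (Suc n) (dl n \<eta>) ?xs = ndB n (dS n \<eta>) ?xs"
  unfolding d10_Bi(2)[OF a' D Ks] Bi_neg_d01_apply[OF d10_Bi(1)[OF a] D Ks] by (simp only: 3)
qed

lemma cochain_complex_F_ell: "cochain_complex \<Omega>l dl"
proof -
 have "\<Omega>l = forms (Cinf A) (TFm) \<L>" "dl = koszul (TFm) lie \<L> (nabla_ell A \<xi>)"
  by (simp_all add: Omega_F_ell_def d_F_ell_def fun_eq_iff)
 thus ?thesis using lie_rep.cochain_complex_koszul[OF lie_rep_TF_ell refl] by simp
qed

lemma fun_module_F_ell: "fun_module S (\<Omega>l n) (\<lambda>\<eta> (xs, i) p. if xs \<in> tuples (TFm) n then l\<iota> (\<eta> xs) i p else 0)"
 unfolding Omega_F_ell_def by (rule fm_pair.fun_module_forms[OF pair_TF_ell refl])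

lemma F_ell_ops: 
 "Xs \<in> tuples (TFm) n ==> (\<eta> \<oplus>\<^bsub>\<Omega>l n\<^esub> \<zeta>) Xs = \<eta> Xs +\<^sub>l \<zeta> Xs"
 "Xs \<in> tuples (TFm) n ==> (r \<odot>\<^bsub>\<Omega>l n\<^esub> \<eta>) Xs = r *\<^sub>l \<eta> Xs"
 by (simp_all add: Omega_F_ell_def forms_ops)

lemma chain_map_d10_symbol:
 "chain_map \<Omega>l dl (Omega_D_bi A \<xi> G 1) (ndB) dS"
 unfolding chain_map_def real_linear_def
proof (intro conjI allI ballI cochain_complex_F_ell cochain_complex_neg_Bi)
 fix n
 interpret B: fun_module S "Bi n" "f\<iota> (Suc n)" by (rule fun_module_Bi)
 interpret F: fun_module S "\<Omega>l n" "\<lambda>\<eta> (xs, i) p. if xs \<in> tuples (TFm) n then l\<iota> (\<eta> xs) i p else 0"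
  by (rule fun_module_F_ell)
 show "dS n \<in> carrier (\<Omega>l n) \<rightarrow> carrier (Bi n)"
  unfolding Omega_F_ell_iff[abs_def] using d10_Bi(1) Omega_F_ell_iff by blast
 fix \<eta> assume \<eta>: "\<eta> \<in> carrier (\<Omega>l n)"
 hence a: "TL_altform n \<eta>" by (simp add: Omega_F_ell_iff)
 have "dl n \<eta> \<in> carrier (\<Omega>l (Suc n))"
  using cochain_complex_F_ell \<eta> unfolding cochain_complex_def real_linear_def by blast
 hence "TL_altform (Suc n) (dl n \<eta>)" by (simp add: Omega_F_ell_iff)
 with a show "dS (Suc n) (dl n \<eta>) = ndB n (dS n \<eta>)"
  by (rule d10_symbol_chain)
 have PKm: "map \<sigma> (map pK xs) \<in> tuples (TFm) n" if "xs \<in> tuples \<A> n" for xs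
  by (rule map_symbol[OF map_pK[OF that]])
 show "dS n (\<eta> \<oplus>\<^bsub>\<Omega>l n\<^esub> \<zeta>) = dS n \<eta> \<oplus>\<^bsub>Bi n\<^esub> dS n \<zeta>" if \<zeta>: "\<zeta> \<in> carrier (\<Omega>l n)" for \<zeta>
 proof -
  have b: "TL_altform n \<zeta>" using \<zeta> by (simp add: Omega_F_ell_iff)
  have "\<eta> \<oplus>\<^bsub>\<Omega>l n\<^esub> \<zeta> \<in> carrier (\<Omega>l n)" using \<eta> \<zeta> by (rule F.add_mem)
  hence c: "TL_altform n (\<eta> \<oplus>\<^bsub>\<Omega>l n\<^esub> \<zeta>)" by (simp add: Omega_F_ell_iff)
  show ?thesis
  proof (rule Bi_eqI[OF d10_Bi(1)[OF c] B.add_mem[OF d10_Bi(1)[OF a] d10_Bi(1)[OF b]]])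
   fix D Ks assume D: "D \<in> GS" "Ks \<in> tuples \<K> n"
   note xs = GK_tuples[OF D]
   have "LD.dif (D # Ks) (PK n (\<eta> \<oplus>\<^bsub>\<Omega>l n\<^esub> \<zeta>)) = LD.dif (D # Ks) (\<lambda>zs. PK n \<eta> zs +\<^sub>l PK n \<zeta> zs)"
    using xs PKm by (intro LD.dif_cong[of n]) (simp_all add: PK_apply F_ell_ops del: map_map)
   also have "\<dots> = LD.dif (D # Ks) (PK n \<eta>) +\<^sub>l LD.dif (D # Ks) (PK n \<zeta>)"
    using LD.altform_valued[OF altform_PK[OF a]] LD.altform_valued[OF altform_PK[OF b]] xs by (rule LD.dif_add)
   finally show "dS n (\<eta> \<oplus>\<^bsub>\<Omega>l n\<^esub> \<zeta>) (D # Ks) = (dS n \<eta> \<oplus>\<^bsub>Bi n\<^esub> dS n \<zeta>) (D # Ks)"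
    unfolding Bi_ops restrict_apply'[OF xs] d10_Bi(2)[OF a D] d10_Bi(2)[OF b D] d10_Bi(2)[OF c D] .
  qed
 qed
 show "dS n ((\<lambda>_. c) \<odot>\<^bsub>\<Omega>l n\<^esub> \<eta>) = (\<lambda>_. c) \<odot>\<^bsub>Bi n\<^esub> dS n \<eta>" for c
 proof -
  have "(\<lambda>_. c) \<odot>\<^bsub>\<Omega>l n\<^esub> \<eta> \<in> carrier (\<Omega>l n)" using Cinf_const \<eta> by (rule F.smult_mem)
  hence c: "TL_altform n ((\<lambda>_. c) \<odot>\<^bsub>\<Omega>l n\<^esub> \<eta>)" by (simp add: Omega_F_ell_iff)
  show ?thesis
  proof (rule Bi_eqI[OF d10_Bi(1)[OF c] B.smult_mem[OF Cinf_const d10_Bi(1)[OF a]]])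
   fix D Ks assume D: "D \<in> GS" "Ks \<in> tuples \<K> n"
   note xs = GK_tuples[OF D]
   have "LD.dif (D # Ks) (PK n ((\<lambda>_. c) \<odot>\<^bsub>\<Omega>l n\<^esub> \<eta>)) = (\<lambda>_. c) *\<^sub>l LD.dif (D # Ks) (PK n \<eta>)"
    using PKm by (intro dif_const[OF altform_PK[OF a] xs]) (simp add: PK_apply F_ell_ops del: map_map)
   thus "dS n ((\<lambda>_. c) \<odot>\<^bsub>\<Omega>l n\<^esub> \<eta>) (D # Ks) = ((\<lambda>_. c) \<odot>\<^bsub>Bi n\<^esub> dS n \<eta>) (D # Ks)"
    unfolding Bi_ops restrict_apply'[OF xs] d10_Bi(2)[OF a D] d10_Bi(2)[OF c D] .
  qed
 qed
qed

section \<open>The map \<open>R\<close>\<close>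

abbreviation "sK \<equiv> symbolK_inv A \<xi>"
abbreviation "NN \<equiv> NF A \<xi>"
abbreviation (input) n_add (infixl "+\<^sub>n" 65) where "s +\<^sub>n t \<equiv> s \<oplus>\<^bsub>NN\<^esub> t"
abbreviation (input) n_diff (infixl "-\<^sub>n" 65) where "s -\<^sub>n t \<equiv> s \<ominus>\<^bsub>NN\<^esub> t"
abbreviation (input) n_neg ("-\<^sub>n _" [81] 80) where "-\<^sub>n s \<equiv> \<ominus>\<^bsub>NN\<^esub> s"
abbreviation (input) n_smult (infixl "*\<^sub>n" 70) where "f *\<^sub>n s \<equiv> f \<odot>\<^bsub>NN\<^esub> s"
abbreviation (input) n_zero ("0\<^sub>n") where "0\<^sub>n \<equiv> \<zero>\<^bsub>NN\<^esub>"

lemma sK_add: "X \<in> XF ==> Y \<in> XF ==> sK (X \<oplus>\<^bsub>TFm\<^esub> Y) = sK X \<oplus>\<^bsub>\<K>\<^esub> sK Y"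
 using sections_add[OF F_subspaces, of X Y] unfolding TF_ops K_ops
 by (intro K_eqI symbolK_inv K_add) (simp_all add: symbolK_inv Dell_add)

lemma sK_smult: "f \<in> S ==> X \<in> XF ==> sK (f \<odot>\<^bsub>TFm\<^esub> X) = f \<odot>\<^bsub>\<K>\<^esub> sK X"
 using sections_smult[OF F_subspaces, of f X] unfolding TF_ops K_ops
 by (intro K_eqI symbolK_inv K_smult) (simp_all add: symbolK_inv Dell_smult)

lemma sK_lie: "X \<in> XF ==> Y \<in> XF ==> sK (lie X Y) = comm (sK X) (sK Y)"
 by (intro K_eqI symbolK_inv K_comm lie_XF) (simp_all add: symbolK_inv comm_mem lie_XF)

lemma map_sK: "Xs \<in> tuples (TFm) n ==> map sK Xs \<in> tuples \<K> n"
 by (auto simp: tuples_def symbolK_inv)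

lemma NN_const_add: "e \<in> carrier NN ==> f \<in> carrier NN ==>
  (\<lambda>_. c) *\<^sub>n (e +\<^sub>n f) = (\<lambda>_. c) *\<^sub>n e +\<^sub>n (\<lambda>_. c) *\<^sub>n f"
 using Cinf_const[of c] by (intro NF.eqI; simp add: algebra_simps)

lemma NN_const_smult: "e \<in> carrier NN ==> r \<in> S ==> (\<lambda>_. c) *\<^sub>n (r *\<^sub>n e) = r *\<^sub>n ((\<lambda>_. c) *\<^sub>n e)"
 using Cinf_const[of c] by (intro NF.eqI; simp add: algebra_simps)

text \<open>c stands for the sign of R, -(-1)^b. In a fixed degree it is a constant, and a constant
  factor does not disturb naturality.\<close>

lemma natural_R: "natural_forms S \<K> d\<iota> \<J> j\<iota> (TFm) (\<lambda>X. X) NN (induced projG) sK (\<lambda>\<alpha>. (\<lambda>_. c) *\<^sub>n \<rho> \<alpha>)"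
proof unfold_locales
 fix e f r
 show "(\<lambda>_. c) *\<^sub>n \<rho> e \<in> carrier NN" if "e \<in> JS"
  using that by (intro NF.smult_mem Cinf_const \<rho>_mem)
 show "(\<lambda>_. c) *\<^sub>n \<rho> (e +\<^sub>j f) = (\<lambda>_. c) *\<^sub>n \<rho> e +\<^sub>n (\<lambda>_. c) *\<^sub>n \<rho> f" if "e \<in> JS" "f \<in> JS"
  unfolding \<rho>_add[OF that] using that by (intro NN_const_add \<rho>_mem)
 show "(\<lambda>_. c) *\<^sub>n \<rho> (r *\<^sub>j e) = r *\<^sub>n ((\<lambda>_. c) *\<^sub>n \<rho> e)" if "r \<in> S" "e \<in> JS"
  unfolding \<rho>_smult[OF that] using that by (intro NN_const_smult \<rho>_mem)
qed (simp_all add: symbolK_inv sK_add sK_smult)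

lemma natural_rep_R:
 "natural_rep S \<K> d\<iota> \<J> j\<iota> comm \<sigma> nJ (TFm) (\<lambda>X. X) NN (induced projG) lie (\<lambda>X. X) (nabla_NF A \<xi>) XF sK (\<lambda>\<alpha>. (\<lambda>_. c) *\<^sub>n \<rho> \<alpha>)"
proof -
 interpret b: lie_rep S "TFm" "\<lambda>X. X" NN "induced projG" lie "\<lambda>X. X" "nabla_NF A \<xi>" by (rule lie_rep_TF_NF)
 interpret n: natural_forms S \<K> d\<iota> \<J> j\<iota> "TFm" "\<lambda>X. X" NN "induced projG" sK "\<lambda>\<alpha>. (\<lambda>_. c) *\<^sub>n \<rho> \<alpha>" by (rule natural_R)
 show ?thesis
 proof unfold_locales
  fix X e assume X: "X \<in> XF" and e: "e \<in> JS"
  have X': "X \<in> carrier (TFm)" using X by simp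
  have m: "nabla_NF A \<xi> X (\<rho> e) \<in> carrier NN" by (rule b.nab_mem[OF X' \<rho>_mem[OF e]])
  have "nabla_NF A \<xi> X ((\<lambda>_. c) *\<^sub>n \<rho> e) = (\<lambda>_. c) *\<^sub>n nabla_NF A \<xi> X (\<rho> e) +\<^sub>n (\<lambda>_. 0) *\<^sub>n \<rho> e"
   using b.nab_smult_right[OF X' \<rho>_mem[OF e] Cinf_const[of c]] unfolding b.anc_const[OF X'] .
  also have "\<dots> = (\<lambda>_. c) *\<^sub>n nabla_NF A \<xi> X (\<rho> e)"
   using m \<rho>_mem[OF e] Cinf_const[of c] Cinf_const[of 0] by (intro NF.eqI) simp_all
  also have "nabla_NF A \<xi> X (\<rho> e) = \<rho> (nJ (sK X) e)"
   using \<rho>_equivariant[OF symbolK_inv(1)[OF X] e] by (simp add: symbolK_inv(2)[OF X])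
  finally show "nabla_NF A \<xi> X ((\<lambda>_. c) *\<^sub>n \<rho> e) = (\<lambda>_. c) *\<^sub>n \<rho> (nJ (sK X) e)" .
 qed (simp_all add: lie_XF symbolK_inv sK_lie n.\<phi>_mem n.\<phi>_add)
qed

lemma Rmap_apply:
 assumes F: "KJ.altform b F" and Xs: "Xs \<in> tuples (TFm) b"
 shows "Rm b F Xs = (\<lambda>_. - ((- 1) ^ b)) *\<^sub>n \<rho> (F (map sK Xs))"
proof -
 have m: "\<rho> (F (map sK Xs)) \<in> carrier NN" by (intro \<rho>_mem KJ.altform_mem[OF F] map_sK[OF Xs])
 have "Rm b F Xs = -\<^sub>n signed NN b (\<rho> (F (map sK Xs)))"
  using Xs by (simp add: Rmap_def \<rho>_def)
 also have "\<dots> = (\<lambda>_. - ((- 1) ^ b)) *\<^sub>n \<rho> (F (map sK Xs))"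
  using m Cinf_const[of "- ((- 1) ^ b)"] by (intro NF.eqI) simp_all
 finally show ?thesis .
qed

lemma Rmap_forms:
 assumes F: "KJ.altform b F"
 shows "TN_altform b (Rm b F)" "Rm b F \<in> carrier (\<Omega>N b)"
proof -
 have "TN_altform b (\<lambda>Xs. (\<lambda>_. - ((- 1) ^ b)) *\<^sub>n \<rho> (F (map sK Xs)))"
  by (rule natural_forms.altform_natural[OF natural_R F])
 moreover have "TN_altform b (Rm b F) \<longleftrightarrow> TN_altform b (\<lambda>Xs. (\<lambda>_. - ((- 1) ^ b)) *\<^sub>n \<rho> (F (map sK Xs)))"
  by (rule fm_pair.altform_cong[OF pair_TF_NF]) (rule Rmap_apply[OF F])
 ultimately show "TN_altform b (Rm b F)" by blast
 thus "Rm b F \<in> carrier (\<Omega>N b)"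
  unfolding Omega_F_NF_iff by (simp add: Rmap_def)
qed

lemma fun_module_F_NF: "fun_module S (\<Omega>N n) (\<lambda>\<eta> (xs, i) p. if xs \<in> tuples (TFm) n then induced projG (\<eta> xs) i p else 0)"
 unfolding Omega_F_NF_def by (rule fm_pair.fun_module_forms[OF pair_TF_NF refl])

lemma Omega_F_NF_mem: "\<eta> \<in> carrier (\<Omega>N n) ==> Xs \<in> tuples (TFm) n ==> \<eta> Xs \<in> carrier NN"
 unfolding Omega_F_NF_iff using fm_pair.altform_mem[OF pair_TF_NF] by blast

lemma cochain_complex_F_NF: "cochain_complex \<Omega>N dN"
proof -
 have "\<Omega>N = forms (Cinf A) (TFm) NN" "dN = koszul (TFm) lie NN (nabla_NF A \<xi>)"
  by (simp_all add: Omega_F_NF_def d_F_NF_def fun_eq_iff)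
 thus ?thesis using lie_rep.cochain_complex_koszul[OF lie_rep_TF_NF refl] by simp
qed

text \<open>Naturality in degree b has the constant -(-1)^b on both sides, while R in degree b + 1
  carries the opposite constant; the change of sign is the minus of the target differential.\<close>

lemma Rmap_chain:
 assumes F: "KJ.altform b F"
 shows "Rm (Suc b) (dJ b F) = neg_diff \<Omega>N dN b (Rm b F)"
proof (rule extensionalityI[of _ "tuples (TFm) (Suc b)"])
 note R = Rmap_forms[OF F]
 have dR: "dN b (Rm b F) \<in> carrier (\<Omega>N (Suc b))"
  using cochain_complex_F_NF R(2) unfolding cochain_complex_def real_linear_def by blast
 interpret N: fun_module S "\<Omega>N (Suc b)" "\<lambda>\<eta> (xs, i) p. if xs \<in> tuples (TFm) (Suc b) then induced projG (\<eta> xs) i p else 0"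
  by (rule fun_module_F_NF)
 show "Rm (Suc b) (dJ b F) \<in> extensional (tuples (TFm) (Suc b))" by (simp add: Rmap_def)
 show "neg_diff \<Omega>N dN b (Rm b F) \<in> extensional (tuples (TFm) (Suc b))"
  using N.a_inv_closed[OF dR] unfolding neg_diff_def Omega_F_NF_iff by blast
 fix Xs assume Xs: "Xs \<in> tuples (TFm) (Suc b)"
 have dF: "KJ.altform (Suc b) (dJ b F)"
  using d_K_mem[OF F] unfolding Omega_K_J1perp_def KJ.forms_iff[OF refl] by blast
 have m: "\<rho> (dJ b F (map sK Xs)) \<in> carrier NN"
  by (intro \<rho>_mem KJ.altform_mem[OF dF] map_sK[OF Xs])
 have neg: "(\<ominus>\<^bsub>\<Omega>N (Suc b)\<^esub> dN b (Rm b F)) Xs = -\<^sub>n dN b (Rm b F) Xs"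
  by (rule fm_pair.neg_apply[OF pair_TF_NF fun_module_F_NF _ dR Xs]) (rule Omega_F_NF_mem[OF _ Xs])
 have "dN b (Rm b F) Xs = (\<lambda>_. - ((- 1) ^ b)) *\<^sub>n \<rho> (dJ b F (map sK Xs))"
  unfolding d_F_NF_def d_K_J1perp_def
 proof (rule natural_rep.koszul_natural[OF natural_rep_R F R(1)])
  show "set Xs \<subseteq> XF" "length Xs = Suc b" using Xs by (simp_all add: tuples_def)
  show "Rm b F ys = (\<lambda>_. - ((- 1) ^ b)) *\<^sub>n \<rho> (F (map sK ys))" if "set ys \<subseteq> XF" "length ys = b" for ys
   using that by (intro Rmap_apply[OF F]) (simp add: tuples_def)
 qed
 hence "neg_diff \<Omega>N dN b (Rm b F) Xs =
   -\<^sub>n ((\<lambda>_. - ((- 1) ^ b)) *\<^sub>n \<rho> (dJ b F (map sK Xs)))"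
  unfolding neg_diff_def neg by simp
 moreover have "(\<lambda>_. - ((- 1) ^ Suc b)) *\<^sub>n \<rho> (dJ b F (map sK Xs)) =
   -\<^sub>n ((\<lambda>_. - ((- 1) ^ b)) *\<^sub>n \<rho> (dJ b F (map sK Xs)))"
  using m Cinf_const[of "- ((- 1) ^ b)"] Cinf_const[of "- ((- 1) ^ Suc b)"] by (intro NF.eqI) simp_all
 ultimately show "Rm (Suc b) (dJ b F) Xs = neg_diff \<Omega>N dN b (Rm b F) Xs"
  unfolding Rmap_apply[OF dF Xs] by simp
qed

lemma Omega_K_J_iff: "F \<in> carrier (\<Omega>J b) \<longleftrightarrow> F \<in> extensional (tuples \<K> b) \<and> KJ.altform b F"
 unfolding Omega_K_J1perp_def by (rule KJ.forms_iff[OF refl])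

lemma chain_map_Rmap:
 "chain_map \<Omega>J dJ \<Omega>N (neg_diff \<Omega>N dN) Rm"
 unfolding chain_map_def real_linear_def
proof (intro conjI allI ballI cochain_complex_K_J)
 show "cochain_complex \<Omega>N (neg_diff \<Omega>N dN)"
  using fun_module_F_NF cochain_complex_F_NF by (rule cochain_complex_neg_diff)
 fix b
 interpret O: fun_module S "\<Omega>J b" "\<lambda>\<eta> (xs, i) p. if xs \<in> tuples \<K> b then j\<iota> (\<eta> xs) i p else 0"
  unfolding Omega_K_J1perp_def by (rule KJ.fun_module_forms[OF refl])
 show "Rm b \<in> carrier (\<Omega>J b) \<rightarrow> carrier (\<Omega>N b)"
  using Rmap_forms(2) Omega_K_J_iff by blast
 fix F assume F: "F \<in> carrier (\<Omega>J b)"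
 hence a: "KJ.altform b F" unfolding Omega_K_J_iff by blast
 thus "Rm (Suc b) (dJ b F) = neg_diff \<Omega>N dN b (Rm b F)"
  by (rule Rmap_chain)
 let ?c = "\<lambda>_. - ((- 1) ^ b) :: real"
 show "Rm b (F \<oplus>\<^bsub>\<Omega>J b\<^esub> H) = Rm b F \<oplus>\<^bsub>\<Omega>N b\<^esub> Rm b H"
  if H: "H \<in> carrier (\<Omega>J b)" for H
 proof (rule extensionalityI[of _ "tuples (TFm) b"])
  have aH: "KJ.altform b H" using H unfolding Omega_K_J_iff by blast
  have as: "KJ.altform b (F \<oplus>\<^bsub>\<Omega>J b\<^esub> H)" using O.add_mem[OF F H] unfolding Omega_K_J_iff by blast
  fix Xs assume Xs: "Xs \<in> tuples (TFm) b"
  have m: "F (map sK Xs) \<in> JS" "H (map sK Xs) \<in> JS"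
   using KJ.altform_mem[OF a map_sK[OF Xs]] KJ.altform_mem[OF aH map_sK[OF Xs]] .
  have "(F \<oplus>\<^bsub>\<Omega>J b\<^esub> H) (map sK Xs) = F (map sK Xs) +\<^sub>j H (map sK Xs)"
   using map_sK[OF Xs] by (simp add: Omega_K_J1perp_def forms_ops)
  hence "Rm b (F \<oplus>\<^bsub>\<Omega>J b\<^esub> H) Xs = Rm b F Xs +\<^sub>n Rm b H Xs"
   unfolding Rmap_apply[OF a Xs] Rmap_apply[OF aH Xs] Rmap_apply[OF as Xs] using m by (simp add: \<rho>_add NN_const_add)
  thus "Rm b (F \<oplus>\<^bsub>\<Omega>J b\<^esub> H) Xs = (Rm b F \<oplus>\<^bsub>\<Omega>N b\<^esub> Rm b H) Xs"
   using Xs by (simp add: Omega_F_NF_def forms_ops)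
 qed (simp_all add: Rmap_def Omega_F_NF_def forms_ops)
 show "Rm b ((\<lambda>_. c) \<odot>\<^bsub>\<Omega>J b\<^esub> F) = (\<lambda>_. c) \<odot>\<^bsub>\<Omega>N b\<^esub> Rm b F" for c
 proof (rule extensionalityI[of _ "tuples (TFm) b"])
  have as: "KJ.altform b ((\<lambda>_. c) \<odot>\<^bsub>\<Omega>J b\<^esub> F)" using O.smult_mem[OF Cinf_const F] unfolding Omega_K_J_iff by blast
  fix Xs assume Xs: "Xs \<in> tuples (TFm) b"
  have m: "F (map sK Xs) \<in> JS" using KJ.altform_mem[OF a map_sK[OF Xs]] .
  have "((\<lambda>_. c) \<odot>\<^bsub>\<Omega>J b\<^esub> F) (map sK Xs) = (\<lambda>_. c) *\<^sub>j F (map sK Xs)"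
   using map_sK[OF Xs] by (simp add: Omega_K_J1perp_def forms_ops)
  hence "Rm b ((\<lambda>_. c) \<odot>\<^bsub>\<Omega>J b\<^esub> F) Xs = (\<lambda>_. c) *\<^sub>n Rm b F Xs"
   unfolding Rmap_apply[OF a Xs] Rmap_apply[OF as Xs] using m Cinf_const[of c] by (simp add: \<rho>_smult NN_const_smult[of _ "\<lambda>_. c"])
  thus "Rm b ((\<lambda>_. c) \<odot>\<^bsub>\<Omega>J b\<^esub> F) Xs = ((\<lambda>_. c) \<odot>\<^bsub>\<Omega>N b\<^esub> Rm b F) Xs"
   using Xs by (simp add: Omega_F_NF_def forms_ops)
 qed (simp_all add: Rmap_def Omega_F_NF_def forms_ops)
qed

section \<open>The map \<open>\<Phi>\<^sub>G\<close>\<close>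

lemma NF_dual_iff: "\<beta> \<in> carrier (NF_dual_ell A \<xi>) \<longleftrightarrow> \<beta> \<in> extensional (carrier NN) \<and> (\<forall>s\<in>carrier NN. \<beta> s \<in> Sec) \<and>
  (\<forall>s\<in>carrier NN. \<forall>t\<in>carrier NN. \<beta> (s +\<^sub>n t) = \<beta> s +\<^sub>l \<beta> t) \<and>
  (\<forall>f\<in>S. \<forall>s\<in>carrier NN. \<beta> (f *\<^sub>n s) = f *\<^sub>l \<beta> s)"
 by (auto simp: NF_dual_ell_def hom_module_def PiE_def)

lemma NF_dualD:
 assumes "\<beta> \<in> carrier (NF_dual_ell A \<xi>)"
 shows "s \<in> carrier NN ==> \<beta> s \<in> Sec"
  and "s \<in> carrier NN ==> t \<in> carrier NN ==> \<beta> (s +\<^sub>n t) = \<beta> s +\<^sub>l \<beta> t"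
  and "f \<in> S ==> s \<in> carrier NN ==> \<beta> (f *\<^sub>n s) = f *\<^sub>l \<beta> s"
 using assms unfolding NF_dual_iff by blast+

lemma NF_dual_exists:
 assumes b: "\<And>Y. Y \<in> T ==> b Y \<in> Sec" "\<And>Y. Y \<in> XF ==> b Y = 0\<^sub>l"
  and add: "\<And>Y Z. Y \<in> T ==> Z \<in> T ==> b (\<lambda>f p. Y f p + Z f p) = b Y +\<^sub>l b Z"
  and sm: "\<And>h Y. h \<in> S ==> Y \<in> T ==> b (\<lambda>f p. h p * Y f p) = h *\<^sub>l b Y"
 shows "\<exists>\<beta>\<in>carrier (NF_dual_ell A \<xi>). \<forall>Y\<in>T. \<beta> (nf Y) = b Y"
proof -
 have ind: "induced b (nf Y) = b Y" if Y: "Y \<in> T" for Y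
 proof (rule induced_nf[OF Y])
  fix Z assume Z: "Z \<in> T" "(\<lambda>f p. Z f p - Y f p) \<in> XF"
  have "b (\<lambda>f p. Y f p + (\<lambda>f p. Z f p - Y f p) f p) = b Y +\<^sub>l b (\<lambda>f p. Z f p - Y f p)"
   using Y Z by (intro add) simp_all
  thus "b Z = b Y" using b(2)[OF Z(2)] b(1)[OF Y] by simp
 qed
 define \<beta> where "\<beta> = (\<lambda>s\<in>carrier NN. induced b s)"
 have \<beta>: "\<beta> (nf Y) = b Y" if "Y \<in> T" for Y using that by (simp add: \<beta>_def ind)
 have "\<beta> \<in> carrier (NF_dual_ell A \<xi>)"
  unfolding NF_dual_iff
 proof (intro conjI ballI)
  fix s t f assume s: "s \<in> carrier NN"
  then obtain Y where Y: "Y \<in> T" "s = nf Y" by (rule NF_cases)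
  show "\<beta> s \<in> Sec" using Y b(1) by (simp add: \<beta>)
  show "\<beta> (f *\<^sub>n s) = f *\<^sub>l \<beta> s" if "f \<in> S" using that Y by (simp add: \<beta> nf_smult sm)
  assume "t \<in> carrier NN"
  then obtain Z where "Z \<in> T" "t = nf Z" by (rule NF_cases)
  thus "\<beta> (s +\<^sub>n t) = \<beta> s +\<^sub>l \<beta> t" using Y by (simp add: \<beta> nf_add add)
 qed (simp add: \<beta>_def)
 with \<beta> show ?thesis by blast
qed

text \<open>The test elements are \<theta> itself and, for Z in \<Gamma>(\<xi>), the map sending Y
  to \<nabla>_Z \<theta>(Y) - \<theta>[Z, Y], with \<nabla>_Z a derivation of symbol Z. If all of
  them kill W, then W and every [Z, W] lie in \<Gamma>(\<xi>), so W is a section of T\<F>.\<close>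

lemma NF_dual_separates:
 assumes s: "s \<in> carrier NN" "t \<in> carrier NN"
  and eq: "\<And>\<beta>. \<beta> \<in> carrier (NF_dual_ell A \<xi>) ==> \<beta> s = \<beta> t"
 shows "s = t"
proof -
 obtain Y where Y: "Y \<in> T" "s = nf Y" using s(1) by (rule NF_cases)
 obtain Y' where Y': "Y' \<in> T" "t = nf Y'" using s(2) by (rule NF_cases)
 define W where "W = (\<lambda>f p. Y f p - Y' f p)"
 have W: "W \<in> T" using Y Y' by (simp add: W_def)
 have zero: "\<beta> (nf W) = 0\<^sub>l" if \<beta>: "\<beta> \<in> carrier (NF_dual_ell A \<xi>)" for \<beta>
 proof -
  have "nf Y = nf W +\<^sub>n nf Y'" using Y Y' W by (simp add: nf_add) (simp add: W_def)
  hence "\<beta> (nf Y) = \<beta> (nf W) +\<^sub>l \<beta> (nf Y')" using NF_dualD(2)[OF \<beta>, of "nf W" "nf Y'"] W Y' by simp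
  moreover have "\<beta> (nf Y) = \<beta> (nf Y')" using eq[OF \<beta>] Y Y' by simp
  moreover have "\<beta> (nf W) \<in> Sec" "\<beta> (nf Y') \<in> Sec" using NF_dualD(1)[OF \<beta>] W Y' by simp_all
  ultimately show ?thesis by simp
 qed
 have "\<exists>\<beta>\<in>carrier (NF_dual_ell A \<xi>). \<forall>Y\<in>T. \<beta> (nf Y) = th Y"
  using XF_subset sec_T by (intro NF_dual_exists) (simp_all add: th_zero_iff th_add th_smult)
 hence "th W = 0\<^sub>l" using zero W by metis
 hence W\<xi>: "W \<in> X\<xi>" using W th_zero_iff by simp
 have "lie W Z \<in> X\<xi>" if Z: "Z \<in> X\<xi>" for Z
 proof -
  have ZT: "Z \<in> T" using Z by (rule sec_T)
  note c = conn[OF ZT]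
  have c0: "conn Z 0\<^sub>l = 0\<^sub>l" using LD.nab_zero[OF c(1)] by (simp add: app_def)
  have ZS: "Z h \<in> S" for h by (rule vf_mem[OF ZT])
  \<comment> \<open>\<theta>[Z, Y] alone has the Leibniz term Z(h) \<theta>(Y). A derivation of
    symbol Z has the same one, so the difference is linear over functions.\<close>
  have "\<exists>\<beta>\<in>carrier (NF_dual_ell A \<xi>). \<forall>Y\<in>T. \<beta> (nf Y) = conn Z (th Y) -\<^sub>l th (lie Z Y)"
  proof (rule NF_dual_exists)
   fix Y assume Y: "Y \<in> T"
   note m = DellD(2)[OF c(1) th_mem[OF Y]]
   show "conn Z (th Y) -\<^sub>l th (lie Z Y) \<in> Sec" using m Y ZT by simp
   show "conn Z (th (\<lambda>f p. h p * Y f p)) -\<^sub>l th (lie Z (\<lambda>f p. h p * Y f p)) = h *\<^sub>l (conn Z (th Y) -\<^sub>l th (lie Z Y))"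
    if h: "h \<in> S" for h
   proof -
    have "th (lie Z (\<lambda>f p. h p * Y f p)) = h *\<^sub>l th (lie Z Y) +\<^sub>l Z h *\<^sub>l th Y"
     using Y ZT h ZS by (simp add: lie_smult_right th_add th_smult)
    moreover have "conn Z (th (\<lambda>f p. h p * Y f p)) = Z h *\<^sub>l th Y +\<^sub>l h *\<^sub>l conn Z (th Y)"
     using DellD(5)[OF c(1) h th_mem[OF Y]] Y h by (simp add: th_smult c(2))
    ultimately show ?thesis
     using m Y ZT h ZS by simp (intro ell.eqI; simp add: algebra_simps)
   qed
   fix Y' assume Y': "Y' \<in> T"
   have "conn Z (th (\<lambda>f p. Y f p + Y' f p)) = conn Z (th Y) +\<^sub>l conn Z (th Y')"
    using DellD(3)[OF c(1) th_mem[OF Y] th_mem[OF Y']] Y Y' by (simp add: th_add)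
   moreover have "th (lie Z (\<lambda>f p. Y f p + Y' f p)) = th (lie Z Y) +\<^sub>l th (lie Z Y')"
    using Y Y' ZT by (simp add: lie_add_right th_add)
   ultimately show "conn Z (th (\<lambda>f p. Y f p + Y' f p)) -\<^sub>l th (lie Z (\<lambda>f p. Y f p + Y' f p)) =
     (conn Z (th Y) -\<^sub>l th (lie Z Y)) +\<^sub>l (conn Z (th Y') -\<^sub>l th (lie Z Y'))"
    using m DellD(2)[OF c(1) th_mem[OF Y']] Y Y' ZT by simp (intro ell.eqI; simp)
  next
   fix Y assume Y: "Y \<in> XF"
   have YT: "Y \<in> T" using Y by (rule sec_T)
   have "lie Y Z \<in> X\<xi>" using Y Z by (simp add: XF_iff)
   from sections_smult[OF xi_subsp Cinf_const[of "- 1"] this] have "lie Z Y \<in> X\<xi>"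
    by (simp add: lie_def)
   hence "th (lie Z Y) = 0\<^sub>l" using th_zero_iff[of "lie Z Y"] YT ZT by simp
   moreover have "th Y = 0\<^sub>l" using XF_subset[OF Y] YT th_zero_iff by blast
   ultimately show "conn Z (th Y) -\<^sub>l th (lie Z Y) = 0\<^sub>l" by (simp add: c0 a_minus_def ell_neg_zero)
  qed
  then obtain \<beta> where "\<beta> \<in> carrier (NF_dual_ell A \<xi>)" "\<forall>Y\<in>T. \<beta> (nf Y) = conn Z (th Y) -\<^sub>l th (lie Z Y)" by blast
  hence "conn Z (th W) -\<^sub>l th (lie Z W) = 0\<^sub>l" using zero W by metis
  hence "0\<^sub>l -\<^sub>l th (lie Z W) = 0\<^sub>l"
   unfolding \<open>th W = 0\<^sub>l\<close> c0 .
  from ell_minus_eq_zero[OF _ _ this] have "0\<^sub>l = th (lie Z W)" using W ZT by simp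
  hence "lie Z W \<in> X\<xi>" using th_zero_iff[of "lie Z W"] W ZT by simp
  from sections_smult[OF xi_subsp Cinf_const[of "- 1"] this] show ?thesis by (simp add: lie_def)
 qed
 hence "W \<in> XF" using W\<xi> by (simp add: XF_iff)
 thus ?thesis using Y Y' by (simp add: nf_eq_iff W_def)
qed

text \<open>\<beta> composed with the symbol vanishes on K, hence lies in J and is
  \<varpi>^\<flat>(D0) for some D0. The K-part of D0 contributes nothing, so its part in
  \<sigma>^(-1)(G) is a preimage of the restricted form, and \<open>inv_into\<close> returns a
  preimage.\<close>

lemma varpi_flat_Gt_inv:
 assumes \<beta>: "\<beta> \<in> carrier (NF_dual_ell A \<xi>)"
 defines "D\<beta> \<equiv> varpi_flat_Gt_inv A \<xi> G (symbol_pull_beta A \<xi> G \<beta>)"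
 shows "D\<beta> \<in> GS" "D' \<in> GS ==> varpi A \<xi> [D\<beta>, D'] = \<beta> (nf (\<sigma> D'))"
proof -
 define \<alpha> where "\<alpha> = (\<lambda>D\<in>Der. \<beta> (nf (\<sigma> D)))"
 have \<alpha>: "\<alpha> D = \<beta> (nf (\<sigma> D))" if "D \<in> Der" for D using that by (simp add: \<alpha>_def)
 have "\<alpha> \<in> JS"
  unfolding J_iff
 proof (intro conjI ballI)
  show "\<alpha> \<in> extensional (Der)" by (simp add: \<alpha>_def)
  fix D assume D: "D \<in> Der"
  show "\<alpha> D \<in> Sec" using D NF_dualD(1)[OF \<beta>] by (simp add: \<alpha>)
  show "\<alpha> (D +\<^sub>d D') = \<alpha> D +\<^sub>l \<alpha> D'" if D': "D' \<in> Der" for D'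
   using D D' NF_dualD(2)[OF \<beta>, of "nf (\<sigma> D)" "nf (\<sigma> D')"] by (simp add: \<alpha> Dell_add nf_add)
  show "\<alpha> (f *\<^sub>d D) = f *\<^sub>l \<alpha> D" if f: "f \<in> S" for f
   using D f NF_dualD(3)[OF \<beta> f, of "nf (\<sigma> D)"] by (simp add: \<alpha> Dell_smult nf_smult)
 next
  fix \<Delta> assume \<Delta>: "\<Delta> \<in> KS"
  have "nf (\<sigma> \<Delta>) = (\<lambda>_. 0) *\<^sub>n nf (\<sigma> \<Delta>)"
   using \<Delta> K_symbol[OF \<Delta>] Cinf_const[of 0] by (simp add: nf_smult nf_eq_iff)
  hence "\<beta> (nf (\<sigma> \<Delta>)) = (\<lambda>_. 0) *\<^sub>l \<beta> (nf (\<sigma> \<Delta>))"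
   using NF_dualD(3)[OF \<beta> Cinf_const[of 0], of "nf (\<sigma> \<Delta>)"] \<Delta> by simp
  also have "\<dots> = 0\<^sub>l"
   using NF_dualD(1)[OF \<beta>, of "nf (\<sigma> \<Delta>)"] \<Delta> Cinf_const[of 0] by (intro ell.eqI) simp_all
  finally show "\<alpha> \<Delta> = 0\<^sub>l" using \<Delta> by (simp add: \<alpha>)
 qed
 then obtain D0 where D0: "D0 \<in> Der" "vf\<beta> D0 = \<alpha>" using varpi_flat_surj by blast
 have "varpi A \<xi> [pG D0, D'] = \<beta> (nf (\<sigma> D'))" if D': "D' \<in> Der" for D'
 proof -
  have "varpi A \<xi> [pG D0 +\<^sub>d pK D0, D'] = varpi A \<xi> [pG D0, D'] +\<^sub>l varpi A \<xi> [pK D0, D']"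
   using D0(1) D' by (intro varpi_linear(1)) simp_all
  hence "varpi A \<xi> [D0, D'] = varpi A \<xi> [pG D0, D']"
   using prK_split[OF D0(1)] varpi_K_left[OF prK(1)[OF D0(1)] D'] D0(1) D' by simp
  moreover have "varpi A \<xi> [D0, D'] = \<alpha> D'" using vflat_apply[OF D', of D0] D0(2) by simp
  ultimately show ?thesis using D' by (simp add: \<alpha>)
 qed
 hence "varpi_flat_Gt A \<xi> G (pG D0) = symbol_pull_beta A \<xi> G \<beta>"
  unfolding varpi_flat_Gt_def symbol_pull_beta_def by (intro restrict_ext) (simp add: Gt_A)
 hence im: "symbol_pull_beta A \<xi> G \<beta> \<in> varpi_flat_Gt A \<xi> G ` GS"
  using prK(2)[OF D0(1)] by (metis imageI)
 show "D\<beta> \<in> GS" unfolding D\<beta>_def varpi_flat_Gt_inv_def using im by (rule inv_into_into)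
 have "varpi_flat_Gt A \<xi> G D\<beta> = symbol_pull_beta A \<xi> G \<beta>"
  unfolding D\<beta>_def varpi_flat_Gt_inv_def using im by (rule f_inv_into_f)
 thus "varpi A \<xi> [D\<beta>, D'] = \<beta> (nf (\<sigma> D'))" if "D' \<in> GS"
  using fun_cong[of "varpi_flat_Gt A \<xi> G D\<beta>" "symbol_pull_beta A \<xi> G \<beta>" D']
  unfolding varpi_flat_Gt_def symbol_pull_beta_def restrict_apply'[OF that] by blast
qed

text \<open>\<varpi> is evaluated on a preimage D of the value of \<tau> and on the preimage of
  \<beta>, in both orders: one order gives \<beta> of the symbol of D, the other gives the form with
  the preimage of \<beta> inserted.\<close>

lemma Phi_characterisation:
 assumes a: "TL_altform n \<eta>" and \<beta>: "\<beta> \<in> carrier (NF_dual_ell A \<xi>)" and Ks: "Ks \<in> tuples \<K> n"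
 shows "\<beta> (Rm n (tB n (dS n \<eta>)) (map \<sigma> Ks)) =
  d_D A \<xi> n (PK n \<eta>) (Ks @ [varpi_flat_Gt_inv A \<xi> G (symbol_pull_beta A \<xi> G \<beta>)])"
proof -
 define D\<beta> where "D\<beta> = varpi_flat_Gt_inv A \<xi> G (symbol_pull_beta A \<xi> G \<beta>)"
 note D\<beta> = varpi_flat_Gt_inv[OF \<beta>, folded D\<beta>_def]
 note B = d10_Bi(1)[OF a]
 have e: "map sK (map \<sigma> Ks) = Ks"
  unfolding map_map using Ks by (intro map_idI) (auto simp: tuples_def symbolK_inv_symbol)
 obtain D0 where D0: "D0 \<in> Der" "tB n (dS n \<eta>) Ks = vf\<beta> D0"
  using tau_apply(1)[OF B Ks] by (rule J_cases)
 \<comment> \<open>Preimages under \<varpi>^\<flat> are unique up to K; the representative in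
   \<sigma>^(-1)(G) is taken because the inverse that belongs to \<beta> is tested on
   \<sigma>^(-1)(G) only.\<close>
 define D where "D = pG D0"
 have D: "D \<in> Der" "D \<in> GS" using prK(2)[OF D0(1)] D0(1) by (simp_all add: D_def)
 have "D0 -\<^sub>d D = pK D0" using D0(1) unfolding D_def by (intro Dell.eqI) simp_all
 hence "vf\<beta> D0 = vf\<beta> D" using varpi_flat_eq_iff[OF D0(1) D(1)] prK(1)[OF D0(1)] by simp
 hence t: "tB n (dS n \<eta>) Ks = vf\<beta> D" using D0(2) by simp
 have m: "dS n \<eta> (D\<beta> # Ks) \<in> Sec" by (rule Bi_mem[OF B GK_tuples[OF D\<beta>(1) Ks]])
 have "\<beta> (nf (\<sigma> D)) = varpi A \<xi> [D\<beta>, D]" using D\<beta>(2)[OF D(2)] ..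
 also have "\<dots> = -\<^sub>l varpi A \<xi> [D, D\<beta>]" by (rule varpi_linear(5)[OF Gt_A[OF D\<beta>(1)] D(1) D(1)])
 also have "varpi A \<xi> [D, D\<beta>] = dS n \<eta> (D\<beta> # Ks)"
  using tau_apply(2)[OF B Ks Gt_A[OF D\<beta>(1)]] unfolding t vflat_apply[OF Gt_A[OF D\<beta>(1)]] .
 finally have 1: "\<beta> (nf (\<sigma> D)) = -\<^sub>l dS n \<eta> (D\<beta> # Ks)" .
 \<comment> \<open>The leading minus of R cancels the one from exchanging the arguments of \<varpi>;
   the factor (-1)^n remains.\<close>
 have "\<beta> (Rm n (tB n (dS n \<eta>)) (map \<sigma> Ks)) = (\<lambda>_. - ((- 1) ^ n)) *\<^sub>l \<beta> (nf (\<sigma> D))"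
  unfolding Rmap_apply[OF tau_forms(1)[OF B] map_symbol[OF Ks]] e t \<rho>_varpi[OF D(1)]
  using D(1) by (intro NF_dualD(3)[OF \<beta>] Cinf_const) simp
 also have "\<dots> = signed \<L> n (dS n \<eta> (D\<beta> # Ks))"
  unfolding 1 using m Cinf_const[of "- ((- 1) ^ n)"] by (intro ell.eqI) simp_all
 also have "dS n \<eta> (D\<beta> # Ks) = d_D A \<xi> n (PK n \<eta>) (D\<beta> # Ks)"
  unfolding d10_Bi(2)[OF a D\<beta>(1) Ks] d_D_dif[OF altform_PK[OF a] GK_tuples[OF D\<beta>(1) Ks]] ..
 finally have 2: "\<beta> (Rm n (tB n (dS n \<eta>)) (map \<sigma> Ks)) = signed \<L> n (d_D A \<xi> n (PK n \<eta>) (D\<beta> # Ks))" .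
 have len: "length Ks = n" using Ks by (simp add: tuples_def)
 have "Ks @ [D\<beta>] \<in> tuples \<A> (Suc n)" using tuples_K_A[OF Ks] Gt_A[OF D\<beta>(1)] by (auto simp: tuples_def)
 from LD.altform_list_update[OF altform_d_D[OF altform_PK[OF a]] this, of n D\<beta>]
 have "d_D A \<xi> n (PK n \<eta>) (Ks @ [D\<beta>]) = signed \<L> n (d_D A \<xi> n (PK n \<eta>) (D\<beta> # Ks))"
  using len Gt_A[OF D\<beta>(1)] by (simp add: omit_def list_update_append)
 with 2 show ?thesis unfolding D\<beta>_def by simp
qed

lemma Phi_eq:
 assumes \<eta>: "\<eta> \<in> carrier (\<Omega>l n)"
 shows "Phi A \<xi> G n \<eta> = Rm n (tB n (dS n \<eta>))"
proof -
 have a: "TL_altform n \<eta>" using \<eta> by (simp add: Omega_F_ell_iff)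
 note B = d10_Bi(1)[OF a]
 note R = Rmap_forms(2)[OF tau_forms(1)[OF B]]
 show ?thesis
  unfolding Phi_def PK_def[symmetric]
 proof (rule the_equality)
  show "Rm n (tB n (dS n \<eta>)) \<in> carrier (\<Omega>N n) \<and>
   (\<forall>\<beta>\<in>carrier (NF_dual_ell A \<xi>). \<forall>Ks\<in>tuples \<K> n. \<beta> (Rm n (tB n (dS n \<eta>)) (map \<sigma> Ks)) =
    d_D A \<xi> n (PK n \<eta>) (Ks @ [varpi_flat_Gt_inv A \<xi> G (symbol_pull_beta A \<xi> G \<beta>)]))"
   using R Phi_characterisation[OF a] by blast
  fix \<zeta> assume *: "\<zeta> \<in> carrier (\<Omega>N n) \<and>
   (\<forall>\<beta>\<in>carrier (NF_dual_ell A \<xi>). \<forall>Ks\<in>tuples \<K> n. \<beta> (\<zeta> (map \<sigma> Ks)) =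
    d_D A \<xi> n (PK n \<eta>) (Ks @ [varpi_flat_Gt_inv A \<xi> G (symbol_pull_beta A \<xi> G \<beta>)]))"
  show "\<zeta> = Rm n (tB n (dS n \<eta>))"
  proof (rule extensionalityI[of _ "tuples (TFm) n"])
   show "\<zeta> \<in> extensional (tuples (TFm) n)" "Rm n (tB n (dS n \<eta>)) \<in> extensional (tuples (TFm) n)"
    using * R unfolding Omega_F_NF_iff by blast+
   fix Xs assume Xs: "Xs \<in> tuples (TFm) n"
   have e: "map \<sigma> (map sK Xs) = Xs"
    unfolding map_map using Xs by (intro map_idI) (auto simp: tuples_def symbolK_inv)
   show "\<zeta> Xs = Rm n (tB n (dS n \<eta>)) Xs"
   proof (rule NF_dual_separates)
    show "\<zeta> Xs \<in> carrier NN" "Rm n (tB n (dS n \<eta>)) Xs \<in> carrier NN"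
     using * R Omega_F_NF_mem[OF _ Xs] by blast+
    show "\<beta> (\<zeta> Xs) = \<beta> (Rm n (tB n (dS n \<eta>)) Xs)" if "\<beta> \<in> carrier (NF_dual_ell A \<xi>)" for \<beta>
     using * Phi_characterisation[OF a that map_sK[OF Xs]] that map_sK[OF Xs] unfolding e by (metis e)
   qed
  qed
 qed
qed

lemma chain_map_Phi:
 "chain_map \<Omega>l dl \<Omega>N (neg_diff \<Omega>N dN) (Phi A \<xi> G)"
 using chain_map_comp[OF chain_map_comp[OF chain_map_d10_symbol chain_map_tau] chain_map_Rmap] fun_module_F_ell
 by (rule chain_map_cong) (rule Phi_eq)

end

theorem theorem2p14:
  fixes A :: "('a::{second_countable_topology, t2_space}, 'e::euclidean_space) atlas"
    and \<xi> G :: "'a distr"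
  assumes "smooth_manifold A"
    and "precontact A \<xi>"
    and "complement_of_TF A \<xi> G"
  shows "chain_map (Omega_F_ell A \<xi>) (d_F_ell A \<xi>)
           (Omega_D_bi A \<xi> G 1) (neg_diff (Omega_D_bi A \<xi> G 1) (d01 A \<xi> G 1))
           (d10_symbolK_pull A \<xi> G) \<and>
         chain_map
           (Omega_D_bi A \<xi> G 1) (neg_diff (Omega_D_bi A \<xi> G 1) (d01 A \<xi> G 1))
           (Omega_K_J1perp A \<xi>) (d_K_J1perp A \<xi>)
           (tau A \<xi> G) \<and>
         chain_map (Omega_K_J1perp A \<xi>) (d_K_J1perp A \<xi>)
           (Omega_F_NF A \<xi>) (neg_diff (Omega_F_NF A \<xi>) (d_F_NF A \<xi>))
           (Rmap A \<xi>) \<and>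
         (\<forall>n. \<forall>\<eta>\<in>carrier (Omega_F_ell A \<xi> n).
           Phi A \<xi> G n \<eta> = Rmap A \<xi> n (tau A \<xi> G n (d10_symbolK_pull A \<xi> G n \<eta>))) \<and>
         chain_map (Omega_F_ell A \<xi>) (d_F_ell A \<xi>)
           (Omega_F_NF A \<xi>) (neg_diff (Omega_F_NF A \<xi>) (d_F_NF A \<xi>))
           (Phi A \<xi> G)"
proof -
 interpret precontact_splitting A \<xi> G
  using assms by unfold_locales (simp_all add: precontact_def)
 show ?thesis
  using chain_map_d10_symbol chain_map_tau chain_map_Rmap Phi_eq chain_map_Phi by blast
qed

end
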